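(* Let $m>1$ and $1\le p<m$. Assume that $\sigma_1>-2$ in dimension $N\ge2$ and $\sigma_1\ge0$ in dimension $N=1$, and that $$\sigma_2=\frac{\sigma_1(m-p)-2(p-1)}{m-1}.$$ Then there exists a unique pair of exponents $$\alpha^*,\ \beta^*\in(0,\infty),\qquad \frac{\alpha^*}{\beta^*}=\frac{\sigma_1+2}{m-1},$$ such that there exists a one-parameter family of compactly supported self-similar solutions in exponential form $u(x,t)=e^{\alpha^* t}f(|x|e^{-\beta^* t})$, $(x,t)\in\mathbb{R}^N\times(-\infty,\infty)$, to $$|x|^{\sigma_1}\partial_tu=\Delta u^m+|x|^{\sigma_2}u^p,$$ whose profiles satisfy $f(0)>0$ and the following local behavior as $\xi\to0$: $$f(\xi)\sim\left[K-\frac{(m-1)^2}{m(\sigma_1+2)[N(m-1)+\sigma_1(m-p)-2(p-1)]}\xi^{(\sigma_1+2)(m-p)/(m-1)}\right]^{1/(m-p)}.\qquad(\ast)$$ Moreover, for any $\alpha\in(\alpha^*,\infty)$ and corresponding $\beta\in(0,\infty)$ connected to $\alpha$ by the ratio $\alpha/\beta=(\sigma_1+2)/(m-1)$, there exists a one-parameter family of self-similar solutions in exponential form $u(x,t)=e^{\alpha t}f(|x|e^{-\beta t})$ to the same equation such that they behave as in $(\ast)$ as $\xi\to0$ and have the following behavior as $\xi\to\infty$: $$f(\xi)\sim C(m,p,\alpha,\sigma_1)\,\xi^{(\sigma_1+2)/(m-1)}(\log\xi)^{-1/(p-1)},$$ where $C(m,p,\alpha,\sigma_1)>0$ is a positive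 constant (that can be made explicit).
   Context: The self-similar variable is $\xi=|x|e^{-\beta t}$ (with $\beta=\beta^*$ in the first part), $f$ is the profile of the solution, and $K$ is a constant.
   Formalization: In dimension N=1 it is also assumed that (m-1)+σ₁(m-p)-2(p-1)>0 (otherwise (∗) is undefined or the source is not locally integrable at 0), and the behavior as ξ→∞ is claimed only for p>1, since (log ξ)^{-1/(p-1)} is undefined at p=1. *)

theory Defs
  imports "HOL-Analysis.Analysis" "HOL-Library.Landau_Symbols"
begin

text \<open>
  The space \<open>\<real>\<^sup>N\<close> is a type \<open>'a :: euclidean_space\<close> with \<open>N = DIM('a)\<close>; functions of space and
  time are curried, \<open>u x t\<close>.
\<close>

definition time_deriv :: "('a \<Rightarrow> real \<Rightarrow> real) \<Rightarrow> 'a \<Rightarrow> real \<Rightarrow> real"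
  where "time_deriv \<phi> x t = deriv (\<phi> x) t"

definition space_deriv ::
    "'a::euclidean_space \<Rightarrow> ('a \<Rightarrow> real \<Rightarrow> real) \<Rightarrow> 'a \<Rightarrow> real \<Rightarrow> real"
  where "space_deriv b \<phi> x t = deriv (\<lambda>h. \<phi> (x + h *\<^sub>R b) t) 0"

definition laplacian :: "('a::euclidean_space \<Rightarrow> real \<Rightarrow> real) \<Rightarrow> 'a \<Rightarrow> real \<Rightarrow> real"
  where "laplacian \<phi> x t = (\<Sum>b\<in>Basis. space_deriv b (space_deriv b \<phi>) x t)"

definition jointly_continuous :: "('a::euclidean_space \<Rightarrow> real \<Rightarrow> real) \<Rightarrow> bool"
  where "jointly_continuous \<phi> \<longleftrightarrow> continuous_on UNIV (\<lambda>(x, t). \<phi> x t)"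

definition time_C1 :: "('a::euclidean_space \<Rightarrow> real \<Rightarrow> real) \<Rightarrow> bool"
  where "time_C1 \<phi> \<longleftrightarrow>
    (\<forall>x t. \<phi> x field_differentiable at t) \<and> jointly_continuous (time_deriv \<phi>)"

definition space_C1 :: "('a::euclidean_space \<Rightarrow> real \<Rightarrow> real) \<Rightarrow> bool"
  where "space_C1 \<phi> \<longleftrightarrow>
    (\<forall>b\<in>Basis. (\<forall>x t. (\<lambda>h. \<phi> (x + h *\<^sub>R b) t) field_differentiable at 0) \<and>
                jointly_continuous (space_deriv b \<phi>))"

text \<open>Test functions: compactly supported functions of class \<open>C\<^sup>2\<close> in \<open>x\<close> and \<open>C\<^sup>1\<close> in \<open>t\<close>.\<close>

definition test_function :: "('a::euclidean_space \<Rightarrow> real \<Rightarrow> real) \<Rightarrow> bool"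
  where "test_function \<phi> \<longleftrightarrow>
    jointly_continuous \<phi> \<and> time_C1 \<phi> \<and> space_C1 \<phi> \<and> (\<forall>b\<in>Basis. space_C1 (space_deriv b \<phi>)) \<and>
    compact (closure {(x, t). \<phi> x t \<noteq> 0})"

text \<open>
  Continuous nonnegative weak solutions, on the whole of \<open>\<real>\<^sup>N \<times> \<real>\<close>, of
  \<open>|x|\<^sup>\<sigma>\<^sup>1 \<partial>\<^sub>t u = \<Delta> u\<^sup>m + |x|\<^sup>\<sigma>\<^sup>2 u\<^sup>p\<close>: the equation is multiplied by a test function and
  all derivatives are moved onto it. Integrability of the integrand is part of the condition, and
  a test function may be nonzero at \<open>x = 0\<close>, where the weights can be singular. (HOL's convention
  \<open>0 powr a = 0\<close> affects the weights only on a null set.)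
\<close>

definition weak_solution ::
    "real \<Rightarrow> real \<Rightarrow> real \<Rightarrow> real \<Rightarrow> ('a::euclidean_space \<Rightarrow> real \<Rightarrow> real) \<Rightarrow> bool"
  where "weak_solution m p \<sigma>1 \<sigma>2 u \<longleftrightarrow>
    jointly_continuous u \<and> (\<forall>x t. 0 \<le> u x t) \<and>
    (\<forall>\<phi>. test_function \<phi> \<longrightarrow>
      has_bochner_integral lborel
        (\<lambda>(x, t). norm x powr \<sigma>1 * u x t * time_deriv \<phi> x t
                 + u x t powr m * laplacian \<phi> x t
                 + norm x powr \<sigma>2 * u x t powr p * \<phi> x t) 0)"

text \<open>Only the values \<open>f \<xi>\<close> with \<open>\<xi> \<ge> 0\<close> matter for a profile \<open>f\<close>.\<close>

definition exp_self_similar ::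
    "real \<Rightarrow> real \<Rightarrow> (real \<Rightarrow> real) \<Rightarrow> 'a::euclidean_space \<Rightarrow> real \<Rightarrow> real"
  where "exp_self_similar \<alpha> \<beta> f x t = exp (\<alpha> * t) * f (norm x * exp (- \<beta> * t))"

definition compactly_supported_in_space :: "('a::euclidean_space \<Rightarrow> real \<Rightarrow> real) \<Rightarrow> bool"
  where "compactly_supported_in_space u \<longleftrightarrow> (\<forall>t. compact (closure {x. u x t \<noteq> 0}))"

definition origin_bracket :: "real \<Rightarrow> real \<Rightarrow> real \<Rightarrow> real \<Rightarrow> real \<Rightarrow> real \<Rightarrow> real"
  where "origin_bracket N m p \<sigma>1 K \<xi> =
    K - (m - 1)\<^sup>2 / (m * (\<sigma>1 + 2) * (N * (m - 1) + \<sigma>1 * (m - p) - 2 * (p - 1)))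
        * \<xi> powr ((\<sigma>1 + 2) * (m - p) / (m - 1))"

text \<open>
  Asymptotic equivalence alone only detects \<open>f 0 = K powr (1 / (m - p))\<close>. For \<open>p > 1\<close> the
  second-order term of the bracket is the true one, so the second clause also requires
  \<open>f\<^sup>m\<^sup>-\<^sup>p\<close> to agree with the bracket up to an error smaller than that term. For \<open>p = 1\<close> this
  would fail: then \<open>\<sigma>2 = \<sigma>1\<close>, the terms \<open>\<alpha> \<xi>\<^sup>\<sigma>\<^sup>1 f\<close> and \<open>\<xi>\<^sup>\<sigma>\<^sup>2 f\<^sup>p\<close> of the profile equation have
  the same order, and the coefficient is multiplied by \<open>1 - \<alpha>\<close>.
\<close>

definition origin_behaviour ::
    "real \<Rightarrow> real \<Rightarrow> real \<Rightarrow> real \<Rightarrow> real \<Rightarrow> (real \<Rightarrow> real) \<Rightarrow> bool"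
  where "origin_behaviour N m p \<sigma>1 K f \<longleftrightarrow>
    f \<sim>[at_right 0] (\<lambda>\<xi>. origin_bracket N m p \<sigma>1 K \<xi> powr (1 / (m - p))) \<and>
    (1 < p \<longrightarrow>
      (\<lambda>\<xi>. f \<xi> powr (m - p) - origin_bracket N m p \<sigma>1 K \<xi>)
        \<in> o[at_right 0](\<lambda>\<xi>. \<xi> powr ((\<sigma>1 + 2) * (m - p) / (m - 1))))"

text \<open>
  Writing \<open>f = \<xi> powr (\<alpha>/\<beta>) * h\<close>, the profile equation reduces to leading order at infinity to
  \<open>\<beta> dh/d(ln \<xi>) = - h\<^sup>p\<close>, so that \<open>h\<^sup>1\<^sup>-\<^sup>p\<close> behaves like \<open>(p - 1)/\<beta> * ln \<xi>\<close>, where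
  \<open>\<beta> = \<alpha> (m - 1) / (\<sigma>1 + 2)\<close>.
\<close>

definition tail_const :: "real \<Rightarrow> real \<Rightarrow> real \<Rightarrow> real \<Rightarrow> real"
  where "tail_const m p \<alpha> \<sigma>1 = (\<alpha> * (m - 1) / ((p - 1) * (\<sigma>1 + 2))) powr (1 / (p - 1))"

definition tail_behaviour :: "real \<Rightarrow> real \<Rightarrow> real \<Rightarrow> real \<Rightarrow> (real \<Rightarrow> real) \<Rightarrow> bool"
  where "tail_behaviour m p \<alpha> \<sigma>1 f \<longleftrightarrow>
    0 < tail_const m p \<alpha> \<sigma>1 \<and>
    f \<sim>[at_top] (\<lambda>\<xi>. tail_const m p \<alpha> \<sigma>1 * \<xi> powr ((\<sigma>1 + 2) / (m - 1))
                      * ln \<xi> powr (- 1 / (p - 1)))"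

text \<open>
  The parameter of the family is \<open>K > 0\<close>, equivalently \<open>f 0\<close>. The dimension enters through the
  type argument.
\<close>

definition compact_family ::
    "'a::euclidean_space itself \<Rightarrow> real \<Rightarrow> real \<Rightarrow> real \<Rightarrow> real \<Rightarrow> real \<Rightarrow> real \<Rightarrow> (real \<Rightarrow> real \<Rightarrow> real) \<Rightarrow> bool"
  where "compact_family E m p \<sigma>1 \<sigma>2 \<alpha> \<beta> F \<longleftrightarrow>
    (\<forall>K>0.
      weak_solution m p \<sigma>1 \<sigma>2 (exp_self_similar \<alpha> \<beta> (F K) :: 'a \<Rightarrow> real \<Rightarrow> real) \<and>
      compactly_supported_in_space (exp_self_similar \<alpha> \<beta> (F K) :: 'a \<Rightarrow> real \<Rightarrow> real) \<and>
      0 < F K 0 \<and>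
      origin_behaviour (real DIM('a)) m p \<sigma>1 K (F K))"

definition tail_family ::
    "'a::euclidean_space itself \<Rightarrow> real \<Rightarrow> real \<Rightarrow> real \<Rightarrow> real \<Rightarrow> real \<Rightarrow> real \<Rightarrow> (real \<Rightarrow> real \<Rightarrow> real) \<Rightarrow> bool"
  where "tail_family E m p \<sigma>1 \<sigma>2 \<alpha> \<beta> F \<longleftrightarrow>
    (\<forall>K>0.
      weak_solution m p \<sigma>1 \<sigma>2 (exp_self_similar \<alpha> \<beta> (F K) :: 'a \<Rightarrow> real \<Rightarrow> real) \<and>
      origin_behaviour (real DIM('a)) m p \<sigma>1 K (F K) \<and>
      (1 < p \<longrightarrow> tail_behaviour m p \<alpha> \<sigma>1 (F K)))"

end

theory Submission
  imports Defs
begin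

text \<open>
  Self-similarity fixes \<open>\<alpha> = k * \<beta>\<close> with \<open>k = (\<sigma>1 + 2) / (m - 1)\<close>, so the profile equation has one free
  parameter \<open>\<beta>\<close>, and the scaling \<open>f \<mapsto> c powr - k * f (c * \<xi>)\<close> reduces everything to \<open>f 0 = 1\<close>. Integrated
  twice, the radial equation is a Volterra equation for \<open>f powr m\<close>, which determines the positive part of
  the profile. In the variable \<open>ln \<xi>\<close> it becomes an autonomous plane system for \<open>h = \<xi> powr - k * f\<close> and a
  flux variable \<open>Z\<close>. The set of \<open>\<beta> \<ge> 0\<close> for which \<open>Z\<close> changes sign is open and contains \<open>0\<close>, and a
  barrier keeps \<open>Z\<close> positive for large \<open>\<beta>\<close>; let \<open>\<beta>s\<close> be the supremum of this set. Positive \<open>Z\<close> leaves two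
  possibilities: a global orbit with \<open>Z / h \<longrightarrow> \<beta>\<close>, which yields the logarithmic tail, or a finite endpoint where
  \<open>h\<close> and \<open>Z\<close> vanish together, which is a compactly supported profile. The first is stable under
  perturbation of \<open>\<beta>\<close>, so the second occurs at \<open>\<beta>s\<close>. Two compactly supported profiles with \<open>\<beta>1 < \<beta>2\<close> cannot
  coexist: written as curves \<open>Q1\<close>, \<open>Q2\<close> over \<open>h\<close>, their difference is positive near \<open>h = 0\<close>, hence everywhere,
  and grows faster than the bound \<open>h powr p\<close> imposed by regularity at the origin. Hence all orbits with
  \<open>\<beta> > \<beta>s\<close> are global.

  Comoving coordinates \<open>x = exp (\<beta> * t) *\<^sub>R y\<close> turn the weak formulation into a stationary one: profiles
  give weak solutions by the divergence theorem, and testing with separated radial functions recovers the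
  Volterra equation from a weak solution.
\<close>

section \<open>Means with a power weight\<close>

text \<open>The given value of \<open>\<sigma>2\<close> is the one for which all terms scale alike
  under \<open>f \<mapsto> c powr - k * f (c * \<xi>)\<close>; hence the system in
  \<open>ln \<xi>\<close> is autonomous. The obstacle is the degeneracy at \<open>f = 0\<close>:
  \<open>w powr (1 / m)\<close> is not Lipschitz there, and \<open>f\<close> need not be
  differentiable at the edge of its support. So the unknown is \<open>f powr m\<close>, the Volterra
  equation is solved above a positive cutoff, and the endpoint is studied in the phase plane. The
  flux variable has Lienard form because \<open>\<beta>\<close> then drops out of its equation,
  \<open>Z' = - B * h powr m - h powr p\<close>: \<open>Z\<close> strictly decreases, so a negative
  value at one point settles a sign change, and this survives small changes of
  \<open>\<beta>\<close>. The quantity \<open>\<beta> * h + A * h powr m - Z\<close> stays positive,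
  so \<open>h\<close> decreases too and can serve as a coordinate. The condition
  \<open>0 < N + \<sigma>2\<close> acts twice: it makes the second weight integrable at the origin,
  and it says \<open>p < q / k\<close>, where \<open>q / k\<close> is the growth exponent of the gap
  between two compact curves and \<open>p\<close> the one allowed by regularity at the
  origin.\<close>

definition pmean :: "real \<Rightarrow> (real \<Rightarrow> real) \<Rightarrow> real \<Rightarrow> real"
  where "pmean a g r = integral {0..1} (\<lambda>\<theta>. \<theta> powr (a - 1) * g (r * \<theta>))"

lemma powr_unit_has_integral:
  assumes "(0::real) < a"
  shows "((\<lambda>\<theta>. \<theta> powr (a - 1)) has_integral 1 / a) {0..1}"
  using has_integral_powr_from_0[of "a - 1" 1] assms by simp

lemma powr_mult_absolutely_integrable:
  fixes g :: "real \<Rightarrow> real"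
  assumes "0 < a" "0 \<le> r" "continuous_on {0..r} g"
  shows "(\<lambda>\<theta>. \<theta> powr (a - 1) * g \<theta>) absolutely_integrable_on {0..r}"
proof -
  have 1: "(\<lambda>\<theta>. \<theta> powr (a - 1)) absolutely_integrable_on {0..r}"
    by (rule nonnegative_absolutely_integrable_1)
       (use has_integral_powr_from_0[of "a - 1" r] assms in auto)
  have 2: "g \<in> borel_measurable (lebesgue_on {0..r})"
    by (rule continuous_imp_measurable_on_sets_lebesgue) (use assms in auto)
  have 3: "bounded (g ` {0..r})"
    by (intro compact_imp_bounded compact_continuous_image assms compact_Icc)
  show ?thesis
    using absolutely_integrable_bounded_measurable_product_real[OF 2 _ 3 1]
    by (simp add: mult.commute)
qed

lemma continuous_on_stretch:
  fixes g :: "real \<Rightarrow> real"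
  assumes "continuous_on {0..} g" "0 \<le> r"
  shows "continuous_on {0..1} (\<lambda>\<theta>. g (r * \<theta>))"
  by (rule continuous_on_compose2[OF assms(1)]) (use assms in \<open>auto intro!: continuous_intros\<close>)

lemma pmean_integrable:
  fixes g :: "real \<Rightarrow> real"
  assumes "0 < a" "0 \<le> r" "continuous_on {0..} g"
  shows "(\<lambda>\<theta>. \<theta> powr (a - 1) * g (r * \<theta>)) integrable_on {0..1}"
  using powr_mult_absolutely_integrable[OF assms(1) _ continuous_on_stretch[OF assms(3,2)]]
  by (simp add: set_lebesgue_integral_eq_integral)

lemma pmean_cong:
  assumes "0 \<le> r" "\<And>x. 0 \<le> x \<Longrightarrow> x \<le> r \<Longrightarrow> g x = g' x"
  shows "pmean a g r = pmean a g' r"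
  unfolding pmean_def by (intro integral_cong) (use assms in \<open>auto simp: mult_left_le\<close>)

lemma pmean_const:
  assumes "0 < a" shows "pmean a (\<lambda>_. c) r = c / a"
  unfolding pmean_def
  using has_integral_mult_left[OF powr_unit_has_integral[OF assms], of c, THEN integral_unique]
  by simp

lemma pmean_zero: "0 < a \<Longrightarrow> pmean a g 0 = g 0 / a"
  using pmean_const[of a "g 0"] by (simp add: pmean_def)

lemma pmean_scale: "pmean a (\<lambda>x. g (c * x)) r = pmean a g (c * r)"
  by (simp add: pmean_def mult.assoc)

lemma pmean_cmult: "pmean a (\<lambda>x. c * g x) r = c * pmean a g r"
  unfolding pmean_def by (simp flip: integral_mult_right add: algebra_simps)

lemma pmean_diff:
  assumes "0 < a" "0 \<le> r" "continuous_on {0..} g" "continuous_on {0..} g'"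
  shows "pmean a (\<lambda>x. g x - g' x) r = pmean a g r - pmean a g' r"
  unfolding pmean_def right_diff_distrib
  by (intro integral_diff pmean_integrable assms)

lemma pmean_mono:
  assumes "0 < a" "0 \<le> r" "continuous_on {0..} g" "continuous_on {0..} g'"
    and "\<And>x. 0 \<le> x \<Longrightarrow> x \<le> r \<Longrightarrow> g x \<le> g' x"
  shows "pmean a g r \<le> pmean a g' r"
  unfolding pmean_def
  by (intro integral_le pmean_integrable mult_left_mono assms)
     (auto simp: mult_left_le assms)

lemma pmean_abs_le:
  assumes "0 < a" "0 \<le> r" "continuous_on {0..} g" "continuous_on {0..} g'"
    and "\<And>x. 0 \<le> x \<Longrightarrow> x \<le> r \<Longrightarrow> \<bar>g x\<bar> \<le> g' x"
  shows "\<bar>pmean a g r\<bar> \<le> pmean a g' r"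
proof -
  have "pmean a g r \<le> pmean a g' r"
    using assms by (intro pmean_mono) (auto simp: abs_le_iff)
  moreover have "pmean a (\<lambda>x. - 1 * g x) r \<le> pmean a g' r"
    using assms by (intro pmean_mono) (auto simp: abs_le_iff intro!: continuous_intros)
  ultimately show ?thesis
    using pmean_cmult[of a "- 1" g r] by (simp add: abs_le_iff)
qed

lemma pmean_bound:
  assumes "0 < a" "0 \<le> r" "continuous_on {0..} g"
    and "\<And>x. 0 \<le> x \<Longrightarrow> x \<le> r \<Longrightarrow> \<bar>g x\<bar> \<le> C"
  shows "\<bar>pmean a g r\<bar> \<le> C / a"
  using pmean_abs_le[of a r g "\<lambda>_. C"] assms by (simp add: pmean_const)

text \<open>Substitution \<open>\<tau> = r * \<theta>\<close>: \<open>pmean\<close> is the primitive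
  of \<open>\<tau> powr (a - 1) * g \<tau>\<close> divided by \<open>r powr a\<close>. The
  normalised form also makes sense at \<open>r = 0\<close>, where that quotient is
  \<open>0 / 0\<close> and the mean is \<open>g 0 / a\<close>.\<close>

lemma powr_mult_pmean:
  assumes "0 < a" "0 < r" "continuous_on {0..} g"
  shows "r powr a * pmean a g r = integral {0..r} (\<lambda>\<tau>. \<tau> powr (a - 1) * g \<tau>)"
proof -
  let ?f = "\<lambda>\<tau>. \<tau> powr (a - 1) * g \<tau>"
  have "?f integrable_on {0..r}"
    using powr_mult_absolutely_integrable[of a r g] assms continuous_on_subset[of "{0..}" g "{0..r}"]
    by (auto simp: set_lebesgue_integral_eq_integral)
  then have "(?f has_integral integral {0..r} ?f) {0..r}" by blast
  from has_integral_stretch_real[OF this, of r] assms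
  have "((\<lambda>x. ?f (r * x)) has_integral integral {0..r} ?f / r) ((\<lambda>x. x / r) ` {0..r})"
    by (simp add: field_simps)
  moreover have "(\<lambda>x. x / r) ` {0..r} = {0..1}"
    using assms image_divide_atLeastAtMost[of r 0 r] by simp
  ultimately have "((\<lambda>x. r powr (1 - a) * ?f (r * x)) has_integral r powr (1 - a) * (integral {0..r} ?f / r)) {0..1}"
    by (intro has_integral_mult_right) simp
  moreover have "r powr (1 - a) * ?f (r * x) = x powr (a - 1) * g (r * x)" if "x \<in> {0..1}" for x
  proof -
    have "r powr (1 - a) * r powr (a - 1) = 1"
      using assms by (simp flip: powr_add)
    then show ?thesis
      using that assms by (simp add: powr_mult)
  qed
  ultimately have "((\<lambda>x. x powr (a - 1) * g (r * x)) has_integral r powr (1 - a) * (integral {0..r} ?f / r)) {0..1}"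
    by (subst has_integral_cong[where g = "\<lambda>x. r powr (1 - a) * ?f (r * x)"]) metis+
  then have "pmean a g r = r powr (1 - a) * (integral {0..r} ?f / r)"
    unfolding pmean_def by (rule integral_unique)
  then show ?thesis
    using assms by (simp add: powr_diff)
qed

lemma has_real_derivative_powr_mult_pmean:
  assumes "0 < a" "0 < r" "continuous_on {0..} g"
  shows "((\<lambda>x. x powr a * pmean a g x) has_real_derivative r powr (a - 1) * g r) (at r)"
proof -
  let ?f = "\<lambda>\<tau>. \<tau> powr (a - 1) * g \<tau>"
  have int: "?f integrable_on {0..2*r}"
    using powr_mult_absolutely_integrable[of a "2*r" g] assms continuous_on_subset[of "{0..}" g "{0..2*r}"]
    by (auto simp: set_lebesgue_integral_eq_integral)
  have cg: "continuous (at r) g"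
    using assms by (intro continuous_on_interior[OF assms(3)]) (auto simp: interior_real_atLeast)
  have "continuous (at r) ?f"
    using assms by (intro continuous_intros cg) auto
  then have "((\<lambda>u. integral {0..u} ?f) has_vector_derivative ?f r) (at r within ({0..2*r} - {}))"
    using assms int by (intro integral_has_vector_derivative_continuous_at)
      (auto simp: continuous_at_imp_continuous_at_within)
  then have "((\<lambda>u. integral {0..u} ?f) has_real_derivative ?f r) (at r)"
    using assms by (simp add: has_real_derivative_iff_has_vector_derivative at_within_Icc_at)
  then show ?thesis
    by (rule has_field_derivative_transform_within_open[of _ _ _ "{0<..}"])
       (use assms powr_mult_pmean in auto)
qed

lemma has_real_derivative_pmean:
  assumes "0 < a" "0 < r" "continuous_on {0..} g"
  shows "(pmean a g has_real_derivative (g r - a * pmean a g r) / r) (at r)"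
proof -
  have "r powr (- a - 1) * r powr a = 1 / r" "r powr (- a) * r powr (a - 1) = 1 / r"
    using assms by (simp_all add: powr_minus powr_diff field_simps)
  then have eq: "(r powr (- a - 1) * r powr a) * (- a * pmean a g r) + (r powr (- a) * r powr (a - 1)) * g r =
      (g r - a * pmean a g r) / r"
    using assms by (simp only:) (simp add: field_simps)
  have "((\<lambda>x. x powr (-a)) has_real_derivative - a * r powr (- a - 1)) (at r)"
    using assms by (auto intro!: derivative_eq_intros)
  from DERIV_mult[OF this has_real_derivative_powr_mult_pmean[OF assms]]
  have "((\<lambda>x. x powr (-a) * (x powr a * pmean a g x)) has_real_derivative (g r - a * pmean a g r) / r) (at r)"
    unfolding eq[symmetric] by (rule DERIV_cong) (simp add: mult_ac)
  then show ?thesis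
    by (rule has_field_derivative_transform_within_open[of _ _ _ "{0<..}"])
       (use assms in \<open>auto simp: powr_minus\<close>)
qed

text \<open>Positive radii follow from differentiability. At \<open>0\<close> the mean of the
  constant \<open>g 0\<close> does not depend on the radius, so only the mean of
  \<open>g - g 0\<close> matters, and it is at most the supremum of that difference divided by
  \<open>a\<close>.\<close>

lemma continuous_on_pmean:
  assumes "0 < a" "continuous_on {0..} g"
  shows "continuous_on {0..} (pmean a g)"
  unfolding continuous_on_eq_continuous_within
proof
  fix r :: real assume r: "r \<in> {0..}"
  show "continuous (at r within {0..}) (pmean a g)"
  proof (cases "r = 0")
    case False
    then have "0 < r" using r by simp
    show ?thesis
      by (rule continuous_at_imp_continuous_at_within, rule DERIV_isCont,
          rule has_real_derivative_pmean[OF assms(1) \<open>0 < r\<close> assms(2)])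
  next
    case True
    show ?thesis
      unfolding True continuous_within_eps_delta
    proof (intro allI impI)
      fix e :: real assume "e > 0"
      then have "e * a / 2 > 0" using assms by simp
      then obtain d where d: "d > 0" "\<And>x. x \<ge> 0 \<Longrightarrow> dist x 0 < d \<Longrightarrow> dist (g x) (g 0) < e * a / 2"
        using assms(2) unfolding continuous_on_iff by (metis atLeast_iff order_refl)
      show "\<exists>d>0. \<forall>x'\<in>{0..}. dist x' 0 < d \<longrightarrow> dist (pmean a g x') (pmean a g 0) < e"
      proof (intro exI conjI ballI impI)
        fix x :: real assume x: "x \<in> {0..}" "dist x 0 < d"
        have "\<bar>pmean a (\<lambda>x. g x - g 0) x\<bar> \<le> (e * a / 2) / a"
          using x d(2) assms by (intro pmean_bound) (auto intro!: continuous_intros simp: dist_real_def less_imp_le)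
        then have "\<bar>pmean a g x - g 0 / a\<bar> \<le> e / 2"
          using x assms by (subst (asm) pmean_diff) (auto simp: pmean_const)
        then show "dist (pmean a g x) (pmean a g 0) < e"
          using assms \<open>e > 0\<close> by (simp add: pmean_zero dist_real_def)
      qed (use d in auto)
    qed
  qed
qed

section \<open>The Volterra equation\<close>

text \<open>Mean value theorem on the truncated arguments: the derivative
  \<open>a * z powr (a - 1)\<close> decreases because \<open>a < 1\<close>, so its largest value is
  the one at the cutoff.\<close>

lemma truncated_powr_lipschitz:
  fixes a \<epsilon> :: real
  assumes "0 < a" "a < 1" "0 < \<epsilon>"
  shows "\<bar>max x \<epsilon> powr a - max y \<epsilon> powr a\<bar> \<le> a * \<epsilon> powr (a - 1) * \<bar>x - y\<bar>"
proof -
  have *: "max y \<epsilon> powr a - max x \<epsilon> powr a \<le> a * \<epsilon> powr (a - 1) * (y - x)"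
    if "x \<le> y" for x y :: real
  proof (cases "max x \<epsilon> < max y \<epsilon>")
    case True
    have "\<exists>z. max x \<epsilon> < z \<and> z < max y \<epsilon> \<and>
        max y \<epsilon> powr a - max x \<epsilon> powr a = (max y \<epsilon> - max x \<epsilon>) * (a * z powr (a - 1))"
      by (rule MVT2[OF True]) (use assms in \<open>auto intro!: has_real_derivative_powr\<close>)
    then obtain z where z: "max x \<epsilon> < z"
      "max y \<epsilon> powr a - max x \<epsilon> powr a = (max y \<epsilon> - max x \<epsilon>) * (a * z powr (a - 1))"
      by blast
    have "z powr (a - 1) \<le> \<epsilon> powr (a - 1)"
      using z assms by (intro powr_mono2') auto
    moreover have "max y \<epsilon> - max x \<epsilon> \<le> y - x" using that by auto
    ultimately have "(max y \<epsilon> - max x \<epsilon>) * (a * z powr (a - 1)) \<le> (y - x) * (a * \<epsilon> powr (a - 1))"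
      using assms that True by (intro mult_mono mult_left_mono) auto
    then show ?thesis using z by (simp add: mult_ac)
  next
    case False
    then have "max y \<epsilon> = max x \<epsilon>" using that by auto
    then show ?thesis using assms that by simp
  qed
  have mono: "max x \<epsilon> powr a \<le> max y \<epsilon> powr a" if "x \<le> y" for x y :: real
    using that assms by (intro powr_mono2) auto
  show ?thesis
    using *[of x y] *[of y x] mono[of x y] mono[of y x] by (cases "x \<le> y") auto
qed

text \<open>The dimension enters as a real number \<open>N\<close>, so the one-dimensional analysis
  does not mention the space type. The last two assumptions say that both weights are integrable
  near the origin of an \<open>N\<close>-dimensional space.\<close>

locale profile_parameters =
  fixes m p \<sigma>1 \<sigma>2 N :: real
  assumes m_gt_1: "1 < m" and p_ge_1: "1 \<le> p" and p_less_m: "p < m"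
    and \<sigma>1_gt: "-2 < \<sigma>1"
    and \<sigma>2_eq: "\<sigma>2 = (\<sigma>1 * (m - p) - 2 * (p - 1)) / (m - 1)"
    and N_\<sigma>1: "0 < N + \<sigma>1" and N_\<sigma>2: "0 < N + \<sigma>2"
begin

definition k where "k = (\<sigma>1 + 2) / (m - 1)"

text \<open>Integrating \<open>\<alpha> * f - \<beta> * r * f'\<close> against
  \<open>r powr (N + \<sigma>1 - 1)\<close> by parts leaves the factor
  \<open>\<alpha> + \<beta> * (N + \<sigma>1)\<close> in front of the integral of \<open>f\<close>,
  and with \<open>\<alpha> = k * \<beta>\<close> this is \<open>\<beta> * q\<close>.\<close>

definition q where "q = k + N + \<sigma>1"

lemma k_pos: "0 < k"
  unfolding k_def using m_gt_1 \<sigma>1_gt by simp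

lemma q_pos: "0 < q"
  unfolding q_def using k_pos N_\<sigma>1 by linarith

lemma m_pos: "0 < m" and p_pos: "0 < p"
  using m_gt_1 p_ge_1 by auto

lemma km_eq: "k * m = k + \<sigma>1 + 2"
  unfolding k_def using m_gt_1 by (simp add: field_simps)

lemma \<sigma>2_plus_2: "\<sigma>2 + 2 = k * (m - p)"
  unfolding \<sigma>2_eq k_def using m_gt_1 by (simp add: divide_simps) (simp add: algebra_simps)

lemma q_eq: "q = k * m + N - 2"
  unfolding q_def km_eq by simp

text \<open>With \<open>0 < N + \<sigma>2\<close> this is the inequality \<open>p < q / k\<close> on
  which the uniqueness of the exponent rests.\<close>

lemma q_minus_pk: "q - p * k = N + \<sigma>2"
  using \<sigma>2_plus_2 q_eq by (simp add: algebra_simps)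

lemma \<sigma>1_plus_2_pos: "0 < \<sigma>1 + 2" and \<sigma>2_plus_2_pos: "0 < \<sigma>2 + 2"
  using \<sigma>1_gt \<sigma>2_plus_2 k_pos p_less_m by auto

lemma \<sigma>2_le_\<sigma>1: "\<sigma>2 \<le> \<sigma>1"
proof -
  have "\<sigma>1 - \<sigma>2 = (p - 1) * k"
    using \<sigma>2_plus_2 km_eq by (simp add: algebra_simps)
  then show ?thesis using p_ge_1 k_pos by (metis diff_ge_0_iff_ge mult_nonneg_nonneg less_imp_le)
qed

text \<open>
  Twice integrated, the profile equation reads \<open>f r powr m = f 0 powr m + prim \<beta> f r\<close>, with
  \<open>r * (f powr m)' = flux \<beta> f r - \<beta> * r powr (\<sigma>1 + 2) * f r\<close>. Writing the integrals as means over the unit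
  interval keeps the weights integrable down to \<open>r = 0\<close>.
\<close>

definition lin where
  "lin \<beta> F G r = \<beta> * q * (r powr (\<sigma>1 + 2) * pmean (\<sigma>1 + 2) (pmean (N + \<sigma>1) F) r)
     - r powr (\<sigma>2 + 2) * pmean (\<sigma>2 + 2) (pmean (N + \<sigma>2) G) r
     - \<beta> * (r powr (\<sigma>1 + 2) * pmean (\<sigma>1 + 2) F r)"

definition flux where
  "flux \<beta> f r = \<beta> * q * r powr (\<sigma>1 + 2) * pmean (N + \<sigma>1) f r
     - r powr (\<sigma>2 + 2) * pmean (N + \<sigma>2) (\<lambda>x. f x powr p) r"

definition prim where
  "prim \<beta> f = lin \<beta> f (\<lambda>x. f x powr p)"

text \<open>The exponential weight in which the Volterra operator is a contraction.\<close>

definition wt where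
  "wt \<Lambda> x = exp (\<Lambda> * (x powr (\<sigma>1 + 2) + x powr (\<sigma>2 + 2)))"

text \<open>One summand per term of \<open>lin\<close>: an inner mean contributes
  \<open>1 / (N + \<sigma>1)\<close> or \<open>1 / (N + \<sigma>2)\<close>, an outer one
  \<open>1 / (\<sigma>1 + 2)\<close> or \<open>1 / (\<sigma>2 + 2)\<close>. The argument
  \<open>b\<close> is an upper bound for \<open>\<beta>\<close>.\<close>

definition kap where
  "kap b = b * q / ((\<sigma>1 + 2) * (N + \<sigma>1)) + 1 / ((\<sigma>2 + 2) * (N + \<sigma>2)) + b / (\<sigma>1 + 2)"

lemma kap_pos: "0 \<le> b \<Longrightarrow> 0 < kap b"
  unfolding kap_def using q_pos \<sigma>1_plus_2_pos \<sigma>2_plus_2_pos N_\<sigma>1 N_\<sigma>2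
  by (intro add_pos_nonneg add_nonneg_pos) auto

lemma kap_mono: "0 \<le> b \<Longrightarrow> b \<le> b' \<Longrightarrow> kap b \<le> kap b'"
  unfolding kap_def using q_pos \<sigma>1_plus_2_pos \<sigma>2_plus_2_pos N_\<sigma>1 N_\<sigma>2
  by (intro add_mono divide_right_mono mult_right_mono) auto

lemma continuous_on_powr_a1: "continuous_on {0..} (\<lambda>x::real. x powr (\<sigma>1 + 2))"
  and continuous_on_powr_a2: "continuous_on {0..} (\<lambda>x::real. x powr (\<sigma>2 + 2))"
  by (rule continuous_on_powr'[OF continuous_on_id continuous_on_const];
      use \<sigma>1_plus_2_pos \<sigma>2_plus_2_pos in auto)+

lemma continuous_on_wt: "continuous_on {0..} (wt \<Lambda>)"
  unfolding wt_def by (intro continuous_intros continuous_on_powr_a1 continuous_on_powr_a2)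

lemma wt_pos: "0 < wt \<Lambda> x"
  unfolding wt_def by simp

lemma wt_mono: "0 \<le> \<Lambda> \<Longrightarrow> 0 \<le> x \<Longrightarrow> x \<le> y \<Longrightarrow> wt \<Lambda> x \<le> wt \<Lambda> y"
  unfolding wt_def using \<sigma>1_plus_2_pos \<sigma>2_plus_2_pos
  by (auto intro!: mult_left_mono add_mono powr_mono2)

lemma wt_0: "wt \<Lambda> 0 = 1"
  unfolding wt_def by simp

lemma wt_ge_1: "0 \<le> \<Lambda> \<Longrightarrow> 0 \<le> x \<Longrightarrow> 1 \<le> wt \<Lambda> x"
  using wt_mono[of \<Lambda> 0 x] wt_0 by simp

text \<open>The left side is the integral of
  \<open>\<tau> powr (a - 1) * wt \<Lambda> \<tau>\<close>. Both powers occur in the exponent of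
  \<open>wt\<close>, so the derivative of \<open>wt \<Lambda> / (\<Lambda> * a)\<close> dominates
  that integrand. The factor \<open>1 / \<Lambda>\<close> gained here is what makes the contraction
  possible.\<close>

lemma powr_mult_pmean_wt:
  assumes a: "a = \<sigma>1 + 2 \<or> a = \<sigma>2 + 2" and "0 < \<Lambda>" "0 \<le> r"
  shows "r powr a * pmean a (wt \<Lambda>) r \<le> wt \<Lambda> r / (\<Lambda> * a)"
proof -
  have apos: "0 < a" using a \<sigma>1_plus_2_pos \<sigma>2_plus_2_pos by auto
  let ?\<psi> = "\<lambda>x. wt \<Lambda> x / (\<Lambda> * a) - x powr a * pmean a (wt \<Lambda>) x"
  have "?\<psi> 0 \<le> ?\<psi> r"
  proof (rule DERIV_nonneg_imp_increasing_open[OF \<open>0 \<le> r\<close>])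
    fix x assume x: "0 < x" "x < r"
    let ?d = "\<Lambda> * ((\<sigma>1 + 2) * x powr (\<sigma>1 + 2 - 1) + (\<sigma>2 + 2) * x powr (\<sigma>2 + 2 - 1))"
    have "(wt \<Lambda> has_real_derivative wt \<Lambda> x * ?d) (at x)"
      unfolding wt_def using x
      by (auto intro!: derivative_eq_intros)
    then have d: "(?\<psi> has_real_derivative wt \<Lambda> x * ?d / (\<Lambda> * a) - x powr (a - 1) * wt \<Lambda> x) (at x)"
      using x apos
      by (intro DERIV_diff DERIV_cdivide has_real_derivative_powr_mult_pmean continuous_on_wt)
    have "0 \<le> (\<sigma>1 + 2) * x powr (\<sigma>1 + 2 - 1)" "0 \<le> (\<sigma>2 + 2) * x powr (\<sigma>2 + 2 - 1)"
      using \<sigma>1_plus_2_pos \<sigma>2_plus_2_pos by simp_all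
    with a have "a * x powr (a - 1) \<le> (\<sigma>1 + 2) * x powr (\<sigma>1 + 2 - 1) + (\<sigma>2 + 2) * x powr (\<sigma>2 + 2 - 1)"
      by auto
    then have "\<Lambda> * a * x powr (a - 1) \<le> ?d"
      using \<open>0 < \<Lambda>\<close> by (simp only: mult.assoc mult_le_cancel_left_pos)
    then have "x powr (a - 1) \<le> ?d / (\<Lambda> * a)"
      using apos \<open>0 < \<Lambda>\<close> by (simp add: field_simps)
    then have "x powr (a - 1) * wt \<Lambda> x \<le> ?d / (\<Lambda> * a) * wt \<Lambda> x"
      using wt_pos[of \<Lambda> x] by (intro mult_right_mono) auto
    then have "0 \<le> wt \<Lambda> x * ?d / (\<Lambda> * a) - x powr (a - 1) * wt \<Lambda> x"
      by (simp only: mult.commute[of _ "wt \<Lambda> x"] times_divide_eq_right diff_ge_0_iff_ge)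
    with d show "\<exists>y. (?\<psi> has_real_derivative y) (at x) \<and> 0 \<le> y" by blast
  next
    show "continuous_on {0..r} ?\<psi>"
      using apos \<open>0 < \<Lambda>\<close>
      by (intro continuous_intros continuous_on_subset[OF continuous_on_wt] continuous_on_powr'
            continuous_on_subset[OF continuous_on_pmean[OF _ continuous_on_wt]]) auto
  qed
  moreover have "0 \<le> ?\<psi> 0" using apos \<open>0 < \<Lambda>\<close> by (simp add: wt_0)
  ultimately show ?thesis by linarith
qed

lemma powr_mult_pmean_bound:
  assumes a: "a = \<sigma>1 + 2 \<or> a = \<sigma>2 + 2" and "0 < \<Lambda>" "0 \<le> r" "0 \<le> D" "continuous_on {0..} F"
    and "\<And>x. 0 \<le> x \<Longrightarrow> x \<le> r \<Longrightarrow> \<bar>F x\<bar> \<le> D * wt \<Lambda> x"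
  shows "\<bar>r powr a * pmean a F r\<bar> \<le> D * (wt \<Lambda> r / (\<Lambda> * a))"
proof -
  have apos: "0 < a" using a \<sigma>1_plus_2_pos \<sigma>2_plus_2_pos by auto
  have "\<bar>pmean a F r\<bar> \<le> pmean a (\<lambda>x. D * wt \<Lambda> x) r"
    by (rule pmean_abs_le) (use assms apos in \<open>auto intro!: continuous_intros continuous_on_wt\<close>)
  then have "r powr a * \<bar>pmean a F r\<bar> \<le> r powr a * (D * pmean a (wt \<Lambda>) r)"
    by (intro mult_left_mono) (auto simp: pmean_cmult)
  also have "\<dots> = D * (r powr a * pmean a (wt \<Lambda>) r)" by simp
  also have "\<dots> \<le> D * (wt \<Lambda> r / (\<Lambda> * a))"
    by (intro mult_left_mono powr_mult_pmean_wt assms)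
  finally show ?thesis by (simp add: abs_mult)
qed

text \<open>The inner means merely preserve the weight, by its monotonicity; the gain in
  \<open>\<Lambda>\<close> comes from the outer means.\<close>

lemma pmean_wt_bound:
  assumes "0 < a" "0 \<le> \<Lambda>" "0 \<le> r" "0 \<le> D" "continuous_on {0..} F"
    and "\<And>x. 0 \<le> x \<Longrightarrow> x \<le> r \<Longrightarrow> \<bar>F x\<bar> \<le> D * wt \<Lambda> x"
  shows "\<bar>pmean a F r\<bar> \<le> D / a * wt \<Lambda> r"
proof -
  have "\<bar>pmean a F r\<bar> \<le> (D * wt \<Lambda> r) / a"
  proof (rule pmean_bound)
    fix x assume x: "0 \<le> x" "x \<le> r"
    then have "D * wt \<Lambda> x \<le> D * wt \<Lambda> r" using assms by (intro mult_left_mono wt_mono)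
    with assms(6)[OF x] show "\<bar>F x\<bar> \<le> D * wt \<Lambda> r" by linarith
  qed (use assms in auto)
  then show ?thesis by simp
qed

lemma lin_bound:
  assumes "0 < \<Lambda>" "0 \<le> r" "0 \<le> \<beta>" "\<beta> \<le> b" "0 \<le> D"
    and F: "continuous_on {0..} F" and G: "continuous_on {0..} G"
    and FD: "\<And>x. 0 \<le> x \<Longrightarrow> x \<le> r \<Longrightarrow> \<bar>F x\<bar> \<le> D * wt \<Lambda> x"
    and GD: "\<And>x. 0 \<le> x \<Longrightarrow> x \<le> r \<Longrightarrow> \<bar>G x\<bar> \<le> D * wt \<Lambda> x"
  shows "\<bar>lin \<beta> F G r\<bar> \<le> D * wt \<Lambda> r * kap b / \<Lambda>"
proof -
  note pos = \<sigma>1_plus_2_pos \<sigma>2_plus_2_pos N_\<sigma>1 N_\<sigma>2 q_pos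
  have 1: "\<bar>r powr (\<sigma>1 + 2) * pmean (\<sigma>1 + 2) (pmean (N + \<sigma>1) F) r\<bar> \<le> D / (N + \<sigma>1) * (wt \<Lambda> r / (\<Lambda> * (\<sigma>1 + 2)))"
  proof (rule powr_mult_pmean_bound)
    fix x assume "0 \<le> x" "x \<le> r"
    then show "\<bar>pmean (N + \<sigma>1) F x\<bar> \<le> D / (N + \<sigma>1) * wt \<Lambda> x"
      using assms(1,5) pos by (intro pmean_wt_bound F FD) auto
  qed (use assms(1,2,5) F pos in \<open>auto intro!: continuous_on_pmean\<close>)
  have 2: "\<bar>r powr (\<sigma>2 + 2) * pmean (\<sigma>2 + 2) (pmean (N + \<sigma>2) G) r\<bar> \<le> D / (N + \<sigma>2) * (wt \<Lambda> r / (\<Lambda> * (\<sigma>2 + 2)))"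
  proof (rule powr_mult_pmean_bound)
    fix x assume "0 \<le> x" "x \<le> r"
    then show "\<bar>pmean (N + \<sigma>2) G x\<bar> \<le> D / (N + \<sigma>2) * wt \<Lambda> x"
      using assms(1,5) pos by (intro pmean_wt_bound G GD) auto
  qed (use assms(1,2,5) G pos in \<open>auto intro!: continuous_on_pmean\<close>)
  have 3: "\<bar>r powr (\<sigma>1 + 2) * pmean (\<sigma>1 + 2) F r\<bar> \<le> D * (wt \<Lambda> r / (\<Lambda> * (\<sigma>1 + 2)))"
    by (rule powr_mult_pmean_bound) (use assms pos in auto)
  have "\<bar>lin \<beta> F G r\<bar> \<le> \<beta> * q * (D / (N + \<sigma>1) * (wt \<Lambda> r / (\<Lambda> * (\<sigma>1 + 2)))) +
      D / (N + \<sigma>2) * (wt \<Lambda> r / (\<Lambda> * (\<sigma>2 + 2))) + \<beta> * (D * (wt \<Lambda> r / (\<Lambda> * (\<sigma>1 + 2))))"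
  proof -
    have tri: "\<bar>x - y - z\<bar> \<le> \<bar>x\<bar> + \<bar>y\<bar> + \<bar>z\<bar>" for x y z :: real by linarith
    have e1: "\<bar>\<beta> * q * u\<bar> = \<beta> * q * \<bar>u\<bar>" and e2: "\<bar>\<beta> * u\<bar> = \<beta> * \<bar>u\<bar>" for u
      using assms pos by (simp_all add: abs_mult)
    show ?thesis
      unfolding lin_def
      by (rule order_trans[OF tri], unfold e1 e2, intro add_mono mult_left_mono 1 2 3)
         (use assms pos in auto)
  qed
  also have "\<dots> = D * wt \<Lambda> r * kap \<beta> / \<Lambda>"
  proof -
    have "b * q * (D / n1 * (W / (l * s1))) + D / n2 * (W / (l * s2)) + b * (D * (W / (l * s1)))
        = D * W * (b * q / (s1 * n1) + 1 / (s2 * n2) + b / s1) / l"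
      if "0 < l" "0 < s1" "0 < s2" "0 < n1" "0 < n2" for b n1 n2 s1 s2 l W :: real
      using that by (simp add: field_simps)
    then show ?thesis unfolding kap_def using assms(1) pos by blast
  qed
  also have "\<dots> \<le> D * wt \<Lambda> r * kap b / \<Lambda>"
    using assms kap_mono[of \<beta> b] wt_pos[of \<Lambda> r] by (intro divide_right_mono mult_left_mono) auto
  finally show ?thesis .
qed

lemma continuous_on_lin:
  assumes "continuous_on {0..} F" "continuous_on {0..} G"
  shows "continuous_on {0..} (lin \<beta> F G)"
  unfolding lin_def[abs_def] using \<sigma>1_plus_2_pos \<sigma>2_plus_2_pos N_\<sigma>1 N_\<sigma>2 assms
  by (intro continuous_intros continuous_on_powr_a1 continuous_on_powr_a2 continuous_on_pmean)

lemma lin_diff: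
  assumes "0 \<le> r" "continuous_on {0..} F" "continuous_on {0..} G"
    "continuous_on {0..} F'" "continuous_on {0..} G'"
  shows "lin \<beta> F G r - lin \<beta> F' G' r = lin \<beta> (\<lambda>x. F x - F' x) (\<lambda>x. G x - G' x) r"
proof -
  note pos = \<sigma>1_plus_2_pos \<sigma>2_plus_2_pos N_\<sigma>1 N_\<sigma>2
  have 1: "pmean (\<sigma>1 + 2) (pmean (N + \<sigma>1) (\<lambda>x. F x - F' x)) r =
      pmean (\<sigma>1 + 2) (pmean (N + \<sigma>1) F) r - pmean (\<sigma>1 + 2) (pmean (N + \<sigma>1) F') r"
    using assms pos
    by (subst pmean_diff[symmetric]) (auto intro!: continuous_on_pmean pmean_cong pmean_diff)
  have 2: "pmean (\<sigma>2 + 2) (pmean (N + \<sigma>2) (\<lambda>x. G x - G' x)) r =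
      pmean (\<sigma>2 + 2) (pmean (N + \<sigma>2) G) r - pmean (\<sigma>2 + 2) (pmean (N + \<sigma>2) G') r"
    using assms pos
    by (subst pmean_diff[symmetric]) (auto intro!: continuous_on_pmean pmean_cong pmean_diff)
  show ?thesis
    unfolding lin_def 1 2 using assms pos by (simp add: pmean_diff algebra_simps)
qed

lemma lin_cong:
  assumes "0 \<le> r" "\<And>x. 0 \<le> x \<Longrightarrow> x \<le> r \<Longrightarrow> F x = F' x" "\<And>x. 0 \<le> x \<Longrightarrow> x \<le> r \<Longrightarrow> G x = G' x"
  shows "lin \<beta> F G r = lin \<beta> F' G' r"
proof -
  have "pmean (\<sigma>1 + 2) (pmean (N + \<sigma>1) F) r = pmean (\<sigma>1 + 2) (pmean (N + \<sigma>1) F') r"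
    "pmean (\<sigma>2 + 2) (pmean (N + \<sigma>2) G) r = pmean (\<sigma>2 + 2) (pmean (N + \<sigma>2) G') r"
    "pmean (\<sigma>1 + 2) F r = pmean (\<sigma>1 + 2) F' r"
    using assms by (auto intro!: pmean_cong)
  then show ?thesis unfolding lin_def by simp
qed

lemma prim_cong:
  assumes "0 \<le> r" "\<And>x. 0 \<le> x \<Longrightarrow> x \<le> r \<Longrightarrow> f x = f' x"
  shows "prim \<beta> f r = prim \<beta> f' r"
  unfolding prim_def by (rule lin_cong) (use assms in auto)

lemma prim_0: "prim \<beta> f 0 = 0"
  unfolding prim_def lin_def by simp

lemma flux_cong:
  assumes "0 \<le> r" "\<And>x. 0 \<le> x \<Longrightarrow> x \<le> r \<Longrightarrow> f x = f' x"
  shows "flux \<beta> f r = flux \<beta> f' r"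
  unfolding flux_def using pmean_cong[of r f f'] pmean_cong[of r "\<lambda>x. f x powr p" "\<lambda>x. f' x powr p"] assms
  by simp

lemma continuous_on_powr_p:
  assumes "continuous_on {0..} f" "\<And>x. 0 \<le> x \<Longrightarrow> 0 \<le> f x"
  shows "continuous_on {0..} (\<lambda>x. f x powr p)"
  using assms p_pos by (intro continuous_on_powr' continuous_intros) auto

lemma has_real_derivative_prim:
  assumes f: "continuous_on {0..} f" "\<And>x. 0 \<le> x \<Longrightarrow> 0 \<le> f x" and "0 < r"
  shows "(prim \<beta> f has_real_derivative (flux \<beta> f r - \<beta> * r powr (\<sigma>1 + 2) * f r) / r) (at r)"
proof -
  note pos = \<sigma>1_plus_2_pos \<sigma>2_plus_2_pos N_\<sigma>1 N_\<sigma>2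
  have fp: "continuous_on {0..} (\<lambda>x. f x powr p)"
    by (rule continuous_on_powr_p) (use f in auto)
  have "(prim \<beta> f has_real_derivative
      \<beta> * q * (r powr (\<sigma>1 + 2 - 1) * pmean (N + \<sigma>1) f r)
     - r powr (\<sigma>2 + 2 - 1) * pmean (N + \<sigma>2) (\<lambda>x. f x powr p) r
     - \<beta> * (r powr (\<sigma>1 + 2 - 1) * f r)) (at r)"
    unfolding prim_def lin_def[abs_def] using pos f fp \<open>0 < r\<close>
    by (intro DERIV_diff DERIV_cmult has_real_derivative_powr_mult_pmean continuous_on_pmean) auto
  moreover have "r powr (\<sigma>1 + 2 - 1) = r powr (\<sigma>1 + 2) / r" "r powr (\<sigma>2 + 2 - 1) = r powr (\<sigma>2 + 2) / r"
    using \<open>0 < r\<close> by (simp_all only: powr_diff) simp_all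
  ultimately show ?thesis
    unfolding flux_def using \<open>0 < r\<close> by (simp add: diff_divide_distrib mult_ac)
qed

lemma has_real_derivative_flux:
  assumes f: "continuous_on {0..} f" "\<And>x. 0 \<le> x \<Longrightarrow> 0 \<le> f x" and "0 < r"
  shows "(flux \<beta> f has_real_derivative
    ((2 - N) * flux \<beta> f r + \<beta> * q * r powr (\<sigma>1 + 2) * f r - r powr (\<sigma>2 + 2) * f r powr p) / r) (at r)"
proof -
  note pos = \<sigma>1_plus_2_pos \<sigma>2_plus_2_pos N_\<sigma>1 N_\<sigma>2
  have fp: "continuous_on {0..} (\<lambda>x. f x powr p)"
    by (rule continuous_on_powr_p) (use f in auto)
  have d1: "(pmean (N + \<sigma>1) f has_real_derivative (f r - (N + \<sigma>1) * pmean (N + \<sigma>1) f r) / r) (at r)"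
    using pos f \<open>0 < r\<close> by (intro has_real_derivative_pmean) auto
  have d2: "(pmean (N + \<sigma>2) (\<lambda>x. f x powr p) has_real_derivative
      (f r powr p - (N + \<sigma>2) * pmean (N + \<sigma>2) (\<lambda>x. f x powr p) r) / r) (at r)"
    using pos fp \<open>0 < r\<close> by (intro has_real_derivative_pmean) auto
  have e: "((\<lambda>r. r powr a) has_real_derivative a * r powr a / r) (at r)" for a
    using has_real_derivative_powr[OF \<open>0 < r\<close>, of a] \<open>0 < r\<close> by (simp add: powr_diff)
  show ?thesis
    unfolding flux_def[abs_def] mult.assoc
    by (rule DERIV_cong[OF DERIV_diff[OF DERIV_cmult[OF DERIV_cmult[OF DERIV_mult[OF e d1]]] DERIV_mult[OF e d2]]])
       (use \<open>0 < r\<close> in \<open>simp add: field_simps\<close>)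
qed

text \<open>
  Replacing \<open>w powr (1 / m)\<close> by \<open>trunc \<epsilon> w\<close> makes the Volterra equation for \<open>w = f powr m\<close> globally Lipschitz
  without changing solutions that stay above \<open>\<epsilon>\<close>.
\<close>

definition trunc :: "real \<Rightarrow> real \<Rightarrow> real" where
  "trunc \<epsilon> x = max x \<epsilon> powr (1 / m)"

lemma trunc_pos: "0 < \<epsilon> \<Longrightarrow> 0 < trunc \<epsilon> x"
  unfolding trunc_def by (simp add: max_def)

lemma trunc_powr_p: "trunc \<epsilon> x powr p = max x \<epsilon> powr (p / m)"
  unfolding trunc_def by (simp add: powr_powr)

lemma trunc_lipschitz:
  assumes "0 < \<epsilon>"
  obtains L where "0 < L" "\<And>x y. \<bar>trunc \<epsilon> x - trunc \<epsilon> y\<bar> \<le> L * \<bar>x - y\<bar>"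
    "\<And>x y. \<bar>trunc \<epsilon> x powr p - trunc \<epsilon> y powr p\<bar> \<le> L * \<bar>x - y\<bar>"
proof -
  define L1 where "L1 = 1 / m * \<epsilon> powr (1 / m - 1)"
  define L2 where "L2 = p / m * \<epsilon> powr (p / m - 1)"
  have "\<bar>trunc \<epsilon> x - trunc \<epsilon> y\<bar> \<le> L1 * \<bar>x - y\<bar>" for x y
    unfolding trunc_def L1_def by (rule truncated_powr_lipschitz) (use m_gt_1 assms in auto)
  moreover have "\<bar>trunc \<epsilon> x powr p - trunc \<epsilon> y powr p\<bar> \<le> L2 * \<bar>x - y\<bar>" for x y
    unfolding trunc_powr_p L2_def
    by (rule truncated_powr_lipschitz) (use p_pos p_less_m m_pos assms in auto)
  moreover have "0 < L1" "0 < L2" unfolding L1_def L2_def using m_pos p_pos assms by auto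
  moreover have "L1 * \<bar>x - y\<bar> \<le> max L1 L2 * \<bar>x - y\<bar>" "L2 * \<bar>x - y\<bar> \<le> max L1 L2 * \<bar>x - y\<bar>" for x y :: real
    by (auto intro!: mult_right_mono)
  ultimately show ?thesis
    by (intro that[of "max L1 L2"]) (simp_all add: less_max_iff_disj, (meson order_trans)+)
qed

lemma continuous_on_trunc:
  assumes "0 < \<epsilon>" "continuous_on S w"
  shows "continuous_on S (\<lambda>x. trunc \<epsilon> (w x))" "continuous_on S (\<lambda>x. trunc \<epsilon> (w x) powr p)"
  unfolding trunc_powr_p unfolding trunc_def
  by (intro continuous_on_powr continuous_on_max continuous_on_const assms(2);
      use assms(1) in \<open>simp add: max_def\<close>)+

text \<open>The Lipschitz constant \<open>L\<close> of the truncated powers multiplies the factor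
  \<open>kap b / \<Lambda>\<close> of \<open>lin_bound\<close>, and
  \<open>\<Lambda> = 2 * L * kap b\<close> makes the product \<open>1 / 2\<close>. The estimate is
  causal, from \<open>[0, r]\<close> to \<open>r\<close>, and \<open>\<Lambda>\<close> depends on
  \<open>\<epsilon>\<close> and \<open>b\<close> alone.\<close>

lemma prim_trunc_contraction:
  assumes "0 < \<epsilon>" "0 \<le> b"
  shows "\<exists>\<Lambda>>0. \<forall>\<beta> w w' r D. 0 \<le> \<beta> \<longrightarrow> \<beta> \<le> b \<longrightarrow> continuous_on {0..} w \<longrightarrow> continuous_on {0..} w' \<longrightarrow>
      0 \<le> r \<longrightarrow> 0 \<le> D \<longrightarrow> (\<forall>x. 0 \<le> x \<longrightarrow> x \<le> r \<longrightarrow> \<bar>w x - w' x\<bar> \<le> D * wt \<Lambda> x) \<longrightarrow>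
      \<bar>prim \<beta> (\<lambda>x. trunc \<epsilon> (w x)) r - prim \<beta> (\<lambda>x. trunc \<epsilon> (w' x)) r\<bar> \<le> 1 / 2 * D * wt \<Lambda> r"
proof -
  obtain L where L: "0 < L" "\<And>x y. \<bar>trunc \<epsilon> x - trunc \<epsilon> y\<bar> \<le> L * \<bar>x - y\<bar>"
    "\<And>x y. \<bar>trunc \<epsilon> x powr p - trunc \<epsilon> y powr p\<bar> \<le> L * \<bar>x - y\<bar>"
    using trunc_lipschitz[OF assms(1)] by blast
  define \<Lambda> where "\<Lambda> = 2 * L * kap b"
  have lam: "0 < \<Lambda>" unfolding \<Lambda>_def using L kap_pos[OF assms(2)] by simp
  show ?thesis
  proof (intro exI[of _ \<Lambda>] conjI lam allI impI)
    fix \<beta> w w' r D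
    assume as: "0 \<le> \<beta>" "\<beta> \<le> b" "continuous_on {0..} w" "continuous_on {0..} w'" "0 \<le> r" "(0::real) \<le> D"
      "\<forall>x. 0 \<le> x \<longrightarrow> x \<le> r \<longrightarrow> \<bar>w x - w' x\<bar> \<le> D * wt \<Lambda> x"
    note cont = continuous_on_trunc[OF assms(1) as(3)] continuous_on_trunc[OF assms(1) as(4)]
    have LD: "L * \<bar>w x - w' x\<bar> \<le> (L * D) * wt \<Lambda> x" if "0 \<le> x" "x \<le> r" for x
      using as(7)[rule_format, OF that] L by (simp add: mult.assoc)
    have "\<bar>lin \<beta> (\<lambda>x. trunc \<epsilon> (w x) - trunc \<epsilon> (w' x)) (\<lambda>x. trunc \<epsilon> (w x) powr p - trunc \<epsilon> (w' x) powr p) r\<bar>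
        \<le> (L * D) * wt \<Lambda> r * kap b / \<Lambda>"
    proof (rule lin_bound[OF lam as(5,1,2)])
      show "0 \<le> L * D" using L(1) as(6) by simp
      fix x assume x: "0 \<le> x" "x \<le> r"
      show "\<bar>trunc \<epsilon> (w x) - trunc \<epsilon> (w' x)\<bar> \<le> (L * D) * wt \<Lambda> x"
        by (rule order_trans[OF L(2) LD[OF x]])
      show "\<bar>trunc \<epsilon> (w x) powr p - trunc \<epsilon> (w' x) powr p\<bar> \<le> (L * D) * wt \<Lambda> x"
        by (rule order_trans[OF L(3) LD[OF x]])
    qed (intro continuous_on_diff cont)+
    also have "\<dots> = 1 / 2 * D * wt \<Lambda> r"
      unfolding \<Lambda>_def using L kap_pos[OF assms(2)] by (simp add: field_simps)
    finally show "\<bar>prim \<beta> (\<lambda>x. trunc \<epsilon> (w x)) r - prim \<beta> (\<lambda>x. trunc \<epsilon> (w' x)) r\<bar> \<le> 1 / 2 * D * wt \<Lambda> r"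
      unfolding prim_def using as cont by (simp add: lin_diff)
  qed
qed

text \<open>At the point of \<open>[0, r]\<close> where the weighted difference is largest, the
  contraction absorbs half of it and leaves twice the defect \<open>\<eta>\<close>. With
  \<open>\<eta> = 0\<close> this gives uniqueness, with \<open>\<eta>\<close> proportional to a
  change of \<open>\<beta>\<close> continuous dependence.\<close>

lemma volterra_stability:
  assumes "0 < \<epsilon>" "0 \<le> b"
  shows "\<exists>\<Lambda>>0. \<forall>\<beta> w w' r \<eta>. 0 \<le> \<beta> \<longrightarrow> \<beta> \<le> b \<longrightarrow> continuous_on {0..} w \<longrightarrow> continuous_on {0..} w' \<longrightarrow>
      0 \<le> r \<longrightarrow> 0 \<le> \<eta> \<longrightarrow>
      (\<forall>x. 0 \<le> x \<longrightarrow> x \<le> r \<longrightarrow> \<bar>w x - w' x\<bar> \<le> \<bar>prim \<beta> (\<lambda>x. trunc \<epsilon> (w x)) x - prim \<beta> (\<lambda>x. trunc \<epsilon> (w' x)) x\<bar> + \<eta>) \<longrightarrow>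
      \<bar>w r - w' r\<bar> \<le> 2 * \<eta> * wt \<Lambda> r"
proof -
  obtain \<Lambda> where lam: "0 < \<Lambda>"
    and contr: "\<forall>\<beta> w w' r D. (0 \<le> \<beta>) \<longrightarrow>
      (\<beta> \<le> b) \<longrightarrow>
      (continuous_on {0..} w) \<longrightarrow>
      (continuous_on {0..} w') \<longrightarrow>
      (0 \<le> r) \<longrightarrow>
      (0 \<le> D) \<longrightarrow>
      (\<forall>x. 0 \<le> x \<longrightarrow> x \<le> r \<longrightarrow> \<bar>w x - w' x\<bar> \<le> D * wt \<Lambda> x) \<longrightarrow>
      \<bar>prim \<beta> (\<lambda>x. trunc \<epsilon> (w x)) r - prim \<beta> (\<lambda>x. trunc \<epsilon> (w' x)) r\<bar> \<le> 1 / 2 * D * wt \<Lambda> r"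
    using prim_trunc_contraction[OF assms] by blast
  show ?thesis
  proof (intro exI[of _ \<Lambda>] conjI lam allI impI)
    fix \<beta> w w' r \<eta>
    assume as: "0 \<le> \<beta>" "\<beta> \<le> b" "continuous_on {0..} w" "continuous_on {0..} w'" "0 \<le> r" "(0::real) \<le> \<eta>"
      "\<forall>x. 0 \<le> x \<longrightarrow> x \<le> r \<longrightarrow> \<bar>w x - w' x\<bar> \<le> \<bar>prim \<beta> (\<lambda>x. trunc \<epsilon> (w x)) x - prim \<beta> (\<lambda>x. trunc \<epsilon> (w' x)) x\<bar> + \<eta>"
    have "continuous_on {0..r} (\<lambda>x. \<bar>w x - w' x\<bar> / wt \<Lambda> x)"
    proof (intro continuous_intros continuous_on_subset[OF continuous_on_wt]
           continuous_on_subset[OF as(3)] continuous_on_subset[OF as(4)])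
      show "\<forall>x\<in>{0..r}. wt \<Lambda> x \<noteq> 0" using wt_pos[of \<Lambda>] by (metis less_irrefl)
    qed auto
    then obtain z where z: "z \<in> {0..r}" "\<And>x. x \<in> {0..r} \<Longrightarrow> \<bar>w x - w' x\<bar> / wt \<Lambda> x \<le> \<bar>w z - w' z\<bar> / wt \<Lambda> z"
      using continuous_attains_sup[of "{0..r}"] as(5) by fastforce
    define D where "D = \<bar>w z - w' z\<bar> / wt \<Lambda> z"
    have D0: "0 \<le> D" unfolding D_def using wt_pos[of \<Lambda> z] by simp
    have D: "\<bar>w x - w' x\<bar> \<le> D * wt \<Lambda> x" if "0 \<le> x" "x \<le> r" for x
      using z(2)[of x] that wt_pos[of \<Lambda> x] unfolding D_def[symmetric] by (simp add: pos_divide_le_eq)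
    have "D * wt \<Lambda> z = \<bar>w z - w' z\<bar>" unfolding D_def using wt_pos[of \<Lambda> z] by simp
    also have "\<dots> \<le> 1 / 2 * D * wt \<Lambda> z + \<eta>"
    proof -
      have z0: "0 \<le> z" "z \<le> r" using z(1) by auto
      have "\<bar>w x - w' x\<bar> \<le> D * wt \<Lambda> x" if "0 \<le> x" "x \<le> z" for x
        by (rule D) (use that z0 in auto)
      from contr[rule_format, OF as(1-4) z0(1) D0 this] as(7)[rule_format, OF z0] show ?thesis by linarith
    qed
    also have "\<eta> \<le> \<eta> * wt \<Lambda> z"
      using wt_ge_1[of \<Lambda> z] lam z(1) as(6) by (simp add: mult_le_cancel_left1)
    finally have "D * wt \<Lambda> z \<le> (1 / 2 * D + \<eta>) * wt \<Lambda> z" by (simp add: algebra_simps)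
    then have "D \<le> 2 * \<eta>" using wt_pos[of \<Lambda> z] by simp
    then have "D * wt \<Lambda> r \<le> 2 * \<eta> * wt \<Lambda> r" using wt_pos[of \<Lambda> r] by simp
    with D[of r] as(5) show "\<bar>w r - w' r\<bar> \<le> 2 * \<eta> * wt \<Lambda> r" by simp
  qed
qed

text \<open>Beyond \<open>R\<close> only continuity is asked, so a function that solves the equation
  on an initial interval can be compared with a global solution without being modified.\<close>

definition tsol where
  "tsol \<epsilon> c \<beta> R w \<longleftrightarrow> continuous_on {0..} w \<and> (\<forall>r. 0 \<le> r \<and> r \<le> R \<longrightarrow> w r = c + prim \<beta> (\<lambda>x. trunc \<epsilon> (w x)) r)"

lemma tsol_unique:
  assumes "0 < \<epsilon>" "0 \<le> \<beta>" "tsol \<epsilon> c \<beta> R w" "tsol \<epsilon> c \<beta> R w'" "0 \<le> r" "r \<le> R"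
  shows "w r = w' r"
proof -
  obtain \<Lambda> where
    "\<forall>\<beta>' w w' r \<eta>. (0 \<le> \<beta>') \<longrightarrow>
      (\<beta>' \<le> \<beta>) \<longrightarrow>
      (continuous_on {0..} w) \<longrightarrow>
      (continuous_on {0..} w') \<longrightarrow>
      (0 \<le> r) \<longrightarrow>
      (0 \<le> \<eta>) \<longrightarrow>
      (\<forall>x. 0 \<le> x \<longrightarrow> x \<le> r \<longrightarrow> \<bar>w x - w' x\<bar> \<le> \<bar>prim \<beta>' (\<lambda>x. trunc \<epsilon> (w x)) x - prim \<beta>' (\<lambda>x. trunc \<epsilon> (w' x)) x\<bar> + \<eta>) \<longrightarrow>
      \<bar>w r - w' r\<bar> \<le> 2 * \<eta> * wt \<Lambda> r"
    using volterra_stability[OF assms(1,2)] by blast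
  note stab = this
  have "\<bar>w r - w' r\<bar> \<le> 2 * 0 * wt \<Lambda> r"
  proof (rule stab[rule_format, OF assms(2) order_refl _ _ assms(5)])
    fix x assume "0 \<le> x" "x \<le> r"
    then show "\<bar>w x - w' x\<bar> \<le> \<bar>prim \<beta> (\<lambda>x. trunc \<epsilon> (w x)) x - prim \<beta> (\<lambda>x. trunc \<epsilon> (w' x)) x\<bar> + 0"
      using assms(3,4,6) unfolding tsol_def by auto
  qed (use assms(3,4) in \<open>auto simp: tsol_def\<close>)
  then show ?thesis by simp
qed

text \<open>\<open>prim\<close> is affine in \<open>\<beta>\<close>: at the fixed solution
  \<open>w\<close>, changing \<open>\<beta>\<close> perturbs the equation by
  \<open>\<beta>' - \<beta>\<close> times a continuous function, which is bounded on
  \<open>[0, R]\<close>.\<close>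

lemma tsol_continuous_parameter:
  assumes "0 < \<epsilon>" "0 \<le> \<beta>" "0 \<le> R" "tsol \<epsilon> c \<beta> R w"
  obtains C where "0 \<le> C" "\<And>\<beta>' w' r. \<lbrakk>0 \<le> \<beta>'; \<beta>' \<le> \<beta> + 1; tsol \<epsilon> c \<beta>' R w'; 0 \<le> r; r \<le> R\<rbrakk> \<Longrightarrow>
    \<bar>w' r - w r\<bar> \<le> C * \<bar>\<beta>' - \<beta>\<bar>"
proof -
  have b: "0 \<le> \<beta> + 1" using assms by simp
  obtain \<Lambda> where lam: "0 < \<Lambda>" and
    stab: "\<forall>\<beta>' w w' r \<eta>. (0 \<le> \<beta>') \<longrightarrow>
      (\<beta>' \<le> \<beta> + 1) \<longrightarrow>
      (continuous_on {0..} w) \<longrightarrow>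
      (continuous_on {0..} w') \<longrightarrow>
      (0 \<le> r) \<longrightarrow>
      (0 \<le> \<eta>) \<longrightarrow>
      (\<forall>x. 0 \<le> x \<longrightarrow> x \<le> r \<longrightarrow> \<bar>w x - w' x\<bar> \<le> \<bar>prim \<beta>' (\<lambda>x. trunc \<epsilon> (w x)) x - prim \<beta>' (\<lambda>x. trunc \<epsilon> (w' x)) x\<bar> + \<eta>) \<longrightarrow>
      \<bar>w r - w' r\<bar> \<le> 2 * \<eta> * wt \<Lambda> r"
    using volterra_stability[OF assms(1) b] by blast
  have cw: "continuous_on {0..} w" using assms(4) unfolding tsol_def by blast
  let ?F = "\<lambda>x. trunc \<epsilon> (w x)"
  have "continuous_on {0..R} (lin 1 ?F (\<lambda>_. 0))"
    by (rule continuous_on_subset[OF continuous_on_lin])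
       (use continuous_on_trunc[OF assms(1) cw] in \<open>auto intro: continuous_intros\<close>)
  then have "compact (lin 1 ?F (\<lambda>_. 0) ` {0..R})" by (intro compact_continuous_image) auto
  then obtain M where M: "M > 0" "\<And>x. x \<in> {0..R} \<Longrightarrow> \<bar>lin 1 ?F (\<lambda>_. 0) x\<bar> \<le> M"
    unfolding real_norm_def[symmetric] using compact_imp_bounded bounded_pos by (metis imageI)
  have aff: "prim \<beta>' ?F x - prim \<beta> ?F x = (\<beta>' - \<beta>) * lin 1 ?F (\<lambda>_. 0) x" for \<beta>' x
    unfolding prim_def lin_def using pmean_const[OF N_\<sigma>2, of 0]
      pmean_const[OF \<sigma>2_plus_2_pos, of 0] by (simp add: algebra_simps fun_eq_iff[symmetric] del: fun_eq_iff)
       (simp add: algebra_simps pmean_def)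
  show ?thesis
  proof (rule that[of "2 * M * wt \<Lambda> R"])
    show "0 \<le> 2 * M * wt \<Lambda> R" using M(1) wt_pos[of \<Lambda> R] by simp
    fix \<beta>' w' r
    assume as: "0 \<le> \<beta>'" "\<beta>' \<le> \<beta> + 1" "tsol \<epsilon> c \<beta>' R w'" "0 \<le> r" "r \<le> R"
    have "\<bar>w' x - w x\<bar> \<le> \<bar>prim \<beta>' (\<lambda>x. trunc \<epsilon> (w' x)) x - prim \<beta>' ?F x\<bar> + \<bar>\<beta>' - \<beta>\<bar> * M" if "0 \<le> x" "x \<le> r" for x
    proof -
      have "w' x - w x = (prim \<beta>' (\<lambda>x. trunc \<epsilon> (w' x)) x - prim \<beta>' ?F x) + (prim \<beta>' ?F x - prim \<beta> ?F x)"
        using as assms(4) that unfolding tsol_def by auto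
      moreover have "\<bar>prim \<beta>' ?F x - prim \<beta> ?F x\<bar> \<le> \<bar>\<beta>' - \<beta>\<bar> * M"
        unfolding aff abs_mult using M(2)[of x] that as by (intro mult_left_mono) auto
      ultimately show ?thesis by linarith
    qed
    then have "\<bar>w' r - w r\<bar> \<le> 2 * (\<bar>\<beta>' - \<beta>\<bar> * M) * wt \<Lambda> r"
      by (intro stab[rule_format, OF as(1,2) _ cw as(4)]) (use as(3) M(1) in \<open>auto simp: tsol_def\<close>)
    also have "\<dots> \<le> 2 * (\<bar>\<beta>' - \<beta>\<bar> * M) * wt \<Lambda> R"
      using wt_mono[of \<Lambda> r R] lam as M(1) by (intro mult_left_mono) auto
    finally show "\<bar>w' r - w r\<bar> \<le> 2 * M * wt \<Lambda> R * \<bar>\<beta>' - \<beta>\<bar>" by (simp add: mult_ac)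
  qed
qed

text \<open>Banach's fixed point theorem for functions of the form \<open>wt \<Lambda> * g\<close>
  with \<open>g\<close> bounded and continuous; the solution is obtained on the whole half line at
  once.\<close>

lemma tsol_exists:
  assumes "0 < \<epsilon>" "0 \<le> \<beta>"
  obtains w where "\<And>R. tsol \<epsilon> c \<beta> R w"
proof -
  obtain \<Lambda> where lam: "0 < \<Lambda>"
    and contr: "\<forall>\<beta>' w w' r D. 0 \<le> \<beta>' \<longrightarrow> \<beta>' \<le> \<beta> \<longrightarrow> (continuous_on {0..} w) \<longrightarrow>
      (continuous_on {0..} w') \<longrightarrow>
      (0 \<le> r) \<longrightarrow>
      (0 \<le> D) \<longrightarrow>
      (\<forall>x. 0 \<le> x \<longrightarrow> x \<le> r \<longrightarrow> \<bar>w x - w' x\<bar> \<le> D * wt \<Lambda> x) \<longrightarrow>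
      \<bar>prim \<beta>' (\<lambda>x. trunc \<epsilon> (w x)) r - prim \<beta>' (\<lambda>x. trunc \<epsilon> (w' x)) r\<bar> \<le> 1 / 2 * D * wt \<Lambda> r"
    using prim_trunc_contraction[OF assms] by blast
  define P where "P w r = prim \<beta> (\<lambda>x. trunc \<epsilon> (w x)) r" for w r
  have contP: "continuous_on {0..} (P w)" if "continuous_on {0..} w" for w
    unfolding P_def[abs_def] prim_def
    by (rule continuous_on_lin) (use continuous_on_trunc[OF assms(1) that] in auto)
  define E where "E g x = wt \<Lambda> x * apply_bcontfun g x" for g :: "real \<Rightarrow>\<^sub>C real" and x
  have contE: "continuous_on {0..} (E g)" for g
    unfolding E_def[abs_def] by (intro continuous_intros continuous_on_wt) auto
  \<comment> \<open>The type of bounded continuous functions has the whole real line as domain; the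
    absolute values extend the half-line operator evenly.\<close>
  define T where "T g r = (c + P (E g) \<bar>r\<bar>) / wt \<Lambda> \<bar>r\<bar>" for g r
  have Pdiff: "\<bar>P (E g) r - P (E g') r\<bar> \<le> 1 / 2 * dist g g' * wt \<Lambda> r" if "0 \<le> r" for g g' r
    unfolding P_def
  proof (rule contr[rule_format, OF assms(2) order_refl])
    fix x :: real assume x: "0 \<le> x" "x \<le> r"
    have "E g x - E g' x = wt \<Lambda> x * (apply_bcontfun g x - apply_bcontfun g' x)"
      unfolding E_def by (simp add: algebra_simps)
    then have "\<bar>E g x - E g' x\<bar> = wt \<Lambda> x * dist (apply_bcontfun g x) (apply_bcontfun g' x)"
      using wt_pos[of \<Lambda> x] by (simp add: abs_mult dist_real_def)
    also have "\<dots> \<le> wt \<Lambda> x * dist g g'"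
      using wt_pos[of \<Lambda> x] dist_bounded by (intro mult_left_mono) (auto intro: less_imp_le)
    finally show "\<bar>E g x - E g' x\<bar> \<le> dist g g' * wt \<Lambda> x" by (simp add: mult.commute)
  qed (use that contE in auto)
  \<comment> \<open>Control of the image of one function is enough: the contraction estimate then
    bounds \<open>T g\<close> for every \<open>g\<close>.\<close>
  have "\<exists>B. \<forall>r\<ge>0. \<bar>P (E 0) r\<bar> \<le> B * wt \<Lambda> r"
  proof -
    have E0: "E 0 x = 0" for x by (simp add: E_def)
    define K where "K = max (trunc \<epsilon> 0) (trunc \<epsilon> 0 powr p)"
    have K: "0 \<le> K" unfolding K_def using trunc_pos[OF assms(1), of 0] by simp
    have "\<bar>P (E 0) r\<bar> \<le> K * wt \<Lambda> r * kap \<beta> / \<Lambda>" if "0 \<le> r" for r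
      unfolding P_def E0 prim_def
    proof (rule lin_bound)
      fix x assume x: "0 \<le> x" "x \<le> r"
      have "K * 1 \<le> K * wt \<Lambda> x" using K lam x wt_ge_1[of \<Lambda> x] by (intro mult_left_mono) auto
      then show "\<bar>trunc \<epsilon> 0\<bar> \<le> K * wt \<Lambda> x" "\<bar>trunc \<epsilon> 0 powr p\<bar> \<le> K * wt \<Lambda> x"
        using trunc_pos[OF assms(1), of 0] unfolding K_def by auto
    qed (use that lam K assms in \<open>auto intro: continuous_intros\<close>)
    then show ?thesis by (intro exI[of _ "K * kap \<beta> / \<Lambda>"]) (simp add: mult_ac)
  qed
  then obtain B where B: "\<And>r. 0 \<le> r \<Longrightarrow> \<bar>P (E 0) r\<bar> \<le> B * wt \<Lambda> r" by blast
  have T_in: "T g \<in> bcontfun" for g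
  proof (rule bcontfun_normI)
    have ca: "continuous_on UNIV (\<lambda>r. h \<bar>r\<bar>)" if "continuous_on {0..} h" for h :: "real \<Rightarrow> real"
      by (rule continuous_on_compose2[OF that]) (auto intro: continuous_intros)
    show "continuous_on UNIV (T g)"
      unfolding T_def[abs_def]
    proof (intro continuous_intros ca contP contE continuous_on_wt)
      show "\<forall>x\<in>UNIV. wt \<Lambda> \<bar>x\<bar> \<noteq> 0" using wt_pos[of \<Lambda>] by (metis less_irrefl)
    qed
    fix r :: real
    have "\<bar>c + P (E g) \<bar>r\<bar>\<bar> \<le> \<bar>c\<bar> + \<bar>P (E g) \<bar>r\<bar> - P (E 0) \<bar>r\<bar>\<bar> + \<bar>P (E 0) \<bar>r\<bar>\<bar>" by linarith
    also have "\<dots> \<le> \<bar>c\<bar> * wt \<Lambda> \<bar>r\<bar> + 1 / 2 * dist g 0 * wt \<Lambda> \<bar>r\<bar> + B * wt \<Lambda> \<bar>r\<bar>"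
    proof (intro add_mono Pdiff B)
      show "\<bar>c\<bar> \<le> \<bar>c\<bar> * wt \<Lambda> \<bar>r\<bar>" using wt_ge_1[of \<Lambda> "\<bar>r\<bar>"] lam by (simp add: mult_le_cancel_left1)
    qed auto
    also have "\<dots> = (\<bar>c\<bar> + 1 / 2 * dist g 0 + B) * wt \<Lambda> \<bar>r\<bar>" by (simp add: algebra_simps)
    finally show "norm (T g r) \<le> \<bar>c\<bar> + 1 / 2 * dist g 0 + B"
      unfolding T_def real_norm_def abs_divide using wt_pos[of \<Lambda> "\<bar>r\<bar>"] by (simp add: pos_divide_le_eq)
  qed
  have app: "apply_bcontfun (Bcontfun (T g)) = T g" for g
    using T_in by (simp add: Bcontfun_inverse)
  have "\<exists>!g. Bcontfun (T g) = g"
  proof (rule banach_fix_type[of "1/2"])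
    show "\<forall>g g'. dist (Bcontfun (T g)) (Bcontfun (T g')) \<le> 1 / 2 * dist g g'"
    proof (intro allI dist_bound)
      fix g g' r
      have "T g r - T g' r = (P (E g) \<bar>r\<bar> - P (E g') \<bar>r\<bar>) / wt \<Lambda> \<bar>r\<bar>"
        unfolding T_def by (simp add: diff_divide_distrib add_divide_distrib)
      then show "dist (apply_bcontfun (Bcontfun (T g)) r) (apply_bcontfun (Bcontfun (T g')) r) \<le> 1 / 2 * dist g g'"
        unfolding app dist_real_def using Pdiff[of "\<bar>r\<bar>" g g'] wt_pos[of \<Lambda> "\<bar>r\<bar>"]
        by (simp add: abs_divide pos_divide_le_eq)
    qed
  qed auto
  then obtain g where g: "Bcontfun (T g) = g" by blast
  have "E g r = c + P (E g) r" if "0 \<le> r" for r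
    using arg_cong[OF g, of "\<lambda>g. apply_bcontfun g r"] that wt_pos[of \<Lambda> r]
    unfolding app by (simp add: E_def T_def field_simps)
  then have "tsol \<epsilon> c \<beta> R (E g)" for R
    unfolding tsol_def using contE unfolding P_def by blast
  then show ?thesis by (rule that)
qed

end

section \<open>The autonomous system\<close>

text \<open>At the first point where \<open>u\<close> is not positive it vanishes, and a positive
  derivative there would make \<open>u\<close> negative just before.\<close>

lemma positive_barrier:
  fixes u u' :: "real \<Rightarrow> real"
  assumes "a \<le> b" "0 < u a"
    and der: "\<And>s. a \<le> s \<Longrightarrow> s \<le> b \<Longrightarrow> (u has_real_derivative u' s) (at s)"
    and zero: "\<And>s. a < s \<Longrightarrow> s \<le> b \<Longrightarrow> u s = 0 \<Longrightarrow> 0 < u' s"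
  shows "0 < u b"
proof (rule ccontr)
  assume nb: "\<not> 0 < u b"
  have cont: "continuous_on {a..b} u"
    using der by (intro DERIV_atLeastAtMost_imp_continuous_on) auto
  define T where "T = {a..b} \<inter> u -` {..0}"
  have "compact T" unfolding T_def
    using bounded_subset[OF bounded_closed_interval[of a b]] continuous_closed_preimage[OF cont closed_atLeastAtMost closed_atMost]
    by (simp add: compact_eq_bounded_closed Int_commute)
  moreover have "b \<in> T" using nb assms(1) by (auto simp: T_def)
  ultimately obtain t where t: "t \<in> T" "\<And>s. s \<in> T \<Longrightarrow> t \<le> s"
    using compact_attains_inf[of T] by blast
  have ta: "a < t" using t(1) assms(2) by (cases "t = a") (auto simp: T_def)
  have tb: "t \<le> b" "u t \<le> 0" using t(1) by (auto simp: T_def)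
  have pos: "0 < u s" if "a \<le> s" "s < t" for s
    using t(2)[of s] that tb by (force simp: T_def)
  have "\<not> u t < 0"
  proof
    assume "u t < 0"
    then obtain s where "a \<le> s" "s \<le> t" "u s = 0"
      using IVT2'[of u t 0 a] assms(2) ta tb continuous_on_subset[OF cont, of "{a..t}"] by force
    then show False using pos[of s] \<open>u t < 0\<close> by (cases "s = t") auto
  qed
  then have ut: "u t = 0" using tb by simp
  obtain d where d: "d > 0" "\<And>h. h > 0 \<Longrightarrow> h < d \<Longrightarrow> u (t - h) < u t"
    using DERIV_pos_inc_left[OF der zero[OF ta tb(1) ut]] ta tb by auto
  define h where "h = min (d / 2) (t - a)"
  have "0 < h" "h < d" "a \<le> t - h" "t - h < t" unfolding h_def using d ta by auto
  then show False using d(2)[of h] pos[of "t - h"] ut by auto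
qed

text \<open>The image under \<open>ln\<close> of an interval \<open>(0, R)\<close> with
  \<open>R\<close> possibly infinite: nonempty and open at the right end, so that derivatives are
  two-sided at every point.\<close>

definition lower_ray :: "real set \<Rightarrow> bool" where
  "lower_ray I \<longleftrightarrow> I = UNIV \<or> (\<exists>S. I = {..<S})"

lemma lower_ray_down: "lower_ray I \<Longrightarrow> s \<in> I \<Longrightarrow> t \<le> s \<Longrightarrow> t \<in> I"
  unfolding lower_ray_def by auto

lemma lower_ray_eventually: "lower_ray I \<Longrightarrow> eventually (\<lambda>s. s \<in> I) at_bot"
  unfolding lower_ray_def by (auto simp: eventually_at_bot_dense)

lemma lower_ray_next: "lower_ray I \<Longrightarrow> s \<in> I \<Longrightarrow> \<exists>t>s. t \<in> I"
  unfolding lower_ray_def using dense gt_ex by fastforce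

text \<open>The barrier argument started at minus infinity, where the behaviour of the profile at
  the origin supplies the initial sign.\<close>

lemma lower_ray_positive:
  fixes u u' :: "real \<Rightarrow> real"
  assumes I: "lower_ray I" and ev: "eventually (\<lambda>s. 0 < u s) at_bot"
    and der: "\<And>s. s \<in> I \<Longrightarrow> (u has_real_derivative u' s) (at s)"
    and zero: "\<And>s. s \<in> I \<Longrightarrow> u s = 0 \<Longrightarrow> 0 < u' s"
    and "s \<in> I"
  shows "0 < u s"
proof -
  obtain a where "\<And>t. t \<le> a \<Longrightarrow> 0 < u t" using ev by (auto simp: eventually_at_bot_linorder)
  then have "0 < u (min a s)" by simp
  then show ?thesis
    by (rule positive_barrier[of "min a s" s u u', rotated])
       (use lower_ray_down[OF I \<open>s \<in> I\<close>] der zero in auto)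
qed

lemma powr_tendsto_0_at_right:
  fixes a :: real assumes "0 < a"
  shows "((\<lambda>x. x powr a) \<longlongrightarrow> 0) (at_right 0)"
proof -
  have "continuous_on {0..} (\<lambda>x::real. x powr a)"
    by (rule continuous_on_powr'[OF continuous_on_id continuous_on_const]) (use assms in auto)
  then have "((\<lambda>x. x powr a) \<longlongrightarrow> 0 powr a) (at 0 within {0..})"
    unfolding continuous_on_def by (rule bspec) simp
  then have "((\<lambda>x. x powr a) \<longlongrightarrow> 0) (at 0 within {0..})" by simp
  then show ?thesis by (rule tendsto_within_subset) auto
qed

lemma powr_tendsto_0_at_top:
  fixes a :: real assumes "a < 0"
  shows "((\<lambda>x. x powr a) \<longlongrightarrow> 0) at_top"
  using assms by (rule tendsto_neg_powr) (rule filterlim_ident)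

context profile_parameters
begin

text \<open>\<open>A\<close> and \<open>B\<close> are the sum and the product of
  \<open>k * m\<close> and \<open>q\<close>. With \<open>v = h powr m\<close> the system reads
  \<open>v'' + A * v' + B * v + \<beta> * h' + h powr p = 0\<close>; the first three terms are the
  radial Laplacian of \<open>f powr m\<close> in the variable \<open>ln \<xi>\<close>, with
  characteristic exponents \<open>- k * m\<close> and \<open>- q\<close>.\<close>

definition A where "A = k * m + q"
definition B where "B = k * m * q"

lemma A_pos: "0 < A" and B_pos: "0 < B"
  unfolding A_def B_def using k_pos m_pos q_pos by (auto intro!: add_pos_pos)

text \<open>
  With \<open>s = ln \<xi>\<close>, the quantities \<open>h = \<xi> powr - k * f\<close> and
  \<open>Z = \<xi> powr - (k * m) * (flux + q * f powr m)\<close> of a profile satisfy this autonomous system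
  of Lienard type; the limit clauses encode regularity at the origin.
\<close>

definition orbit :: "real \<Rightarrow> real set \<Rightarrow> (real \<Rightarrow> real) \<Rightarrow> (real \<Rightarrow> real) \<Rightarrow> bool" where
  "orbit \<beta> I h Z \<longleftrightarrow> lower_ray I \<and>
    (\<forall>s\<in>I. 0 < h s \<and>
      (h has_real_derivative (Z s - \<beta> * h s - A * h s powr m) / (m * h s powr (m - 1))) (at s) \<and>
      (Z has_real_derivative - B * h s powr m - h s powr p) (at s)) \<and>
    filterlim h at_top at_bot \<and>
    ((\<lambda>s. (Z s - q * h s powr m - \<beta> * q / (N + \<sigma>1) * h s + h s powr p / (N + \<sigma>2)) / h s powr p)
      \<longlongrightarrow> 0) at_bot"

lemma orbitD:
  assumes "orbit \<beta> I h Z"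
  shows "lower_ray I" "\<And>s. s \<in> I \<Longrightarrow> 0 < h s"
    "\<And>s. s \<in> I \<Longrightarrow> (h has_real_derivative (Z s - \<beta> * h s - A * h s powr m) / (m * h s powr (m - 1))) (at s)"
    "\<And>s. s \<in> I \<Longrightarrow> (Z has_real_derivative - B * h s powr m - h s powr p) (at s)"
    "filterlim h at_top at_bot"
    "((\<lambda>s. (Z s - q * h s powr m - \<beta> * q / (N + \<sigma>1) * h s + h s powr p / (N + \<sigma>2)) / h s powr p)
      \<longlongrightarrow> 0) at_bot"
  using assms unfolding orbit_def by auto

lemma orbit_asym:
  assumes "orbit \<beta> I h Z" "0 < e"
  shows "eventually (\<lambda>s. 1 \<le> h s \<and> \<bar>Z s - q * h s powr m - \<beta> * q / (N + \<sigma>1) * h s + h s powr p / (N + \<sigma>2)\<bar>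
    \<le> e * h s powr p) at_bot"
proof -
  have "eventually (\<lambda>s. 1 \<le> h s) at_bot"
    using orbitD(5)[OF assms(1)] by (simp add: filterlim_at_top)
  moreover have "eventually (\<lambda>s. dist ((Z s - q * h s powr m - \<beta> * q / (N + \<sigma>1) * h s + h s powr p / (N + \<sigma>2)) / h s powr p) 0 < e) at_bot"
    using orbitD(6)[OF assms(1)] assms(2) by (rule tendstoD)
  ultimately show ?thesis
  proof eventually_elim
    case (elim s)
    then have "0 < h s powr p" by simp
    with elim show ?case by (simp add: dist_real_def abs_divide pos_divide_less_eq less_imp_le)
  qed
qed

text \<open>As \<open>h\<close> tends to infinity and \<open>1 \<le> p\<close>, the term linear in
  \<open>h\<close> is absorbed by \<open>h powr p\<close>.\<close>

lemma orbit_Z_growth: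
  assumes "orbit \<beta> I h Z" "0 \<le> \<beta>"
  obtains C where "0 < C" "eventually (\<lambda>s. 1 \<le> h s \<and> \<bar>Z s - q * h s powr m\<bar> \<le> C * h s powr p) at_bot"
proof (rule that)
  let ?C = "\<beta> * q / (N + \<sigma>1) + 1 / (N + \<sigma>2) + 1"
  show "0 < ?C" using assms q_pos N_\<sigma>1 N_\<sigma>2 by (intro add_nonneg_pos) auto
  show "eventually (\<lambda>s. 1 \<le> h s \<and> \<bar>Z s - q * h s powr m\<bar> \<le> ?C * h s powr p) at_bot"
    using orbit_asym[OF assms(1) zero_less_one]
  proof eventually_elim
    case (elim s)
    have "h s powr 1 \<le> h s powr p" using elim p_ge_1 by (intro powr_mono) auto
    then have "h s \<le> h s powr p" using elim by simp
    then have "\<beta> * q / (N + \<sigma>1) * h s \<le> \<beta> * q / (N + \<sigma>1) * h s powr p"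
      using assms q_pos N_\<sigma>1 by (intro mult_left_mono) auto
    moreover have "0 \<le> \<beta> * q / (N + \<sigma>1) * h s"
      using assms q_pos N_\<sigma>1 elim by (intro mult_nonneg_nonneg) auto
    moreover have "0 \<le> h s powr p / (N + \<sigma>2)" using N_\<sigma>2 by simp
    moreover have "?C * h s powr p = \<beta> * q / (N + \<sigma>1) * h s powr p + h s powr p / (N + \<sigma>2) + h s powr p"
      by (simp add: algebra_simps)
    moreover have "\<bar>Z s - q * h s powr m - \<beta> * q / (N + \<sigma>1) * h s + h s powr p / (N + \<sigma>2)\<bar> \<le> h s powr p"
      using elim by simp
    ultimately show ?case using elim by linarith
  qed
qed

lemma orbit_eventually_bot_powr:
  assumes "orbit \<beta> I h Z" "0 < c"
  shows "eventually (\<lambda>s. C * h s powr p < c * h s powr m) at_bot"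
proof -
  have "((\<lambda>x. C * x powr (p - m)) \<longlongrightarrow> C * 0) at_top"
    using p_less_m by (intro tendsto_mult powr_tendsto_0_at_top) auto
  from order_tendstoD(2)[OF this, of c] assms(2)
  have "eventually (\<lambda>x. C * x powr (p - m) < c) at_top" by simp
  then have "eventually (\<lambda>s. C * h s powr (p - m) < c) at_bot"
    using orbitD(5)[OF assms(1)] by (rule eventually_compose_filterlim)
  moreover have "eventually (\<lambda>s. 1 \<le> h s) at_bot"
    using orbitD(5)[OF assms(1)] by (simp add: filterlim_at_top)
  ultimately show ?thesis
  proof eventually_elim
    case (elim s)
    then have "h s powr m > 0" by simp
    then have "C * h s powr (p - m) * h s powr m < c * h s powr m" using elim by simp
    then show ?case using elim by (simp add: powr_diff)
  qed
qed

text \<open>\<open>P\<close> is, up to a positive factor, the decay rate of \<open>h\<close>.\<close>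

definition P where "P \<beta> h Z s = \<beta> * h s + A * h s powr m - (Z s :: real)" for h :: "real \<Rightarrow> real"

lemma orbit_h_deriv:
  assumes "orbit \<beta> I h Z" "s \<in> I"
  shows "(h has_real_derivative - P \<beta> h Z s / (m * h s powr (m - 1))) (at s)"
  by (rule DERIV_cong[OF orbitD(3)[OF assms]]) (simp add: P_def algebra_simps)

lemma orbit_P_deriv:
  assumes "orbit \<beta> I h Z" "s \<in> I"
  shows "(P \<beta> h Z has_real_derivative
    (\<beta> + A * m * h s powr (m - 1)) * (- P \<beta> h Z s / (m * h s powr (m - 1))) + B * h s powr m + h s powr p) (at s)"
proof -
  have d: "((\<lambda>s. h s powr m) has_real_derivative (m * h s powr (m - 1)) * (- P \<beta> h Z s / (m * h s powr (m - 1)))) (at s)"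
    by (rule DERIV_chain2[OF has_real_derivative_powr orbit_h_deriv[OF assms]]) (rule orbitD(2)[OF assms])
  have ring: "\<beta> * D + A * (m * H * D) - (- B * X - Y) = (\<beta> + A * m * H) * D + B * X + Y" for D H X Y
    by algebra
  show ?thesis
    unfolding P_def[abs_def]
    by (rule DERIV_cong[OF DERIV_diff[OF DERIV_add[OF DERIV_cmult[OF orbit_h_deriv[OF assms]] DERIV_cmult[OF d]]
          orbitD(4)[OF assms]]])
       (simp only: P_def, rule ring)
qed

text \<open>Near minus infinity \<open>Z\<close> is close to \<open>q * h powr m\<close>, so
  \<open>P\<close> is close to \<open>(A - q) * h powr m = k * m * h powr m\<close>. At a zero of
  \<open>P\<close> its derivative reduces to \<open>B * h powr m + h powr p\<close>.\<close>

lemma orbit_P_pos: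
  assumes "orbit \<beta> I h Z" "0 \<le> \<beta>" "s \<in> I"
  shows "0 < P \<beta> h Z s"
proof (rule lower_ray_positive[OF orbitD(1)[OF assms(1)] _ orbit_P_deriv[OF assms(1)] _ assms(3)])
  obtain C where C: "0 < C" "eventually (\<lambda>s. 1 \<le> h s \<and> \<bar>Z s - q * h s powr m\<bar> \<le> C * h s powr p) at_bot"
    using orbit_Z_growth[OF assms(1,2)] by blast
  have "0 < k * m" using k_pos m_pos by simp
  from C(2) orbit_eventually_bot_powr[OF assms(1) this, of C]
  show "eventually (\<lambda>s. 0 < P \<beta> h Z s) at_bot"
  proof eventually_elim
    case (elim s)
    have "P \<beta> h Z s = \<beta> * h s + k * m * h s powr m - (Z s - q * h s powr m)"
      unfolding P_def A_def by (simp add: algebra_simps)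
    moreover have "0 \<le> \<beta> * h s" using elim assms(2) by simp
    ultimately show ?case using elim by linarith
  qed
next
  fix s assume s: "s \<in> I" "P \<beta> h Z s = 0"
  then have "0 < h s" using orbitD(2)[OF assms(1)] by blast
  then have "0 < h s powr m" "0 < h s powr p" by simp_all
  then show "0 < (\<beta> + A * m * h s powr (m - 1)) * (- P \<beta> h Z s / (m * h s powr (m - 1))) + B * h s powr m + h s powr p"
    using s B_pos by (simp add: add_pos_pos)
qed

lemma orbit_Z_decreasing:
  assumes "orbit \<beta> I h Z" "t \<in> I" "s < t"
  shows "Z t < Z s"
proof (rule DERIV_neg_imp_decreasing[OF assms(3)])
  fix x assume "s \<le> x" "x \<le> t"
  then have x: "x \<in> I" using lower_ray_down[OF orbitD(1)[OF assms(1)] assms(2)] by simp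
  then have "0 < h x" using orbitD(2)[OF assms(1)] by blast
  then have "0 < h x powr m" "0 < h x powr p" by simp_all
  then have "- B * h x powr m - h x powr p < 0" using mult_pos_pos[OF B_pos, of "h x powr m"] by linarith
  with orbitD(4)[OF assms(1) x] show "\<exists>y. (Z has_real_derivative y) (at x) \<and> y < 0" by blast
qed

lemma orbit_h_decreasing:
  assumes "orbit \<beta> I h Z" "0 \<le> \<beta>" "t \<in> I" "s < t"
  shows "h t < h s"
proof (rule DERIV_neg_imp_decreasing[OF assms(4)])
  fix x assume "s \<le> x" "x \<le> t"
  then have x: "x \<in> I" using lower_ray_down[OF orbitD(1)[OF assms(1)] assms(3)] by simp
  then have "0 < h x" using orbitD(2)[OF assms(1)] by blast
  then have "0 < m * h x powr (m - 1)" using m_pos by simp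
  then have "- P \<beta> h Z x / (m * h x powr (m - 1)) < 0"
    using orbit_P_pos[OF assms(1,2) x] by (simp add: divide_neg_pos)
  with orbit_h_deriv[OF assms(1) x] show "\<exists>y. (h has_real_derivative y) (at x) \<and> y < 0" by blast
qed

lemma orbit_eventually_positive_if_nonneg:
  assumes "orbit \<beta> I h Z" "\<And>s. s \<in> I \<Longrightarrow> 0 \<le> Z s" "s \<in> I"
  shows "0 < Z s"
  using lower_ray_next[OF orbitD(1)[OF assms(1)] assms(3)] orbit_Z_decreasing[OF assms(1)] assms(2)
  by (meson le_less_trans)

section \<open>Barriers in the phase plane: trapping for small \<open>h\<close>, and positivity of
  \<open>Z\<close> for large \<open>\<beta>\<close>\<close>

lemma small_argument_bound:
  assumes "0 < c"
  obtains h0 where "0 < h0" "\<And>x. 0 < x \<Longrightarrow> x \<le> h0 \<Longrightarrow> B * x powr m + x powr p < c * (x * x / x powr m)"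
proof -
  \<comment> \<open>After division by \<open>x * x / x powr m\<close> the left side consists of
    powers with the positive exponents \<open>2 * m - 2\<close> and
    \<open>m + p - 2\<close>.\<close>
  have "((\<lambda>x. B * x powr (2 * m - 2) + x powr (m + p - 2)) \<longlongrightarrow> B * 0 + 0) (at_right 0)"
    using m_gt_1 p_ge_1 by (intro tendsto_intros powr_tendsto_0_at_right) auto
  from order_tendstoD(2)[OF this, of c] assms
  obtain b where b: "0 < b" "\<And>x. 0 < x \<Longrightarrow> x < b \<Longrightarrow> B * x powr (2 * m - 2) + x powr (m + p - 2) < c"
    by (auto simp: eventually_at_right)
  show ?thesis
  proof (rule that[of "b / 2"])
    fix x :: real assume x: "0 < x" "x \<le> b / 2"
    then have *: "B * x powr (2 * m - 2) + x powr (m + p - 2) < c" using b by auto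
    have "x powr (2 * m - 2) = x powr m * (x powr m / (x * x))" "x powr (m + p - 2) = x powr p * (x powr m / (x * x))"
    proof -
      have e: "2 * m - 2 = m + m - 2" by simp
      have "x powr 2 = x * x" using x by (simp add: power2_eq_square)
      then show "x powr (2 * m - 2) = x powr m * (x powr m / (x * x))" "x powr (m + p - 2) = x powr p * (x powr m / (x * x))"
        unfolding e powr_diff powr_add by simp_all
    qed
    with * have "(B * x powr m + x powr p) * (x powr m / (x * x)) < c" by (simp add: algebra_simps)
    then show "B * x powr m + x powr p < c * (x * x / x powr m)"
      using x by (simp add: field_simps)
  qed (use b in auto)
qed

text \<open>On the line \<open>Z = \<theta> * \<beta> * h\<close> the decay of \<open>h\<close>
  contributes \<open>\<theta> * (1 - \<theta>) * \<beta>^2 / m * h powr (2 - m)\<close> to the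
  derivative of \<open>Z - \<theta> * \<beta> * h\<close>, and for small \<open>h\<close> this beats
  the decay of \<open>Z\<close>. Since the smallness is expressed through a lower bound
  \<open>b\<close> for \<open>\<beta>\<close>, one \<open>h0\<close> serves all
  \<open>\<beta> \<ge> b\<close>.\<close>

lemma orbit_trap:
  assumes "orbit \<beta> I h Z" "0 < \<theta>" "\<theta> < 1" "0 < b" "b \<le> \<beta>"
    and h0: "\<And>x. 0 < x \<Longrightarrow> x \<le> h0 \<Longrightarrow> B * x powr m + x powr p < \<theta> * (1 - \<theta>) * b\<^sup>2 / m * (x * x / x powr m)"
    and s: "s \<in> I" "h s \<le> h0" "\<theta> * \<beta> * h s < Z s" and t: "t \<in> I" "s \<le> t"
  shows "\<theta> * \<beta> * h t < Z t"
proof -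
  let ?u = "\<lambda>s. Z s - \<theta> * \<beta> * h s"
  let ?u' = "\<lambda>s. (- B * h s powr m - h s powr p) - \<theta> * \<beta> * (- P \<beta> h Z s / (m * h s powr (m - 1)))"
  have "0 < ?u t"
  proof (rule positive_barrier[OF t(2), of ?u ?u'])
    show "0 < ?u s" using s by simp
    fix x assume "s \<le> x" "x \<le> t"
    then have x: "x \<in> I" using lower_ray_down[OF orbitD(1)[OF assms(1)] t(1)] by simp
    show "(?u has_real_derivative ?u' x) (at x)"
      by (intro DERIV_diff DERIV_cmult orbitD(4)[OF assms(1) x] orbit_h_deriv[OF assms(1) x])
  next
    fix x assume xx: "s < x" "x \<le> t" and z: "?u x = 0"
    then have x: "x \<in> I" using lower_ray_down[OF orbitD(1)[OF assms(1)] t(1)] by simp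
    have hx: "0 < h x" by (rule orbitD(2)[OF assms(1) x])
    have "h x \<le> h0" using orbit_h_decreasing[OF assms(1) _ x xx(1)] s assms(4,5) by simp
    note bound = h0[OF hx this]
    have Pz: "P \<beta> h Z x = (1 - \<theta>) * \<beta> * h x + A * h x powr m"
      using z unfolding P_def by (simp add: algebra_simps)
    define X where "X = h x powr m"
    have X: "0 < X" unfolding X_def using hx by simp
    have m1: "h x powr (m - 1) = X / h x" unfolding X_def using hx by (simp add: powr_diff)
    have "\<theta> * (1 - \<theta>) * b\<^sup>2 / m * (h x * h x / X) \<le> \<theta> * (1 - \<theta>) * \<beta>\<^sup>2 / m * (h x * h x / X)"
      using assms(2-5) m_pos hx X
      by (intro mult_right_mono divide_right_mono mult_left_mono power_mono) auto
    moreover have "0 \<le> \<theta> * \<beta> * A / m * h x" using assms(2-5) A_pos m_pos hx by simp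
    moreover have "?u' x = \<theta> * (1 - \<theta>) * \<beta>\<^sup>2 / m * (h x * h x / X) + \<theta> * \<beta> * A / m * h x - (B * X + h x powr p)"
      unfolding m1 Pz X_def[symmetric] using hx X m_pos by (simp add: field_simps power2_eq_square)
    ultimately show "0 < ?u' x" using bound unfolding X_def by linarith
  qed
  then show ?thesis by simp
qed

text \<open>The barrier \<open>q * h powr m - c * h powr p + \<theta> * \<beta> * h\<close> imitates
  the expansion of \<open>Z\<close> at the origin, with a more negative coefficient of
  \<open>h powr p\<close> and a smaller one of \<open>h\<close>, so \<open>Z\<close> starts above
  it. A gain quadratic in \<open>\<beta>\<close> prevents \<open>Z\<close> from crossing it
  downwards, and the barrier itself is positive for large \<open>\<beta>\<close>.\<close>

lemma orbit_large_\<beta>: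
  obtains b where "0 < b" "\<And>\<beta> I h Z s. b \<le> \<beta> \<Longrightarrow> orbit \<beta> I h Z \<Longrightarrow> s \<in> I \<Longrightarrow> 0 < Z s"
proof -
  \<comment> \<open>Twice the coefficient \<open>1 / (N + \<sigma>2)\<close> of the expansion. The
    excess puts the barrier below \<open>Z\<close> at the start, and
    \<open>c * (N + \<sigma>2) - 1 = 1\<close> leaves one positive copy of \<open>h powr p\<close>
    in the derivative.\<close>
  define c where "c = 2 / (N + \<sigma>2)"
  \<comment> \<open>The solution of \<open>\<theta> = p * (1 - \<theta>)\<close>, which removes the
    mixed term of order \<open>h powr (p + 1 - m)\<close> from the derivative.\<close>
  define \<theta> where "\<theta> = p / (1 + p)"
  define C where "C = c\<^sup>2 * p / m"
  define H0 where "H0 = C powr (1 / (m - p))"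
  define H1 where "H1 = (c / q) powr (1 / (m - p))"
  \<comment> \<open>The second and third summands are what \<open>key1\<close> and
    \<open>key0\<close> need when \<open>h\<close> is below the thresholds \<open>H0\<close> and
    \<open>H1\<close>; above them the powers of \<open>h\<close> alone decide.\<close>
  define b where "b = 1 + C * H0 powr (2 * (p - 1)) * m / (\<theta> * (1 - \<theta>)) + c * H1 powr (p - 1) / \<theta>"
  have c: "0 < c" unfolding c_def using N_\<sigma>2 by simp
  have th: "0 < \<theta>" "\<theta> < 1" unfolding \<theta>_def using p_pos by auto
  have thp: "\<theta> = p * (1 - \<theta>)" unfolding \<theta>_def using p_pos by (simp add: field_simps)
  have Cpos: "0 < C" unfolding C_def using c p_pos m_pos by simp
  have b1: "1 \<le> b" unfolding b_def using c th Cpos m_pos by simp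
  have key0: "c * x powr p < q * x powr m + \<theta> * \<beta> * x" if "0 < x" "b \<le> \<beta>" for x \<beta>
  proof (cases "c * x powr p \<le> q * x powr m")
    case True
    moreover have "0 < \<theta> * \<beta> * x" using that b1 th by simp
    ultimately show ?thesis by linarith
  next
    case False
    then have "x powr m / x powr p < c / q" using that q_pos by (simp add: field_simps)
    then have "x powr (m - p) < c / q" by (simp add: powr_diff)
    then have "(x powr (m - p)) powr (1 / (m - p)) < H1"
      unfolding H1_def using p_less_m that by (intro powr_less_mono2) auto
    then have "x < H1" using p_less_m that by (simp add: powr_powr)
    then have "x powr (p - 1) \<le> H1 powr (p - 1)" using p_ge_1 that by (intro powr_mono2) auto
    then have "c * x powr (p - 1) \<le> c * H1 powr (p - 1)" using c by simp
    also have "\<dots> = \<theta> * (c * H1 powr (p - 1) / \<theta>)" using th by simp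
    also have "\<dots> \<le> \<theta> * \<beta>"
    proof (rule mult_left_mono)
      have "0 \<le> C * H0 powr (2 * (p - 1)) * m / (\<theta> * (1 - \<theta>))" using Cpos m_pos th by simp
      then show "c * H1 powr (p - 1) / \<theta> \<le> \<beta>" using that(2) unfolding b_def by linarith
    qed (use th in simp)
    finally have "c * x powr (p - 1) * x \<le> \<theta> * \<beta> * x" using that by simp
    then have "c * x powr p \<le> \<theta> * \<beta> * x" using that by (simp add: powr_diff)
    moreover have "0 < q * x powr m" using q_pos that by simp
    ultimately show ?thesis by linarith
  qed
  \<comment> \<open>The left side is the only negative term that survives in the derivative; the
    right side collects the two terms that pay for it, one for large and one for small
    \<open>x\<close>.\<close>
  have key1: "C * (x powr p * x powr p / x powr m) \<le> x powr p + \<theta> * (1 - \<theta>) * \<beta>\<^sup>2 / m * (x * x / x powr m)"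
    if "0 < x" "b \<le> \<beta>" for x \<beta>
  proof (cases "C * x powr p \<le> x powr m")
    case True
    then have "C * (x powr p * x powr p / x powr m) \<le> x powr p"
      using that by (simp add: field_simps)
    moreover have "0 \<le> \<theta> * (1 - \<theta>) * \<beta>\<^sup>2 / m * (x * x / x powr m)"
      using th m_pos that by (intro mult_nonneg_nonneg divide_nonneg_nonneg) auto
    ultimately show ?thesis by linarith
  next
    case False
    then have "x powr m / x powr p < C" using that by (simp add: field_simps)
    then have "x powr (m - p) < C" by (simp add: powr_diff)
    then have "(x powr (m - p)) powr (1 / (m - p)) < H0"
      unfolding H0_def using p_less_m that by (intro powr_less_mono2) auto
    then have "x < H0" using p_less_m that by (simp add: powr_powr)
    then have le: "x powr (2 * (p - 1)) \<le> H0 powr (2 * (p - 1))" using p_ge_1 that by (intro powr_mono2) auto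
    have "x powr p * x powr p = x powr (2 * (p - 1)) * (x * x)"
    proof -
      have e: "2 * (p - 1) = p + p - 2" by simp
      have "x powr 2 = x * x" using that by (simp add: power2_eq_square)
      then show ?thesis unfolding e powr_diff powr_add using that by simp
    qed
    then have "C * (x powr p * x powr p / x powr m) = C * x powr (2 * (p - 1)) * (x * x / x powr m)"
      by simp
    also have "\<dots> \<le> C * H0 powr (2 * (p - 1)) * (x * x / x powr m)"
      using Cpos le that by (intro mult_right_mono mult_left_mono) auto
    also have "\<dots> \<le> \<theta> * (1 - \<theta>) * \<beta>\<^sup>2 / m * (x * x / x powr m)"
    proof (rule mult_right_mono)
      have "C * H0 powr (2 * (p - 1)) * m / (\<theta> * (1 - \<theta>)) \<le> \<beta>"
        using that(2) th c unfolding b_def by (smt (verit) divide_nonneg_pos mult_nonneg_nonneg powr_ge_zero)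
      also have "\<beta> \<le> \<beta>\<^sup>2" using that(2) b1 by (simp add: power2_eq_square)
      finally show "C * H0 powr (2 * (p - 1)) \<le> \<theta> * (1 - \<theta>) * \<beta>\<^sup>2 / m"
        using th m_pos by (simp add: field_simps)
    qed (use that in auto)
    finally show ?thesis using that by (smt (verit) powr_ge_zero)
  qed
  show ?thesis
  proof (rule that)
    show "0 < b" using b1 by simp
    fix \<beta> I h Z s
    assume be: "b \<le> \<beta>" and orb: "orbit \<beta> I h Z" and sI: "s \<in> I"
    have be0: "0 < \<beta>" using be b1 by simp
    let ?u = "\<lambda>s. Z s - (q * h s powr m - c * h s powr p + \<theta> * \<beta> * h s)"
    let ?d = "\<lambda>s. - P \<beta> h Z s / (m * h s powr (m - 1))"
    let ?u' = "\<lambda>s. (- B * h s powr m - h s powr p) -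
        (q * (m * h s powr (m - 1) * ?d s) - c * (p * h s powr (p - 1) * ?d s) + \<theta> * \<beta> * ?d s)"
    have "0 < ?u s"
    proof (rule lower_ray_positive[OF orbitD(1)[OF orb], of ?u ?u'])
      have "0 < 1 / (2 * (N + \<sigma>2))" using N_\<sigma>2 by simp
      from orbit_asym[OF orb this] show "eventually (\<lambda>s. 0 < ?u s) at_bot"
      proof eventually_elim
        case (elim s)
        have "1 \<le> q / (N + \<sigma>1)" using N_\<sigma>1 k_pos unfolding q_def by (simp add: field_simps)
        then have "\<beta> * h s * 1 \<le> \<beta> * h s * (q / (N + \<sigma>1))" using be0 elim by (intro mult_left_mono) auto
        moreover have "\<theta> * (\<beta> * h s) < 1 * (\<beta> * h s)" using th be0 elim by (intro mult_strict_right_mono) auto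
        ultimately have 1: "\<theta> * \<beta> * h s < \<beta> * q / (N + \<sigma>1) * h s" by (simp add: mult_ac)
        have "c * h s powr p - h s powr p / (N + \<sigma>2) - 1 / (2 * (N + \<sigma>2)) * h s powr p
            = 1 / (2 * (N + \<sigma>2)) * h s powr p"
        proof -
          have "2 / n * Y - Y / n - 1 / (2 * n) * Y = 1 / (2 * n) * Y" if "0 < n" for n Y :: real
            using that by (simp add: field_simps)
          then show ?thesis unfolding c_def using N_\<sigma>2 by blast
        qed
        moreover have "0 \<le> 1 / (2 * (N + \<sigma>2)) * h s powr p" using N_\<sigma>2 by simp
        ultimately show ?case using 1 elim by linarith
      qed
    next
      fix s assume s: "s \<in> I"
      note dh = orbit_h_deriv[OF orb s] and hs = orbitD(2)[OF orb s]
      have dp: "((\<lambda>s. h s powr a) has_real_derivative a * h s powr (a - 1) * ?d s) (at s)" for a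
        by (rule DERIV_chain2[OF has_real_derivative_powr[OF hs] dh])
      show "(?u has_real_derivative ?u' s) (at s)"
        by (intro DERIV_diff DERIV_add DERIV_cmult dp dh orbitD(4)[OF orb s])
      assume z: "?u s = 0"
      define X where "X = h s powr m"
      define Y where "Y = h s powr p"
      define x where "x = h s"
      have x: "0 < x" "0 < X" "0 < Y" unfolding X_def Y_def x_def using hs by auto
      have m1: "h s powr (m - 1) = X / x" "h s powr (p - 1) = Y / x"
        unfolding X_def Y_def x_def using hs by (simp_all add: powr_diff)
      have Pz: "P \<beta> h Z s = k * m * X + c * Y + (1 - \<theta>) * \<beta> * x"
        using z unfolding P_def A_def X_def Y_def x_def by (simp add: algebra_simps)
      have "?u' s = q * P \<beta> h Z s - c * p * Y / (m * X) * P \<beta> h Z s + \<theta> * \<beta> * x / (m * X) * P \<beta> h Z s - B * X - Y"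
        unfolding m1 X_def[symmetric] Y_def[symmetric] using x m_pos by (simp add: field_simps)
      also have "\<dots> = (c * (q - p * k) - 1) * Y + q * (1 - \<theta>) * \<beta> * x + \<theta> * \<beta> * k * x
          - C * (Y * Y / X) + c * \<beta> / m * (\<theta> - p * (1 - \<theta>)) * (x * Y / X)
          + \<theta> * (1 - \<theta>) * \<beta>\<^sup>2 / m * (x * x / X)"
        unfolding Pz B_def C_def using x m_pos by (simp add: field_simps power2_eq_square)
      also have "\<dots> = Y + q * (1 - \<theta>) * \<beta> * x + \<theta> * \<beta> * k * x
          - C * (Y * Y / X) + \<theta> * (1 - \<theta>) * \<beta>\<^sup>2 / m * (x * x / X)"
      proof -
        have "c * (N + \<sigma>2) = 2" using c_def N_\<sigma>2 nonzero_eq_divide_eq[of "N + \<sigma>2" c 2] by simp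
        moreover have "\<theta> - p * (1 - \<theta>) = 0" using thp by simp
        ultimately show ?thesis unfolding q_minus_pk by simp
      qed
      finally have e: "?u' s = \<dots>" .
      have key: "C * (Y * Y / X) \<le> Y + \<theta> * (1 - \<theta>) * \<beta>\<^sup>2 / m * (x * x / X)"
        unfolding X_def Y_def x_def by (rule key1[OF hs be])
      have "0 < q * (1 - \<theta>) * \<beta> * x" "0 < \<theta> * \<beta> * k * x" using q_pos th be0 x k_pos by auto
      then show "0 < ?u' s"
        unfolding e using key by linarith
    qed (rule sI)
    moreover have "0 < q * h s powr m - c * h s powr p + \<theta> * \<beta> * h s"
      using key0[OF orbitD(2)[OF orb sI] be] by linarith
    ultimately show "0 < Z s" by linarith
  qed
qed


section \<open>Tails and uniqueness of compact orbits\<close>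

text \<open>If \<open>h\<close> stayed above \<open>a\<close>, \<open>Z\<close> would fall at least
  at the rate \<open>a powr p\<close> and be nonpositive at time
  \<open>Z 0 / a powr p\<close>.\<close>

lemma orbit_tail_h_tendsto_0:
  assumes orb: "orbit \<beta> UNIV h Z" and "0 \<le> \<beta>" and Zpos: "\<And>s. 0 < Z s"
  shows "(h \<longlongrightarrow> 0) at_top"
proof (rule order_tendstoI)
  fix a :: real assume "a < 0"
  then show "eventually (\<lambda>s. a < h s) at_top"
    using orbitD(2)[OF orb] by (intro always_eventually allI) (metis UNIV_I less_trans)
next
  fix a :: real assume a: "0 < a"
  have "\<exists>s. h s < a"
  proof (rule ccontr)
    assume "\<not> (\<exists>s. h s < a)"
    then have ha: "a \<le> h s" for s by (simp add: not_less)
    define t where "t = Z 0 / a powr p"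
    have t: "0 \<le> t" unfolding t_def using Zpos[of 0] by simp
    have "Z t + a powr p * t \<le> Z 0 + a powr p * 0"
    proof (rule DERIV_nonpos_imp_nonincreasing[OF t])
      fix x :: real
      have "a powr p \<le> h x powr p" using ha[of x] a p_pos by (intro powr_mono2) auto
      moreover have "0 \<le> B * h x powr m" using B_pos by simp
      ultimately have "- B * h x powr m - h x powr p + a powr p * 1 \<le> 0" by linarith
      moreover have "((\<lambda>x. Z x + a powr p * x) has_real_derivative - B * h x powr m - h x powr p + a powr p * 1) (at x)"
        by (intro DERIV_add DERIV_cmult DERIV_ident orbitD(4)[OF orb]) simp
      ultimately show "\<exists>y. ((\<lambda>x. Z x + a powr p * x) has_real_derivative y) (at x) \<and> y \<le> 0" by blast
    qed
    then have "Z t \<le> 0" unfolding t_def using a by simp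
    then show False using Zpos[of t] by simp
  qed
  then obtain s where s: "h s < a" by blast
  have "h t < a" if "s \<le> t" for t
    using orbit_h_decreasing[OF orb assms(2), of t s] s that by (cases "s = t") auto
  then show "eventually (\<lambda>s. h s < a) at_top" by (auto simp: eventually_at_top_linorder)
qed

text \<open>As long as \<open>Z \<le> \<theta> * \<beta> * h\<close>, the function
  \<open>h powr (m - 1)\<close> decreases at least linearly, so \<open>h\<close> would vanish in
  finite time. Hence the orbit is above the line at some time, and \<open>orbit_trap\<close> keeps
  it there.\<close>

lemma orbit_tail_Z_lower:
  assumes orb: "orbit \<beta> UNIV h Z" and be: "0 < \<beta>" and Zpos: "\<And>s. 0 < Z s" and th: "0 < \<theta>" "\<theta> < 1"
  shows "eventually (\<lambda>s. \<theta> * \<beta> * h s < Z s) at_top"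
proof -
  have "0 < \<theta> * (1 - \<theta>) * \<beta>\<^sup>2 / m" using th be m_pos by simp
  then obtain h0 where h0: "0 < h0"
    "\<And>x. 0 < x \<Longrightarrow> x \<le> h0 \<Longrightarrow> B * x powr m + x powr p < \<theta> * (1 - \<theta>) * \<beta>\<^sup>2 / m * (x * x / x powr m)"
    by (rule small_argument_bound) blast
  obtain s1 where s1: "\<And>s. s1 \<le> s \<Longrightarrow> h s < h0"
    using order_tendstoD(2)[OF orbit_tail_h_tendsto_0[OF orb less_imp_le[OF be] Zpos] h0(1)]
    by (auto simp: eventually_at_top_linorder)
  have hpos: "0 < h s" for s using orbitD(2)[OF orb] by simp
  have "\<exists>s\<ge>s1. \<theta> * \<beta> * h s < Z s"
  proof (rule ccontr)
    assume "\<not> (\<exists>s\<ge>s1. \<theta> * \<beta> * h s < Z s)"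
    then have Zle: "Z s \<le> \<theta> * \<beta> * h s" if "s1 \<le> s" for s using that by (meson not_less)
    define c where "c = (m - 1) / m * ((1 - \<theta>) * \<beta>)"
    have c: "0 < c" unfolding c_def using m_gt_1 th be by simp
    \<comment> \<open>Late enough for the linear upper bound on \<open>h powr (m - 1)\<close> to
      equal \<open>- c\<close>.\<close>
    define t where "t = s1 + h s1 powr (m - 1) / c + 1"
    have t: "s1 \<le> t" unfolding t_def using c by simp
    have "h t powr (m - 1) + c * t \<le> h s1 powr (m - 1) + c * s1"
    proof (rule DERIV_nonpos_imp_nonincreasing[OF t])
      fix x assume x: "s1 \<le> x" "x \<le> t"
      let ?d = "(m - 1) * h x powr (m - 1 - 1) * (- P \<beta> h Z x / (m * h x powr (m - 1))) + c * 1"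
      have "((\<lambda>x. h x powr (m - 1) + c * x) has_real_derivative ?d) (at x)"
        by (intro DERIV_add DERIV_cmult DERIV_ident DERIV_chain2[OF has_real_derivative_powr orbit_h_deriv[OF orb]] hpos UNIV_I)
      moreover have "?d = - (m - 1) / m * (P \<beta> h Z x / h x) + c"
      proof -
        have *: "(m - 1) * (H / x) * (- Q / (m * H)) + c * 1 = - (m - 1) / m * (Q / x) + c"
          if "0 < H" "0 < x" for H x Q :: real
          using that m_pos by (simp add: field_simps)
        have "h x powr (m - 1 - 1) = h x powr (m - 1) / h x"
          using hpos[of x] by (subst powr_diff) simp
        then show ?thesis using *[of "h x powr (m - 1)" "h x"] hpos[of x] by (simp only:) simp
      qed
      moreover have "(1 - \<theta>) * \<beta> \<le> P \<beta> h Z x / h x"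
      proof -
        have "(1 - \<theta>) * \<beta> * h x \<le> P \<beta> h Z x"
          using Zle[OF x(1)] mult_pos_pos[OF A_pos, of "h x powr m"] hpos[of x]
          unfolding P_def by (simp add: algebra_simps)
        then show ?thesis using hpos[of x] by (simp add: field_simps)
      qed
      then have "(m - 1) / m * ((1 - \<theta>) * \<beta>) \<le> (m - 1) / m * (P \<beta> h Z x / h x)"
        using m_gt_1 by (intro mult_left_mono) auto
      then have "- ((m - 1) / m * (P \<beta> h Z x / h x)) + c \<le> 0" unfolding c_def by linarith
      then have "- (m - 1) / m * (P \<beta> h Z x / h x) + c \<le> 0" by (simp only: minus_divide_left minus_mult_left)
      ultimately show "\<exists>y. ((\<lambda>x. h x powr (m - 1) + c * x) has_real_derivative y) (at x) \<and> y \<le> 0" by metis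
    qed
    moreover have "c * t = c * s1 + h s1 powr (m - 1) + c" unfolding t_def using c by (simp add: algebra_simps)
    moreover have "0 \<le> h t powr (m - 1)" by simp
    ultimately show False using c by linarith
  qed
  then obtain s where s: "s1 \<le> s" "\<theta> * \<beta> * h s < Z s" by blast
  have "\<theta> * \<beta> * h t < Z t" if "s \<le> t" for t
    by (rule orbit_trap[OF orb th be order_refl h0(2) _ _ s(2) _ that]) (use s1[OF s(1)] in auto)
  then show ?thesis by (auto simp: eventually_at_top_linorder)
qed

text \<open>The lower bound is \<open>orbit_tail_Z_lower\<close> for all
  \<open>\<theta> < 1\<close>; the upper bound is \<open>0 < P\<close> together with
  \<open>h powr (m - 1) \<longlongrightarrow> 0\<close>.\<close>

lemma orbit_tail_ratio:
  assumes orb: "orbit \<beta> UNIV h Z" and be: "0 < \<beta>" and Zpos: "\<And>s. 0 < Z s"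
  shows "((\<lambda>s. Z s / h s) \<longlongrightarrow> \<beta>) at_top"
proof (rule order_tendstoI)
  have hpos: "0 < h s" for s using orbitD(2)[OF orb] by simp
  fix a assume "a < \<beta>"
  then have "max 0 (a / \<beta>) < 1" using be by simp
  then obtain \<theta> where th: "max 0 (a / \<beta>) < \<theta>" "\<theta> < 1" using dense by blast
  then have a: "a < \<theta> * \<beta>" using be by (simp add: field_simps)
  have "eventually (\<lambda>s. \<theta> * \<beta> * h s < Z s) at_top"
    by (rule orbit_tail_Z_lower[OF orb be Zpos]) (use th in auto)
  then show "eventually (\<lambda>s. a < Z s / h s) at_top"
  proof eventually_elim
    case (elim s)
    then have "\<theta> * \<beta> < Z s / h s" using hpos[of s] by (simp add: pos_less_divide_eq)
    then show ?case using a by simp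
  qed
next
  have hpos: "0 < h s" for s using orbitD(2)[OF orb] by simp
  fix a assume a: "\<beta> < a"
  have "((\<lambda>s. \<beta> + A * h s powr (m - 1)) \<longlongrightarrow> \<beta> + A * 0) at_top"
  proof (intro tendsto_intros)
    show "((\<lambda>s. h s powr (m - 1)) \<longlongrightarrow> 0) at_top"
      using m_gt_1 tendsto_powr'[OF orbit_tail_h_tendsto_0[OF orb less_imp_le[OF be] Zpos] tendsto_const, of "m - 1"] hpos
      by (auto simp: less_imp_le)
  qed
  from order_tendstoD(2)[OF this, of a] a
  have "eventually (\<lambda>s. \<beta> + A * h s powr (m - 1) < a) at_top" by simp
  then show "eventually (\<lambda>s. Z s / h s < a) at_top"
  proof eventually_elim
    case (elim s)
    have "Z s < \<beta> * h s + A * h s powr m"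
      using orbit_P_pos[OF orb less_imp_le[OF be], of s] unfolding P_def by simp
    also have "\<dots> = (\<beta> + A * h s powr (m - 1)) * h s"
      using hpos[of s] by (simp add: powr_diff field_simps)
    finally have "Z s / h s < \<beta> + A * h s powr (m - 1)" using hpos[of s] by (simp add: pos_divide_less_eq)
    then show ?case using elim by simp
  qed
qed

text \<open>L'Hospital's rule is applied to \<open>Z powr (1 - p)\<close> and not to
  \<open>h powr (1 - p)\<close>: \<open>Z'\<close> is explicit in \<open>h\<close>, whereas
  \<open>h'\<close> contains the small difference \<open>Z - \<beta> * h\<close> divided by a
  vanishing power. The limit \<open>Z / h \<longlongrightarrow> \<beta>\<close> then transfers the
  result to \<open>h\<close>.\<close>

lemma orbit_tail_asymptotics:
  assumes orb: "orbit \<beta> UNIV h Z" and be: "0 < \<beta>" and Zpos: "\<And>s. 0 < Z s" and p: "1 < p"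
  shows "((\<lambda>s. h s * s powr (1 / (p - 1))) \<longlongrightarrow> (\<beta> / (p - 1)) powr (1 / (p - 1))) at_top"
proof -
  have hpos: "0 < h s" for s using orbitD(2)[OF orb] by simp
  note h0 = orbit_tail_h_tendsto_0[OF orb less_imp_le[OF be] Zpos]
  note ratio = orbit_tail_ratio[OF orb be Zpos]
  have lim: "((\<lambda>s. ((p - 1) * (B * h s powr (m - p) + 1) * (Z s / h s) powr (- p)) / 1)
      \<longlongrightarrow> ((p - 1) * (B * 0 + 1) * \<beta> powr (- p)) / 1) at_top"
    using be p_less_m hpos tendsto_powr'[OF h0 tendsto_const, of "m - p"]
    by (intro tendsto_intros ratio) (auto simp: less_imp_le)
  have "((\<lambda>s. Z s powr (1 - p) / s) \<longlongrightarrow> ((p - 1) * (B * 0 + 1) * \<beta> powr (- p)) / 1) at_top"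
  proof (rule lhospital_at_top_at_top[OF _ _ _ _ lim])
    show "eventually (\<lambda>s. ((\<lambda>s. Z s powr (1 - p)) has_real_derivative
        (p - 1) * (B * h s powr (m - p) + 1) * (Z s / h s) powr (- p)) (at s)) at_top"
    proof (intro always_eventually allI)
      fix s
      have d: "((\<lambda>s. Z s powr (1 - p)) has_real_derivative
         (1 - p) * Z s powr (1 - p - 1) * (- B * h s powr m - h s powr p)) (at s)"
        by (intro DERIV_chain2[OF has_real_derivative_powr[OF Zpos] orbitD(4)[OF orb]]) simp
      have "(Z s / h s) powr (- p) = Z s powr (- p) * h s powr p"
        using hpos[of s] Zpos[of s] by (simp add: powr_divide powr_minus field_simps)
      moreover have "h s powr m = h s powr (m - p) * h s powr p" by (simp flip: powr_add)
      ultimately show "((\<lambda>s. Z s powr (1 - p)) has_real_derivative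
        (p - 1) * (B * h s powr (m - p) + 1) * (Z s / h s) powr (- p)) (at s)"
        by (intro DERIV_cong[OF d]) (simp add: algebra_simps)
    qed
  qed (auto intro: filterlim_ident DERIV_ident)
  then have "((\<lambda>s. (Z s / h s) powr (p - 1) * (Z s powr (1 - p) / s)) \<longlongrightarrow>
      \<beta> powr (p - 1) * ((p - 1) * \<beta> powr (- p))) at_top"
    using be p by (intro tendsto_mult tendsto_powr' ratio) auto
  moreover have "(Z s / h s) powr (p - 1) * (Z s powr (1 - p) / s) = h s powr (1 - p) / s" for s
    using hpos[of s] Zpos[of s] by (simp add: powr_divide powr_diff)
  moreover have "\<beta> powr (p - 1) * ((p - 1) * \<beta> powr (- p)) = (p - 1) / \<beta>"
    using be by (simp add: powr_diff powr_minus field_simps)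
  ultimately have "((\<lambda>s. h s powr (1 - p) / s) \<longlongrightarrow> (p - 1) / \<beta>) at_top" by (simp only:)
  then have "((\<lambda>s. (h s powr (1 - p) / s) powr (- (1 / (p - 1)))) \<longlongrightarrow> ((p - 1) / \<beta>) powr (- (1 / (p - 1)))) at_top"
    using be p by (intro tendsto_powr tendsto_const) auto
  moreover have "eventually (\<lambda>s. (h s powr (1 - p) / s) powr (- (1 / (p - 1))) = h s * s powr (1 / (p - 1))) at_top"
    using eventually_gt_at_top[of 0]
  proof eventually_elim
    case (elim s)
    have "(1 - p) * (- (1 / (p - 1))) = 1" using p by (simp add: field_simps)
    then have "(h s powr (1 - p)) powr (- (1 / (p - 1))) = h s"
      using hpos[of s] by (simp only: powr_powr) simp
    then show ?case using elim hpos[of s] by (simp add: powr_divide powr_minus field_simps)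
  qed
  moreover have "((p - 1) / \<beta>) powr (- (1 / (p - 1))) = (\<beta> / (p - 1)) powr (1 / (p - 1))"
    using be p by (simp add: powr_divide powr_minus field_simps)
  ultimately show ?thesis by (simp add: tendsto_cong)
qed

section \<open>Compact orbits: behaviour at the endpoint and uniqueness of the exponent\<close>

definition compact_orbit where
  "compact_orbit \<beta> S h Z \<longleftrightarrow> orbit \<beta> {..<S} h Z \<and> (h \<longlongrightarrow> 0) (at_left S) \<and> (Z \<longlongrightarrow> 0) (at_left S)"

text \<open>\<open>Z s\<close> is the integral of \<open>B * h powr m + h powr p\<close> from
  \<open>s\<close> to \<open>S\<close>, hence at most \<open>S - s\<close> times the integrand at
  \<open>s\<close>, as \<open>h\<close> decreases. Both powers are at most \<open>h\<close> once
  \<open>h < 1\<close>, so \<open>Z / h \<longlongrightarrow> 0\<close>.\<close>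

lemma compact_orbit_ratio:
  assumes co: "compact_orbit \<beta> S h Z" and be: "0 \<le> \<beta>"
  shows "((\<lambda>s. P \<beta> h Z s / h s) \<longlongrightarrow> \<beta>) (at_left S)"
proof -
  have orb: "orbit \<beta> {..<S} h Z" and h0: "(h \<longlongrightarrow> 0) (at_left S)" and Z0: "(Z \<longlongrightarrow> 0) (at_left S)"
    using co unfolding compact_orbit_def by auto
  have hpos: "0 < h s" if "s < S" for s using orbitD(2)[OF orb] that by simp
  have left: "eventually (\<lambda>s. s < S) (at_left S)" by (auto simp: eventually_at_filter)
  have Zup: "Z s \<le> (S - s) * (B * h s powr m + h s powr p)" if s: "s < S" for s
  proof -
    let ?c = "B * h s powr m + h s powr p"
    have c: "0 \<le> ?c" using B_pos by simp
    have "Z s \<le> (S - s) * ?c + Z t" if t: "s < t" "t < S" for t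
    proof -
      have "Z s + ?c * s \<le> Z t + ?c * t"
      proof (rule DERIV_nonneg_imp_nondecreasing[where f = "\<lambda>x. Z x + ?c * x"])
        show "s \<le> t" using t by simp
        fix x assume x: "s \<le> x" "x \<le> t"
        then have xS: "x < S" using t by simp
        have "h x \<le> h s" using orbit_h_decreasing[OF orb be, of x s] xS x by (cases "s = x") auto
        then have "h x powr m \<le> h s powr m" "h x powr p \<le> h s powr p"
          using hpos[OF xS] m_pos p_pos by (auto intro!: powr_mono2)
        then have "B * h x powr m \<le> B * h s powr m" using B_pos by simp
        then have "0 \<le> - B * h x powr m - h x powr p + ?c * 1"
          using \<open>h x powr p \<le> h s powr p\<close> by simp
        moreover have "((\<lambda>x. Z x + ?c * x) has_real_derivative - B * h x powr m - h x powr p + ?c * 1) (at x)"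
          by (intro DERIV_add DERIV_cmult DERIV_ident orbitD(4)[OF orb]) (use xS in simp)
        ultimately show "\<exists>y. ((\<lambda>x. Z x + ?c * x) has_real_derivative y) (at x) \<and> 0 \<le> y" by blast
      qed
      then have "Z s \<le> Z t + ?c * (t - s)" by (simp add: algebra_simps)
      also have "?c * (t - s) \<le> ?c * (S - s)" using c t by (intro mult_left_mono) auto
      finally show ?thesis by (simp add: mult.commute)
    qed
    then have "eventually (\<lambda>t. Z s \<le> (S - s) * ?c + Z t) (at_left S)"
      using eventually_at_left_real[OF s] by (rule eventually_mono[rotated]) auto
    moreover have "((\<lambda>t. (S - s) * ?c + Z t) \<longlongrightarrow> (S - s) * ?c + 0) (at_left S)"
      by (intro tendsto_intros Z0)
    ultimately have "Z s \<le> (S - s) * ?c + 0"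
      by (intro tendsto_lowerbound[of "\<lambda>t. (S - s) * ?c + Z t"]) auto
    then show ?thesis by simp
  qed
  have Znn: "0 \<le> Z s" if s: "s < S" for s
  proof (rule tendsto_upperbound[OF Z0])
    show "eventually (\<lambda>t. Z t \<le> Z s) (at_left S)"
      using eventually_at_left_real[OF s] by eventually_elim (use orbit_Z_decreasing[OF orb] in force)
  qed simp
  have "((\<lambda>s. Z s / h s) \<longlongrightarrow> 0) (at_left S)"
  proof (rule tendsto_sandwich[of "\<lambda>_. 0" _ _ "\<lambda>s. (S - s) * (B + 1)"])
    show "eventually (\<lambda>s. 0 \<le> Z s / h s) (at_left S)"
      using left by eventually_elim (use Znn hpos in \<open>auto simp: less_imp_le\<close>)
    show "eventually (\<lambda>s. Z s / h s \<le> (S - s) * (B + 1)) (at_left S)"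
      using left order_tendstoD(2)[OF h0 zero_less_one]
    proof eventually_elim
      case (elim s)
      have "h s powr m = h s powr (m - 1) * h s" "h s powr p = h s powr (p - 1) * h s"
        using hpos[OF elim(1)] by (simp_all add: powr_diff)
      moreover have "h s powr (m - 1) \<le> 1" "h s powr (p - 1) \<le> 1"
        using hpos[OF elim(1)] elim m_gt_1 p_ge_1 by (auto intro!: powr_le1)
      ultimately have "h s powr m \<le> h s" "h s powr p \<le> h s"
        using hpos[OF elim(1)] by (auto simp: mult_le_cancel_right1)
      then have "B * h s powr m + h s powr p \<le> B * h s + h s"
        using B_pos by (intro add_mono mult_left_mono) auto
      then have "(S - s) * (B * h s powr m + h s powr p) \<le> (S - s) * ((B + 1) * h s)"
        using elim by (intro mult_left_mono) (auto simp: algebra_simps)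
      with Zup[OF elim(1)] have "Z s \<le> (S - s) * (B + 1) * h s" by simp
      then show ?case using hpos[OF elim(1)] by (simp add: pos_divide_le_eq)
    qed
    have "((\<lambda>s. (S - s) * (B + 1)) \<longlongrightarrow> (S - S) * (B + 1)) (at_left S)" by (intro tendsto_intros)
    then show "((\<lambda>s. (S - s) * (B + 1)) \<longlongrightarrow> 0) (at_left S)" by simp
  qed simp
  moreover have "((\<lambda>s. h s powr (m - 1)) \<longlongrightarrow> 0) (at_left S)"
  proof -
    have "eventually (\<lambda>s. 0 \<le> h s) (at_left S)" using left by eventually_elim (use hpos in \<open>auto simp: less_imp_le\<close>)
    from tendsto_powr'[OF h0 tendsto_const, of "m - 1"] this show ?thesis using m_gt_1 by simp
  qed
  ultimately have "((\<lambda>s. \<beta> + A * h s powr (m - 1) - Z s / h s) \<longlongrightarrow> \<beta> + A * 0 - 0) (at_left S)"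
    by (intro tendsto_intros)
  moreover have "eventually (\<lambda>s. P \<beta> h Z s / h s = \<beta> + A * h s powr (m - 1) - Z s / h s) (at_left S)"
    using left
  proof eventually_elim
    case (elim s)
    then show ?case using hpos[OF elim] unfolding P_def by (simp add: powr_diff field_simps)
  qed
  ultimately show ?thesis by (simp add: tendsto_cong)
qed

text \<open>The variable \<open>P\<close> of a compact orbit as a function \<open>Q\<close> of \<open>h\<close>.\<close>

definition phase_curve where
  "phase_curve \<beta> Q \<longleftrightarrow>
    (\<forall>x>0. 0 < Q x \<and> (Q has_real_derivative
      \<beta> + A * m * x powr (m - 1) - m * x powr (m - 1) * (B * x powr m + x powr p) / Q x) (at x)) \<and>
    (\<exists>C. eventually (\<lambda>x. \<bar>Q x - k * m * x powr m\<bar> \<le> C * x powr p) at_top) \<and>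
    ((\<lambda>x. Q x / x) \<longlongrightarrow> \<beta>) (at_right 0)"

text \<open>\<open>h\<close> decreases from infinity to \<open>0\<close>, so it maps the ray
  bijectively onto the positive half line. Its inverse \<open>\<sigma>\<close> is differentiable
  because \<open>0 < P\<close> makes \<open>h'\<close> nonzero, and the chain rule gives the
  equation for \<open>Q = P \<circ> \<sigma>\<close>.\<close>

lemma compact_orbit_phase:
  assumes co: "compact_orbit \<beta> S h Z" and be: "0 \<le> \<beta>"
  shows "\<exists>Q. phase_curve \<beta> Q"
proof -
  have orb: "orbit \<beta> {..<S} h Z" and h0: "(h \<longlongrightarrow> 0) (at_left S)"
    using co unfolding compact_orbit_def by auto
  have hpos: "0 < h s" if "s < S" for s using orbitD(2)[OF orb] that by simp
  have hdec: "h t < h s" if "s < t" "t < S" for s t using orbit_h_decreasing[OF orb be, of t s] that by simp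
  have hcont: "isCont h s" if "s < S" for s using orbit_h_deriv[OF orb, of s] that by (auto intro: DERIV_isCont)
  have ex: "\<exists>s<S. h s = x" if x: "0 < x" for x
  proof -
    have "eventually (\<lambda>s. x \<le> h s \<and> s < S) at_bot"
      using orbitD(5)[OF orb] lower_ray_eventually[OF orbitD(1)[OF orb]]
      by (intro eventually_conj) (simp_all add: filterlim_at_top)
    then obtain s where s: "x \<le> h s" "s < S" by (auto simp: eventually_at_bot_linorder)
    have "eventually (\<lambda>t. h t < x) (at_left S)" using order_tendstoD(2)[OF h0 x] .
    with eventually_at_left_real[OF s(2)] have "eventually (\<lambda>t. t \<in> {s<..<S} \<and> h t < x) (at_left S)"
      by (rule eventually_conj)
    then obtain t where t: "t \<in> {s<..<S}" "h t < x"
      using eventually_happens'[OF trivial_limit_at_left_real] by blast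
    have "continuous_on {s..t} h" using t hcont by (intro continuous_at_imp_continuous_on) auto
    with IVT2'[of h t x s] s t obtain u where "s \<le> u" "u \<le> t" "h u = x" by auto
    then show ?thesis using t by (intro exI[of _ u]) auto
  qed
  define \<sigma> where "\<sigma> x = (SOME s. s < S \<and> h s = x)" for x
  have sig: "\<sigma> x < S" "h (\<sigma> x) = x" if "0 < x" for x
    using someI_ex[OF ex[OF that, simplified]] unfolding \<sigma>_def by auto
  have sig_h: "\<sigma> (h s) = s" if s: "s < S" for s
  proof -
    have "\<sigma> (h s) < S" "h (\<sigma> (h s)) = h s" using sig[OF hpos[OF s]] by auto
    then show ?thesis using hdec[of "\<sigma> (h s)" s] hdec[of s "\<sigma> (h s)"] s
      by (cases "\<sigma> (h s)" s rule: linorder_cases) auto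
  qed
  have sig_cont: "isCont \<sigma> x" if x: "0 < x" for x
  proof -
    have "isCont \<sigma> (h (\<sigma> x))"
    proof (rule isCont_inverse_function[where d = "(S - \<sigma> x) / 2" and f = h and x = "\<sigma> x"])
      show "0 < (S - \<sigma> x) / 2" using sig[OF x] by simp
      fix z assume "\<bar>z - \<sigma> x\<bar> \<le> (S - \<sigma> x) / 2"
      then have "z - \<sigma> x \<le> (S - \<sigma> x) / 2" by (rule order_trans[OF abs_ge_self])
      then have "z < S" using sig[OF x] by (simp add: field_simps)
      then show "\<sigma> (h z) = z" "isCont h z" using sig_h hcont by auto
    qed
    then show ?thesis using sig[OF x] by simp
  qed
  define Q where "Q x = P \<beta> h Z (\<sigma> x)" for x
  have Qpos: "0 < Q x" if "0 < x" for x
    unfolding Q_def using orbit_P_pos[OF orb be] sig[OF that] by simp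
  obtain C where C: "0 < C" "eventually (\<lambda>s. 1 \<le> h s \<and> \<bar>Z s - q * h s powr m\<bar> \<le> C * h s powr p) at_bot"
    using orbit_Z_growth[OF orb be] by blast
  show ?thesis
    unfolding phase_curve_def
  proof (intro exI[of _ Q] exI[of _ "\<beta> + C"] conjI allI impI Qpos)
    fix x :: real assume x: "0 < x"
    let ?D = "- Q x / (m * x powr (m - 1))"
    have D: "?D \<noteq> 0" using Qpos[OF x] m_pos x by simp
    have dh: "(h has_real_derivative ?D) (at (\<sigma> x))"
      using orbit_h_deriv[OF orb, of "\<sigma> x"] sig[OF x] by (simp add: Q_def)
    have ds: "(\<sigma> has_real_derivative inverse ?D) (at x)"
      by (rule DERIV_inverse_function[where f = h and g = \<sigma> and x = x and a = 0 and b = "x + 1", OF dh D]) (use x sig sig_cont in auto)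
    have dP: "(P \<beta> h Z has_real_derivative (\<beta> + A * m * x powr (m - 1)) * ?D + B * x powr m + x powr p) (at (\<sigma> x))"
      using orbit_P_deriv[OF orb, of "\<sigma> x"] sig[OF x] by (simp add: Q_def)
    have "(\<beta> + A * m * x powr (m - 1)) * ?D + B * x powr m + x powr p = 
      ((\<beta> + A * m * x powr (m - 1)) - m * x powr (m - 1) * (B * x powr m + x powr p) / Q x) * ?D"
      using Qpos[OF x] m_pos x by (simp add: field_simps)
    then show "(Q has_real_derivative
      \<beta> + A * m * x powr (m - 1) - m * x powr (m - 1) * (B * x powr m + x powr p) / Q x) (at x)"
      unfolding Q_def[abs_def] using D by (intro DERIV_cong[OF DERIV_chain2[OF dP ds]]) (simp add: Q_def)
  next
    have "filterlim \<sigma> at_bot at_top"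
      unfolding filterlim_at_bot_dense
    proof
      fix s0
      define s where "s = min s0 (S - 1)"
      have s: "s < S" "s \<le> s0" unfolding s_def by auto
      have "\<sigma> x < s0" if "h s < x" for x
      proof -
        have "0 < x" using hpos[OF s(1)] that by simp
        note sg = sig[OF this]
        show ?thesis
        proof (rule ccontr)
          assume "\<not> \<sigma> x < s0"
          then have "h (\<sigma> x) \<le> h s" using hdec[of s "\<sigma> x"] sg s by (cases "s = \<sigma> x") auto
          then show False using sg that by simp
        qed
      qed
      then show "eventually (\<lambda>x. \<sigma> x < s0) at_top" by (auto simp: eventually_at_top_dense)
    qed
    with C(2) have "eventually (\<lambda>x. 1 \<le> h (\<sigma> x) \<and> \<bar>Z (\<sigma> x) - q * h (\<sigma> x) powr m\<bar> \<le> C * h (\<sigma> x) powr p) at_top"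
      by (rule eventually_compose_filterlim)
    then show "eventually (\<lambda>x. \<bar>Q x - k * m * x powr m\<bar> \<le> (\<beta> + C) * x powr p) at_top"
      using eventually_gt_at_top[of 0]
    proof eventually_elim
      case (elim x)
      note sg = sig[OF elim(2)]
      have "x powr 1 \<le> x powr p" using elim sg p_ge_1 by (intro powr_mono) auto
      then have "\<beta> * x \<le> \<beta> * x powr p" using be elim by (intro mult_left_mono) auto
      moreover have "0 \<le> \<beta> * x" using be elim by simp
      moreover have "Q x - k * m * x powr m = \<beta> * x - (Z (\<sigma> x) - q * x powr m)"
        unfolding Q_def P_def A_def using sg by (simp add: algebra_simps)
      moreover have "\<bar>Z (\<sigma> x) - q * x powr m\<bar> \<le> C * x powr p" using elim sg by simp
      ultimately show ?case unfolding distrib_right by linarith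
    qed
  next
    have "filterlim \<sigma> (at_left S) (at_right 0)"
      unfolding filterlim_at
    proof
      show "eventually (\<lambda>x. \<sigma> x \<in> {..<S} \<and> \<sigma> x \<noteq> S) (at_right 0)"
        using eventually_at_right_less[of "0::real"] by eventually_elim (use sig in force)
      show "(\<sigma> \<longlongrightarrow> S) (at_right 0)"
      proof (rule order_tendstoI)
        fix a assume a: "S < a"
        show "eventually (\<lambda>x. \<sigma> x < a) (at_right 0)"
          using eventually_at_right_less[of "0::real"] by eventually_elim (use sig a in force)
      next
        fix a assume a: "a < S"
        have "a < \<sigma> x" if "0 < x" "x < h a" for x
        proof (rule ccontr)
          assume "\<not> a < \<sigma> x"
          then have "h a \<le> h (\<sigma> x)" using hdec[of "\<sigma> x" a] a by (cases "\<sigma> x = a") auto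
          then show False using sig[OF that(1)] that by simp
        qed
        then show "eventually (\<lambda>x. a < \<sigma> x) (at_right 0)"
          using hpos[OF a] by (auto simp: eventually_at_right intro!: exI[of _ "h a"])
      qed
    qed
    from filterlim_compose[OF compact_orbit_ratio[OF co be] this]
    have "((\<lambda>x. P \<beta> h Z (\<sigma> x) / h (\<sigma> x)) \<longlongrightarrow> \<beta>) (at_right 0)" .
    moreover have "eventually (\<lambda>x. P \<beta> h Z (\<sigma> x) / h (\<sigma> x) = Q x / x) (at_right 0)"
      using eventually_at_right_less[of "0::real"] by eventually_elim (simp add: Q_def sig)
    ultimately show "((\<lambda>x. Q x / x) \<longlongrightarrow> \<beta>) (at_right 0)" by (simp add: tendsto_cong)
  qed
qed

lemma powr_quotient_tendsto:
  assumes "eventually (\<lambda>x. \<bar>Q x - k * m * x powr m\<bar> \<le> C * x powr p) at_top"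
  shows "((\<lambda>x. Q x / x powr m) \<longlongrightarrow> k * m) at_top"
proof -
  have "((\<lambda>x. Q x / x powr m - k * m) \<longlongrightarrow> 0) at_top"
  proof (rule Lim_null_comparison)
    show "eventually (\<lambda>x. norm (Q x / x powr m - k * m) \<le> C * x powr (p - m)) at_top"
      using assms eventually_gt_at_top[of 0]
    proof eventually_elim
      case (elim x)
      have "Q x / x powr m - k * m = (Q x - k * m * x powr m) / x powr m"
        using elim by (simp add: diff_divide_distrib)
      then show ?case using elim by (simp add: powr_diff abs_divide divide_right_mono)
    qed
    have "((\<lambda>x. C * x powr (p - m)) \<longlongrightarrow> C * 0) at_top"
      using p_less_m by (intro tendsto_mult powr_tendsto_0_at_top) auto
    then show "((\<lambda>x. C * x powr (p - m)) \<longlongrightarrow> 0) at_top" by simp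
  qed
  then show ?thesis by (simp add: LIM_zero_iff)
qed

text \<open>The difference \<open>D = Q2 - Q1\<close> satisfies
  \<open>D' = (\<beta>2 - \<beta>1) + c * D\<close> with \<open>0 < c\<close>, and it starts
  positive because \<open>Q x / x \<longlongrightarrow> \<beta>\<close> at \<open>0\<close>. As
  \<open>x * c x\<close> tends to \<open>m * B / (k * m)^2 = q / k\<close>, \<open>D\<close> grows
  at least like \<open>x powr \<kappa>\<close> for \<open>\<kappa> < q / k\<close>, while regularity
  at the origin bounds it by a multiple of \<open>x powr p\<close>.\<close>

lemma compact_orbit_unique_aux:
  assumes c1: "compact_orbit \<beta>1 S1 h1 Z1" and c2: "compact_orbit \<beta>2 S2 h2 Z2"
    and "0 \<le> \<beta>1" "\<beta>1 < \<beta>2"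
  shows False
proof -
  have b2: "0 \<le> \<beta>2" using assms by simp
  obtain Q1 where phase1: "phase_curve \<beta>1 Q1" using compact_orbit_phase[OF c1 assms(3)] by blast
  then obtain C1 where C1: "eventually (\<lambda>x. \<bar>Q1 x - k * m * x powr m\<bar> \<le> C1 * x powr p) at_top"
    unfolding phase_curve_def by blast
  note Q1 = phase1[unfolded phase_curve_def, THEN conjunct1, rule_format, THEN conjunct1]
    phase1[unfolded phase_curve_def, THEN conjunct1, rule_format, THEN conjunct2] C1
    phase1[unfolded phase_curve_def, THEN conjunct2, THEN conjunct2]
  obtain Q2 where phase2: "phase_curve \<beta>2 Q2" using compact_orbit_phase[OF c2 b2] by blast
  then obtain C2 where C2: "eventually (\<lambda>x. \<bar>Q2 x - k * m * x powr m\<bar> \<le> C2 * x powr p) at_top"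
    unfolding phase_curve_def by blast
  note Q2 = phase2[unfolded phase_curve_def, THEN conjunct1, rule_format, THEN conjunct1]
    phase2[unfolded phase_curve_def, THEN conjunct1, rule_format, THEN conjunct2] C2
    phase2[unfolded phase_curve_def, THEN conjunct2, THEN conjunct2]
  define D where "D x = Q2 x - Q1 x" for x
  define G where "G x = m * x powr (m - 1) * (B * x powr m + x powr p)" for x
  define c where "c x = G x / (Q1 x * Q2 x)" for x
  have Gpos: "0 < G x" if "0 < x" for x
    unfolding G_def using that m_pos B_pos by (simp add: add_pos_pos)
  have cpos: "0 < c x" if "0 < x" for x unfolding c_def using Gpos Q1(1) Q2(1) that by simp
  have dD: "(D has_real_derivative (\<beta>2 - \<beta>1) + c x * D x) (at x)" if x: "0 < x" for x
    unfolding D_def[abs_def]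
    by (rule DERIV_cong[OF DERIV_diff[OF Q2(2)[OF x] Q1(2)[OF x]]])
       (use Q1(1)[OF x] Q2(1)[OF x] in \<open>simp only: G_def[symmetric] c_def D_def, simp add: field_simps\<close>)
  have "((\<lambda>x. Q2 x / x - Q1 x / x) \<longlongrightarrow> \<beta>2 - \<beta>1) (at_right 0)"
    by (intro tendsto_diff Q1 Q2)
  then have "eventually (\<lambda>x. 0 < Q2 x / x - Q1 x / x \<and> 0 < x) (at_right 0)"
    using assms(4) by (intro eventually_conj order_tendstoD(1) eventually_at_right_less) auto
  then obtain x0 where x0: "0 < x0" "0 < Q2 x0 / x0 - Q1 x0 / x0"
    using eventually_happens'[OF trivial_limit_at_right_real] by blast
  have Dx0: "0 < D x0" using x0 unfolding D_def by (simp add: divide_less_cancel)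
  have Dpos: "0 < D x" if "x0 \<le> x" for x
    by (rule positive_barrier[OF that, of D "\<lambda>x. (\<beta>2 - \<beta>1) + c x * D x", OF Dx0])
       (use dD x0 assms(4) in auto)
  \<comment> \<open>This gap of exponents closes the argument; it is
    \<open>0 < N + \<sigma>2\<close> rewritten.\<close>
  have "p < q / k" using q_minus_pk N_\<sigma>2 k_pos by (simp add: field_simps)
  then obtain \<kappa> where ka: "p < \<kappa>" "\<kappa> < q / k" using dense by blast
  have "((\<lambda>x. m * (B + x powr (p - m)) / ((Q1 x / x powr m) * (Q2 x / x powr m))) \<longlongrightarrow>
      m * (B + 0) / ((k * m) * (k * m))) at_top"
    using k_pos m_pos p_less_m
    by (intro tendsto_intros powr_quotient_tendsto[OF Q1(3)] powr_quotient_tendsto[OF Q2(3)] powr_tendsto_0_at_top) auto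
  moreover have "m * (B + 0) / ((k * m) * (k * m)) = q / k"
    unfolding B_def using k_pos m_pos by (simp add: field_simps)
  ultimately have "eventually (\<lambda>x. \<kappa> < m * (B + x powr (p - m)) / ((Q1 x / x powr m) * (Q2 x / x powr m))) at_top"
    using ka(2) by (simp only: order_tendstoD(1))
  then have "eventually (\<lambda>x. \<kappa> / x < c x) at_top"
    using eventually_gt_at_top[of 0]
  proof eventually_elim
    case (elim x)
    have "x powr (p - m) = x powr p / x powr m" "x powr (m - 1) = x powr m / x"
      using elim by (simp_all add: powr_diff)
    moreover have "m * (B + Y / X) / ((u / X) * (v / X)) = m * (X / x) * (B * X + Y) / (u * v) * x"
      if "0 < X" "0 < x" "0 < u" "0 < v" for X Y u v x :: real
      using that by (simp add: field_simps)
    ultimately have "m * (B + x powr (p - m)) / ((Q1 x / x powr m) * (Q2 x / x powr m)) = c x * x"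
      unfolding c_def G_def using elim Q1(1)[OF elim(2)] Q2(1)[OF elim(2)] by simp
    then show ?case using elim by (simp add: pos_divide_less_eq)
  qed
  then obtain x1 where x1: "\<And>x. x1 \<le> x \<Longrightarrow> \<kappa> / x < c x" by (auto simp: eventually_at_top_linorder)
  define y where "y = max x0 x1"
  have y: "0 < y" "x0 \<le> y" "x1 \<le> y" unfolding y_def using x0 by auto
  define \<eta> where "\<eta> = D y * y powr (- \<kappa>)"
  have eta: "0 < \<eta>" unfolding \<eta>_def using Dpos[OF y(2)] y by simp
  have low: "\<eta> \<le> D x * x powr (- \<kappa>)" if x: "y \<le> x" for x
    unfolding \<eta>_def
  proof (rule DERIV_nonneg_imp_nondecreasing[OF x])
    fix z assume z: "y \<le> z" "z \<le> x"
    then have zp: "0 < z" "0 < D z" "\<kappa> / z < c z" using y x1 Dpos by auto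
    have "((\<lambda>x. D x * x powr (- \<kappa>)) has_real_derivative
        ((\<beta>2 - \<beta>1) + c z * D z) * z powr (- \<kappa>) + (- \<kappa> * z powr (- \<kappa> - 1)) * D z) (at z)"
      by (rule DERIV_mult[OF dD[OF zp(1)] has_real_derivative_powr[OF zp(1)]])
    moreover have "((\<beta>2 - \<beta>1) + c z * D z) * z powr (- \<kappa>) + (- \<kappa> * z powr (- \<kappa> - 1)) * D z
        = ((\<beta>2 - \<beta>1) + (c z - \<kappa> / z) * D z) * z powr (- \<kappa>)"
    proof -
      have "z powr (- \<kappa> - 1) = z powr (- \<kappa>) / z" using zp by (subst powr_diff) simp
      then show ?thesis by (simp add: algebra_simps)
    qed
    moreover have "0 \<le> ((\<beta>2 - \<beta>1) + (c z - \<kappa> / z) * D z) * z powr (- \<kappa>)"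
      using zp assms(4) by (intro mult_nonneg_nonneg add_nonneg_nonneg) auto
    ultimately show "\<exists>w. ((\<lambda>x. D x * x powr (- \<kappa>)) has_real_derivative w) (at z) \<and> 0 \<le> w" by metis
  qed
  have "((\<lambda>x. (C1 + C2) * x powr (p - \<kappa>)) \<longlongrightarrow> (C1 + C2) * 0) at_top"
    using ka by (intro tendsto_mult powr_tendsto_0_at_top) auto
  from order_tendstoD(2)[OF this, of \<eta>] eta
  have "eventually (\<lambda>x. (C1 + C2) * x powr (p - \<kappa>) < \<eta>) at_top" by simp
  with Q1(3) Q2(3) eventually_ge_at_top[of y]
  have "eventually (\<lambda>x::real. False) at_top"
  proof eventually_elim
    case (elim x)
    then have "D x \<le> (C1 + C2) * x powr p" unfolding D_def by (simp add: algebra_simps abs_le_iff)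
    then have "D x * x powr (- \<kappa>) \<le> (C1 + C2) * x powr p * x powr (- \<kappa>)" by (intro mult_right_mono) auto
    also have "\<dots> = (C1 + C2) * x powr (p - \<kappa>)" using elim y by (simp add: powr_diff powr_minus divide_simps)
    finally show ?case using low[OF elim(3)] elim by linarith
  qed
  then show False by simp
qed

lemma compact_orbit_unique:
  assumes "compact_orbit \<beta>1 S1 h1 Z1" "compact_orbit \<beta>2 S2 h2 Z2" "0 \<le> \<beta>1" "0 \<le> \<beta>2"
  shows "\<beta>1 = \<beta>2"
  using compact_orbit_unique_aux[OF assms(1,2)] compact_orbit_unique_aux[OF assms(2,1)] assms(3,4)
  by (cases \<beta>1 \<beta>2 rule: linorder_cases) auto


section \<open>Maximal positive profiles\<close>

text \<open>The copy \<open>f'\<close> is continuous and nonnegative on the whole half line, as the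
  calculus of \<open>prim\<close> and \<open>flux\<close> demands, while \<open>f\<close> itself may
  be meaningless beyond \<open>r'\<close>. The strict inequality \<open>r < r'\<close> leaves room
  for two-sided derivatives at \<open>r\<close>.\<close>

definition local_profile where
  "local_profile \<beta> c f r \<longleftrightarrow> (\<exists>f' r'. r < r' \<and> continuous_on {0..} f' \<and> (\<forall>x\<ge>0. 0 \<le> f' x) \<and>
    (\<forall>x. 0 \<le> x \<and> x \<le> r' \<longrightarrow> f x = f' x \<and> 0 < f x \<and> f x powr m = c + prim \<beta> f x))"

definition log_h where
  "log_h f s = exp (- k * s) * f (exp s)"

definition log_Z where
  "log_Z \<beta> f s = exp (- (k * m) * s) * (flux \<beta> f (exp s) + q * f (exp s) powr m)"

lemma exp_powr_shift:
  "exp (- (k * m) * s) * exp s powr (\<sigma>1 + 2) = exp (- k * s)"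
  "exp (- (k * m) * s) * exp s powr (\<sigma>2 + 2) = exp (- (p * k) * s)"
  unfolding exp_powr_real exp_add[symmetric] \<sigma>2_plus_2 using km_eq by (simp_all add: algebra_simps)

lemma log_h_powr:
  assumes "0 \<le> f (exp s)"
  shows "log_h f s powr a = exp (- (k * a) * s) * f (exp s) powr a"
  unfolding log_h_def using assms by (simp add: powr_mult exp_powr_real mult_ac)

text \<open>What \<open>prim\<close> shows to be differentiable is \<open>f powr m\<close>, not
  \<open>f\<close>. So \<open>v = h powr m\<close> is differentiated first, and \<open>h\<close> is
  recovered as its root where it is positive.\<close>

lemma local_profile_derivatives:
  assumes "local_profile \<beta> c f (exp s)"
  shows "0 < log_h f s"
    "(log_h f has_real_derivative (log_Z \<beta> f s - \<beta> * log_h f s - A * log_h f s powr m) / (m * log_h f s powr (m - 1))) (at s)"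
    "(log_Z \<beta> f has_real_derivative - B * log_h f s powr m - log_h f s powr p) (at s)"
proof -
  define r where "r = exp s"
  have r0: "0 < r" unfolding r_def by simp
  obtain f' r' where lp: "r < r' \<and> continuous_on {0..} f' \<and> (\<forall>x\<ge>0. 0 \<le> f' x) \<and>
    (\<forall>x. 0 \<le> x \<and> x \<le> r' \<longrightarrow> f x = f' x \<and> 0 < f x \<and> f x powr m = c + prim \<beta> f x)"
    using assms unfolding local_profile_def r_def[symmetric] by (elim exE) (rule that)
  then have f': "r < r'" "continuous_on {0..} f'" "\<And>x. 0 \<le> x \<Longrightarrow> 0 \<le> f' x"
    and eq: "\<And>x. 0 \<le> x \<Longrightarrow> x \<le> r' \<Longrightarrow> f x = f' x \<and> 0 < f x \<and> f x powr m = c + prim \<beta> f x"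
    by blast+
  have fr: "0 < f r" using eq[OF less_imp_le[OF r0] less_imp_le[OF f'(1)]] by (elim conjE)
  have op: "open {0<..<r'}" "r \<in> {0<..<r'}" using r0 f' by auto
  have fl: "flux \<beta> f x = flux \<beta> f' x" "prim \<beta> f x = prim \<beta> f' x" if "0 \<le> x" "x \<le> r'" for x
  proof -
    have "f y = f' y" if "0 \<le> y" "y \<le> x" for y
      using eq[OF that(1) order_trans[OF that(2) \<open>x \<le> r'\<close>]] by (rule conjunct1)
    note e = this
    show "flux \<beta> f x = flux \<beta> f' x" by (rule flux_cong[OF \<open>0 \<le> x\<close> e])
    show "prim \<beta> f x = prim \<beta> f' x" by (rule prim_cong[OF \<open>0 \<le> x\<close> e])
  qed
  note feq = eq[THEN conjunct1] and fpos = eq[THEN conjunct2, THEN conjunct1] and fpr = eq[THEN conjunct2, THEN conjunct2]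
  have rr: "0 \<le> r" "r \<le> r'" using r0 f'(1) by simp_all
  have "((\<lambda>x. c + prim \<beta> f' x) has_real_derivative 0 + (flux \<beta> f' r - \<beta> * r powr (\<sigma>1 + 2) * f' r) / r) (at r)"
    using f' r0 by (intro DERIV_add DERIV_const has_real_derivative_prim)
  then have dw0: "((\<lambda>x. c + prim \<beta> f' x) has_real_derivative (flux \<beta> f r - \<beta> * r powr (\<sigma>1 + 2) * f r) / r) (at r)"
    by (simp only: fl(1)[OF rr] feq[OF rr] add_0)
  have dw: "((\<lambda>x. f x powr m) has_real_derivative (flux \<beta> f r - \<beta> * r powr (\<sigma>1 + 2) * f r) / r) (at r)"
  proof (rule has_field_derivative_transform_within_open[OF dw0 op])
    fix x assume "x \<in> {0<..<r'}"
    then have x: "0 \<le> x" "x \<le> r'" by simp_all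
    show "c + prim \<beta> f' x = f x powr m" by (simp only: fpr[OF x] fl(2)[OF x])
  qed
  have "(flux \<beta> f' has_real_derivative
    ((2 - N) * flux \<beta> f' r + \<beta> * q * r powr (\<sigma>1 + 2) * f' r - r powr (\<sigma>2 + 2) * f' r powr p) / r) (at r)"
    by (rule has_real_derivative_flux[OF f'(2,3) r0])
  then have dfl0: "(flux \<beta> f' has_real_derivative
    ((2 - N) * flux \<beta> f r + \<beta> * q * r powr (\<sigma>1 + 2) * f r - r powr (\<sigma>2 + 2) * f r powr p) / r) (at r)"
    by (simp only: fl(1)[OF rr] feq[OF rr])
  have dfl: "(flux \<beta> f has_real_derivative
    ((2 - N) * flux \<beta> f r + \<beta> * q * r powr (\<sigma>1 + 2) * f r - r powr (\<sigma>2 + 2) * f r powr p) / r) (at r)"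
    by (rule has_field_derivative_transform_within_open[OF dfl0 op]) (simp add: fl(1))
  have dexp: "(exp has_real_derivative r) (at s)" unfolding r_def by (rule DERIV_exp)
  have dE: "((\<lambda>s. exp (- (k * m) * s)) has_real_derivative - (k * m) * exp (- (k * m) * s)) (at s)"
    by (auto intro!: derivative_eq_intros)
  define E where "E = exp (- (k * m) * s)"
  define v where "v = (\<lambda>s. exp (- (k * m) * s) * f (exp s) powr m)"
  define v' where "v' = - (k * m) * v s + E * (flux \<beta> f r - \<beta> * r powr (\<sigma>1 + 2) * f r)"
  have dv: "(v has_real_derivative v') (at s)"
    unfolding v_def
    by (rule DERIV_cong[OF DERIV_mult[OF dE DERIV_chain2[OF dw[unfolded r_def] dexp]]])
       (use r0 in \<open>simp add: v'_def v_def E_def r_def[symmetric] mult_ac\<close>)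
  show hpos: "0 < log_h f s" unfolding log_h_def using fr by (simp add: r_def)
  have vpos: "0 < v s" unfolding v_def using fr by (simp add: r_def)
  have vh: "v x = log_h f x powr m" if "0 \<le> f (exp x)" for x
    unfolding v_def log_h_powr[of f x m, OF that] by simp
  have hm: "v s = log_h f s powr m" using vh[of s] fr by (simp add: r_def)
  have E1: "E * r powr (\<sigma>1 + 2) * f r = log_h f s"
    unfolding E_def r_def exp_powr_shift log_h_def ..
  have E2: "E * r powr (\<sigma>2 + 2) * f r powr p = log_h f s powr p"
    unfolding E_def r_def exp_powr_shift using log_h_powr[of f s p] fr by (simp add: r_def mult_ac)
  have Zs: "log_Z \<beta> f x = exp (- (k * m) * x) * flux \<beta> f (exp x) + q * v x" for x
    unfolding log_Z_def v_def by (simp add: algebra_simps)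
  have v'_eq: "v' = log_Z \<beta> f s - \<beta> * log_h f s - A * log_h f s powr m"
  proof -
    have "v' = - (k * m) * v s + E * flux \<beta> f r - \<beta> * (E * r powr (\<sigma>1 + 2) * f r)"
      unfolding v'_def by (simp add: algebra_simps)
    then show ?thesis
      unfolding E1 unfolding Zs A_def hm[symmetric] E_def r_def by (simp add: algebra_simps)
  qed
  have d1m: "((\<lambda>x. v x powr (1 / m)) has_real_derivative (1 / m * v s powr (1 / m - 1)) * v') (at s)"
    by (rule DERIV_chain2[OF has_real_derivative_powr[OF vpos] dv])
  have c1m: "1 / m * v s powr (1 / m - 1) = 1 / (m * log_h f s powr (m - 1))"
  proof -
    have "v s powr (1 / m - 1) = log_h f s powr (- (m - 1))"
    proof -
      have "m * (1 / m - 1) = - (m - 1)" using m_pos by (simp add: right_diff_distrib)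
      then show ?thesis unfolding hm powr_powr by simp
    qed
    then show ?thesis unfolding powr_minus by (simp only: divide_inverse inverse_mult_distrib mult_1)
  qed
  have d1: "((\<lambda>x. v x powr (1 / m)) has_real_derivative v' / (m * log_h f s powr (m - 1))) (at s)"
    by (rule DERIV_cong[OF d1m]) (subst c1m, simp)
  have root: "v x powr (1 / m) = log_h f x" if "x \<in> {..<ln r'}" for x
  proof -
    have "exp x < r'" using that r0 f'(1) by (metis exp_less_mono exp_ln lessThan_iff less_trans)
    then have "0 < f (exp x)" using eq[of "exp x"] by simp
    then show ?thesis using vh[of x] m_pos by (simp add: powr_powr log_h_def)
  qed
  have sin: "s \<in> {..<ln r'}"
    using ln_less_cancel_iff[OF r0 less_trans[OF r0 f'(1)]] f'(1) unfolding r_def by simp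
  show "(log_h f has_real_derivative (log_Z \<beta> f s - \<beta> * log_h f s - A * log_h f s powr m) / (m * log_h f s powr (m - 1))) (at s)"
    using has_field_derivative_transform_within_open[OF d1 open_lessThan sin root] unfolding v'_eq .
  have "(log_Z \<beta> f has_real_derivative
      - (k * m) * E * flux \<beta> f r +
      ((2 - N) * flux \<beta> f r + \<beta> * q * r powr (\<sigma>1 + 2) * f r - r powr (\<sigma>2 + 2) * f r powr p) / r * r * E + q * v') (at s)"
    unfolding Zs[abs_def]
    by (rule DERIV_cong[OF DERIV_add[OF DERIV_mult[OF dE DERIV_chain2[OF dfl[unfolded r_def] dexp]] DERIV_cmult[OF dv]]])
       (simp add: E_def r_def mult_ac)
  \<comment> \<open>The coefficient of the flux is \<open>2 - N + q - k * m\<close>, which is zero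
    by \<open>q_eq\<close>; this is the purpose of adding \<open>q * f powr m\<close> to the flux in
    \<open>log_Z\<close>.\<close>
  moreover have "- (k * m) * E * flux \<beta> f r +
      ((2 - N) * flux \<beta> f r + \<beta> * q * r powr (\<sigma>1 + 2) * f r - r powr (\<sigma>2 + 2) * f r powr p) / r * r * E + q * v'
      = (2 - N + q - k * m) * (E * flux \<beta> f r) - (k * m * q) * v s - E * r powr (\<sigma>2 + 2) * f r powr p"
  proof -
    have "X / r * r = X" for X using r0 by simp
    then show ?thesis unfolding v'_def by (simp only:) (simp add: algebra_simps)
  qed
  ultimately show "(log_Z \<beta> f has_real_derivative - B * log_h f s powr m - log_h f s powr p) (at s)"
    unfolding E2 hm B_def q_eq by simp
qed

text \<open>After division by \<open>h powr p\<close> the remainder is a combination of defects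
  \<open>pmean a g - g / a\<close> at \<open>exp s\<close>, and these vanish in the limit because
  the means are continuous at the origin.\<close>

lemma local_profile_asymptotics:
  assumes "local_profile \<beta> c f 0"
  shows "filterlim (log_h f) at_top at_bot"
    "((\<lambda>s. (log_Z \<beta> f s - q * log_h f s powr m - \<beta> * q / (N + \<sigma>1) * log_h f s + log_h f s powr p / (N + \<sigma>2)) / log_h f s powr p)
      \<longlongrightarrow> 0) at_bot"
proof -
  obtain f' r' where lp: "0 < r' \<and> continuous_on {0..} f' \<and> (\<forall>x\<ge>0. 0 \<le> f' x) \<and>
    (\<forall>x. 0 \<le> x \<and> x \<le> r' \<longrightarrow> f x = f' x \<and> 0 < f x \<and> f x powr m = c + prim \<beta> f x)"
    using assms unfolding local_profile_def by (elim exE) (rule that)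
  then have f': "0 < r'" "continuous_on {0..} f'" "\<And>x. 0 \<le> x \<Longrightarrow> 0 \<le> f' x"
    and eq: "\<And>x. 0 \<le> x \<Longrightarrow> x \<le> r' \<Longrightarrow> f x = f' x \<and> 0 < f x"
    by blast+
  have ev: "eventually (\<lambda>s. s \<le> 0 \<and> exp s \<le> r') at_bot"
  proof -
    have "exp s \<le> r'" if "s \<le> ln r'" for s using that f'(1) by (metis exp_le_cancel_iff exp_ln)
    then show ?thesis unfolding eventually_at_bot_linorder by (intro exI[of _ "min 0 (ln r')"]) auto
  qed
  have lim0: "((\<lambda>s. g (exp s)) \<longlongrightarrow> g 0) at_bot" if "continuous_on {0..} g" for g :: "real \<Rightarrow> real"
  proof -
    have "(g \<longlongrightarrow> g 0) (at 0 within {0..})" using that unfolding continuous_on_def by (rule bspec) simp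
    moreover have "filterlim (exp :: real \<Rightarrow> real) (at 0 within {0..}) at_bot"
      unfolding filterlim_at using exp_at_bot by (auto simp: less_imp_le)
    ultimately show ?thesis by (rule filterlim_compose)
  qed
  have f0: "0 < f' 0" using eq[of 0] f'(1) by simp
  have fp: "continuous_on {0..} (\<lambda>x. f' x powr p)" by (rule continuous_on_powr_p) (use f' in auto)
  have l1: "((\<lambda>s. f' (exp s)) \<longlongrightarrow> f' 0) at_bot" by (rule lim0[OF f'(2)])
  have l2: "((\<lambda>s. pmean (N + \<sigma>1) f' (exp s)) \<longlongrightarrow> f' 0 / (N + \<sigma>1)) at_bot"
    using lim0[OF continuous_on_pmean[OF N_\<sigma>1 f'(2)]] N_\<sigma>1 by (simp add: pmean_zero)
  have l3: "((\<lambda>s. pmean (N + \<sigma>2) (\<lambda>x. f' x powr p) (exp s)) \<longlongrightarrow> f' 0 powr p / (N + \<sigma>2)) at_bot"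
    using lim0[OF continuous_on_pmean[OF N_\<sigma>2 fp]] N_\<sigma>2 by (simp add: pmean_zero)
  have "filterlim (\<lambda>s. exp (- k * s) * f' (exp s)) at_top at_bot"
  proof (rule filterlim_at_top_mult_tendsto_pos[OF l1 f0])
    have "filterlim (\<lambda>s. (- k) * s) at_top at_bot"
      unfolding filterlim_at_top
    proof
      fix C
      have "C \<le> - k * s" if "s \<le> - C / k" for s using that k_pos by (simp add: field_simps)
      then show "eventually (\<lambda>s. C \<le> - k * s) at_bot" unfolding eventually_at_bot_linorder by blast
    qed
    then show "filterlim (\<lambda>s. exp (- k * s)) at_top at_bot" by (rule filterlim_compose[OF exp_at_top])
  qed
  then have "filterlim (\<lambda>s. f' (exp s) * exp (- k * s)) at_top at_bot" by (simp add: mult.commute)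
  then show "filterlim (log_h f) at_top at_bot"
    unfolding log_h_def[abs_def]
    by (rule filterlim_mono_eventually[OF _ order_refl order_refl])
       (use ev in \<open>auto elim!: eventually_mono simp: eq[THEN conjunct1] mult.commute\<close>)
  let ?e = "\<lambda>s. \<beta> * q * (exp ((p - 1) * k * s) * (pmean (N + \<sigma>1) f' (exp s) - f' (exp s) / (N + \<sigma>1))) / f' (exp s) powr p
     - (pmean (N + \<sigma>2) (\<lambda>x. f' x powr p) (exp s) - f' (exp s) powr p / (N + \<sigma>2)) / f' (exp s) powr p"
  \<comment> \<open>For \<open>s \<le> 0\<close> the exponential is at most \<open>1\<close>. It
    tends to zero only if \<open>1 < p\<close>, so the smallness is taken from the other
    factor.\<close>
  have z: "((\<lambda>s. exp ((p - 1) * k * s) * (pmean (N + \<sigma>1) f' (exp s) - f' (exp s) / (N + \<sigma>1))) \<longlongrightarrow> 0) at_bot"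
  proof (rule Lim_null_comparison)
    show "eventually (\<lambda>s. norm (exp ((p - 1) * k * s) * (pmean (N + \<sigma>1) f' (exp s) - f' (exp s) / (N + \<sigma>1)))
        \<le> \<bar>pmean (N + \<sigma>1) f' (exp s) - f' (exp s) / (N + \<sigma>1)\<bar>) at_bot"
      using ev
    proof eventually_elim
      case (elim s)
      then have "(p - 1) * k * s \<le> 0" using p_ge_1 k_pos by (simp add: mult_nonneg_nonpos)
      then show ?case
        using mult_right_mono[of "exp ((p - 1) * k * s)" 1 "\<bar>pmean (N + \<sigma>1) f' (exp s) - f' (exp s) / (N + \<sigma>1)\<bar>"]
        by (simp add: abs_mult)
    qed
    have "((\<lambda>s. \<bar>pmean (N + \<sigma>1) f' (exp s) - f' (exp s) / (N + \<sigma>1)\<bar>) \<longlongrightarrow> \<bar>f' 0 / (N + \<sigma>1) - f' 0 / (N + \<sigma>1)\<bar>) at_bot"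
      using N_\<sigma>1 by (intro tendsto_intros l1 l2) auto
    then show "((\<lambda>s. \<bar>pmean (N + \<sigma>1) f' (exp s) - f' (exp s) / (N + \<sigma>1)\<bar>) \<longlongrightarrow> 0) at_bot" by simp
  qed
  have "(?e \<longlongrightarrow> \<beta> * q * 0 / f' 0 powr p - (f' 0 powr p / (N + \<sigma>2) - f' 0 powr p / (N + \<sigma>2)) / f' 0 powr p) at_bot"
    using N_\<sigma>2 f0 by (intro tendsto_intros l1 l3 z) auto
  then have e0: "(?e \<longlongrightarrow> 0) at_bot" by simp
  have "eventually (\<lambda>s. (log_Z \<beta> f s - q * log_h f s powr m - \<beta> * q / (N + \<sigma>1) * log_h f s + log_h f s powr p / (N + \<sigma>2)) / log_h f s powr p = ?e s) at_bot"
    using ev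
  proof eventually_elim
    case (elim s)
    have fe: "f (exp s) = f' (exp s)" "0 < f' (exp s)" using eq[of "exp s"] elim by auto
    have "flux \<beta> f (exp s) = flux \<beta> f' (exp s)"
      by (rule flux_cong) (use elim eq[THEN conjunct1] in auto)
    then have "log_Z \<beta> f s - q * log_h f s powr m = exp (- (k * m) * s) * flux \<beta> f' (exp s)"
      unfolding log_Z_def using log_h_powr[of f s m] fe by (simp add: algebra_simps)
    also have "\<dots> = \<beta> * q * (exp (- (k * m) * s) * exp s powr (\<sigma>1 + 2)) * pmean (N + \<sigma>1) f' (exp s)
        - (exp (- (k * m) * s) * exp s powr (\<sigma>2 + 2)) * pmean (N + \<sigma>2) (\<lambda>x. f' x powr p) (exp s)"
      unfolding flux_def by (simp add: algebra_simps)
    finally have 1: "log_Z \<beta> f s - q * log_h f s powr m = \<beta> * q * exp (- k * s) * pmean (N + \<sigma>1) f' (exp s)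
        - exp (- (p * k) * s) * pmean (N + \<sigma>2) (\<lambda>x. f' x powr p) (exp s)"
      unfolding exp_powr_shift .
    have 2: "log_h f s = exp (- k * s) * f' (exp s)" "log_h f s powr p = exp (- (p * k) * s) * f' (exp s) powr p"
      using log_h_powr[of f s p] fe by (simp_all add: log_h_def mult_ac)
    have 3: "exp (- k * s) = exp (- (p * k) * s) * exp ((p - 1) * k * s)"
      by (simp add: exp_add[symmetric] algebra_simps)
    have "(\<beta> * q * (E * e) * M1 - E * M2 - \<beta> * q / n1 * (E * e * X) + E * Y / n2) / (E * Y)
        = \<beta> * q * (e * (M1 - X / n1)) / Y - (M2 - Y / n2) / Y"
      if "0 < E" "0 < Y" "0 < n1" "0 < n2" for E e M1 M2 X Y n1 n2 :: real
      using that by (simp add: field_simps)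
    then show ?case
      unfolding 1 2(2) unfolding 2(1) 3 using fe N_\<sigma>1 N_\<sigma>2 by simp
  qed
  with e0 show "((\<lambda>s. (log_Z \<beta> f s - q * log_h f s powr m - \<beta> * q / (N + \<sigma>1) * log_h f s + log_h f s powr p / (N + \<sigma>2)) / log_h f s powr p)
      \<longlongrightarrow> 0) at_bot"
    by (simp add: tendsto_cong)
qed

lemma local_profile_orbit:
  assumes "lower_ray I" "local_profile \<beta> c f 0" "\<And>s. s \<in> I \<Longrightarrow> local_profile \<beta> c f (exp s)"
  shows "orbit \<beta> I (log_h f) (log_Z \<beta> f)"
  unfolding orbit_def using assms local_profile_derivatives local_profile_asymptotics[OF assms(2)] by blast


section \<open>The maximal positive solution with \<open>f 0 = 1\<close>, glued from truncated
  solutions\<close>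

definition trunc_sol where
  "trunc_sol \<epsilon> \<beta> = (SOME w. \<forall>R. tsol \<epsilon> 1 \<beta> R w)"

lemma trunc_sol_tsol:
  assumes "0 < \<epsilon>" "0 \<le> \<beta>"
  shows "tsol \<epsilon> 1 \<beta> R (trunc_sol \<epsilon> \<beta>)"
proof -
  obtain w where "\<And>R. tsol \<epsilon> 1 \<beta> R w" using tsol_exists[OF assms] by blast
  then have "\<forall>R. tsol \<epsilon> 1 \<beta> R w" by blast
  then have "\<forall>R. tsol \<epsilon> 1 \<beta> R (trunc_sol \<epsilon> \<beta>)" unfolding trunc_sol_def by (rule someI[where P = "\<lambda>w. \<forall>R. tsol \<epsilon> 1 \<beta> R w"])
  then show ?thesis by blast
qed

lemma trunc_sol_continuous: "0 < \<epsilon> \<Longrightarrow> 0 \<le> \<beta> \<Longrightarrow> continuous_on {0..} (trunc_sol \<epsilon> \<beta>)"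
  using trunc_sol_tsol[of \<epsilon> \<beta> 0] unfolding tsol_def by blast

lemma trunc_sol_eq: "0 < \<epsilon> \<Longrightarrow> 0 \<le> \<beta> \<Longrightarrow> 0 \<le> r \<Longrightarrow> trunc_sol \<epsilon> \<beta> r = 1 + prim \<beta> (\<lambda>x. trunc \<epsilon> (trunc_sol \<epsilon> \<beta> x)) r"
  using trunc_sol_tsol[of \<epsilon> \<beta> r] unfolding tsol_def by blast

text \<open>Above both cutoffs the two truncations coincide, so the solution for
  \<open>\<epsilon>\<close> also solves the equation for \<open>\<epsilon>'\<close> on
  \<open>[0, r]\<close>, and uniqueness applies.\<close>

lemma trunc_sol_agree:
  assumes "0 < \<epsilon>" "0 < \<epsilon>'" "0 \<le> \<beta>"
    and ge: "\<And>x. 0 \<le> x \<Longrightarrow> x \<le> r \<Longrightarrow> \<epsilon> \<le> trunc_sol \<epsilon> \<beta> x \<and> \<epsilon>' \<le> trunc_sol \<epsilon> \<beta> x"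
    and x: "0 \<le> x" "x \<le> r"
  shows "trunc_sol \<epsilon>' \<beta> x = trunc_sol \<epsilon> \<beta> x"
proof (rule tsol_unique[OF assms(2,3) trunc_sol_tsol[OF assms(2,3)] _ x])
  show "tsol \<epsilon>' 1 \<beta> r (trunc_sol \<epsilon> \<beta>)"
    unfolding tsol_def
  proof (intro conjI allI impI trunc_sol_continuous assms)
    fix y assume y: "0 \<le> y \<and> y \<le> r"
    have "prim \<beta> (\<lambda>x. trunc \<epsilon> (trunc_sol \<epsilon> \<beta> x)) y = prim \<beta> (\<lambda>x. trunc \<epsilon>' (trunc_sol \<epsilon> \<beta> x)) y"
    proof (rule prim_cong)
      fix x assume "0 \<le> x" "x \<le> y"
      then have "\<epsilon> \<le> trunc_sol \<epsilon> \<beta> x" "\<epsilon>' \<le> trunc_sol \<epsilon> \<beta> x" using ge[of x] y by auto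
      then show "trunc \<epsilon> (trunc_sol \<epsilon> \<beta> x) = trunc \<epsilon>' (trunc_sol \<epsilon> \<beta> x)" unfolding trunc_def by (simp add: max_def)
    qed (use y in simp)
    then show "trunc_sol \<epsilon> \<beta> y = 1 + prim \<beta> (\<lambda>x. trunc \<epsilon>' (trunc_sol \<epsilon> \<beta> x)) y"
      using trunc_sol_eq[OF assms(1,3), of y] y by simp
  qed
qed

text \<open>The inequality is strict so that it persists slightly beyond \<open>r\<close>; this
  makes the domain \<open>pos_dom\<close> open at its right end.\<close>

definition good_cutoff where
  "good_cutoff \<beta> r \<epsilon> \<longleftrightarrow> 0 < \<epsilon> \<and> (\<forall>x. 0 \<le> x \<and> x \<le> r \<longrightarrow> \<epsilon> < trunc_sol \<epsilon> \<beta> x)"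

definition pos_dom where
  "pos_dom \<beta> = {r. 0 \<le> r \<and> (\<exists>\<epsilon>. good_cutoff \<beta> r \<epsilon>)}"

text \<open>The chosen cutoff may vary with \<open>r\<close>; by \<open>good_cutoff_agree\<close>
  the value does not depend on the choice.\<close>

definition msol where
  "msol \<beta> r = trunc_sol (SOME \<epsilon>. good_cutoff \<beta> r \<epsilon>) \<beta> r powr (1 / m)"

lemma good_cutoff_down: "good_cutoff \<beta> r \<epsilon> \<Longrightarrow> x \<le> r \<Longrightarrow> good_cutoff \<beta> x \<epsilon>"
  unfolding good_cutoff_def by auto

lemma good_cutoff_agree:
  assumes "0 \<le> \<beta>" "good_cutoff \<beta> r \<epsilon>" "good_cutoff \<beta> r \<epsilon>'" "0 \<le> r"
  shows "trunc_sol \<epsilon> \<beta> r = trunc_sol \<epsilon>' \<beta> r"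
proof -
  have *: "trunc_sol \<epsilon>' \<beta> r = trunc_sol \<epsilon> \<beta> r" if "\<epsilon>' \<le> \<epsilon>" "good_cutoff \<beta> r \<epsilon>" "0 < \<epsilon>'" for \<epsilon> \<epsilon>'
    by (rule trunc_sol_agree[of _ _ _ r]) (use that assms in \<open>force simp: good_cutoff_def\<close>)+
  show ?thesis
    using *[of "min \<epsilon> \<epsilon>'" \<epsilon>] *[of "min \<epsilon> \<epsilon>'" \<epsilon>'] assms by (simp add: good_cutoff_def)
qed

lemma msol_eq:
  assumes "0 \<le> \<beta>" "good_cutoff \<beta> r \<epsilon>" "0 \<le> r"
  shows "msol \<beta> r = trunc \<epsilon> (trunc_sol \<epsilon> \<beta> r)" "msol \<beta> r powr m = trunc_sol \<epsilon> \<beta> r" "0 < msol \<beta> r"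
proof -
  have "good_cutoff \<beta> r (SOME \<epsilon>. good_cutoff \<beta> r \<epsilon>)" using assms(2) by (rule someI)
  from good_cutoff_agree[OF assms(1,2) this assms(3)]
  have e: "msol \<beta> r = trunc_sol \<epsilon> \<beta> r powr (1 / m)" unfolding msol_def by simp
  have trunc_sol: "0 < \<epsilon>" "\<epsilon> < trunc_sol \<epsilon> \<beta> r" using assms(2,3) unfolding good_cutoff_def by auto
  show "msol \<beta> r = trunc \<epsilon> (trunc_sol \<epsilon> \<beta> r)" unfolding e trunc_def using trunc_sol by simp
  show "msol \<beta> r powr m = trunc_sol \<epsilon> \<beta> r" unfolding e using trunc_sol m_pos by (simp add: powr_powr)
  show "0 < msol \<beta> r" unfolding e using trunc_sol by simp
qed

lemma good_cutoff_extend: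
  assumes "0 \<le> \<beta>" "good_cutoff \<beta> r \<epsilon>" "0 \<le> r"
  obtains r' where "r < r'" "good_cutoff \<beta> r' \<epsilon>"
proof -
  have e: "0 < \<epsilon>" "\<epsilon> < trunc_sol \<epsilon> \<beta> r" using assms unfolding good_cutoff_def by auto
  then have "0 < trunc_sol \<epsilon> \<beta> r - \<epsilon>" by simp
  then obtain d where d: "d > 0" "\<And>x. x \<ge> 0 \<Longrightarrow> dist x r < d \<Longrightarrow> dist (trunc_sol \<epsilon> \<beta> x) (trunc_sol \<epsilon> \<beta> r) < trunc_sol \<epsilon> \<beta> r - \<epsilon>"
    using trunc_sol_continuous[OF e(1) assms(1)] assms(3) unfolding continuous_on_iff by (metis atLeast_iff)
  show ?thesis
  proof (rule that[of "r + d / 2"])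
    show "good_cutoff \<beta> (r + d / 2) \<epsilon>"
      unfolding good_cutoff_def
    proof (intro conjI allI impI e)
      fix x assume x: "0 \<le> x \<and> x \<le> r + d / 2"
      show "\<epsilon> < trunc_sol \<epsilon> \<beta> x"
      proof (cases "x \<le> r")
        case True
        then show ?thesis using assms(2) x unfolding good_cutoff_def by auto
      next
        case False
        then have "dist x r < d" using x d by (simp add: dist_real_def)
        from d(2)[OF _ this] x show ?thesis by (simp add: dist_real_def abs_less_iff)
      qed
    qed
  qed (use d in simp)
qed

lemma dom_0: "0 \<le> \<beta> \<Longrightarrow> 0 \<in> pos_dom \<beta>"
  unfolding pos_dom_def good_cutoff_def using trunc_sol_eq[of "1/2" \<beta> 0] by (auto intro!: exI[of _ "1/2"] simp: prim_0)

lemma dom_down: "r \<in> pos_dom \<beta> \<Longrightarrow> 0 \<le> x \<Longrightarrow> x \<le> r \<Longrightarrow> x \<in> pos_dom \<beta>"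
  unfolding pos_dom_def using good_cutoff_down by blast

lemma msol_local:
  assumes "0 \<le> \<beta>" "r \<in> pos_dom \<beta>"
  shows "local_profile \<beta> 1 (msol \<beta>) r"
proof -
  obtain \<epsilon> where e: "good_cutoff \<beta> r \<epsilon>" and r: "0 \<le> r" using assms(2) unfolding pos_dom_def by blast
  obtain r' where r': "r < r'" "good_cutoff \<beta> r' \<epsilon>" using good_cutoff_extend[OF assms(1) e r] by blast
  have e0: "0 < \<epsilon>" using e unfolding good_cutoff_def by simp
  have m: "msol \<beta> x = trunc \<epsilon> (trunc_sol \<epsilon> \<beta> x)" "msol \<beta> x powr m = trunc_sol \<epsilon> \<beta> x" "0 < msol \<beta> x" if "0 \<le> x" "x \<le> r'" for x
    using msol_eq[OF assms(1) good_cutoff_down[OF r'(2) that(2)] that(1)] by auto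
  show ?thesis
    unfolding local_profile_def
  proof (intro exI[of _ "\<lambda>x. trunc \<epsilon> (trunc_sol \<epsilon> \<beta> x)"] exI[of _ r'] conjI allI impI)
    show "continuous_on {0..} (\<lambda>x. trunc \<epsilon> (trunc_sol \<epsilon> \<beta> x))"
      by (rule continuous_on_trunc[OF e0 trunc_sol_continuous[OF e0 assms(1)]])
    fix x assume x: "0 \<le> x \<and> x \<le> r'"
    then show "msol \<beta> x = trunc \<epsilon> (trunc_sol \<epsilon> \<beta> x)" "0 < msol \<beta> x" using m by auto
    have "prim \<beta> (msol \<beta>) x = prim \<beta> (\<lambda>x. trunc \<epsilon> (trunc_sol \<epsilon> \<beta> x)) x"
      by (rule prim_cong) (use x m in auto)
    then show "msol \<beta> x powr m = 1 + prim \<beta> (msol \<beta>) x"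
      using m(2)[of x] x trunc_sol_eq[OF e0 assms(1), of x] by simp
  qed (use r'(1) trunc_pos[OF e0] in \<open>auto intro: less_imp_le\<close>)
qed

definition mdom where "mdom \<beta> = {s. exp s \<in> pos_dom \<beta>}"

abbreviation mh where "mh \<beta> \<equiv> log_h (msol \<beta>)"
abbreviation mZ where "mZ \<beta> \<equiv> log_Z \<beta> (msol \<beta>)"

text \<open>The domain is downward closed and, since good cutoffs extend, has no largest element; if
  it is bounded, it is the open ray below its supremum.\<close>

lemma lower_ray_mdom:
  assumes "0 \<le> \<beta>"
  shows "lower_ray (mdom \<beta>)"
proof (cases "mdom \<beta> = UNIV")
  case True
  then show ?thesis unfolding lower_ray_def by simp
next
  case False
  then obtain t where t: "t \<notin> mdom \<beta>" by blast
  have down: "x \<in> mdom \<beta>" if "s \<in> mdom \<beta>" "x \<le> s" for x s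
    using that dom_down unfolding mdom_def by auto
  have nxt: "\<exists>t>s. t \<in> mdom \<beta>" if s: "s \<in> mdom \<beta>" for s
  proof -
    obtain \<epsilon> where e: "good_cutoff \<beta> (exp s) \<epsilon>" using s unfolding mdom_def pos_dom_def by blast
    obtain r' where r': "exp s < r'" "good_cutoff \<beta> r' \<epsilon>" using good_cutoff_extend[OF assms e] by auto
    have "0 < r'" using r'(1) by (meson exp_gt_zero less_trans)
    then show ?thesis
      using r' ln_less_cancel_iff[of "exp s" r'] unfolding mdom_def pos_dom_def
      by (intro exI[of _ "ln r'"]) auto
  qed
  have ne: "mdom \<beta> \<noteq> {}"
  proof -
    obtain \<epsilon> where e: "good_cutoff \<beta> 0 \<epsilon>" using dom_0[OF assms] unfolding pos_dom_def by blast
    obtain r' where r': "0 < r'" "good_cutoff \<beta> r' \<epsilon>" using good_cutoff_extend[OF assms e] by auto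
    then have "ln r' \<in> mdom \<beta>" unfolding mdom_def pos_dom_def by auto
    then show ?thesis by blast
  qed
  have bdd: "bdd_above (mdom \<beta>)" using down t by (meson bdd_above.I not_le less_imp_le)
  have "mdom \<beta> = {..<Sup (mdom \<beta>)}"
  proof (intro set_eqI iffI)
    fix s assume "s \<in> mdom \<beta>"
    then obtain t where "s < t" "t \<in> mdom \<beta>" using nxt by blast
    then show "s \<in> {..<Sup (mdom \<beta>)}" using cSup_upper[OF _ bdd, of t] by simp
  next
    fix s assume "s \<in> {..<Sup (mdom \<beta>)}"
    then obtain t where "t \<in> mdom \<beta>" "s < t" using less_cSup_iff[OF ne bdd] by auto
    then show "s \<in> mdom \<beta>" using down by simp
  qed
  then show ?thesis unfolding lower_ray_def by blast
qed

lemma msol_orbit: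
  assumes "0 \<le> \<beta>"
  shows "orbit \<beta> (mdom \<beta>) (mh \<beta>) (mZ \<beta>)"
  by (rule local_profile_orbit[OF lower_ray_mdom[OF assms] msol_local[OF assms dom_0[OF assms]]])
     (use msol_local[OF assms] in \<open>simp add: mdom_def\<close>)

text \<open>The usual alternative for maximal solutions. If \<open>h\<close> stayed above some
  \<open>a > 0\<close>, then \<open>msol powr m\<close> would be bounded below up to
  \<open>R = exp S\<close>. The truncated solution for a smaller cutoff is global and continuous, so
  it would still exceed that cutoff at \<open>R\<close>, and \<open>S\<close> would belong to the
  domain.\<close>

lemma mdom_bounded_extinction:
  assumes be: "0 \<le> \<beta>" and S: "mdom \<beta> = {..<S}"
  shows "(mh \<beta> \<longlongrightarrow> 0) (at_left S)"
proof (rule ccontr)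
  assume neg: "\<not> (mh \<beta> \<longlongrightarrow> 0) (at_left S)"
  note orb = msol_orbit[OF be]
  have hpos: "0 < mh \<beta> s" if "s < S" for s using orbitD(2)[OF orb] S that by auto
  have hdec: "mh \<beta> t < mh \<beta> s" if "s < t" "t < S" for s t
    using orbit_h_decreasing[OF orb be, of t s] that S by auto
  have "\<exists>a>0. \<forall>s<S. a \<le> mh \<beta> s"
  proof (rule ccontr)
    assume c: "\<not> (\<exists>a>0. \<forall>s<S. a \<le> mh \<beta> s)"
    have "(mh \<beta> \<longlongrightarrow> 0) (at_left S)"
    proof (rule order_tendstoI)
      fix a :: real assume "a < 0"
      then have "a < mh \<beta> s" if "s < S" for s using hpos[OF that] by simp
      then show "eventually (\<lambda>s. a < mh \<beta> s) (at_left S)"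
        by (auto simp: eventually_at_filter)
    next
      fix a :: real assume "0 < a"
      then obtain s where s: "s < S" "mh \<beta> s < a" using c by (meson not_le)
      have "mh \<beta> t < a" if "t \<in> {s<..<S}" for t using hdec[of s t] that s by auto
      then show "eventually (\<lambda>s. mh \<beta> s < a) (at_left S)"
        using eventually_at_left_real[OF s(1)] by (rule eventually_mono[rotated])
    qed
    then show False using neg by simp
  qed
  then obtain a where a: "0 < a" "\<And>s. s < S \<Longrightarrow> a \<le> mh \<beta> s" by blast
  define R where "R = exp S"
  define r1 where "r1 = exp (S - 1)"
  have R: "0 < r1" "r1 < R" unfolding R_def r1_def by auto
  have in_dom: "r \<in> pos_dom \<beta>" if "0 \<le> r" "r < R" for r
  proof (cases "r = 0")
    case True then show ?thesis using dom_0[OF be] by simp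
  next
    case False
    then have "ln r < S" using that unfolding R_def by (metis exp_less_cancel_iff exp_ln less_eq_real_def)
    then have "ln r \<in> mdom \<beta>" using S by simp
    then show ?thesis unfolding mdom_def using False that by simp
  qed
  have low1: "exp (k * m * (S - 1)) * a powr m \<le> msol \<beta> r powr m" if r: "r1 \<le> r" "r < R" for r
  proof -
    define s where "s = ln r"
    have r0: "0 < r" using r R by simp
    have s: "S - 1 \<le> s" "s < S" "exp s = r"
      unfolding s_def using r r0 unfolding R_def r1_def
      by (auto simp: ln_ge_iff ) (metis exp_less_cancel_iff exp_ln)
    have "msol \<beta> r = exp (k * s) * mh \<beta> s" unfolding log_h_def s(3) by (simp add: exp_minus)
    then have e: "msol \<beta> r powr m = exp (k * m * s) * mh \<beta> s powr m"
      using hpos[OF s(2)] by (simp add: powr_mult exp_powr_real mult_ac)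
    have "exp (k * m * (S - 1)) \<le> exp (k * m * s)" using s k_pos m_pos by simp
    moreover have "a powr m \<le> mh \<beta> s powr m" using a s m_pos by (intro powr_mono2) auto
    ultimately show ?thesis unfolding e using a by (intro mult_mono) auto
  qed
  obtain \<epsilon>1 where e1: "good_cutoff \<beta> r1 \<epsilon>1" using in_dom[of r1] R unfolding pos_dom_def by auto
  \<comment> \<open>Half of a lower bound for \<open>msol powr m\<close>, so that the inequality at
    \<open>R\<close>, obtained by passing to the limit, is strict for
    \<open>\<epsilon>\<close>.\<close>
  define \<epsilon> where "\<epsilon> = min \<epsilon>1 (exp (k * m * (S - 1)) * a powr m) / 2"
  have e1pos: "0 < \<epsilon>1" using e1 unfolding good_cutoff_def by simp
  have epos: "0 < \<epsilon>" unfolding \<epsilon>_def using e1pos a by simp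
  have low: "2 * \<epsilon> \<le> msol \<beta> r powr m" if r: "0 \<le> r" "r < R" for r
  proof (cases "r1 \<le> r")
    case True
    then show ?thesis using low1[OF True r(2)] unfolding \<epsilon>_def by simp
  next
    case False
    then have "good_cutoff \<beta> r \<epsilon>1" using good_cutoff_down[OF e1] by simp
    from msol_eq(2)[OF be this r(1)] this r(1) show ?thesis unfolding good_cutoff_def \<epsilon>_def by auto
  qed
  have WR: "2 * \<epsilon> \<le> trunc_sol \<epsilon> \<beta> r" if r: "0 \<le> r" "r < R" for r
  proof -
    obtain \<delta> where d: "good_cutoff \<beta> r \<delta>" using in_dom[OF r] unfolding pos_dom_def by blast
    have "trunc_sol \<epsilon> \<beta> r = trunc_sol \<delta> \<beta> r"
    proof (rule trunc_sol_agree[OF _ epos be _ r(1) order_refl])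
      show "0 < \<delta>" using d unfolding good_cutoff_def by simp
      fix x assume x: "0 \<le> x" "x \<le> r"
      note dx = good_cutoff_down[OF d x(2)]
      show "\<delta> \<le> trunc_sol \<delta> \<beta> x \<and> \<epsilon> \<le> trunc_sol \<delta> \<beta> x"
        using low[of x] msol_eq(2)[OF be dx x(1)] dx x r epos unfolding good_cutoff_def by force
    qed
    then show ?thesis using low[OF r] msol_eq(2)[OF be d r(1)] by simp
  qed
  have "2 * \<epsilon> \<le> trunc_sol \<epsilon> \<beta> R"
  proof (rule tendsto_lowerbound)
    have R0: "0 < R" using R by simp
    have "isCont (trunc_sol \<epsilon> \<beta>) R"
      by (rule continuous_on_interior[OF trunc_sol_continuous[OF epos be]]) (use R0 in \<open>simp add: interior_real_atLeast\<close>)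
    then show "(trunc_sol \<epsilon> \<beta> \<longlongrightarrow> trunc_sol \<epsilon> \<beta> R) (at_left R)"
      unfolding isCont_def by (rule tendsto_within_subset) auto
    show "eventually (\<lambda>r. 2 * \<epsilon> \<le> trunc_sol \<epsilon> \<beta> r) (at_left R)"
      using eventually_at_left_real[OF R0] by eventually_elim (use WR in auto)
  qed simp
  then have "good_cutoff \<beta> R \<epsilon>"
    unfolding good_cutoff_def using epos WR by (force simp: less_le)
  then have "R \<in> pos_dom \<beta>" unfolding pos_dom_def using R by auto
  then have "S \<in> mdom \<beta>" unfolding mdom_def R_def by simp
  then show False using S by simp
qed

section \<open>Continuous dependence of the maximal solution on \<open>\<beta>\<close>\<close>

lemma msol_continuous_parameter:
  assumes be: "0 \<le> \<beta>0" and r: "r \<in> pos_dom \<beta>0"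
  shows "eventually (\<lambda>\<beta>. r \<in> pos_dom \<beta>) (at \<beta>0 within {0..})"
    "((\<lambda>\<beta>. msol \<beta> r) \<longlongrightarrow> msol \<beta>0 r) (at \<beta>0 within {0..})"
    "((\<lambda>\<beta>. flux \<beta> (msol \<beta>) r) \<longlongrightarrow> flux \<beta>0 (msol \<beta>0) r) (at \<beta>0 within {0..})"
proof -
  obtain \<epsilon> where e: "good_cutoff \<beta>0 r \<epsilon>" and r0: "0 \<le> r" using r unfolding pos_dom_def by blast
  have e0: "0 < \<epsilon>" using e unfolding good_cutoff_def by simp
  let ?F = "at \<beta>0 within {0..}"
  have cont: "continuous_on {0..r} (trunc_sol \<epsilon> \<beta>0)"
    using trunc_sol_continuous[OF e0 be] by (rule continuous_on_subset) auto
  obtain z where z: "z \<in> {0..r}" "\<And>x. x \<in> {0..r} \<Longrightarrow> trunc_sol \<epsilon> \<beta>0 z \<le> trunc_sol \<epsilon> \<beta>0 x"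
    using continuous_attains_inf[OF compact_Icc _ cont] r0 by auto
  \<comment> \<open>The room between the unperturbed solution and the cutoff on
    \<open>[0, r]\<close>; perturbations smaller than \<open>d\<close> keep
    \<open>\<epsilon>\<close> a good cutoff.\<close>
  define d where "d = trunc_sol \<epsilon> \<beta>0 z - \<epsilon>"
  have d: "0 < d" unfolding d_def using e z(1) unfolding good_cutoff_def by simp
  obtain C where C: "0 \<le> C" "\<And>\<beta>' w' x. \<lbrakk>0 \<le> \<beta>'; \<beta>' \<le> \<beta>0 + 1; tsol \<epsilon> 1 \<beta>' r w'; 0 \<le> x; x \<le> r\<rbrakk> \<Longrightarrow>
    \<bar>w' x - trunc_sol \<epsilon> \<beta>0 x\<bar> \<le> C * \<bar>\<beta>' - \<beta>0\<bar>"
    by (rule tsol_continuous_parameter[OF e0 be r0 trunc_sol_tsol[OF e0 be]]) (rule that)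
  have lim: "((\<lambda>\<beta>. K * \<bar>\<beta> - \<beta>0\<bar>) \<longlongrightarrow> 0) ?F" for K
  proof -
    have "((\<lambda>\<beta>. K * \<bar>\<beta> - \<beta>0\<bar>) \<longlongrightarrow> K * \<bar>\<beta>0 - \<beta>0\<bar>) ?F" by (intro tendsto_intros)
    then show ?thesis by simp
  qed
  have ev: "eventually (\<lambda>\<beta>. 0 \<le> \<beta> \<and> \<beta> \<le> \<beta>0 + 1 \<and> C * \<bar>\<beta> - \<beta>0\<bar> < d) ?F"
  proof (intro eventually_conj)
    show "eventually (\<lambda>\<beta>. 0 \<le> \<beta>) ?F" by (auto simp: eventually_at_filter)
    show "eventually (\<lambda>\<beta>. C * \<bar>\<beta> - \<beta>0\<bar> < d) ?F" by (rule order_tendstoD(2)[OF lim d])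
    have "((\<lambda>\<beta>. \<beta>) \<longlongrightarrow> \<beta>0) ?F" by (rule tendsto_ident_at)
    from order_tendstoD(2)[OF this, of "\<beta>0 + 1"] show "eventually (\<lambda>\<beta>. \<beta> \<le> \<beta>0 + 1) ?F"
      by (auto elim: eventually_mono)
  qed
  have close: "\<bar>trunc_sol \<epsilon> \<beta> x - trunc_sol \<epsilon> \<beta>0 x\<bar> \<le> C * \<bar>\<beta> - \<beta>0\<bar>"
    if "0 \<le> \<beta>" "\<beta> \<le> \<beta>0 + 1" "0 \<le> x" "x \<le> r" for \<beta> x
    by (rule C(2)[OF that(1,2) trunc_sol_tsol[OF e0 that(1)] that(3,4)])
  have gd: "good_cutoff \<beta> r \<epsilon>" if b: "0 \<le> \<beta> \<and> \<beta> \<le> \<beta>0 + 1 \<and> C * \<bar>\<beta> - \<beta>0\<bar> < d" for \<beta>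
    unfolding good_cutoff_def
  proof (intro conjI e0 allI impI)
    fix x assume x: "0 \<le> x \<and> x \<le> r"
    then show "\<epsilon> < trunc_sol \<epsilon> \<beta> x"
      using close[of \<beta> x] b z(2)[of x] unfolding d_def by auto
  qed
  show "eventually (\<lambda>\<beta>. r \<in> pos_dom \<beta>) ?F"
    using ev by eventually_elim (use gd r0 in \<open>auto simp: pos_dom_def\<close>)
  obtain L where L: "0 < L" "\<And>x y. \<bar>trunc \<epsilon> x - trunc \<epsilon> y\<bar> \<le> L * \<bar>x - y\<bar>"
    "\<And>x y. \<bar>trunc \<epsilon> x powr p - trunc \<epsilon> y powr p\<bar> \<le> L * \<bar>x - y\<bar>"
    using trunc_lipschitz[OF e0] by blast
  have mW: "msol \<beta> x = trunc \<epsilon> (trunc_sol \<epsilon> \<beta> x)"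
    if "0 \<le> \<beta> \<and> \<beta> \<le> \<beta>0 + 1 \<and> C * \<bar>\<beta> - \<beta>0\<bar> < d" "0 \<le> x" "x \<le> r" for \<beta> x
    using msol_eq(1)[OF _ good_cutoff_down[OF gd[OF that(1)] that(3)] that(2)] that by simp
  have b0: "0 \<le> \<beta>0 \<and> \<beta>0 \<le> \<beta>0 + 1 \<and> C * \<bar>\<beta>0 - \<beta>0\<bar> < d" using be d by simp
  have diff: "\<bar>msol \<beta> x - msol \<beta>0 x\<bar> \<le> L * C * \<bar>\<beta> - \<beta>0\<bar>"
    "\<bar>msol \<beta> x powr p - msol \<beta>0 x powr p\<bar> \<le> L * C * \<bar>\<beta> - \<beta>0\<bar>"
    if b: "0 \<le> \<beta> \<and> \<beta> \<le> \<beta>0 + 1 \<and> C * \<bar>\<beta> - \<beta>0\<bar> < d" and x: "0 \<le> x" "x \<le> r" for \<beta> x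
  proof -
    have "L * \<bar>trunc_sol \<epsilon> \<beta> x - trunc_sol \<epsilon> \<beta>0 x\<bar> \<le> L * C * \<bar>\<beta> - \<beta>0\<bar>"
      using close[of \<beta> x] b x L(1) by simp
    then show "\<bar>msol \<beta> x - msol \<beta>0 x\<bar> \<le> L * C * \<bar>\<beta> - \<beta>0\<bar>"
      "\<bar>msol \<beta> x powr p - msol \<beta>0 x powr p\<bar> \<le> L * C * \<bar>\<beta> - \<beta>0\<bar>"
      unfolding mW[OF b x] mW[OF b0 x] using L(2,3) order_trans by blast+
  qed
  show lim1: "((\<lambda>\<beta>. msol \<beta> r) \<longlongrightarrow> msol \<beta>0 r) ?F"
  proof (rule LIM_zero_cancel, rule Lim_null_comparison)
    show "eventually (\<lambda>\<beta>. norm (msol \<beta> r - msol \<beta>0 r) \<le> L * C * \<bar>\<beta> - \<beta>0\<bar>) ?F"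
      using ev by eventually_elim (use diff(1) r0 in auto)
  qed (rule lim)
  let ?f = "\<lambda>\<beta> x. trunc \<epsilon> (trunc_sol \<epsilon> \<beta> x)"
  have pm: "\<bar>pmean (N + \<sigma>1) (msol \<beta>) r - pmean (N + \<sigma>1) (msol \<beta>0) r\<bar> \<le> L * C / (N + \<sigma>1) * \<bar>\<beta> - \<beta>0\<bar> \<and>
    \<bar>pmean (N + \<sigma>2) (\<lambda>x. msol \<beta> x powr p) r - pmean (N + \<sigma>2) (\<lambda>x. msol \<beta>0 x powr p) r\<bar> \<le> L * C / (N + \<sigma>2) * \<bar>\<beta> - \<beta>0\<bar>"
    if b: "0 \<le> \<beta> \<and> \<beta> \<le> \<beta>0 + 1 \<and> C * \<bar>\<beta> - \<beta>0\<bar> < d" for \<beta>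
  proof -
    have bb: "0 \<le> \<beta>" using b by simp
    note c = continuous_on_trunc[OF e0 trunc_sol_continuous[OF e0 bb]] continuous_on_trunc[OF e0 trunc_sol_continuous[OF e0 be]]
    have 1: "pmean (N + \<sigma>1) (msol \<beta>) r - pmean (N + \<sigma>1) (msol \<beta>0) r = pmean (N + \<sigma>1) (\<lambda>x. ?f \<beta> x - ?f \<beta>0 x) r"
      using pmean_cong[OF r0 mW[OF b]] pmean_cong[OF r0 mW[OF b0]] pmean_diff[OF N_\<sigma>1 r0 c(1,3)] by simp
    have "pmean (N + \<sigma>2) (\<lambda>x. msol \<beta> x powr p) r = pmean (N + \<sigma>2) (\<lambda>x. ?f \<beta> x powr p) r"
      "pmean (N + \<sigma>2) (\<lambda>x. msol \<beta>0 x powr p) r = pmean (N + \<sigma>2) (\<lambda>x. ?f \<beta>0 x powr p) r"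
      by (rule pmean_cong[OF r0]; simp add: mW[OF b] mW[OF b0])+
    then have 2: "pmean (N + \<sigma>2) (\<lambda>x. msol \<beta> x powr p) r - pmean (N + \<sigma>2) (\<lambda>x. msol \<beta>0 x powr p) r
        = pmean (N + \<sigma>2) (\<lambda>x. ?f \<beta> x powr p - ?f \<beta>0 x powr p) r"
      using pmean_diff[OF N_\<sigma>2 r0 c(2,4)] by simp
    have "\<bar>pmean (N + \<sigma>1) (\<lambda>x. ?f \<beta> x - ?f \<beta>0 x) r\<bar> \<le> (L * C * \<bar>\<beta> - \<beta>0\<bar>) / (N + \<sigma>1)"
      by (rule pmean_bound[OF N_\<sigma>1 r0 continuous_on_diff[OF c(1,3)]])
         (use diff(1)[OF b] mW[OF b] mW[OF b0] in auto)
    moreover have "\<bar>pmean (N + \<sigma>2) (\<lambda>x. ?f \<beta> x powr p - ?f \<beta>0 x powr p) r\<bar> \<le> (L * C * \<bar>\<beta> - \<beta>0\<bar>) / (N + \<sigma>2)"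
      by (rule pmean_bound[OF N_\<sigma>2 r0 continuous_on_diff[OF c(2,4)]])
         (use diff(2)[OF b] mW[OF b] mW[OF b0] in auto)
    ultimately show ?thesis unfolding 1 2 by simp
  qed
  have p1: "((\<lambda>\<beta>. pmean (N + \<sigma>1) (msol \<beta>) r) \<longlongrightarrow> pmean (N + \<sigma>1) (msol \<beta>0) r) ?F"
  proof (rule LIM_zero_cancel, rule Lim_null_comparison)
    show "eventually (\<lambda>\<beta>. norm (pmean (N + \<sigma>1) (msol \<beta>) r - pmean (N + \<sigma>1) (msol \<beta>0) r) \<le> L * C / (N + \<sigma>1) * \<bar>\<beta> - \<beta>0\<bar>) ?F"
      using ev by eventually_elim (use pm in auto)
  qed (rule lim)
  have p2: "((\<lambda>\<beta>. pmean (N + \<sigma>2) (\<lambda>x. msol \<beta> x powr p) r) \<longlongrightarrow> pmean (N + \<sigma>2) (\<lambda>x. msol \<beta>0 x powr p) r) ?F"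
  proof (rule LIM_zero_cancel, rule Lim_null_comparison)
    show "eventually (\<lambda>\<beta>. norm (pmean (N + \<sigma>2) (\<lambda>x. msol \<beta> x powr p) r - pmean (N + \<sigma>2) (\<lambda>x. msol \<beta>0 x powr p) r)
        \<le> L * C / (N + \<sigma>2) * \<bar>\<beta> - \<beta>0\<bar>) ?F"
      using ev by eventually_elim (use pm in auto)
  qed (rule lim)
  show "((\<lambda>\<beta>. flux \<beta> (msol \<beta>) r) \<longlongrightarrow> flux \<beta>0 (msol \<beta>0) r) ?F"
    unfolding flux_def by (intro tendsto_intros p1 p2)
qed

lemma mdom_continuous_parameter:
  assumes "0 \<le> \<beta>0" "s \<in> mdom \<beta>0"
  shows "eventually (\<lambda>\<beta>. s \<in> mdom \<beta>) (at \<beta>0 within {0..})"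
    "((\<lambda>\<beta>. mh \<beta> s) \<longlongrightarrow> mh \<beta>0 s) (at \<beta>0 within {0..})"
    "((\<lambda>\<beta>. mZ \<beta> s) \<longlongrightarrow> mZ \<beta>0 s) (at \<beta>0 within {0..})"
proof -
  have r: "exp s \<in> pos_dom \<beta>0" using assms(2) unfolding mdom_def by simp
  note mc = msol_continuous_parameter[OF assms(1) r]
  have pos: "0 < msol \<beta>0 (exp s)"
    using r msol_eq(3)[OF assms(1)] unfolding pos_dom_def by auto
  show "eventually (\<lambda>\<beta>. s \<in> mdom \<beta>) (at \<beta>0 within {0..})" unfolding mdom_def using mc(1) by simp
  show "((\<lambda>\<beta>. mh \<beta> s) \<longlongrightarrow> mh \<beta>0 s) (at \<beta>0 within {0..})"
    unfolding log_h_def by (intro tendsto_intros mc)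
  show "((\<lambda>\<beta>. mZ \<beta> s) \<longlongrightarrow> mZ \<beta>0 s) (at \<beta>0 within {0..})"
    unfolding log_Z_def using pos by (intro tendsto_intros mc) auto
qed


text \<open>For \<open>\<beta> = 0\<close> a positive \<open>Z\<close> gives
  \<open>h' \<ge> - (A / m) * h\<close>, so \<open>h\<close> cannot vanish at a finite endpoint. On
  the whole line \<open>Z / h powr m\<close> solves a Riccati equation with the forcing
  \<open>- h powr (p - m)\<close>, which tends to minus infinity as \<open>h\<close> tends to
  \<open>0\<close> and drives the quotient below zero.\<close>

lemma orbit_zero_\<beta>:
  assumes orb: "orbit 0 I h Z"
    and fin: "\<And>S. I = {..<S} \<Longrightarrow> (h \<longlongrightarrow> 0) (at_left S)"
  shows "\<exists>s\<in>I. Z s < 0"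
proof (rule ccontr)
  assume "\<not> (\<exists>s\<in>I. Z s < 0)"
  then have Zpos: "0 < Z s" if "s \<in> I" for s
    using orbit_eventually_positive_if_nonneg[OF orb _ that] by force
  have hpos: "0 < h s" if "s \<in> I" for s by (rule orbitD(2)[OF orb that])
  consider "I = UNIV" | S where "I = {..<S}"
    using orbitD(1)[OF orb] unfolding lower_ray_def by blast
  then show False
  proof cases
    case 2
    define s0 where "s0 = S - 1"
    have s0: "s0 < S" unfolding s0_def by simp
    have low: "h s0 * exp (A / m * s0) \<le> h s * exp (A / m * s)" if s: "s0 \<le> s" "s < S" for s
    proof (rule DERIV_nonneg_imp_nondecreasing[where f = "\<lambda>s. h s * exp (A / m * s)", OF s(1)])
      fix x assume "s0 \<le> x" "x \<le> s"
      then have x: "x \<in> I" using 2 s by simp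
      let ?d = "- P 0 h Z x / (m * h x powr (m - 1))"
      have dE: "((\<lambda>s. exp (A / m * s)) has_real_derivative A / m * exp (A / m * x)) (at x)"
        using m_pos by (auto intro!: derivative_eq_intros)
      have "((\<lambda>s. h s * exp (A / m * s)) has_real_derivative ?d * exp (A / m * x) + (A / m * exp (A / m * x)) * h x) (at x)"
        by (rule DERIV_mult[OF orbit_h_deriv[OF orb x] dE])
      moreover have "P 0 h Z x \<le> A * h x powr m" unfolding P_def using Zpos[OF x] by simp
      then have "P 0 h Z x / (m * h x powr (m - 1)) \<le> A * h x powr m / (m * h x powr (m - 1))"
        using hpos[OF x] m_pos by (intro divide_right_mono) auto
      moreover have "A * h x powr m / (m * h x powr (m - 1)) = A / m * h x"
        using hpos[OF x] m_pos by (simp add: powr_diff)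
      ultimately have "0 \<le> ?d + A / m * h x" by simp
      then have "0 \<le> (?d + A / m * h x) * exp (A / m * x)" by simp
      then have "0 \<le> ?d * exp (A / m * x) + (A / m * exp (A / m * x)) * h x" by (simp add: algebra_simps)
      then show "\<exists>y. ((\<lambda>s. h s * exp (A / m * s)) has_real_derivative y) (at x) \<and> 0 \<le> y"
        using DERIV_mult[OF orbit_h_deriv[OF orb x] dE] by blast
    qed
    have "((\<lambda>s. h s * exp (A / m * s)) \<longlongrightarrow> 0 * exp (A / m * S)) (at_left S)"
      by (intro tendsto_intros fin[OF 2])
    then have "h s0 * exp (A / m * s0) \<le> 0 * exp (A / m * S)"
    proof (rule tendsto_lowerbound)
      show "eventually (\<lambda>s. h s0 * exp (A / m * s0) \<le> h s * exp (A / m * s)) (at_left S)"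
        using eventually_at_left_real[OF s0] by eventually_elim (use low in auto)
    qed simp
    then show False using hpos[of s0] 2 s0 by (simp add: mult_le_0_iff)
  next
    case 1
    have h0: "(h \<longlongrightarrow> 0) at_top"
      by (rule orbit_tail_h_tendsto_0[OF orb[unfolded 1]]) (use Zpos 1 in auto)
    \<comment> \<open>With \<open>y = Z / h powr m\<close> one has
      \<open>y' = - B - h powr (p - m) - y * y + A * y\<close>, and \<open>A^2 / 4\<close> is the
      maximum of \<open>A * y - y * y\<close>. The extra \<open>1\<close> gives
      \<open>y' \<le> - 1\<close> as soon as \<open>h powr (p - m) \<ge> C\<close>.\<close>
    define C where "C = A\<^sup>2 / 4 + 1"
    have C: "0 < C" unfolding C_def using A_pos by (simp add: add_pos_pos)
    define h1 where "h1 = C powr (1 / (p - m))"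
    have h1: "0 < h1" unfolding h1_def using C by simp
    obtain s1 where s1: "\<And>s. s1 \<le> s \<Longrightarrow> h s < h1"
      using order_tendstoD(2)[OF h0 h1] by (auto simp: eventually_at_top_linorder)
    let ?y = "\<lambda>s. Z s / h s powr m"
    define t where "t = s1 + ?y s1 + 1"
    have y1: "0 \<le> ?y s1" using Zpos[of s1] 1 by simp
    have t: "s1 \<le> t" unfolding t_def using y1 by simp
    have "?y t + 1 * t \<le> ?y s1 + 1 * s1"
    proof (rule DERIV_nonpos_imp_nonincreasing[where f = "\<lambda>s. ?y s + 1 * s", OF t])
      fix x assume x: "s1 \<le> x" "x \<le> t"
      have xI: "x \<in> I" using 1 by simp
      define v where "v = h x powr m"
      have v: "0 < v" unfolding v_def using hpos[OF xI] by simp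
      have "((\<lambda>s. h s powr m) has_real_derivative (m * h x powr (m - 1)) * (- P 0 h Z x / (m * h x powr (m - 1)))) (at x)"
        by (rule DERIV_chain2[OF has_real_derivative_powr[OF hpos[OF xI]] orbit_h_deriv[OF orb xI]])
      then have dv: "((\<lambda>s. h s powr m) has_real_derivative Z x - A * v) (at x)"
        by (rule DERIV_cong) (use hpos[OF xI] m_pos in \<open>simp add: P_def v_def\<close>)
      have d: "((\<lambda>s. ?y s + 1 * s) has_real_derivative
          ((- B * v - h x powr p) * v - Z x * (Z x - A * v)) / (v * v) + 1 * 1) (at x)"
        unfolding v_def
        by (rule DERIV_add[OF DERIV_divide[OF orbitD(4)[OF orb xI] dv[unfolded v_def]] DERIV_cmult[OF DERIV_ident]])
           (use v in \<open>simp add: v_def\<close>)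
      have "((- B * v - h x powr p) * v - Z x * (Z x - A * v)) / (v * v) = - B - h x powr p / v - (?y x - A / 2)\<^sup>2 + A\<^sup>2 / 4"
        unfolding v_def[symmetric] using v by (simp add: field_simps power2_eq_square)
      moreover have "C \<le> h x powr p / v"
      proof -
        have "h1 powr (p - m) \<le> h x powr (p - m)"
          using s1[OF x(1)] hpos[OF xI] p_less_m by (intro powr_mono2') auto
        moreover have "h1 powr (p - m) = C" unfolding h1_def using C p_less_m by (simp add: powr_powr)
        ultimately show ?thesis unfolding v_def by (simp add: powr_diff)
      qed
      moreover have "0 \<le> (?y x - A / 2)\<^sup>2" by simp
      ultimately have "((- B * v - h x powr p) * v - Z x * (Z x - A * v)) / (v * v) + 1 * 1 \<le> 0"
        using B_pos unfolding C_def by linarith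
      with d show "\<exists>y. ((\<lambda>s. ?y s + 1 * s) has_real_derivative y) (at x) \<and> y \<le> 0" by blast
    qed
    then have "?y t < 0" unfolding t_def by simp
    moreover have "0 \<le> ?y t" using Zpos[of t] 1 by simp
    ultimately show False by simp
  qed
qed

text \<open>By \<open>0 < P\<close>, \<open>Z\<close> is squeezed between \<open>0\<close> and
  \<open>\<beta> * h + A * h powr m\<close>.\<close>

lemma bounded_orbit_compact:
  assumes orb: "orbit \<beta> {..<S} h Z" and be: "0 \<le> \<beta>" and Z: "\<And>s. s < S \<Longrightarrow> 0 < Z s"
    and h0: "(h \<longlongrightarrow> 0) (at_left S)"
  shows "compact_orbit \<beta> S h Z"
  unfolding compact_orbit_def
proof (intro conjI orb h0)
  have left: "eventually (\<lambda>s. s < S) (at_left S)" by (auto simp: eventually_at_filter)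
  have hm: "((\<lambda>s. h s powr m) \<longlongrightarrow> 0) (at_left S)"
  proof -
    have "eventually (\<lambda>s. 0 \<le> h s) (at_left S)"
      using left by eventually_elim (use orbitD(2)[OF orb] in \<open>auto simp: less_imp_le\<close>)
    from tendsto_powr'[OF h0 tendsto_const, of m] this m_pos show ?thesis by simp
  qed
  show "(Z \<longlongrightarrow> 0) (at_left S)"
  proof (rule tendsto_sandwich[of "\<lambda>_. 0" _ _ "\<lambda>s. \<beta> * h s + A * h s powr m"])
    show "eventually (\<lambda>s. 0 \<le> Z s) (at_left S)" using left by eventually_elim (use Z in \<open>auto simp: less_imp_le\<close>)
    show "eventually (\<lambda>s. Z s \<le> \<beta> * h s + A * h s powr m) (at_left S)"
      using left
    proof eventually_elim
      case (elim s)
      then show ?case using orbit_P_pos[OF orb be, of s] unfolding P_def by simp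
    qed
    have "((\<lambda>s. \<beta> * h s + A * h s powr m) \<longlongrightarrow> \<beta> * 0 + A * 0) (at_left S)"
      by (intro tendsto_intros h0 hm)
    then show "((\<lambda>s. \<beta> * h s + A * h s powr m) \<longlongrightarrow> 0) (at_left S)" by simp
  qed simp
qed

section \<open>The critical exponent\<close>

theorem critical_exponent_exists:
  obtains \<beta>s S where "0 < \<beta>s" "mdom \<beta>s = {..<S}" "compact_orbit \<beta>s S (mh \<beta>s) (mZ \<beta>s)"
    "\<And>\<beta>. \<beta>s < \<beta> \<Longrightarrow> mdom \<beta> = UNIV \<and> (\<forall>s. 0 < mZ \<beta> s)"
proof -
  define Sa where "Sa = {\<beta>. 0 \<le> \<beta> \<and> (\<exists>s\<in>mdom \<beta>. mZ \<beta> s < 0)}"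
  have zero: "0 \<in> Sa"
    unfolding Sa_def using orbit_zero_\<beta>[OF msol_orbit] mdom_bounded_extinction[of 0] by auto
  obtain b where b: "0 < b" "\<And>\<beta> I h Z s. b \<le> \<beta> \<Longrightarrow> orbit \<beta> I h Z \<Longrightarrow> s \<in> I \<Longrightarrow> 0 < Z s"
    by (rule orbit_large_\<beta>) (rule that)
  have bound: "\<beta> \<le> b" if "\<beta> \<in> Sa" for \<beta>
  proof (rule ccontr)
    assume "\<not> \<beta> \<le> b"
    then have "b \<le> \<beta>" by simp
    have "0 \<le> \<beta> \<and> (\<exists>s\<in>mdom \<beta>. mZ \<beta> s < 0)" using \<open>\<beta> \<in> Sa\<close> unfolding Sa_def by blast
    then obtain s where s: "0 \<le> \<beta>" "s \<in> mdom \<beta>" "mZ \<beta> s < 0" by blast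
    show False using b(2)[OF \<open>b \<le> \<beta>\<close> msol_orbit[OF s(1)] s(2)] s(3) by simp
  qed
  have bdd: "bdd_above Sa" using bound by (rule bdd_aboveI)
  have open_Sa: "\<exists>d>0. \<forall>\<beta>\<ge>0. \<bar>\<beta> - \<beta>0\<bar> < d \<longrightarrow> \<beta> \<in> Sa" if "\<beta>0 \<in> Sa" for \<beta>0
  proof -
    have "0 \<le> \<beta>0 \<and> (\<exists>s\<in>mdom \<beta>0. mZ \<beta>0 s < 0)" using \<open>\<beta>0 \<in> Sa\<close> unfolding Sa_def by blast
    then obtain s where s: "0 \<le> \<beta>0" "s \<in> mdom \<beta>0" "mZ \<beta>0 s < 0" by blast
    have "eventually (\<lambda>\<beta>. s \<in> mdom \<beta> \<and> mZ \<beta> s < 0) (at \<beta>0 within {0..})"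
      by (intro eventually_conj mdom_continuous_parameter(1)[OF s(1,2)]
           order_tendstoD(2)[OF mdom_continuous_parameter(3)[OF s(1,2)] s(3)])
    then obtain d where "d > 0" "\<And>\<beta>. \<lbrakk>\<beta> \<in> {0..}; \<beta> \<noteq> \<beta>0; dist \<beta> \<beta>0 < d\<rbrakk> \<Longrightarrow> s \<in> mdom \<beta> \<and> mZ \<beta> s < 0"
      unfolding eventually_at by auto
    then show ?thesis using that unfolding Sa_def dist_real_def by (intro exI[of _ d]) auto
  qed
  define \<beta>s where "\<beta>s = Sup Sa"
  have up: "\<beta> \<le> \<beta>s" if "\<beta> \<in> Sa" for \<beta> unfolding \<beta>s_def by (rule cSup_upper[OF that bdd])
  have pos: "0 < \<beta>s"
  proof -
    obtain d where "d > 0" "\<forall>\<beta>\<ge>0. \<bar>\<beta> - 0\<bar> < d \<longrightarrow> \<beta> \<in> Sa" using open_Sa[OF zero] by blast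
    then have "d / 2 \<in> Sa" by simp
    from up[OF this] \<open>d > 0\<close> show ?thesis by simp
  qed
  have nin: "\<beta>s \<notin> Sa"
  proof
    assume "\<beta>s \<in> Sa"
    then obtain d where "d > 0" "\<forall>\<beta>\<ge>0. \<bar>\<beta> - \<beta>s\<bar> < d \<longrightarrow> \<beta> \<in> Sa" using open_Sa by blast
    then have "\<beta>s + d / 2 \<in> Sa" using pos by simp
    from up[OF this] \<open>d > 0\<close> show False by simp
  qed
  have near: "\<exists>\<beta>\<in>Sa. \<beta>s - d < \<beta> \<and> \<beta> < \<beta>s" if "0 < d" for d
  proof -
    have "\<beta>s - d < Sup Sa" unfolding \<beta>s_def[symmetric] using that by simp
    then obtain \<beta> where "\<beta> \<in> Sa" "\<beta>s - d < \<beta>" using less_cSup_iff[of Sa] bdd zero by auto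
    then show ?thesis using up[of \<beta>] nin by (cases "\<beta> = \<beta>s") auto
  qed
  have Zpos: "0 < mZ \<beta> s" if "0 \<le> \<beta>" "\<beta> \<notin> Sa" "s \<in> mdom \<beta>" for \<beta> s
  proof (rule orbit_eventually_positive_if_nonneg[OF msol_orbit[OF that(1)] _ that(3)])
    fix t assume "t \<in> mdom \<beta>"
    then show "0 \<le> mZ \<beta> t" using that(1,2) unfolding Sa_def by (simp add: not_less)
  qed
  \<comment> \<open>A global orbit at \<open>\<beta>s\<close> would enter the trap with
    \<open>\<theta> = 1 / 2\<close>. Entering it at a fixed \<open>s\<close> is an open condition,
    so the parameters of \<open>Sa\<close> close to \<open>\<beta>s\<close> would be trapped as
    well, contrary to the negative values of their \<open>Z\<close>.\<close>
  have not_UNIV: "mdom \<beta>s \<noteq> UNIV"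
  proof
    assume U: "mdom \<beta>s = UNIV"
    have bs0: "0 \<le> \<beta>s" using pos by simp
    have orb: "orbit \<beta>s UNIV (mh \<beta>s) (mZ \<beta>s)" using msol_orbit[OF bs0] U by simp
    have Zp: "0 < mZ \<beta>s s" for s using Zpos[OF bs0 nin] U by simp
    \<comment> \<open>\<open>\<beta>s / 2\<close> plays the role of the bound \<open>b\<close> in
      \<open>orbit_trap\<close>, so that one \<open>h0\<close> works for all \<open>\<beta>\<close>
      near \<open>\<beta>s\<close>.\<close>
    have "0 < 1 / 2 * (1 - 1 / 2) * (\<beta>s / 2)\<^sup>2 / m" using pos m_pos by simp
    then obtain h0 where h0: "0 < h0"
      "\<And>x. 0 < x \<Longrightarrow> x \<le> h0 \<Longrightarrow> B * x powr m + x powr p < 1 / 2 * (1 - 1 / 2) * (\<beta>s / 2)\<^sup>2 / m * (x * x / x powr m)"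
      by (rule small_argument_bound) (rule that)
    have "eventually (\<lambda>s. mh \<beta>s s < h0 \<and> 1 / 2 * \<beta>s * mh \<beta>s s < mZ \<beta>s s) at_top"
      by (intro eventually_conj order_tendstoD(2)[OF orbit_tail_h_tendsto_0[OF orb bs0 Zp] h0(1)]
           orbit_tail_Z_lower[OF orb pos Zp]) auto
    then obtain s where s: "mh \<beta>s s < h0" "1 / 2 * \<beta>s * mh \<beta>s s < mZ \<beta>s s"
      by (auto simp: eventually_at_top_linorder)
    have sU: "s \<in> mdom \<beta>s" using U by simp
    note mc = mdom_continuous_parameter[OF bs0 sU]
    have "((\<lambda>\<beta>. mZ \<beta> s - 1 / 2 * \<beta> * mh \<beta> s) \<longlongrightarrow> mZ \<beta>s s - 1 / 2 * \<beta>s * mh \<beta>s s) (at \<beta>s within {0..})"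
      by (intro tendsto_intros mc)
    from order_tendstoD(1)[OF this, of 0] s(2)
    have "eventually (\<lambda>\<beta>. 0 < mZ \<beta> s - 1 / 2 * \<beta> * mh \<beta> s) (at \<beta>s within {0..})" by simp
    then have "eventually (\<lambda>\<beta>. s \<in> mdom \<beta> \<and> mh \<beta> s < h0 \<and> 0 < mZ \<beta> s - 1 / 2 * \<beta> * mh \<beta> s) (at \<beta>s within {0..})"
      by (intro eventually_conj mc(1) order_tendstoD(2)[OF mc(2) s(1)])
    then obtain d where d: "d > 0" "\<And>\<beta>. \<lbrakk>\<beta> \<in> {0..}; \<beta> \<noteq> \<beta>s; dist \<beta> \<beta>s < d\<rbrakk> \<Longrightarrow>
        s \<in> mdom \<beta> \<and> mh \<beta> s < h0 \<and> 0 < mZ \<beta> s - 1 / 2 * \<beta> * mh \<beta> s"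
      unfolding eventually_at by auto
    obtain \<beta> where be: "\<beta> \<in> Sa" "\<beta>s - min d (\<beta>s / 2) < \<beta>" "\<beta> < \<beta>s"
      using near[of "min d (\<beta>s / 2)"] d(1) pos by auto
    have b0: "0 \<le> \<beta>" using be(1) unfolding Sa_def by simp
    have bh: "\<beta>s / 2 \<le> \<beta>" using be(2) by linarith
    have "dist \<beta> \<beta>s < d" using be by (simp add: dist_real_def)
    with d(2)[of \<beta>] b0 be(3) have ds: "s \<in> mdom \<beta>" "mh \<beta> s \<le> h0" "1 / 2 * \<beta> * mh \<beta> s < mZ \<beta> s" by auto
    note orb\<beta> = msol_orbit[OF b0]
    obtain t where t: "t \<in> mdom \<beta>" "mZ \<beta> t < 0" using be(1) unfolding Sa_def by blast
    show False
    proof (cases "s \<le> t")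
      case True
      have "1 / 2 * \<beta> * mh \<beta> t < mZ \<beta> t"
        by (rule orbit_trap[OF orb\<beta> _ _ _ bh h0(2) ds t(1) True]) (use pos in auto)
      moreover have "0 \<le> 1 / 2 * \<beta> * mh \<beta> t" using orbitD(2)[OF orb\<beta> t(1)] b0 by simp
      ultimately show False using t(2) by linarith
    next
      case False
      then have "mZ \<beta> s < mZ \<beta> t" using orbit_Z_decreasing[OF orb\<beta> ds(1)] by simp
      moreover have "0 \<le> 1 / 2 * \<beta> * mh \<beta> s" using orbitD(2)[OF orb\<beta> ds(1)] b0 by simp
      ultimately show False using t(2) ds(3) by linarith
    qed
  qed
  have compact: "compact_orbit \<beta> S (mh \<beta>) (mZ \<beta>)" if "0 \<le> \<beta>" "\<beta> \<notin> Sa" "mdom \<beta> = {..<S}" for \<beta> S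
    using msol_orbit[OF that(1)] Zpos[OF that(1,2)] mdom_bounded_extinction[OF that(1,3)] that
    by (intro bounded_orbit_compact) auto
  obtain S where S: "mdom \<beta>s = {..<S}"
    using lower_ray_mdom[of \<beta>s] not_UNIV pos unfolding lower_ray_def by auto
  have cs: "compact_orbit \<beta>s S (mh \<beta>s) (mZ \<beta>s)" using compact[OF _ nin S] pos by simp
  show ?thesis
  proof (rule that[OF pos S cs])
    fix \<beta> assume be: "\<beta>s < \<beta>"
    have b0: "0 \<le> \<beta>" and n: "\<beta> \<notin> Sa" using be pos up[of \<beta>] by auto
    have "mdom \<beta> = UNIV"
    proof (rule ccontr)
      assume "mdom \<beta> \<noteq> UNIV"
      then obtain T where "mdom \<beta> = {..<T}" using lower_ray_mdom[OF b0] unfolding lower_ray_def by auto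
      from compact_orbit_unique[OF cs compact[OF b0 n this]] pos b0 be show False by simp
    qed
    then show "mdom \<beta> = UNIV \<and> (\<forall>s. 0 < mZ \<beta> s)" using Zpos[OF b0 n] by simp
  qed
qed

section \<open>Profiles: nonnegative solutions of the Volterra equation on the whole half
  line\<close>

definition profile where
  "profile \<beta> f \<longleftrightarrow> continuous_on {0..} f \<and> (\<forall>x\<ge>0. 0 \<le> f x) \<and> 0 < f 0 \<and>
    (\<forall>r\<ge>0. f r powr m = f 0 powr m + prim \<beta> f r)"

lemma profileD:
  assumes "profile \<beta> f"
  shows "continuous_on {0..} f" "\<And>x. 0 \<le> x \<Longrightarrow> 0 \<le> f x" "0 < f 0"
    "\<And>r. 0 \<le> r \<Longrightarrow> f r powr m = f 0 powr m + prim \<beta> f r"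
  using assms unfolding profile_def by blast+

lemma profile_local:
  assumes "profile \<beta> f" "r < r'" "\<And>x. 0 \<le> x \<Longrightarrow> x \<le> r' \<Longrightarrow> 0 < f x"
  shows "local_profile \<beta> (f 0 powr m) f r"
  unfolding local_profile_def
proof (intro exI[of _ f] exI[of _ r'] conjI allI impI)
  fix x assume "0 \<le> x \<and> x \<le> r'"
  then show "0 < f x" "f x powr m = f 0 powr m + prim \<beta> f x"
    using assms(3) profileD(4)[OF assms(1)] by blast+
qed (use assms(2) profileD(1,2)[OF assms(1)] in blast)+

lemma continuous_on_flux:
  assumes "continuous_on {0..} f" "\<And>x. 0 \<le> x \<Longrightarrow> 0 \<le> f x"
  shows "continuous_on {0..} (flux \<beta> f)"
  unfolding flux_def[abs_def]
  by (intro continuous_intros continuous_on_powr_a1 continuous_on_powr_a2 continuous_on_pmean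
      continuous_on_powr_p assms N_\<sigma>1 N_\<sigma>2)

lemma continuous_on_prim:
  assumes "continuous_on {0..} f" "\<And>x. 0 \<le> x \<Longrightarrow> 0 \<le> f x"
  shows "continuous_on {0..} (prim \<beta> f)"
  unfolding prim_def by (intro continuous_on_lin continuous_on_powr_p assms)

lemma at_left_tendsto:
  assumes "continuous_on {0..} (g :: real \<Rightarrow> real)" "0 < R"
  shows "(g \<longlongrightarrow> g R) (at_left R)" "isCont g R"
proof -
  show "isCont g R"
    by (rule continuous_on_interior[OF assms(1)]) (use assms(2) in \<open>simp add: interior_real_atLeast\<close>)
  then show "(g \<longlongrightarrow> g R) (at_left R)"
    unfolding isCont_def by (rule tendsto_within_subset) auto
qed

text \<open>Since \<open>f 0 powr m + prim \<beta> f\<close> equals \<open>f powr m\<close> and is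
  nonnegative, \<open>prim\<close> has a minimum at the first zero \<open>R\<close>. Its derivative
  vanishes there, and so does the flux, which is the condition
  \<open>Z \<longlongrightarrow> 0\<close> of a compact orbit.\<close>

lemma profile_first_zero_compact_orbit:
  assumes pr: "profile \<beta> f" and z: "f R0 = 0" "0 \<le> R0"
  shows "\<exists>S. compact_orbit \<beta> S (log_h f) (log_Z \<beta> f)"
proof -
  note pd = profileD[OF pr]
  have "closed ({0..R0} \<inter> f -` {0})"
    by (rule continuous_closed_preimage) (use continuous_on_subset[OF pd(1)] in auto)
  then have "compact ({0..R0} \<inter> f -` {0})"
    using bounded_subset[OF bounded_closed_interval[of 0 R0]] by (auto simp: compact_eq_bounded_closed)
  moreover have "R0 \<in> {0..R0} \<inter> f -` {0}" using z by simp
  ultimately obtain R where R: "R \<in> {0..R0} \<inter> f -` {0}" "\<And>x. x \<in> {0..R0} \<inter> f -` {0} \<Longrightarrow> R \<le> x"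
    using compact_attains_inf by (metis empty_iff)
  have R0: "0 < R" using R(1) pd(3) by (cases "R = 0") auto
  have fR: "f R = 0" using R(1) by simp
  have fpos: "0 < f x" if "0 \<le> x" "x < R" for x
    using R(2)[of x] R(1) pd(2)[OF that(1)] that by (cases "f x = 0") auto
  define S where "S = ln R"
  have ES: "exp S = R" unfolding S_def using R0 by simp
  have loc: "local_profile \<beta> (f 0 powr m) f r" if "r < R" for r
    by (rule profile_local[OF pr, of r "(r + R) / 2"]) (use that fpos in \<open>auto simp: field_simps\<close>)
  have orb: "orbit \<beta> {..<S} (log_h f) (log_Z \<beta> f)"
  proof (rule local_profile_orbit[OF _ loc[OF R0]])
    show "lower_ray {..<S}" unfolding lower_ray_def by blast
    fix s assume "s \<in> {..<S}"
    then show "local_profile \<beta> (f 0 powr m) f (exp s)" using ES by (intro loc) auto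
  qed
  have flux0: "flux \<beta> f R = 0"
  proof -
    have "(prim \<beta> f has_real_derivative (flux \<beta> f R - \<beta> * R powr (\<sigma>1 + 2) * f R) / R) (at R)"
      by (rule has_real_derivative_prim[OF pd(1,2) R0])
    then have d: "(prim \<beta> f has_real_derivative flux \<beta> f R / R) (at R)" using fR by simp
    have "prim \<beta> f R \<le> prim \<beta> f y" if "\<bar>R - y\<bar> < R" for y
    proof -
      have "0 \<le> y" using that by linarith
      then show ?thesis using pd(4)[of y] pd(4)[of R] R0 fR m_pos powr_ge_zero[of "f y" m] by simp
    qed
    then have "flux \<beta> f R / R = 0" by (intro DERIV_local_min[OF d R0]) auto
    then show ?thesis using R0 by simp
  qed
  have el: "filterlim exp (at_left R) (at_left S)"
    unfolding filterlim_at
  proof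
    have "(exp \<longlongrightarrow> exp S) (at_left S)" by (intro tendsto_intros)
    then show "(exp \<longlongrightarrow> R) (at_left S)" using ES by simp
    show "eventually (\<lambda>x. exp x \<in> {..<R} \<and> exp x \<noteq> R) (at_left S)"
      using ES by (auto simp: eventually_at_filter)
  qed
  have l1: "((\<lambda>s. f (exp s)) \<longlongrightarrow> 0) (at_left S)"
    using filterlim_compose[OF at_left_tendsto(1)[OF pd(1) R0] el] fR by simp
  have "((\<lambda>s. flux \<beta> f (exp s)) \<longlongrightarrow> 0) (at_left S)"
    using filterlim_compose[OF at_left_tendsto(1)[OF continuous_on_flux[OF pd(1,2), of \<beta>] R0] el] flux0
    by (simp only:)
  moreover have "((\<lambda>s. f (exp s) powr m) \<longlongrightarrow> 0) (at_left S)"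
    using tendsto_powr'[OF l1 tendsto_const, of m] pd(2) m_pos by auto
  ultimately have "((\<lambda>s. exp (- (k * m) * s) * (flux \<beta> f (exp s) + q * f (exp s) powr m)) \<longlongrightarrow>
      exp (- (k * m) * S) * (0 + q * 0)) (at_left S)"
    by (intro tendsto_intros)
  moreover have "((\<lambda>s. exp (- k * s) * f (exp s)) \<longlongrightarrow> exp (- k * S) * 0) (at_left S)"
    by (intro tendsto_intros l1)
  ultimately show ?thesis
    unfolding compact_orbit_def using orb by (auto simp: log_h_def[abs_def] log_Z_def[abs_def])
qed

lemma msol_0: assumes "0 \<le> \<beta>" shows "msol \<beta> 0 = 1"
proof -
  obtain \<epsilon> where e: "good_cutoff \<beta> 0 \<epsilon>" using dom_0[OF assms] unfolding pos_dom_def by blast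
  have "trunc_sol \<epsilon> \<beta> 0 = 1" using trunc_sol_eq[OF _ assms, of \<epsilon> 0] e unfolding good_cutoff_def by (simp add: prim_0)
  with msol_eq[OF assms e] have "msol \<beta> 0 powr m = 1" "0 < msol \<beta> 0" by auto
  then show ?thesis using m_pos by (metis less_irrefl powr_eq_one_iff_gen powr_one_gt_zero_iff powr_one_eq_one less_numeral_extra(1) powr_inj zero_less_one)
qed

lemma local_profileE:
  assumes "local_profile \<beta> c f r"
  obtains f' r' where "r < r'" "continuous_on {0..} f'" "\<And>x. 0 \<le> x \<Longrightarrow> x \<le> r' \<Longrightarrow> f x = f' x"
    "\<And>x. 0 \<le> x \<Longrightarrow> x \<le> r' \<Longrightarrow> 0 < f x" "\<And>x. 0 \<le> x \<Longrightarrow> x \<le> r' \<Longrightarrow> f x powr m = c + prim \<beta> f x"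
proof -
  obtain f' r' where lp: "r < r' \<and> continuous_on {0..} f' \<and> (\<forall>x\<ge>0. 0 \<le> f' x) \<and>
    (\<forall>x. 0 \<le> x \<and> x \<le> r' \<longrightarrow> f x = f' x \<and> 0 < f x \<and> f x powr m = c + prim \<beta> f x)"
    using assms unfolding local_profile_def by (elim exE) (rule that)
  show ?thesis by (rule that[of r' f']) (use lp in blast)+
qed

lemma local_profile_isCont:
  assumes "local_profile \<beta> c f r" "0 \<le> r"
  shows "continuous (at r within {0..}) f"
proof -
  obtain f' r' where *: "r < r'" "continuous_on {0..} f'" "\<And>x. 0 \<le> x \<Longrightarrow> x \<le> r' \<Longrightarrow> f x = f' x"
    by (rule local_profileE[OF assms(1)]) (rule that)
  have "(f' \<longlongrightarrow> f' r) (at r within {0..})" using *(2) assms(2) unfolding continuous_on_def by simp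
  moreover have "eventually (\<lambda>x. f' x = f x) (at r within {0..})"
  proof -
    have "eventually (\<lambda>x. x < r') (at r within {0..})"
      by (rule order_tendstoD(2)[OF tendsto_ident_at *(1)])
    moreover have "eventually (\<lambda>x. x \<in> {0..}) (at r within {0..})" by (auto simp: eventually_at_filter)
    ultimately show ?thesis by eventually_elim (use *(3) in force)
  qed
  ultimately show ?thesis unfolding continuous_within using *(3)[of r] *(1) assms(2)
    by (simp add: tendsto_cong)
qed

lemma msol_profile_global:
  assumes be: "0 \<le> \<beta>" and U: "mdom \<beta> = UNIV"
  shows "profile \<beta> (msol \<beta>)" "\<And>x. 0 \<le> x \<Longrightarrow> 0 < msol \<beta> x"
proof -
  have pos_dom: "r \<in> pos_dom \<beta>" if "0 \<le> r" for r
  proof (cases "r = 0")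
    case False
    then have "ln r \<in> mdom \<beta>" "exp (ln r) = r" using U that by auto
    then show ?thesis unfolding mdom_def by simp
  qed (use dom_0[OF be] in simp)
  have loc: "local_profile \<beta> 1 (msol \<beta>) r" if "0 \<le> r" for r by (rule msol_local[OF be pos_dom[OF that]])
  show pos: "0 < msol \<beta> x" if x: "0 \<le> x" for x
  proof (rule local_profileE[OF loc[OF x]])
    fix f' r' assume "x < r'" "\<And>y. 0 \<le> y \<Longrightarrow> y \<le> r' \<Longrightarrow> 0 < msol \<beta> y"
    then show ?thesis using x by simp
  qed
  have eq: "msol \<beta> r powr m = 1 + prim \<beta> (msol \<beta>) r" if r: "0 \<le> r" for r
  proof (rule local_profileE[OF loc[OF r]])
    fix f' r' assume "r < r'" "\<And>y. 0 \<le> y \<Longrightarrow> y \<le> r' \<Longrightarrow> msol \<beta> y powr m = 1 + prim \<beta> (msol \<beta>) y"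
    then show ?thesis using r by simp
  qed
  show "profile \<beta> (msol \<beta>)"
    unfolding profile_def continuous_on_eq_continuous_within
    using local_profile_isCont[OF loc] pos eq by (auto simp: msol_0[OF be] less_imp_le)
qed

text \<open>The extension by zero still solves the Volterra equation:
  \<open>Z \<longlongrightarrow> 0\<close> makes the flux vanish at \<open>R\<close>. Beyond
  \<open>R\<close> the quantity \<open>x powr (N - 2) * flux\<close> is constant because
  \<open>f\<close> is zero, so the flux stays zero and \<open>prim\<close> keeps its value at
  \<open>R\<close>.\<close>

lemma msol_profile_compact:
  assumes be: "0 \<le> \<beta>" and S: "mdom \<beta> = {..<S}" and co: "compact_orbit \<beta> S (mh \<beta>) (mZ \<beta>)"
  shows "profile \<beta> (\<lambda>r. if r < exp S then msol \<beta> r else 0)"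
proof -
  define R where "R = exp S"
  define f where "f r = (if r < R then msol \<beta> r else 0)" for r
  have R0: "0 < R" unfolding R_def by simp
  have pos_dom: "r \<in> pos_dom \<beta>" if "0 \<le> r" "r < R" for r
  proof (cases "r = 0")
    case False
    then have "0 < r" using that by simp
    then have "ln r < S" using that unfolding R_def by (metis exp_less_cancel_iff exp_ln)
    then have "ln r \<in> mdom \<beta>" "exp (ln r) = r" using S \<open>0 < r\<close> by auto
    then show ?thesis unfolding mdom_def by simp
  qed (use dom_0[OF be] in simp)
  have loc: "local_profile \<beta> 1 (msol \<beta>) r" if "0 \<le> r" "r < R" for r by (rule msol_local[OF be pos_dom[OF that]])
  have pos: "0 < msol \<beta> x" if x: "0 \<le> x" "x < R" for x
  proof (rule local_profileE[OF loc[OF x]])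
    fix f' r' assume "x < r'" "\<And>y. 0 \<le> y \<Longrightarrow> y \<le> r' \<Longrightarrow> 0 < msol \<beta> y"
    then show ?thesis using x by simp
  qed
  have eq: "msol \<beta> r powr m = 1 + prim \<beta> (msol \<beta>) r" if r: "0 \<le> r" "r < R" for r
  proof (rule local_profileE[OF loc[OF r]])
    fix f' r' assume "r < r'" "\<And>y. 0 \<le> y \<Longrightarrow> y \<le> r' \<Longrightarrow> msol \<beta> y powr m = 1 + prim \<beta> (msol \<beta>) y"
    then show ?thesis using r by simp
  qed
  have h0: "(mh \<beta> \<longlongrightarrow> 0) (at_left S)" and Z0: "(mZ \<beta> \<longlongrightarrow> 0) (at_left S)"
    using co unfolding compact_orbit_def by auto
  have lnl: "filterlim ln (at_left S) (at_left R)"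
    unfolding filterlim_at
  proof
    have "(ln \<longlongrightarrow> ln R) (at_left R)" using R0 by (intro tendsto_intros) auto
    then show "(ln \<longlongrightarrow> S) (at_left R)" by (simp add: R_def)
    show "eventually (\<lambda>x. ln x \<in> {..<S} \<and> ln x \<noteq> S) (at_left R)"
      using eventually_at_left_real[OF R0]
    proof eventually_elim
      case (elim x)
      then have "ln x < S" unfolding R_def by (metis exp_less_cancel_iff exp_ln greaterThanLessThan_iff)
      then show ?case by simp
    qed
  qed
  have mR: "(msol \<beta> \<longlongrightarrow> 0) (at_left R)"
  proof -
    have "((\<lambda>x. x powr k * mh \<beta> (ln x)) \<longlongrightarrow> R powr k * 0) (at_left R)"
      using R0 by (intro tendsto_intros filterlim_compose[OF h0 lnl]) auto
    moreover have "eventually (\<lambda>x. x powr k * mh \<beta> (ln x) = msol \<beta> x) (at_left R)"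
      using eventually_at_left_real[OF R0]
    proof eventually_elim
      case (elim x)
      then show ?case by (simp add: log_h_def powr_def exp_minus)
    qed
    ultimately show ?thesis by (simp add: tendsto_cong)
  qed
  have fR: "(f \<longlongrightarrow> 0) (at_left R)"
    by (rule Lim_transform_eventually[OF mR]) (auto simp: f_def eventually_at_filter)
  have cf: "continuous_on {0..} f"
    unfolding continuous_on_eq_continuous_within
  proof
    fix r :: real assume r: "r \<in> {0..}"
    consider "r < R" | "r = R" | "R < r" by linarith
    then show "continuous (at r within {0..}) f"
    proof cases
      case 1
      have "continuous (at r within {0..}) (msol \<beta>)" using local_profile_isCont[OF loc[OF _ 1]] r by simp
      moreover have "eventually (\<lambda>x. msol \<beta> x = f x) (at r within {0..})"
        using order_tendstoD(2)[OF tendsto_ident_at 1] by eventually_elim (simp add: f_def)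
      ultimately have "(f \<longlongrightarrow> msol \<beta> r) (at r within {0..})"
        unfolding continuous_within by (rule Lim_transform_eventually)
      then show ?thesis unfolding continuous_within using 1 by (simp add: f_def[of r])
    next
      case 2
      have "(f \<longlongrightarrow> 0) (at_right R)"
        by (rule Lim_transform_eventually[OF tendsto_const]) (auto simp: f_def eventually_at_filter)
      with fR have "(f \<longlongrightarrow> 0) (at R)" by (simp add: filterlim_split_at)
      then have "(f \<longlongrightarrow> 0) (at R within {0..})" by (rule tendsto_within_subset) simp
      then have "(f \<longlongrightarrow> f R) (at R within {0..})" by (simp add: f_def[of R])
      then show ?thesis unfolding continuous_within 2 .
    next
      case 3
      have "(f \<longlongrightarrow> 0) (at r within {0..})"
      proof (rule Lim_transform_eventually[OF tendsto_const])
        show "eventually (\<lambda>x. 0 = f x) (at r within {0..})"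
          using order_tendstoD(1)[OF tendsto_ident_at 3] by eventually_elim (simp add: f_def)
      qed
      then show ?thesis unfolding continuous_within using 3 by (simp add: f_def)
    qed
  qed
  have fnn: "0 \<le> f x" if "0 \<le> x" for x using pos[OF that] by (auto simp: f_def less_imp_le)
  have peq: "prim \<beta> f r = prim \<beta> (msol \<beta>) r" "flux \<beta> f r = flux \<beta> (msol \<beta>) r" if "0 \<le> r" "r < R" for r
    using that by (auto intro!: prim_cong flux_cong simp: f_def)
  have eqf: "f r powr m = 1 + prim \<beta> f r" if "0 \<le> r" "r < R" for r
    using eq[OF that] peq[OF that] that by (simp add: f_def)
  note cprim = continuous_on_prim[OF cf fnn] and cflux = continuous_on_flux[OF cf fnn]
  have prR: "1 + prim \<beta> f R = 0"
  proof -
    have "((\<lambda>r. 1 + prim \<beta> f r) \<longlongrightarrow> 1 + prim \<beta> f R) (at_left R)"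
      by (intro tendsto_intros at_left_tendsto[OF cprim R0])
    moreover have "((\<lambda>r. f r powr m) \<longlongrightarrow> 0) (at_left R)"
    proof -
      have "eventually (\<lambda>x. 0 \<le> f x) (at_left R)"
        using eventually_at_left_real[OF R0] by eventually_elim (use fnn in auto)
      from tendsto_powr'[OF fR tendsto_const, of m] this show ?thesis using m_pos by simp
    qed
    then have "((\<lambda>r. 1 + prim \<beta> f r) \<longlongrightarrow> 0) (at_left R)"
      by (rule Lim_transform_eventually)
         (use eventually_at_left_real[OF R0] in eventually_elim, use eqf in auto)
    ultimately show ?thesis using tendsto_unique trivial_limit_at_left_real by blast
  qed
  have flR: "flux \<beta> f R = 0"
  proof -
    have "((\<lambda>r. flux \<beta> f r) \<longlongrightarrow> flux \<beta> f R) (at_left R)" by (intro at_left_tendsto[OF cflux R0])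
    moreover have "((\<lambda>x. x powr (k * m) * mZ \<beta> (ln x) - q * msol \<beta> x powr m) \<longlongrightarrow> R powr (k * m) * 0 - q * 0) (at_left R)"
    proof (intro tendsto_intros filterlim_compose[OF Z0 lnl])
      have "eventually (\<lambda>x. 0 \<le> msol \<beta> x) (at_left R)"
        using eventually_at_left_real[OF R0] by eventually_elim (use pos in \<open>auto simp: less_imp_le\<close>)
      from tendsto_powr'[OF mR tendsto_const, of m] this
      show "((\<lambda>x. msol \<beta> x powr m) \<longlongrightarrow> 0) (at_left R)" using m_pos by simp
    qed (use R0 in auto)
    then have "((\<lambda>r. flux \<beta> f r) \<longlongrightarrow> R powr (k * m) * 0 - q * 0) (at_left R)"
    proof (rule Lim_transform_eventually)
      show "eventually (\<lambda>x. x powr (k * m) * mZ \<beta> (ln x) - q * msol \<beta> x powr m = flux \<beta> f x) (at_left R)"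
        using eventually_at_left_real[OF R0]
      proof eventually_elim
        case (elim x)
        then have x: "0 < x" "x < R" by auto
        have "x powr (k * m) * exp (- (k * m) * ln x) = 1" using x by (simp add: powr_def exp_minus)
        then have "x powr (k * m) * mZ \<beta> (ln x) = flux \<beta> (msol \<beta>) x + q * msol \<beta> x powr m"
          unfolding log_Z_def using x by (simp add: mult.assoc[symmetric])
        then show ?case using peq(2)[of x] x by simp
      qed
    qed
    ultimately have "flux \<beta> f R = R powr (k * m) * 0 - q * 0"
      using tendsto_unique trivial_limit_at_left_real by blast
    then show ?thesis by simp
  qed
  have "prim \<beta> f r = prim \<beta> f R" if r: "R \<le> r" for r
  proof -
    have fz: "f x = 0" if "R \<le> x" for x using that by (simp add: f_def)
    have "x powr (N - 2) * flux \<beta> f x = R powr (N - 2) * flux \<beta> f R" if x: "R \<le> x" for x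
    proof (cases "x = R")
      case False
      show ?thesis
      proof (rule DERIV_isconst_end[where f = "\<lambda>x. x powr (N - 2) * flux \<beta> f x" and a = R and b = x])
        show "R < x" using x False by simp
        show "continuous_on {R..x} (\<lambda>x. x powr (N - 2) * flux \<beta> f x)"
          using R0 by (intro continuous_intros continuous_on_subset[OF cflux]) auto
        fix y assume y: "R < y" "y < x"
        then have y0: "0 < y" using R0 by simp
        have "((\<lambda>x. x powr (N - 2) * flux \<beta> f x) has_real_derivative
          (N - 2) * y powr (N - 2 - 1) * flux \<beta> f y + ((2 - N) * flux \<beta> f y + \<beta> * q * y powr (\<sigma>1 + 2) * f y - y powr (\<sigma>2 + 2) * f y powr p) / y * y powr (N - 2)) (at y)"
          by (rule DERIV_mult[OF has_real_derivative_powr[OF y0] has_real_derivative_flux[OF cf fnn y0]])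
        moreover have "y powr (N - 2 - 1) = y powr (N - 2) / y" using y0 by (subst powr_diff) simp
        ultimately show "((\<lambda>x. x powr (N - 2) * flux \<beta> f x) has_real_derivative 0) (at y)"
          using fz[of y] y y0 by (simp add: algebra_simps diff_divide_distrib)
      qed
    qed simp
    then have fl0: "flux \<beta> f x = 0" if "R \<le> x" for x using that R0 flR by force
    show ?thesis
    proof (cases "r = R")
      case False
      show ?thesis
      proof (rule DERIV_isconst_end[of R r])
        show "R < r" using r False by simp
        show "continuous_on {R..r} (prim \<beta> f)" using R0 by (intro continuous_on_subset[OF cprim]) auto
        fix y assume y: "R < y" "y < r"
        then have y0: "0 < y" using R0 by simp
        show "(prim \<beta> f has_real_derivative 0) (at y)"
          using has_real_derivative_prim[OF cf fnn y0, of \<beta>] fl0[of y] fz[of y] y by simp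
      qed
    qed simp
  qed
  note primc = this
  have eq2: "f r powr m = 1 + prim \<beta> f r" if "R \<le> r" for r
    unfolding primc[OF that] prR using that by (simp add: f_def[of r])
  have f0: "f 0 = 1" unfolding f_def using R0 msol_0[OF be] by simp
  have "f r powr m = f 0 powr m + prim \<beta> f r" if "0 \<le> r" for r
    unfolding f0 using eqf[OF that] eq2[of r] by (cases "r < R") auto
  note eqall = this
  have "profile \<beta> f"
    unfolding profile_def
  proof (intro conjI allI impI cf)
    show "0 < f 0" by (simp add: f0)
    show "0 \<le> f x" if "0 \<le> x" for x by (rule fnn[OF that])
    show "f r powr m = f 0 powr m + prim \<beta> f r" if "0 \<le> r" for r by (rule eqall[OF that])
  qed
  then show ?thesis unfolding f_def[abs_def] R_def .
qed

end

section \<open>Profiles are weak solutions\<close>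

lemma lborel_integral_translate:
  fixes f :: "'a::euclidean_space \<Rightarrow> real"
  assumes [measurable]: "f \<in> borel_measurable borel"
  shows "integral\<^sup>L lborel (\<lambda>x. f (x + c)) = integral\<^sup>L lborel f"
    "integrable lborel (\<lambda>x. f (x + c)) \<longleftrightarrow> integrable lborel f"
proof -
  have e: "distr lborel borel ((+) c) = lborel" by (rule lborel_distr_plus)
  show "integral\<^sup>L lborel (\<lambda>x. f (x + c)) = integral\<^sup>L lborel f"
    using integral_distr[of "(+) c" lborel borel f] unfolding e by (simp add: add.commute)
  show "integrable lborel (\<lambda>x. f (x + c)) \<longleftrightarrow> integrable lborel f"
    using integrable_distr_eq[of "(+) c" lborel borel f] unfolding e by (simp add: add.commute)
qed

text \<open>
  Translation invariance makes the integral of \<open>g (x + s *\<^sub>R b)\<close> independent of \<open>s\<close>; writing the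
  increment of \<open>g\<close> along a segment as an integral of \<open>D\<close>, Fubini gives the claim.
\<close>

lemma integral_directional_derivative_zero:
  fixes g D :: "'a::euclidean_space \<Rightarrow> real"
  assumes g: "integrable lborel g" and D: "integrable lborel D"
    and ftc: "AE x in lborel. ((\<lambda>s. D (x + s *\<^sub>R b)) has_integral g (x + b) - g x) {0..1}"
  shows "integral\<^sup>L lborel D = 0"
proof -
  have [measurable]: "D \<in> borel_measurable borel" "g \<in> borel_measurable borel"
    using g D by auto
  let ?H = "\<lambda>s x. indicator {0..1} s * D (x + s *\<^sub>R b)"
  have meas: "(\<lambda>(s, x). ?H s x) \<in> borel_measurable (lborel \<Otimes>\<^sub>M lborel)" by measurable
  have int: "integrable (lborel \<Otimes>\<^sub>M lborel) (\<lambda>(s, x). ?H s x)"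
  proof (rule lborel_pair.Fubini_integrable[OF meas])
    have "(\<integral>x. norm (?H s x) \<partial>lborel) = indicator {0..1} s * (\<integral>x. \<bar>D x\<bar> \<partial>lborel)" for s :: real
      using lborel_integral_translate(1)[of "\<lambda>x. \<bar>D x\<bar>" "s *\<^sub>R b"]
      by (simp add: abs_mult)
    moreover have "integrable lborel (\<lambda>s::real. indicator {0..1} s * (\<integral>x. \<bar>D x\<bar> \<partial>lborel))" by simp
    ultimately show "integrable lborel (\<lambda>s. \<integral>x. norm (case (s, x) of (s, x) \<Rightarrow> ?H s x) \<partial>lborel)"
      by simp
    show "AE s in lborel. integrable lborel (\<lambda>x. case (s, x) of (s, x) \<Rightarrow> ?H s x)"
      using lborel_integral_translate(2)[of D] D by simp
  qed
  have "(\<integral>x. (\<integral>s. ?H s x \<partial>lborel) \<partial>lborel) = (\<integral>s. (\<integral>x. ?H s x \<partial>lborel) \<partial>lborel)"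
    by (rule lborel_pair.Fubini_integral[OF int])
  also have "\<dots> = integral\<^sup>L lborel (\<lambda>s::real. indicator {0..1} s * integral\<^sup>L lborel D)"
    by (simp add: lborel_integral_translate(1))
  also have "\<dots> = integral\<^sup>L lborel D" by simp
  finally have 1: "(\<integral>x. (\<integral>s. ?H s x \<partial>lborel) \<partial>lborel) = integral\<^sup>L lborel D" .
  have "AE x in lborel. integrable lborel (\<lambda>s. ?H s x)"
    by (rule lborel_pair.AE_integrable_snd[OF int])
  with ftc have "AE x in lborel. (\<integral>s. ?H s x \<partial>lborel) = g (x + b) - g x"
  proof eventually_elim
    case (elim x)
    have "set_integrable lborel {0..1} (\<lambda>s. D (x + s *\<^sub>R b))"
      using elim(2) by (simp add: set_integrable_def)
    from set_borel_integral_eq_integral(2)[OF this] integral_unique[OF elim(1)]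
    show ?case by (simp add: set_lebesgue_integral_def)
  qed
  then have "(\<integral>x. (\<integral>s. ?H s x \<partial>lborel) \<partial>lborel) = (\<integral>x. g (x + b) - g x \<partial>lborel)"
    by (intro integral_cong_AE) (auto intro!: borel_measurable_integrable lborel_pair.integrable_snd[OF int])
  also have "\<dots> = (\<integral>x. g (x + b) \<partial>lborel) - (\<integral>x. g x \<partial>lborel)"
    using g lborel_integral_translate(2)[of g b] by (intro Bochner_Integration.integral_diff) auto
  also have "\<dots> = 0" by (simp add: lborel_integral_translate(1))
  finally show ?thesis using 1 by simp
qed

section \<open>Integration in comoving and in polar coordinates\<close>

lemma lborel_scale:
  fixes F :: "'a::euclidean_space \<Rightarrow> ennreal"
  assumes "0 < c" and [measurable]: "F \<in> borel_measurable borel"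
  shows "(\<integral>\<^sup>+x. F (c *\<^sub>R x) \<partial>lborel) * ennreal (c ^ DIM('a)) = (\<integral>\<^sup>+x. F x \<partial>lborel)"
proof -
  have "(\<integral>\<^sup>+x. F x \<partial>(lborel :: 'a measure)) = (\<integral>\<^sup>+x. F x \<partial>density (distr lborel borel (\<lambda>x. 0 + c *\<^sub>R x)) (\<lambda>_. \<bar>c\<bar>^DIM('a)))"
    using assms by (subst lborel_affine[of c "0 :: 'a"]) auto
  also have "\<dots> = (\<integral>\<^sup>+x. ennreal (c ^ DIM('a)) * F (c *\<^sub>R x) \<partial>lborel)"
    using assms by (simp add: nn_integral_density nn_integral_distr)
  also have "\<dots> = ennreal (c ^ DIM('a)) * (\<integral>\<^sup>+x. F (c *\<^sub>R x) \<partial>lborel)"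
    by (rule nn_integral_cmult) simp
  finally show ?thesis by (simp add: mult.commute)
qed

definition comoving :: "real \<Rightarrow> 'a::euclidean_space \<times> real \<Rightarrow> 'a \<times> real" where
  "comoving \<beta> z = (exp (\<beta> * snd z) *\<^sub>R fst z, snd z)"

lemma comoving_measurable [measurable]: "comoving \<beta> \<in> borel_measurable borel"
  unfolding comoving_def by (intro borel_measurable_continuous_onI continuous_intros)

text \<open>At each fixed time \<open>comoving\<close> is the dilation of space by
  \<open>exp (\<beta> * t)\<close>, whose Jacobian is the power \<open>DIM('a)\<close> of that
  factor; Tonelli's theorem glues the time slices.\<close>

lemma lborel_comoving:
  "lborel = distr (density lborel (\<lambda>z. ennreal (exp (real DIM('a) * \<beta> * snd z)))) borel (comoving \<beta> :: 'a::euclidean_space \<times> real \<Rightarrow> _)"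
proof (rule measure_eqI)
  fix X :: "('a \<times> real) set" assume "X \<in> sets lborel"
  then have X[measurable]: "X \<in> sets borel" by simp
  have X2[measurable]: "X \<in> sets (borel \<Otimes>\<^sub>M borel)" unfolding borel_prod by (rule X)
  let ?w = "\<lambda>z::'a \<times> real. ennreal (exp (real DIM('a) * \<beta> * snd z))"
  have ex: "exp (real DIM('a) * \<beta> * t) = exp (\<beta> * t) ^ DIM('a)" for t
    by (simp add: exp_of_nat_mult[symmetric] mult.assoc)
  have wm: "(\<lambda>z::'a \<times> real. exp (real DIM('a) * \<beta> * snd z)) \<in> borel_measurable borel"
    by (intro borel_measurable_continuous_onI continuous_intros)
  then have wm'[measurable]: "?w \<in> borel_measurable borel" by (intro measurable_compose[OF _ measurable_ennreal])
  have "emeasure (distr (density lborel ?w) borel (comoving \<beta>)) X = emeasure (density lborel ?w) (comoving \<beta> -` X)"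
    by (subst emeasure_distr) auto
  also have "\<dots> = (\<integral>\<^sup>+z. ?w z * indicator X (comoving \<beta> z) \<partial>lborel)"
  proof (subst emeasure_density)
    show "comoving \<beta> -` X \<in> sets lborel" using measurable_sets[OF comoving_measurable[of \<beta>] X] by simp
    show "?w \<in> borel_measurable lborel" by (subst measurable_cong_sets[OF sets_lborel refl]) (rule wm')
    show "(\<integral>\<^sup>+z. ?w z * indicator (comoving \<beta> -` X) z \<partial>lborel) = (\<integral>\<^sup>+z. ?w z * indicator X (comoving \<beta> z) \<partial>lborel)"
      by (auto intro!: nn_integral_cong simp: indicator_def)
  qed
  also have "\<dots> = (\<integral>\<^sup>+z. ?w z * indicator X (comoving \<beta> z) \<partial>(lborel \<Otimes>\<^sub>M lborel))"
    by (simp add: lborel_prod)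
  also have "\<dots> = (\<integral>\<^sup>+t. (\<integral>\<^sup>+x. ?w (x, t) * indicator X (comoving \<beta> (x, t)) \<partial>lborel) \<partial>lborel)"
    by (rule lborel_pair.nn_integral_snd[symmetric]) (simp add: lborel_prod)
  also have "\<dots> = (\<integral>\<^sup>+t. (\<integral>\<^sup>+x. indicator X (x, t) \<partial>lborel) \<partial>lborel)"
  proof (rule nn_integral_cong)
    fix t :: real
    have "(\<integral>\<^sup>+x. ?w (x, t) * indicator X (comoving \<beta> (x, t)) \<partial>lborel)
        = (\<integral>\<^sup>+x. indicator X (exp (\<beta> * t) *\<^sub>R x, t) \<partial>lborel) * ennreal (exp (\<beta> * t) ^ DIM('a))"
      unfolding comoving_def fst_conv snd_conv ex
      by (subst nn_integral_cmult) (simp_all add: mult.commute)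
    also have "\<dots> = (\<integral>\<^sup>+x. indicator X (x, t) \<partial>lborel)"
      by (rule lborel_scale) simp_all
    finally show "(\<integral>\<^sup>+x. ?w (x, t) * indicator X (comoving \<beta> (x, t)) \<partial>lborel) = (\<integral>\<^sup>+x. indicator X (x, t) \<partial>lborel)" .
  qed
  also have "\<dots> = (\<integral>\<^sup>+z. indicator X z \<partial>(lborel \<Otimes>\<^sub>M lborel))"
    by (rule lborel_pair.nn_integral_snd) simp
  also have "\<dots> = emeasure lborel X" by (simp add: lborel_prod)
  finally show "emeasure lborel X = emeasure (distr (density lborel ?w) borel (comoving \<beta>)) X" by simp
qed simp

lemma has_bochner_integral_comoving:
  fixes F :: "'a::euclidean_space \<times> real \<Rightarrow> real"
  assumes [measurable]: "F \<in> borel_measurable borel"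
  shows "has_bochner_integral lborel F c \<longleftrightarrow>
    has_bochner_integral lborel (\<lambda>z. exp (real DIM('a) * \<beta> * snd z) * F (comoving \<beta> z)) c"
proof -
  have [measurable]: "(\<lambda>z::'a \<times> real. exp (real DIM('a) * \<beta> * snd z)) \<in> borel_measurable borel"
    by (intro borel_measurable_continuous_onI continuous_intros)
  have "has_bochner_integral lborel F c \<longleftrightarrow>
      has_bochner_integral (distr (density lborel (\<lambda>z. ennreal (exp (real DIM('a) * \<beta> * snd z)))) borel (comoving \<beta>)) F c"
    by (subst lborel_comoving[of \<beta>]) simp
  also have "\<dots> \<longleftrightarrow> has_bochner_integral (density lborel (\<lambda>z. ennreal (exp (real DIM('a) * \<beta> * snd z)))) (\<lambda>z. F (comoving \<beta> z)) c"
    by (simp add: has_bochner_integral_iff integrable_distr_eq integral_distr)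
  also have "\<dots> \<longleftrightarrow> has_bochner_integral lborel (\<lambda>z. exp (real DIM('a) * \<beta> * snd z) * F (comoving \<beta> z)) c"
    by (simp add: has_bochner_integral_iff integrable_real_density integral_real_density)
  finally show ?thesis .
qed

text \<open>The surface area of the unit sphere, the derivative of the ball volume at radius
  one.\<close>

definition sphere_const :: "'a::euclidean_space itself \<Rightarrow> real" where
  "sphere_const _ = real DIM('a) * unit_ball_vol (real DIM('a))"

lemma sphere_const_pos: "0 < sphere_const TYPE('a::euclidean_space)"
  unfolding sphere_const_def by simp

text \<open>Both measures give \<open>{..a}\<close> the volume of the ball of radius
  \<open>a\<close>, and these half lines generate the Borel sets. For radial integrands this takes
  the place of spherical coordinates.\<close>

lemma distr_norm_lborel:
  "distr lborel borel (norm :: 'a::euclidean_space \<Rightarrow> real) =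
    density lborel (\<lambda>r. ennreal (sphere_const TYPE('a) * (indicator {0<..} r * r powr (real DIM('a) - 1))))"
proof (rule measure_eqI_generator_eq[where E = "range (\<lambda>a. {..a::real})" and \<Omega> = UNIV and A = "\<lambda>i. {..real i}"])
  let ?n = "real DIM('a)"
  let ?d = "\<lambda>r. ennreal (sphere_const TYPE('a) * (indicator {0<..} r * r powr (?n - 1)))"
  have n: "1 \<le> ?n" using DIM_positive[where 'a = 'a] by linarith
  show "Int_stable (range (\<lambda>a. {..a::real}))"
    unfolding Int_stable_def by (auto simp: Int_atMost)
  show "sets (distr lborel borel (norm :: 'a \<Rightarrow> real)) = sigma_sets UNIV (range (\<lambda>a. {..a}))"
    "sets (density lborel ?d) = sigma_sets UNIV (range (\<lambda>a. {..a}))"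
    by (simp_all add: borel_eq_atMost)
  have l: "emeasure (distr lborel borel (norm :: 'a \<Rightarrow> real)) {..a} = ennreal (if a < 0 then 0 else unit_ball_vol ?n * a powr ?n)" for a
  proof -
    have "emeasure (distr lborel borel (norm :: 'a \<Rightarrow> real)) {..a} = emeasure lborel (cball (0::'a) a)"
      by (subst emeasure_distr) (auto simp: cball_def vimage_def)
    also have "\<dots> = ennreal (if a < 0 then 0 else unit_ball_vol ?n * a powr ?n)"
      by (auto simp: emeasure_cball powr_realpow' less_le)
    finally show ?thesis .
  qed
  have r: "emeasure (density lborel ?d) {..a} = ennreal (if a < 0 then 0 else unit_ball_vol ?n * a powr ?n)" for a
  proof -
    let ?f = "\<lambda>r. sphere_const TYPE('a) * (indicator {0..a} r * r powr (?n - 1))"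
    have "emeasure (density lborel ?d) {..a} = (\<integral>\<^sup>+r. ?d r * indicator {..a} r \<partial>lborel)"
      by (rule emeasure_density) auto
    also have "\<dots> = (\<integral>\<^sup>+r. ennreal (?f r) \<partial>lborel)"
    proof (rule nn_integral_cong)
      fix r :: real
      show "?d r * indicator {..a} r = ennreal (?f r)"
        by (cases "r = 0") (auto simp: indicator_def)
    qed
    also have "\<dots> = ennreal (if a < 0 then 0 else unit_ball_vol ?n * a powr ?n)"
    proof (cases "a < 0")
      case True
      then have "?f r = 0" for r by (auto simp: indicator_def)
      then show ?thesis using True by simp
    next
      case False
      have "((\<lambda>r. r powr (?n - 1)) has_integral a powr ?n / ?n) {0..a}"
        using has_integral_powr_from_0[of "?n - 1" a] False n by simp
      then have "((\<lambda>r. if r \<in> {0..a} then r powr (?n - 1) else 0) has_integral a powr ?n / ?n) UNIV"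
        by (simp only: has_integral_restrict_UNIV)
      then have "((\<lambda>r. indicator {0..a} r * r powr (?n - 1)) has_integral a powr ?n / ?n) UNIV"
        by (rule has_integral_eq[rotated]) (auto simp: indicator_def)
      then have "(?f has_integral sphere_const TYPE('a) * (a powr ?n / ?n)) UNIV"
        by (rule has_integral_mult_right)
      then have "(\<integral>\<^sup>+r. ennreal (?f r) \<partial>lborel) = ennreal (sphere_const TYPE('a) * (a powr ?n / ?n))"
        by (intro nn_integral_has_integral_lborel) (use sphere_const_pos[where 'a = 'a] in \<open>auto simp: less_imp_le\<close>)
      then show ?thesis using False n by (simp add: sphere_const_def)
    qed
    finally show ?thesis .
  qed
  show "emeasure (distr lborel borel (norm :: 'a \<Rightarrow> real)) X = emeasure (density lborel ?d) X" if "X \<in> range (\<lambda>a. {..a})" for X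
    using that l r by auto
  show "emeasure (distr lborel borel (norm :: 'a \<Rightarrow> real)) {..real i} \<noteq> \<infinity>" for i
    unfolding l by simp
  show "(\<Union>i. {..real i}) = UNIV" using real_arch_simple by auto
qed auto

lemma radial_integral:
  fixes g :: "real \<Rightarrow> real"
  assumes [measurable]: "g \<in> borel_measurable borel"
  shows "integrable lborel (\<lambda>x::'a::euclidean_space. g (norm x)) \<longleftrightarrow>
      integrable lborel (\<lambda>r. indicator {0<..} r * r powr (real DIM('a) - 1) * g r)"
    "integral\<^sup>L lborel (\<lambda>x::'a. g (norm x)) =
      sphere_const TYPE('a) * integral\<^sup>L lborel (\<lambda>r. indicator {0<..} r * r powr (real DIM('a) - 1) * g r)"
proof -
  note cp = sphere_const_pos[where 'a = 'a]
  have "integrable lborel (\<lambda>x::'a. g (norm x)) \<longleftrightarrow> integrable (distr lborel borel (norm :: 'a \<Rightarrow> real)) g"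
    by (simp add: integrable_distr_eq)
  also have "\<dots> \<longleftrightarrow> integrable lborel (\<lambda>r. sphere_const TYPE('a) * (indicator {0<..} r * r powr (real DIM('a) - 1)) * g r)"
    unfolding distr_norm_lborel by (subst integrable_real_density) (use cp in \<open>auto simp: less_imp_le\<close>)
  also have "\<dots> \<longleftrightarrow> integrable lborel (\<lambda>r. indicator {0<..} r * r powr (real DIM('a) - 1) * g r)"
    using cp by (simp add: mult.assoc)
  finally show "integrable lborel (\<lambda>x::'a. g (norm x)) \<longleftrightarrow>
      integrable lborel (\<lambda>r. indicator {0<..} r * r powr (real DIM('a) - 1) * g r)" .
  have "integral\<^sup>L lborel (\<lambda>x::'a. g (norm x)) = integral\<^sup>L (distr lborel borel (norm :: 'a \<Rightarrow> real)) g"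
    by (simp add: integral_distr)
  also have "\<dots> = integral\<^sup>L lborel (\<lambda>r. sphere_const TYPE('a) * (indicator {0<..} r * r powr (real DIM('a) - 1)) * g r)"
    unfolding distr_norm_lborel by (subst integral_real_density) (use cp in \<open>auto simp: less_imp_le\<close>)
  finally show "integral\<^sup>L lborel (\<lambda>x::'a. g (norm x)) =
      sphere_const TYPE('a) * integral\<^sup>L lborel (\<lambda>r. indicator {0<..} r * r powr (real DIM('a) - 1) * g r)"
    by (simp add: mult.assoc)
qed

section \<open>Integrability of the singular weights against functions of bounded support\<close>

lemma norm_powr_integrable_cball:
  assumes "0 < real DIM('a::euclidean_space) + \<sigma>"
  shows "integrable lborel (\<lambda>x::'a. norm x powr \<sigma> * indicator {..R} (norm x))"
proof -
  have "(\<lambda>r. r powr (real DIM('a) + \<sigma> - 1) * 1) absolutely_integrable_on {0..max 0 R}"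
    by (rule powr_mult_absolutely_integrable) (use assms in auto)
  then have "integrable lebesgue (\<lambda>r. indicator {0..max 0 R} r * (r powr (real DIM('a) + \<sigma> - 1)))"
    by (simp add: set_integrable_def)
  then have "integrable lborel (\<lambda>r. indicator {0..max 0 R} r * (r powr (real DIM('a) + \<sigma> - 1)))"
    by (subst (asm) integrable_completion) auto
  then have "integrable lborel (\<lambda>r. indicator {0<..} r * r powr (real DIM('a) - 1) * (r powr \<sigma> * indicator {..R} r))"
  proof (rule Bochner_Integration.integrable_bound)
    show "AE r in lborel. norm (indicator {0<..} r * r powr (real DIM('a) - 1) * (r powr \<sigma> * indicator {..R} r))
        \<le> norm (indicator {0..max 0 R} r * (r powr (real DIM('a) + \<sigma> - 1)))"
    proof (intro AE_I2)
      fix r :: real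
      have "r powr (real DIM('a) + \<sigma> - 1) = r powr (real DIM('a) - 1) * r powr \<sigma>"
        by (simp flip: powr_add add: algebra_simps)
      then show "norm (indicator {0<..} r * r powr (real DIM('a) - 1) * (r powr \<sigma> * indicator {..R} r))
        \<le> norm (indicator {0..max 0 R} r * (r powr (real DIM('a) + \<sigma> - 1)))"
        by (auto simp: indicator_def)
    qed
  qed auto
  then show ?thesis by (subst radial_integral(1)) auto
qed

lemma weighted_integrable:
  fixes h :: "'a::euclidean_space \<Rightarrow> real"
  assumes "0 < real DIM('a) + \<sigma>" and [measurable]: "h \<in> borel_measurable borel"
    and bd: "\<And>x. \<bar>h x\<bar> \<le> C" and z: "\<And>x. R < norm x \<Longrightarrow> h x = 0"
  shows "integrable lborel (\<lambda>x. norm x powr \<sigma> * h x)"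
proof (rule Bochner_Integration.integrable_bound)
  show "integrable lborel (\<lambda>x::'a. C * (norm x powr \<sigma> * indicator {..R} (norm x)))"
    using norm_powr_integrable_cball[OF assms(1)] by simp
  show "AE x in lborel. norm (norm x powr \<sigma> * h x) \<le> norm (C * (norm x powr \<sigma> * indicator {..R} (norm x)))"
  proof (intro AE_I2)
    fix x :: 'a
    have "0 \<le> C" using bd[of 0] by linarith
    then show "norm (norm x powr \<sigma> * h x) \<le> norm (C * (norm x powr \<sigma> * indicator {..R} (norm x)))"
      using bd[of x] z[of x] mult_left_mono[OF bd[of x], of "norm x powr \<sigma>"]
      by (cases "norm x \<le> R") (auto simp: abs_mult mult.commute)
  qed
qed measurable

lemma weighted_integrable_prod:
  fixes h :: "'a::euclidean_space \<times> real \<Rightarrow> real"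
  assumes "0 < real DIM('a) + \<sigma>" and [measurable]: "h \<in> borel_measurable borel"
    and bd: "\<And>z. \<bar>h z\<bar> \<le> C" and z: "\<And>z. R < norm (fst z) \<or> T < \<bar>snd z\<bar> \<Longrightarrow> h z = 0"
  shows "integrable lborel (\<lambda>z. norm (fst z) powr \<sigma> * h z)"
proof -
  have [measurable]: "h \<in> borel_measurable (borel \<Otimes>\<^sub>M borel)" unfolding borel_prod by measurable
  let ?b = "\<lambda>z::'a \<times> real. norm (fst z) powr \<sigma> * indicator {..R} (norm (fst z)) * indicator {-T..T} (snd z)"
  have "integrable (lborel \<Otimes>\<^sub>M lborel) ?b"
  proof (rule lborel_pair.Fubini_integrable)
    show "?b \<in> borel_measurable (lborel \<Otimes>\<^sub>M lborel)" by measurable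
    have "(\<integral>t. norm (?b (x, t)) \<partial>lborel) = norm x powr \<sigma> * indicator {..R} (norm x) * measure lborel {-T..T}" for x
      by (simp add: abs_mult)
    then show "integrable lborel (\<lambda>x. \<integral>t. norm (?b (x, t)) \<partial>lborel)"
      using norm_powr_integrable_cball[OF assms(1), of R] by simp
    have "integrable lborel (indicator {-T..T} :: real \<Rightarrow> real)" by (simp add: integrable_indicator_iff emeasure_lborel_Icc_eq)
    then show "AE x in lborel. integrable lborel (\<lambda>t. ?b (x, t))" by simp
  qed
  then have b: "integrable lborel ?b" by (simp add: lborel_prod)
  show ?thesis
  proof (rule Bochner_Integration.integrable_bound)
    show "integrable lborel (\<lambda>z. C * ?b z)" using b by simp
    show "(\<lambda>z. norm (fst z) powr \<sigma> * h z) \<in> borel_measurable lborel"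
      by (simp add: lborel_prod[symmetric])
    show "AE z in lborel. norm (norm (fst z) powr \<sigma> * h z) \<le> norm (C * ?b z)"
    proof (intro AE_I2)
      fix w :: "'a \<times> real"
      have C: "0 \<le> C" using bd[of 0] by linarith
      show "norm (norm (fst w) powr \<sigma> * h w) \<le> norm (C * ?b w)"
      proof (cases "norm (fst w) \<le> R \<and> \<bar>snd w\<bar> \<le> T")
        case True
        then have b: "?b w = norm (fst w) powr \<sigma>" by (auto simp: indicator_def abs_le_iff)
        show ?thesis
          unfolding b using mult_left_mono[OF bd[of w], of "norm (fst w) powr \<sigma>"] C by (simp add: abs_mult mult.commute)
      next
        case False
        then have "h w = 0" using z[of w] by auto
        then show ?thesis by simp
      qed
    qed
  qed
qed

text \<open>Continuous partial derivatives give a total derivative: the increment is split along the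
  basis, by induction over subsets of \<open>Basis\<close>, with the mean value theorem in each
  direction. Test functions come with partial derivatives only, whereas a comoving point moves in
  space and time together.\<close>

lemma has_derivative_basis:
  fixes F :: "'e::euclidean_space \<Rightarrow> real"
  assumes der: "\<And>b x. b \<in> Basis \<Longrightarrow> ((\<lambda>s. F (x + s *\<^sub>R b)) has_real_derivative D b x) (at 0)"
    and cont: "\<And>b. b \<in> Basis \<Longrightarrow> continuous (at x) (D b)"
  shows "(F has_derivative (\<lambda>h. \<Sum>b\<in>Basis. (h \<bullet> b) * D b x)) (at x)"
  unfolding has_derivative_at_within[symmetric]
proof (subst has_derivative_at_alt, intro conjI allI impI)
  show "bounded_linear (\<lambda>h. \<Sum>b\<in>Basis. (h \<bullet> b) * D b x)"
    by (intro bounded_linear_sum bounded_linear_mult_const bounded_linear_inner_left)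
  have der': "((\<lambda>s. F (y + s *\<^sub>R b)) has_real_derivative D b (y + u *\<^sub>R b)) (at u)" if "b \<in> Basis" for b y u
  proof -
    have "((\<lambda>s. F ((y + u *\<^sub>R b) + s *\<^sub>R b)) has_real_derivative D b (y + u *\<^sub>R b)) (at 0)"
      by (rule der[OF that])
    then have "((\<lambda>s. F (y + (s + u) *\<^sub>R b)) has_real_derivative D b (y + u *\<^sub>R b)) (at 0)"
      by (simp add: algebra_simps)
    then show ?thesis using DERIV_shift[of "\<lambda>s. F (y + s *\<^sub>R b)" "D b (y + u *\<^sub>R b)" 0 u] by simp
  qed
  have main: "\<exists>d>0. \<forall>h. norm h < d \<longrightarrow>
      \<bar>F (x + (\<Sum>b\<in>S. (h \<bullet> b) *\<^sub>R b)) - F x - (\<Sum>b\<in>S. (h \<bullet> b) * D b x)\<bar> \<le> e * norm h"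
    if "S \<subseteq> Basis" "0 < e" for S e
    using finite_subset[OF that(1) finite_Basis] that
  proof (induction S arbitrary: e rule: finite_induct)
    case empty
    then show ?case by (auto intro!: exI[of _ 1])
  next
    case (insert c S)
    have c: "c \<in> Basis" using insert by simp
    have e2: "0 < e / 2" using insert by simp
    obtain d1 where d1: "d1 > 0" "\<And>h. norm h < d1 \<Longrightarrow>
      \<bar>F (x + (\<Sum>b\<in>S. (h \<bullet> b) *\<^sub>R b)) - F x - (\<Sum>b\<in>S. (h \<bullet> b) * D b x)\<bar> \<le> e / 2 * norm h"
      using insert.IH[OF _ e2] insert.prems by auto
    obtain d2 where d2: "d2 > 0" "\<And>y. dist y x < d2 \<Longrightarrow> dist (D c y) (D c x) < e / 2"
      using cont[OF c] e2 unfolding continuous_at_eps_delta by blast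
    \<comment> \<open>Every point met on the coordinate path from \<open>x\<close> to
      \<open>x + h\<close> is within \<open>K * norm h\<close> of \<open>x\<close>.\<close>
    define K where "K = real DIM('e) + 1"
    have K: "0 < K" unfolding K_def by simp
    show ?case
    proof (intro exI[of _ "min d1 (d2 / K)"] conjI allI impI)
      show "0 < min d1 (d2 / K)" using d1 d2 K by simp
      fix h :: 'e assume h: "norm h < min d1 (d2 / K)"
      define y where "y = x + (\<Sum>b\<in>S. (h \<bullet> b) *\<^sub>R b)"
      have near: "dist (D c (y + s *\<^sub>R c)) (D c x) < e / 2" if "\<bar>s\<bar> \<le> norm h" for s
      proof (rule d2(2))
        have "dist (y + s *\<^sub>R c) x \<le> norm (\<Sum>b\<in>S. (h \<bullet> b) *\<^sub>R b) + norm (s *\<^sub>R c)"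
          using norm_triangle_ineq[of "\<Sum>b\<in>S. (h \<bullet> b) *\<^sub>R b" "s *\<^sub>R c"]
          unfolding y_def dist_norm by (simp add: algebra_simps)
        also have "norm (\<Sum>b\<in>S. (h \<bullet> b) *\<^sub>R b) \<le> (\<Sum>b\<in>S. norm h)"
          by (rule order_trans[OF norm_sum], rule sum_mono)
             (use insert.prems in \<open>auto simp: Basis_le_norm subset_iff\<close>)
        also have "\<dots> \<le> real DIM('e) * norm h"
          using card_mono[OF finite_Basis, of S] insert.prems by (simp add: mult_right_mono)
        also have "norm (s *\<^sub>R c) \<le> norm h" using that c by simp
        finally have "dist (y + s *\<^sub>R c) x \<le> K * norm h" unfolding K_def by (simp add: algebra_simps)
        also have "\<dots> < d2" using h K by (simp add: field_simps)
        finally show "dist (y + s *\<^sub>R c) x < d2" .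
      qed
      have hc: "\<bar>h \<bullet> c\<bar> \<le> norm h" by (rule Basis_le_norm[OF c])
      have "\<exists>s. \<bar>s\<bar> \<le> norm h \<and> F (y + (h \<bullet> c) *\<^sub>R c) - F y = (h \<bullet> c) * D c (y + s *\<^sub>R c)"
      proof (cases "h \<bullet> c" "0::real" rule: linorder_cases)
        case equal
        then show ?thesis by (auto intro!: exI[of _ 0])
      next
        case less
        obtain s where "h \<bullet> c < s" "s < 0" "F (y + 0 *\<^sub>R c) - F (y + (h \<bullet> c) *\<^sub>R c) = (0 - h \<bullet> c) * D c (y + s *\<^sub>R c)"
          using MVT2[OF less, of "\<lambda>s. F (y + s *\<^sub>R c)" "\<lambda>s. D c (y + s *\<^sub>R c)", OF der'[OF c]] by blast
        then show ?thesis using hc by (intro exI[of _ s]) (auto simp: algebra_simps)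
      next
        case greater
        obtain s where "0 < s" "s < h \<bullet> c" "F (y + (h \<bullet> c) *\<^sub>R c) - F (y + 0 *\<^sub>R c) = (h \<bullet> c - 0) * D c (y + s *\<^sub>R c)"
          using MVT2[OF greater, of "\<lambda>s. F (y + s *\<^sub>R c)" "\<lambda>s. D c (y + s *\<^sub>R c)", OF der'[OF c]] by blast
        then show ?thesis using hc by (intro exI[of _ s]) auto
      qed
      then obtain s where s: "\<bar>s\<bar> \<le> norm h" "F (y + (h \<bullet> c) *\<^sub>R c) - F y = (h \<bullet> c) * D c (y + s *\<^sub>R c)" by blast
      have "\<bar>(h \<bullet> c) * D c (y + s *\<^sub>R c) - (h \<bullet> c) * D c x\<bar> = \<bar>h \<bullet> c\<bar> * \<bar>D c (y + s *\<^sub>R c) - D c x\<bar>"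
        by (simp add: abs_mult right_diff_distrib[symmetric])
      also have "\<dots> \<le> norm h * (e / 2)"
        using hc near[OF s(1)] by (intro mult_mono) (auto simp: dist_real_def)
      finally have 1: "\<bar>(h \<bullet> c) * D c (y + s *\<^sub>R c) - (h \<bullet> c) * D c x\<bar> \<le> e / 2 * norm h" by (simp add: mult.commute)
      have 2: "\<bar>F y - F x - (\<Sum>b\<in>S. (h \<bullet> b) * D b x)\<bar> \<le> e / 2 * norm h"
        unfolding y_def using h by (intro d1(2)) simp
      have 3: "x + (\<Sum>b\<in>insert c S. (h \<bullet> b) *\<^sub>R b) = y + (h \<bullet> c) *\<^sub>R c"
        unfolding y_def using insert.hyps by (simp add: algebra_simps)
      have 4: "(\<Sum>b\<in>insert c S. (h \<bullet> b) * D b x) = (h \<bullet> c) * D c x + (\<Sum>b\<in>S. (h \<bullet> b) * D b x)"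
        using insert.hyps by simp
      show "\<bar>F (x + (\<Sum>b\<in>insert c S. (h \<bullet> b) *\<^sub>R b)) - F x - (\<Sum>b\<in>insert c S. (h \<bullet> b) * D b x)\<bar> \<le> e * norm h"
        unfolding 3 4 using 1 2 s(2) by linarith
    qed
  qed
  fix e :: real assume "0 < e"
  from main[OF order_refl this]
  obtain d where d: "d > 0" "\<And>h. norm h < d \<Longrightarrow>
      \<bar>F (x + (\<Sum>b\<in>Basis. (h \<bullet> b) *\<^sub>R b)) - F x - (\<Sum>b\<in>Basis. (h \<bullet> b) * D b x)\<bar> \<le> e * norm h" by blast
  show "\<exists>d>0. \<forall>y. norm (y - x) < d \<longrightarrow> norm (F y - F x - (\<Sum>b\<in>Basis. ((y - x) \<bullet> b) * D b x)) \<le> e * norm (y - x)"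
    using d(1) d(2)[of "y - x" for y] by (intro exI[of _ d]) (auto simp: euclidean_representation)
qed

lemma continuous_compact_support_bounded:
  fixes h :: "'a::euclidean_space \<Rightarrow> real"
  assumes "continuous_on UNIV h" "\<And>y. R < norm y \<Longrightarrow> h y = 0"
  obtains C where "\<And>y. \<bar>h y\<bar> \<le> C"
proof -
  have "compact (h ` cball 0 R)"
    by (intro compact_continuous_image continuous_on_subset[OF assms(1)]) auto
  then obtain C where C: "0 < C" "\<And>y. y \<in> cball 0 R \<Longrightarrow> \<bar>h y\<bar> \<le> C"
    unfolding real_norm_def[symmetric] using compact_imp_bounded bounded_pos by (metis imageI)
  have "\<bar>h y\<bar> \<le> C" for y
    using C(2)[of y] C(1) assms(2)[of y] by (cases "norm y \<le> R") auto
  then show ?thesis by (rule that)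
qed

lemma continuous_compact_support_integrable:
  fixes h :: "'a::euclidean_space \<Rightarrow> real"
  assumes "continuous_on UNIV h" "\<And>y. R < norm y \<Longrightarrow> h y = 0"
  shows "integrable lborel h"
proof -
  have "integrable lborel (\<lambda>x. indicator (cball 0 R) x *\<^sub>R h x)"
    by (rule borel_integrable_compact) (auto intro: continuous_on_subset[OF assms(1)])
  moreover have "(\<lambda>x. indicator (cball 0 R) x *\<^sub>R h x) = h"
    using assms(2) by (auto simp: indicator_def not_le fun_eq_iff)
  ultimately show ?thesis by (simp only:)
qed

section \<open>Supports and derivatives of test functions\<close>

definition vanishes_beyond :: "real \<Rightarrow> ('a::euclidean_space \<Rightarrow> real \<Rightarrow> real) \<Rightarrow> bool" where
  "vanishes_beyond R \<psi> \<longleftrightarrow> (\<forall>x t. R < norm (x, t) \<longrightarrow> \<psi> x t = 0)"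

lemma vanishes_beyond_space_deriv:
  assumes "vanishes_beyond R \<psi>"
  shows "vanishes_beyond R (space_deriv b \<psi>)"
  unfolding vanishes_beyond_def
proof (intro allI impI)
  fix x :: 'a and t :: real assume "R < norm (x, t)"
  moreover have "((\<lambda>h. norm (x + h *\<^sub>R b, t)) \<longlongrightarrow> norm (x + 0 *\<^sub>R b, t)) (nhds 0)"
    by (intro tendsto_intros) (simp add: filterlim_ident)
  ultimately have "eventually (\<lambda>h. R < norm (x + h *\<^sub>R b, t)) (nhds 0)"
    by (intro order_tendstoD(1)) auto
  then have "eventually (\<lambda>h. \<psi> (x + h *\<^sub>R b) t = 0) (nhds 0)"
    by eventually_elim (use assms in \<open>simp add: vanishes_beyond_def\<close>)
  from deriv_cong_ev[OF this refl] show "space_deriv b \<psi> x t = 0"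
    unfolding space_deriv_def by simp
qed

lemma vanishes_beyond_time_deriv:
  assumes "vanishes_beyond R \<psi>"
  shows "vanishes_beyond R (time_deriv \<psi>)"
  unfolding vanishes_beyond_def
proof (intro allI impI)
  fix x :: 'a and t :: real assume "R < norm (x, t)"
  moreover have "((\<lambda>s. norm (x, s)) \<longlongrightarrow> norm (x, t)) (nhds t)"
    by (intro tendsto_intros) (simp add: filterlim_ident)
  ultimately have "eventually (\<lambda>s. R < norm (x, s)) (nhds t)"
    by (intro order_tendstoD(1)) auto
  then have "eventually (\<lambda>s. \<psi> x s = 0) (nhds t)"
    by eventually_elim (use assms in \<open>simp add: vanishes_beyond_def\<close>)
  from deriv_cong_ev[OF this refl] show "time_deriv \<psi> x t = 0"
    unfolding time_deriv_def by simp
qed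

lemma test_function_vanishes:
  assumes "test_function \<phi>"
  obtains R where "0 < R" "vanishes_beyond R \<phi>"
proof -
  have "bounded (closure {(x, t). \<phi> x t \<noteq> 0})"
    using assms compact_imp_bounded unfolding test_function_def by blast
  then obtain R where "0 < R" "\<And>z. z \<in> closure {(x, t). \<phi> x t \<noteq> 0} \<Longrightarrow> norm z \<le> R"
    using bounded_pos by blast
  moreover have "{(x, t). \<phi> x t \<noteq> 0} \<subseteq> closure {(x, t). \<phi> x t \<noteq> 0}" by (rule closure_subset)
  ultimately have "vanishes_beyond R \<phi>" unfolding vanishes_beyond_def by force
  with \<open>0 < R\<close> show ?thesis by (rule that)
qed

text \<open>For \<open>\<bar>t\<bar> \<le> R\<close> the dilation factor is at least
  \<open>exp (- \<bar>\<beta>\<bar> * R)\<close>, which fixes the radius in the comoving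
  variable.\<close>

lemma vanishes_beyond_comoving:
  assumes "vanishes_beyond R \<psi>" "0 < R" "R * exp (\<bar>\<beta>\<bar> * R) < norm y \<or> R < \<bar>t\<bar>"
  shows "\<psi> (exp (\<beta> * t) *\<^sub>R y) t = 0"
proof (cases "R < \<bar>t\<bar>")
  case True
  then have "R < norm (exp (\<beta> * t) *\<^sub>R y, t)" using norm_snd_le[of t "exp (\<beta> * t) *\<^sub>R y"] by simp
  then show ?thesis using assms(1) unfolding vanishes_beyond_def by blast
next
  case False
  then have y: "R * exp (\<bar>\<beta>\<bar> * R) < norm y" using assms(3) by simp
  have "- (\<beta> * t) \<le> \<bar>\<beta>\<bar> * \<bar>t\<bar>" by (metis abs_ge_minus_self abs_mult)
  also have "\<dots> \<le> \<bar>\<beta>\<bar> * R" using False by (intro mult_left_mono) auto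
  finally have "R * exp (- (\<beta> * t)) \<le> R * exp (\<bar>\<beta>\<bar> * R)" using assms(2) by simp
  then have "R * exp (- (\<beta> * t)) < norm y" using y by linarith
  then have "R < exp (\<beta> * t) * norm y" by (simp add: exp_minus field_simps)
  then have "R < norm (exp (\<beta> * t) *\<^sub>R y, t)"
    using norm_fst_le[of "exp (\<beta> * t) *\<^sub>R y" t] by simp
  then show ?thesis using assms(1) unfolding vanishes_beyond_def by blast
qed

lemma test_function_derivs:
  assumes "test_function \<phi>"
  shows "jointly_continuous \<phi>" "jointly_continuous (time_deriv \<phi>)"
    "\<And>b. b \<in> Basis \<Longrightarrow> jointly_continuous (space_deriv b \<phi>)"
    "\<And>b. b \<in> Basis \<Longrightarrow> jointly_continuous (space_deriv b (space_deriv b \<phi>))"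
    "\<And>x t. ((\<lambda>t. \<phi> x t) has_real_derivative time_deriv \<phi> x t) (at t)"
    "\<And>b x t. b \<in> Basis \<Longrightarrow> ((\<lambda>h. \<phi> (x + h *\<^sub>R b) t) has_real_derivative space_deriv b \<phi> x t) (at 0)"
    "\<And>b x t. b \<in> Basis \<Longrightarrow> ((\<lambda>h. space_deriv b \<phi> (x + h *\<^sub>R b) t) has_real_derivative space_deriv b (space_deriv b \<phi>) x t) (at 0)"
proof -
  have sd: "space_deriv b \<psi> x t = deriv (\<lambda>h. \<psi> (x + h *\<^sub>R b) t) 0" for b \<psi> and x :: 'a and t
    by (rule space_deriv_def)
  show "jointly_continuous \<phi>" "jointly_continuous (time_deriv \<phi>)"
    "\<And>b. b \<in> Basis \<Longrightarrow> jointly_continuous (space_deriv b \<phi>)"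
    "\<And>b. b \<in> Basis \<Longrightarrow> jointly_continuous (space_deriv b (space_deriv b \<phi>))"
    using assms unfolding test_function_def time_C1_def space_C1_def by blast+
  show "((\<lambda>t. \<phi> x t) has_real_derivative time_deriv \<phi> x t) (at t)" for x t
    using assms unfolding test_function_def time_C1_def time_deriv_def DERIV_deriv_iff_field_differentiable by blast
  show "((\<lambda>h. \<phi> (x + h *\<^sub>R b) t) has_real_derivative space_deriv b \<phi> x t) (at 0)" if "b \<in> Basis" for b x t
    using assms that unfolding test_function_def space_C1_def sd DERIV_deriv_iff_field_differentiable by blast
  show "((\<lambda>h. space_deriv b \<phi> (x + h *\<^sub>R b) t) has_real_derivative space_deriv b (space_deriv b \<phi>) x t) (at 0)"
    if "b \<in> Basis" for b x t
    unfolding sd[of b "space_deriv b \<phi>"] DERIV_deriv_iff_field_differentiable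
    using assms that unfolding test_function_def space_C1_def by blast
qed

lemma has_real_derivative_norm_line:
  fixes y b :: "'a::euclidean_space"
  assumes "y \<noteq> 0"
  shows "((\<lambda>s. norm (y + s *\<^sub>R b)) has_real_derivative (y \<bullet> b) / norm y) (at 0)"
proof -
  have "((\<lambda>s. y \<bullet> y + 2 * s * (y \<bullet> b) + s\<^sup>2 * (b \<bullet> b)) has_real_derivative 2 * (y \<bullet> b)) (at 0)"
    by (auto intro!: derivative_eq_intros)
  moreover have "(\<lambda>s. y \<bullet> y + 2 * s * (y \<bullet> b) + s\<^sup>2 * (b \<bullet> b)) = (\<lambda>s. (y + s *\<^sub>R b) \<bullet> (y + s *\<^sub>R b))"
    by (simp add: fun_eq_iff inner_simps inner_commute power2_eq_square algebra_simps)
  ultimately have "((\<lambda>s. (y + s *\<^sub>R b) \<bullet> (y + s *\<^sub>R b)) has_real_derivative 2 * (y \<bullet> b)) (at 0)" by simp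
  from DERIV_chain2[OF DERIV_real_sqrt this] assms show ?thesis
    by (simp add: norm_eq_sqrt_inner inverse_eq_divide)
qed

lemma shift_line_derivative:
  fixes F :: "'a::euclidean_space \<Rightarrow> real"
  assumes "\<And>y. P y \<Longrightarrow> ((\<lambda>s. F (y + s *\<^sub>R b)) has_real_derivative F' y) (at 0)" "P (y + u *\<^sub>R b)"
  shows "((\<lambda>s. F (y + s *\<^sub>R b)) has_real_derivative F' (y + u *\<^sub>R b)) (at u)"
proof -
  have "((\<lambda>s. F ((y + u *\<^sub>R b) + s *\<^sub>R b)) has_real_derivative F' (y + u *\<^sub>R b)) (at 0)"
    by (rule assms(1)[OF assms(2)])
  moreover have "(\<lambda>s. F ((y + u *\<^sub>R b) + s *\<^sub>R b)) = (\<lambda>s. F (y + (s + u) *\<^sub>R b))"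
    by (simp add: fun_eq_iff algebra_simps)
  ultimately have "((\<lambda>s. F (y + (s + u) *\<^sub>R b)) has_real_derivative F' (y + u *\<^sub>R b)) (at 0)"
    by (simp only:)
  then show ?thesis using DERIV_shift[of "\<lambda>s. F (y + s *\<^sub>R b)" "F' (y + u *\<^sub>R b)" 0 u] by simp
qed

text \<open>The exceptional points lie on the line spanned by \<open>b\<close>, a null set in
  dimension at least two. For all others, integration in direction \<open>b\<close> never meets the
  singularity of the weights.\<close>

lemma AE_line_avoids_0:
  fixes b :: "'a::euclidean_space"
  assumes "2 \<le> DIM('a)"
  shows "AE y in lborel. \<forall>s. y + s *\<^sub>R b \<noteq> 0"
proof -
  have "dim (span {b}) \<le> 1" using dim_le_card[of "span {b}" "{b}"] by (simp add: dim_span)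
  then have "negligible (span {b})" using assms by (intro negligible_lowdim) simp
  moreover have "closed (span {b})" by simp
  ultimately have "span {b} \<in> null_sets lborel"
    by (simp add: negligible_iff_null_sets null_sets_completion_iff borel_closed)
  then show ?thesis
  proof (rule AE_I')
    show "{y \<in> space lborel. \<not> (\<forall>s. y + s *\<^sub>R b \<noteq> 0)} \<subseteq> span {b}"
    proof
      fix y assume "y \<in> {y \<in> space lborel. \<not> (\<forall>s. y + s *\<^sub>R b \<noteq> 0)}"
      then obtain s where "y + s *\<^sub>R b = 0" by blast
      then have "y = (- s) *\<^sub>R b" by (simp add: eq_neg_iff_add_eq_0)
      then show "y \<in> span {b}" by (metis span_base span_mul singletonI)
    qed
  qed
qed

text \<open>Serves dimension one, where some line always hits the origin: both exponents then exceed
  \<open>-1\<close>, and the factor \<open>y \<bullet> b\<close> makes the weighted field continuous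
  with value \<open>0\<close> there.\<close>

lemma continuous_on_norm_powr_mult_inner:
  fixes b :: "'a::euclidean_space"
  assumes "0 \<notin> S \<or> -1 < \<sigma>" "b \<in> Basis"
  shows "continuous_on S (\<lambda>y. norm y powr \<sigma> * (y \<bullet> b))"
  unfolding continuous_on_eq_continuous_within
proof
  fix y assume y: "y \<in> S"
  show "continuous (at y within S) (\<lambda>y. norm y powr \<sigma> * (y \<bullet> b))"
  proof (cases "y = 0")
    case False
    then show ?thesis unfolding continuous_within by (intro tendsto_intros) auto
  next
    case True
    then have s: "0 < \<sigma> + 1" using assms(1) y by auto
    have "((\<lambda>z. norm z powr \<sigma> * (z \<bullet> b)) \<longlongrightarrow> 0) (at 0 within S)"
    proof (rule Lim_null_comparison)
      show "eventually (\<lambda>z. norm (norm z powr \<sigma> * (z \<bullet> b)) \<le> norm z powr (\<sigma> + 1)) (at 0 within S)"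
      proof (intro always_eventually allI)
        fix z :: 'a
        have "norm z powr \<sigma> * \<bar>z \<bullet> b\<bar> \<le> norm z powr \<sigma> * norm z"
          by (intro mult_left_mono Basis_le_norm assms(2)) auto
        also have "\<dots> = norm z powr (\<sigma> + 1)" by (cases "z = 0") (simp_all add: powr_add)
        finally show "norm (norm z powr \<sigma> * (z \<bullet> b)) \<le> norm z powr (\<sigma> + 1)" by (simp add: abs_mult)
      qed
      have "((\<lambda>z. norm z powr (\<sigma> + 1)) \<longlongrightarrow> norm (0::'a) powr (\<sigma> + 1)) (at 0 within S)"
        using s by (intro tendsto_powr' tendsto_intros) auto
      then show "((\<lambda>z. norm z powr (\<sigma> + 1)) \<longlongrightarrow> 0) (at 0 within S)" by simp
    qed
    then show ?thesis unfolding True continuous_within by simp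
  qed
qed

context profile_parameters
begin

text \<open>Divergence theorem for the field
  \<open>f powr m * grad \<Phi> - (flux / norm y ^ 2) * \<Phi> * y\<close>. Using the flux in place
  of the gradient of \<open>f powr m\<close> leaves the weighted transport term
  \<open>\<beta> * f * (y \<bullet> grad \<Phi>)\<close> as their difference, so \<open>f\<close>
  itself is never differentiated and may be irregular at the edge of its support.\<close>

lemma spatial_identity:
  fixes \<Phi> :: "'a::euclidean_space \<Rightarrow> real" and \<Phi>1 \<Phi>2 :: "'a \<Rightarrow> 'a \<Rightarrow> real"
  assumes N: "N = real DIM('a)" and pr: "profile \<beta> f"
    and d1: "\<And>b y. b \<in> Basis \<Longrightarrow> ((\<lambda>s. \<Phi> (y + s *\<^sub>R b)) has_real_derivative \<Phi>1 b y) (at 0)"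
    and d2: "\<And>b y. b \<in> Basis \<Longrightarrow> ((\<lambda>s. \<Phi>1 b (y + s *\<^sub>R b)) has_real_derivative \<Phi>2 b y) (at 0)"
    and c: "continuous_on UNIV \<Phi>" "\<And>b. b \<in> Basis \<Longrightarrow> continuous_on UNIV (\<Phi>1 b)"
      "\<And>b. b \<in> Basis \<Longrightarrow> continuous_on UNIV (\<Phi>2 b)"
    and v: "\<And>y. R < norm y \<Longrightarrow> \<Phi> y = 0" "\<And>b y. b \<in> Basis \<Longrightarrow> R < norm y \<Longrightarrow> \<Phi>1 b y = 0"
      "\<And>b y. b \<in> Basis \<Longrightarrow> R < norm y \<Longrightarrow> \<Phi>2 b y = 0"
  shows "(\<integral>y. f (norm y) powr m * (\<Sum>b\<in>Basis. \<Phi>2 b y)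
     - norm y powr \<sigma>1 * (f (norm y) * (\<beta> * (\<Sum>b\<in>Basis. (y \<bullet> b) * \<Phi>1 b y) + \<beta> * q * \<Phi> y))
     + norm y powr \<sigma>2 * (f (norm y) powr p * \<Phi> y) \<partial>lborel) = 0"
proof -
  note pd = profileD[OF pr]
  define G1 where "G1 = pmean (N + \<sigma>1) f"
  define G2 where "G2 = pmean (N + \<sigma>2) (\<lambda>x. f x powr p)"
  have cn: "continuous_on UNIV (\<lambda>y::'a. g (norm y))" if "continuous_on {0..} g" for g :: "real \<Rightarrow> real"
    by (rule continuous_on_compose2[OF that]) (auto intro: continuous_intros)
  have fp: "continuous_on {0..} (\<lambda>x. f x powr p)" by (rule continuous_on_powr_p[OF pd(1,2)])
  have fm: "continuous_on {0..} (\<lambda>x. f x powr m)"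
    using pd(1,2) m_pos by (intro continuous_on_powr' continuous_intros) auto
  have cG: "continuous_on UNIV (\<lambda>y::'a. f (norm y))" "continuous_on UNIV (\<lambda>y::'a. f (norm y) powr p)"
    "continuous_on UNIV (\<lambda>y::'a. f (norm y) powr m)"
    "continuous_on UNIV (\<lambda>y::'a. G1 (norm y))" "continuous_on UNIV (\<lambda>y::'a. G2 (norm y))"
    unfolding G1_def G2_def
    by (intro cn pd(1) fp fm continuous_on_pmean N_\<sigma>1 N_\<sigma>2)+
  \<comment> \<open>Squared direction cosines: bounded by \<open>1\<close> and, away from the
    origin, summing to \<open>1\<close> over the basis.\<close>
  define cc where "cc b y = (y \<bullet> b)\<^sup>2 / (norm y)\<^sup>2" for b y :: 'a
  have cc1: "\<bar>cc b y\<bar> \<le> 1" if "b \<in> Basis" for b y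
  proof -
    have "(y \<bullet> b)\<^sup>2 \<le> (norm y)\<^sup>2" using Basis_le_norm[OF that, of y] by (metis abs_norm_cancel abs_le_square_iff)
    then show ?thesis unfolding cc_def by (simp add: divide_le_eq_1)
  qed
  have ccm: "cc b \<in> borel_measurable borel" for b unfolding cc_def[abs_def] by measurable
  define U1 where "U1 b y = - \<beta> * (y \<bullet> b) * f (norm y) * \<Phi>1 b y - \<beta> * q * G1 (norm y) * \<Phi> y" for b y
  define U2 where "U2 y = - \<beta> * q * (f (norm y) - N * G1 (norm y)) * \<Phi> y" for y
  define U3 where "U3 y = G2 (norm y) * \<Phi> y" for y
  define U4 where "U4 y = - (N * G2 (norm y) - f (norm y) powr p) * \<Phi> y" for y
  \<comment> \<open>The derivative of the component \<open>g b\<close> in direction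
    \<open>b\<close>, arranged so that each weight multiplies a bounded function of bounded support;
    the terms with \<open>cc\<close> come from the radial derivative of
    \<open>flux / r^2\<close>.\<close>
  define D where "D b y = f (norm y) powr m * \<Phi>2 b y + norm y powr \<sigma>1 * (U1 b y + cc b y * U2 y)
     + norm y powr \<sigma>2 * (U3 y + cc b y * U4 y)" for b y
  define g where "g b y = f (norm y) powr m * \<Phi>1 b y - (G1 (norm y) * (\<beta> * q * (norm y powr \<sigma>1 * (y \<bullet> b)))
     - G2 (norm y) * (norm y powr \<sigma>2 * (y \<bullet> b))) * \<Phi> y" for b y
  note ci = continuous_intros c cG
  have wi: "integrable lborel (\<lambda>y::'a. norm y powr \<sigma> * h y)"
    if "0 < N + \<sigma>" "continuous_on UNIV h" "\<And>y. R < norm y \<Longrightarrow> h y = 0" for \<sigma> h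
  proof -
    note t = that
    obtain C where "\<And>y. \<bar>h y\<bar> \<le> C" using continuous_compact_support_bounded[OF t(2,3)] by blast
    then show ?thesis
      using that N by (intro weighted_integrable[where C = C and R = R]) (auto intro: borel_measurable_continuous_onI)
  qed
  have wic: "integrable lborel (\<lambda>y::'a. norm y powr \<sigma> * (cc b y * h y))"
    if "0 < N + \<sigma>" "continuous_on UNIV h" "\<And>y. R < norm y \<Longrightarrow> h y = 0" "b \<in> Basis" for \<sigma> h b
  proof -
    note t = that
    obtain C where C: "\<And>y. \<bar>h y\<bar> \<le> C" using continuous_compact_support_bounded[OF t(2,3)] by blast
    have hm: "h \<in> borel_measurable borel" by (rule borel_measurable_continuous_onI[OF that(2)])
    have "\<bar>cc b y * h y\<bar> \<le> 1 * C" for y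
      unfolding abs_mult using cc1[OF that(4), of y] C[of y] by (intro mult_mono) auto
    then show ?thesis
      using that N ccm hm by (intro weighted_integrable[where C = C and R = R]) (auto intro: borel_measurable_times)
  qed
  have Dint: "integrable lborel (D b)" if b: "b \<in> Basis" for b
  proof -
    have 0: "integrable lborel (\<lambda>y. f (norm y) powr m * \<Phi>2 b y)"
      by (rule continuous_compact_support_integrable[of _ R]) (use b v in \<open>auto intro!: ci\<close>)
    have 1: "integrable lborel (\<lambda>y. norm y powr \<sigma>1 * U1 b y)"
      by (rule wi[OF N_\<sigma>1]) (use b v in \<open>auto simp: U1_def[abs_def] intro!: ci\<close>)
    have 2: "integrable lborel (\<lambda>y. norm y powr \<sigma>1 * (cc b y * U2 y))"
      by (rule wic[OF N_\<sigma>1 _ _ b]) (use v in \<open>auto simp: U2_def[abs_def] intro!: ci\<close>)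
    have 3: "integrable lborel (\<lambda>y. norm y powr \<sigma>2 * U3 y)"
      by (rule wi[OF N_\<sigma>2]) (use v in \<open>auto simp: U3_def[abs_def] intro!: ci\<close>)
    have 4: "integrable lborel (\<lambda>y. norm y powr \<sigma>2 * (cc b y * U4 y))"
      by (rule wic[OF N_\<sigma>2 _ _ b]) (use v in \<open>auto simp: U4_def[abs_def] intro!: ci\<close>)
    show ?thesis
      unfolding D_def[abs_def] distrib_left
      by (intro Bochner_Integration.integrable_add 0 1 2 3 4)
  qed
  have gint: "integrable lborel (g b)" if b: "b \<in> Basis" for b
  proof -
    have 0: "integrable lborel (\<lambda>y. f (norm y) powr m * \<Phi>1 b y)"
      by (rule continuous_compact_support_integrable[of _ R]) (use b v in \<open>auto intro!: ci\<close>)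
    have 1: "integrable lborel (\<lambda>y. norm y powr \<sigma>1 * (G1 (norm y) * \<beta> * q * (y \<bullet> b) * \<Phi> y))"
      by (rule wi[OF N_\<sigma>1]) (use b v in \<open>auto intro!: ci\<close>)
    have 2: "integrable lborel (\<lambda>y. norm y powr \<sigma>2 * (G2 (norm y) * (y \<bullet> b) * \<Phi> y))"
      by (rule wi[OF N_\<sigma>2]) (use b v in \<open>auto intro!: ci\<close>)
    have "g b = (\<lambda>y. f (norm y) powr m * \<Phi>1 b y - norm y powr \<sigma>1 * (G1 (norm y) * \<beta> * q * (y \<bullet> b) * \<Phi> y)
        + norm y powr \<sigma>2 * (G2 (norm y) * (y \<bullet> b) * \<Phi> y))"
      unfolding g_def[abs_def] by (simp add: algebra_simps)
    then show ?thesis using 0 1 2 by (simp only:) (intro Bochner_Integration.integrable_add Bochner_Integration.integrable_diff)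
  qed
  have gder: "((\<lambda>s. g b (y + s *\<^sub>R b)) has_real_derivative D b y) (at 0)" if b: "b \<in> Basis" and y: "y \<noteq> 0" for b y
  proof -
    define r where "r = norm y"
    have r: "0 < r" unfolding r_def using y by simp
    note dn = has_real_derivative_norm_line[OF y, of b]
    have rad: "((\<lambda>s. h (norm (y + s *\<^sub>R b))) has_real_derivative h' * ((y \<bullet> b) / r)) (at 0)"
      if "(h has_real_derivative h') (at r)" for h h'
      using DERIV_chain2[OF _ dn[folded r_def], of h h'] that by (simp add: r_def)
    define w' where "w' = (flux \<beta> f r - \<beta> * r powr (\<sigma>1 + 2) * f r) / r"
    have dw: "((\<lambda>x. f x powr m) has_real_derivative w') (at r)"
    proof (rule has_field_derivative_transform_within_open[of "\<lambda>x. f 0 powr m + prim \<beta> f x" _ _ "{0<..}"])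
      show "((\<lambda>x. f 0 powr m + prim \<beta> f x) has_real_derivative w') (at r)"
        using DERIV_add[OF DERIV_const has_real_derivative_prim[OF pd(1,2) r, of \<beta>], of "f 0 powr m"] by (simp add: w'_def)
      show "f 0 powr m + prim \<beta> f x = f x powr m" if "x \<in> {0<..}" for x
        using pd(4)[of x] that by (simp only: greaterThan_iff less_imp_le)
    qed (use r in auto)
    define V where "V x = flux \<beta> f x / x\<^sup>2" for x
    define F where "F = flux \<beta> f r"
    define F' where "F' = ((2 - N) * F + \<beta> * q * r powr (\<sigma>1 + 2) * f r - r powr (\<sigma>2 + 2) * f r powr p) / r"
    have dF: "(flux \<beta> f has_real_derivative F') (at r)"
      unfolding F'_def F_def by (rule has_real_derivative_flux[OF pd(1,2) r])
    have dsq: "((\<lambda>x. x\<^sup>2) has_real_derivative 2 * r) (at r)" by (auto intro!: derivative_eq_intros)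
    have dV: "(V has_real_derivative (F' * r\<^sup>2 - F * (2 * r)) / (r\<^sup>2 * r\<^sup>2)) (at r)"
      unfolding V_def[abs_def] F_def by (rule DERIV_divide[OF dF dsq]) (use r in simp)
    have di: "((\<lambda>s. (y + s *\<^sub>R b) \<bullet> b) has_real_derivative 1) (at 0)"
    proof -
      have "((\<lambda>s. y \<bullet> b + s * 1) has_real_derivative 0 + 1 * 1) (at 0)"
        by (intro DERIV_add DERIV_const DERIV_cmult_right DERIV_ident)
      then show ?thesis using b by (simp add: inner_add_left)
    qed
    have pw: "x powr (\<sigma> + 2) / x\<^sup>2 = x powr \<sigma>" if "0 < x" for x \<sigma> :: real
      using that by (simp add: powr_add power2_eq_square)
    have Vx: "V x = \<beta> * q * x powr \<sigma>1 * G1 x - x powr \<sigma>2 * G2 x" if "0 < x" for x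
    proof -
      have "V x = \<beta> * q * (x powr (\<sigma>1 + 2) / x\<^sup>2) * G1 x - (x powr (\<sigma>2 + 2) / x\<^sup>2) * G2 x"
        unfolding V_def flux_def G1_def G2_def by (simp add: diff_divide_distrib)
      then show ?thesis unfolding pw[OF that] .
    qed
    have "((\<lambda>s. f (norm (y + s *\<^sub>R b)) powr m * \<Phi>1 b (y + s *\<^sub>R b) - (V (norm (y + s *\<^sub>R b)) * ((y + s *\<^sub>R b) \<bullet> b)) * \<Phi> (y + s *\<^sub>R b))
      has_real_derivative ((w' * ((y \<bullet> b) / r)) * \<Phi>1 b y + \<Phi>2 b y * f r powr m) -
        (((F' * r\<^sup>2 - F * (2 * r)) / (r\<^sup>2 * r\<^sup>2) * ((y \<bullet> b) / r) * (y \<bullet> b) + 1 * V r) * \<Phi> y + \<Phi>1 b y * (V r * (y \<bullet> b)))) (at 0)"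
      using DERIV_diff[OF DERIV_mult[OF rad[OF dw] d2[OF b]] DERIV_mult[OF DERIV_mult[OF rad[OF dV] di] d1[OF b]], of y y]
      by (simp add: r_def)
    moreover have "((w' * ((y \<bullet> b) / r)) * \<Phi>1 b y + \<Phi>2 b y * f r powr m) -
        (((F' * r\<^sup>2 - F * (2 * r)) / (r\<^sup>2 * r\<^sup>2) * ((y \<bullet> b) / r) * (y \<bullet> b) + 1 * V r) * \<Phi> y + \<Phi>1 b y * (V r * (y \<bullet> b))) = D b y"
    proof -
      define a where "a = r powr \<sigma>1"
      define a' where "a' = r powr \<sigma>2"
      have p1: "r powr (\<sigma>1 + 2) = a * r\<^sup>2" "r powr (\<sigma>2 + 2) = a' * r\<^sup>2"
        unfolding a_def a'_def using r by (simp_all add: powr_add)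
      have Fr: "F = r\<^sup>2 * (\<beta> * q * a * G1 r - a' * G2 r)"
        using Vx[OF r] r unfolding V_def F_def a_def a'_def by (simp add: field_simps)
      have Vr: "V r = \<beta> * q * a * G1 r - a' * G2 r" unfolding a_def a'_def by (rule Vx[OF r])
      have w'r: "w' = r * (\<beta> * q * a * G1 r - a' * G2 r - \<beta> * a * f r)"
        unfolding w'_def F_def[symmetric] Fr p1 using r by (simp add: field_simps power2_eq_square)
      have F'r: "F' = r * ((2 - N) * (\<beta> * q * a * G1 r - a' * G2 r) + \<beta> * q * a * f r - a' * f r powr p)"
        unfolding F'_def p1 Fr using r by (simp add: field_simps power2_eq_square)
      have dvr: "(F' * r\<^sup>2 - F * (2 * r)) / (r\<^sup>2 * r\<^sup>2) * ((y \<bullet> b) / r) * (y \<bullet> b)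
          = cc b y * (- N * (\<beta> * q * a * G1 r - a' * G2 r) + \<beta> * q * a * f r - a' * f r powr p)"
        unfolding F'r Fr cc_def r_def[symmetric] using r by (simp add: field_simps power2_eq_square)
      have U: "U1 b y = - \<beta> * (y \<bullet> b) * f r * \<Phi>1 b y - \<beta> * q * G1 r * \<Phi> y" 
        "U2 y = - \<beta> * q * (f r - N * G1 r) * \<Phi> y" "U3 y = G2 r * \<Phi> y" "U4 y = - (N * G2 r - f r powr p) * \<Phi> y"
        unfolding U1_def U2_def U3_def U4_def r_def by simp_all
      show ?thesis
        unfolding dvr w'r Vr unfolding D_def U r_def[symmetric] a_def[symmetric] a'_def[symmetric] using r by (simp add: algebra_simps)
    qed
    ultimately have dd: "((\<lambda>s. f (norm (y + s *\<^sub>R b)) powr m * \<Phi>1 b (y + s *\<^sub>R b) - (V (norm (y + s *\<^sub>R b)) * ((y + s *\<^sub>R b) \<bullet> b)) * \<Phi> (y + s *\<^sub>R b))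
      has_real_derivative D b y) (at 0)" by simp
    have "((\<lambda>s. y + s *\<^sub>R b) \<longlongrightarrow> y + 0 *\<^sub>R b) (nhds 0)"
      by (intro tendsto_intros) (simp add: filterlim_ident)
    then have "eventually (\<lambda>s. y + s *\<^sub>R b \<in> - {0}) (nhds 0)"
      by (rule topological_tendstoD) (use y in auto)
    then have "eventually (\<lambda>s. f (norm (y + s *\<^sub>R b)) powr m * \<Phi>1 b (y + s *\<^sub>R b) - (V (norm (y + s *\<^sub>R b)) * ((y + s *\<^sub>R b) \<bullet> b)) * \<Phi> (y + s *\<^sub>R b)
        = g b (y + s *\<^sub>R b)) (nhds 0)"
    proof eventually_elim
      case (elim s)
      then have "0 < norm (y + s *\<^sub>R b)" by simp
      note e = Vx[OF this]
      have "M * P - (\<beta> * q * u * G - w * G') * i * Q = M * P - (G * (\<beta> * q * (u * i)) - G' * (w * i)) * Q"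
        for M P u G w G' i Q :: real by (simp add: algebra_simps)
      then show ?case unfolding g_def e by blast
    qed
    from DERIV_cong_ev[OF refl this refl] dd show ?thesis by blast
  qed
  have zero: "integral\<^sup>L lborel (D b) = 0" if b: "b \<in> Basis" for b
  proof (rule integral_directional_derivative_zero[OF gint[OF b] Dint[OF b], of b])
    have ok: "((\<lambda>s. D b (y + s *\<^sub>R b)) has_integral g b (y + b) - g b y) {0..1}"
      if y: "(\<forall>s. y + s *\<^sub>R b \<noteq> 0) \<or> (-1 < \<sigma>1 \<and> -1 < \<sigma>2)" for y
    proof -
      have fin: "finite {s. y + s *\<^sub>R b = 0}"
      proof (rule finite_subset)
        show "{s. y + s *\<^sub>R b = 0} \<subseteq> {- (y \<bullet> b)}"
        proof clarify
          fix s assume "y + s *\<^sub>R b = 0"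
          then have "(y + s *\<^sub>R b) \<bullet> b = 0" by simp
          then show "s = - (y \<bullet> b)" using b by (simp add: inner_add_left)
        qed
      qed simp
      let ?L = "range (\<lambda>s. y + s *\<^sub>R b)"
      have L: "0 \<notin> ?L \<or> -1 < \<sigma>1" "0 \<notin> ?L \<or> -1 < \<sigma>2" using y by auto
      have cg: "continuous_on ?L (g b)"
      proof -
        have sub: "continuous_on ?L h" if "continuous_on UNIV h" for h :: "'a \<Rightarrow> real"
          by (rule continuous_on_subset[OF that]) simp
        show ?thesis
          unfolding g_def[abs_def]
          by (rule continuous_on_diff continuous_on_mult continuous_on_const
              continuous_on_norm_powr_mult_inner[OF L(1) b] continuous_on_norm_powr_mult_inner[OF L(2) b]
              sub[OF cG(3)] sub[OF cG(4)] sub[OF cG(5)] sub[OF c(1)] sub[OF c(2)[OF b]])+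
      qed
      have "continuous_on {0..1} (\<lambda>s. g b (y + s *\<^sub>R b))"
        by (rule continuous_on_compose2[OF cg]) (auto intro!: continuous_intros)
      then have "((\<lambda>s. D b (y + s *\<^sub>R b)) has_integral g b (y + 1 *\<^sub>R b) - g b (y + 0 *\<^sub>R b)) {0..1}"
      proof (intro fundamental_theorem_of_calculus_interior_strong[OF fin])
        fix s assume "s \<in> {0<..<1} - {s. y + s *\<^sub>R b = 0}"
        then have "y + s *\<^sub>R b \<noteq> 0" by simp
        from shift_line_derivative[of "\<lambda>y. y \<noteq> 0" "g b" b "D b" y s, OF gder[OF b] this]
        show "((\<lambda>s. g b (y + s *\<^sub>R b)) has_vector_derivative D b (y + s *\<^sub>R b)) (at s)"
          by (simp add: has_real_derivative_iff_has_vector_derivative)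
      qed auto
      then show ?thesis by simp
    qed
    show "AE y in lborel. ((\<lambda>s. D b (y + s *\<^sub>R b)) has_integral g b (y + b) - g b y) {0..1}"
    proof (cases "2 \<le> DIM('a)")
      case True
      show ?thesis using AE_line_avoids_0[OF True, of b] by eventually_elim (use ok in blast)
    next
      case False
      then have "DIM('a) = 1" using DIM_positive[where 'a = 'a] by linarith
      then have "-1 < \<sigma>1 \<and> -1 < \<sigma>2" using N N_\<sigma>1 N_\<sigma>2 by simp
      then show ?thesis using ok by (intro AE_I2) blast
    qed
  qed
  have sumcc: "(\<Sum>b\<in>Basis. cc b y) = 1" if "y \<noteq> 0" for y :: 'a
  proof -
    have "(\<Sum>b\<in>Basis. (y \<bullet> b)\<^sup>2) = (norm y)\<^sup>2"
      by (simp add: norm_eq_sqrt_inner euclidean_inner[of y y] power2_eq_square sum_nonneg)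
    then show ?thesis unfolding cc_def sum_divide_distrib[symmetric] using that by simp
  qed
  have "f (norm y) powr m * (\<Sum>b\<in>Basis. \<Phi>2 b y)
     - norm y powr \<sigma>1 * (f (norm y) * (\<beta> * (\<Sum>b\<in>Basis. (y \<bullet> b) * \<Phi>1 b y) + \<beta> * q * \<Phi> y))
     + norm y powr \<sigma>2 * (f (norm y) powr p * \<Phi> y) = (\<Sum>b\<in>Basis. D b y)" for y
  \<comment> \<open>At the origin both weights are \<open>0 powr \<sigma> = 0\<close>, so only the
    terms with \<open>f powr m\<close> remain on either side.\<close>
  proof (cases "y = 0")
    case True
    then show ?thesis unfolding D_def by (simp add: sum_distrib_left)
  next
    case False
    have e1: "(\<Sum>b\<in>Basis. U1 b y + cc b y * U2 y) = - \<beta> * f (norm y) * (\<Sum>b\<in>Basis. (y \<bullet> b) * \<Phi>1 b y) - N * (\<beta> * q * G1 (norm y) * \<Phi> y) + U2 y"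
      unfolding U1_def sum.distrib sum_distrib_right[symmetric] sumcc[OF False] sum_subtractf N
      by (simp add: sum_distrib_left mult_ac)
    have e2: "(\<Sum>b\<in>Basis. U3 y + cc b y * U4 y) = N * U3 y + U4 y"
      unfolding sum.distrib sum_distrib_right[symmetric] sumcc[OF False] N by simp
    have "(\<Sum>b\<in>Basis. D b y) = f (norm y) powr m * (\<Sum>b\<in>Basis. \<Phi>2 b y)
        + norm y powr \<sigma>1 * (\<Sum>b\<in>Basis. U1 b y + cc b y * U2 y) + norm y powr \<sigma>2 * (\<Sum>b\<in>Basis. U3 y + cc b y * U4 y)"
      unfolding D_def by (subst (1) sum.distrib, subst (1) sum.distrib) (simp only: sum_distrib_left)
    then show ?thesis
      unfolding e1 e2 unfolding U2_def U3_def U4_def by (simp add: algebra_simps)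
  qed
  then have "(\<integral>y. f (norm y) powr m * (\<Sum>b\<in>Basis. \<Phi>2 b y)
     - norm y powr \<sigma>1 * (f (norm y) * (\<beta> * (\<Sum>b\<in>Basis. (y \<bullet> b) * \<Phi>1 b y) + \<beta> * q * \<Phi> y))
     + norm y powr \<sigma>2 * (f (norm y) powr p * \<Phi> y) \<partial>lborel) = (\<integral>y. (\<Sum>b\<in>Basis. D b y) \<partial>lborel)"
    by simp
  also have "\<dots> = (\<Sum>b\<in>Basis. integral\<^sup>L lborel (D b))" by (rule Bochner_Integration.integral_sum) (rule Dint)
  also have "\<dots> = 0" using zero by simp
  finally show ?thesis .
qed

end

lemma scaled_line_derivative:
  fixes \<psi> :: "'a::euclidean_space \<Rightarrow> real"
  assumes "((\<lambda>h. \<psi> (c *\<^sub>R y + h *\<^sub>R b)) has_real_derivative d) (at 0)"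
  shows "((\<lambda>s. \<psi> (c *\<^sub>R (y + s *\<^sub>R b))) has_real_derivative c * d) (at 0)"
proof -
  have i: "((\<lambda>s. c * s) has_real_derivative c) (at 0)" by (auto intro!: derivative_eq_intros)
  have "((\<lambda>h. \<psi> (c *\<^sub>R y + h *\<^sub>R b)) has_real_derivative d) (at (c * 0))" using assms by simp
  from DERIV_chain2[OF this i]
  have "((\<lambda>s. \<psi> (c *\<^sub>R y + (c * s) *\<^sub>R b)) has_real_derivative d * c) (at 0)" .
  moreover have "(\<lambda>s. \<psi> (c *\<^sub>R y + (c * s) *\<^sub>R b)) = (\<lambda>s. \<psi> (c *\<^sub>R (y + s *\<^sub>R b)))"
    by (simp add: fun_eq_iff scaleR_add_right)
  ultimately show ?thesis by (simp only: mult.commute)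
qed

lemma test_function_comoving_derivative:
  fixes \<phi> :: "'a::euclidean_space \<Rightarrow> real \<Rightarrow> real"
  assumes "test_function \<phi>"
  shows "((\<lambda>t. \<phi> (exp (\<beta> * t) *\<^sub>R y) t) has_real_derivative
    time_deriv \<phi> (exp (\<beta> * t) *\<^sub>R y) t + (\<Sum>b\<in>Basis. \<beta> * exp (\<beta> * t) * (y \<bullet> b) * space_deriv b \<phi> (exp (\<beta> * t) *\<^sub>R y) t)) (at t)"
proof -
  note td = test_function_derivs[OF assms]
  let ?F = "\<lambda>z::'a \<times> real. \<phi> (fst z) (snd z)"
  let ?D = "\<lambda>b z. if snd b = 0 then space_deriv (fst b) \<phi> (fst z) (snd z) else time_deriv \<phi> (fst z) (snd z)"
  define z where "z = (exp (\<beta> * t) *\<^sub>R y, t)"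
  have nz: "(u :: 'a) \<noteq> 0" if "u \<in> Basis" for u using that nonzero_Basis by blast
  have "(?F has_derivative (\<lambda>h. \<Sum>b\<in>Basis. (h \<bullet> b) * ?D b z)) (at z)"
  proof (rule has_derivative_basis)
    fix b :: "'a \<times> real" and x :: "'a \<times> real" assume "b \<in> Basis"
    then consider u where "u \<in> Basis" "b = (u, 0)" | "b = (0, 1)" unfolding Basis_prod_def by auto
    then show "((\<lambda>s. ?F (x + s *\<^sub>R b)) has_real_derivative ?D b x) (at 0)"
    proof cases
      case 1
      then show ?thesis using td(6)[of u "fst x" "snd x"] by simp
    next
      case 2
      have "((\<lambda>s. \<phi> (fst x) (s + snd x)) has_real_derivative time_deriv \<phi> (fst x) (snd x)) (at 0)"
        using td(5)[of "fst x" "snd x"] DERIV_shift[of "\<phi> (fst x)" "time_deriv \<phi> (fst x) (snd x)" 0 "snd x"] by simp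
      then show ?thesis using 2 by (simp add: add.commute)
    qed
  next
    fix b :: "'a \<times> real" assume "b \<in> Basis"
    then consider u where "u \<in> Basis" "b = (u, 0)" | "b = (0, 1)" unfolding Basis_prod_def by auto
    then have "continuous_on UNIV (?D b)"
    proof cases
      case 1
      then show ?thesis using td(3)[of u] unfolding jointly_continuous_def by (simp add: case_prod_unfold)
    next
      case 2
      then show ?thesis using td(2) unfolding jointly_continuous_def by (simp add: case_prod_unfold)
    qed
    then show "continuous (at z) (?D b)" unfolding continuous_on_eq_continuous_at[OF open_UNIV] by blast
  qed
  moreover have "((\<lambda>t. (exp (\<beta> * t) *\<^sub>R y, t)) has_derivative (\<lambda>h. ((h * (\<beta> * exp (\<beta> * t))) *\<^sub>R y, h))) (at t)"
    by (rule derivative_eq_intros refl)+ (simp add: fun_eq_iff mult_ac)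
  ultimately have "((\<lambda>t. \<phi> (exp (\<beta> * t) *\<^sub>R y) t) has_derivative
      (\<lambda>h. \<Sum>b\<in>Basis. (((h * (\<beta> * exp (\<beta> * t))) *\<^sub>R y, h) \<bullet> b) * ?D b z)) (at t)"
    using has_derivative_compose[of "\<lambda>t. (exp (\<beta> * t) *\<^sub>R y, t)" _ t UNIV ?F] unfolding z_def by simp
  moreover have "(\<Sum>b\<in>Basis. (((h * (\<beta> * exp (\<beta> * t))) *\<^sub>R y, h) \<bullet> b) * ?D b z) =
      (time_deriv \<phi> (fst z) (snd z) + (\<Sum>b\<in>Basis. \<beta> * exp (\<beta> * t) * (y \<bullet> b) * space_deriv b \<phi> (fst z) (snd z))) * h" for h
  proof -
    have "(\<Sum>b\<in>Basis. g b) = (\<Sum>u\<in>Basis. g (u, 0)) + g (0, 1)" for g :: "'a \<times> real \<Rightarrow> real"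
    proof -
      have "(\<Sum>b\<in>Basis. g b) = (\<Sum>b\<in>(\<lambda>u. (u, 0)) ` Basis. g b) + (\<Sum>b\<in>(\<lambda>v. (0, v)) ` Basis. g b)"
        unfolding Basis_prod_def by (rule sum.union_disjoint) (use nz in auto)
      then show ?thesis by (simp add: sum.reindex inj_on_def)
    qed
    then show ?thesis by (simp add: sum_distrib_left sum_distrib_right algebra_simps)
  qed
  ultimately show ?thesis unfolding has_field_derivative_def z_def by simp
qed

context profile_parameters
begin

text \<open>The expressions \<open>k + N + \<sigma>1\<close>, \<open>k * m + N - 2\<close> and
  \<open>N + \<sigma>2 + p * k\<close> all equal \<open>q\<close>, so every term acquires the factor
  \<open>exp (\<beta> * q * t)\<close>. The two further factors \<open>exp (\<beta> * t)\<close> in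
  the diffusion term belong to the second derivatives with respect to the comoving variable.\<close>

lemma comoving_exponents:
  assumes "0 \<le> Y" "0 \<le> F"
  shows "exp (N * \<beta> * t) * ((exp (\<beta> * t) * Y) powr \<sigma>1 * (exp (k * \<beta> * t) * F)) = exp (\<beta> * q * t) * (Y powr \<sigma>1 * F)"
    "exp (N * \<beta> * t) * (exp (k * \<beta> * t) * F) powr m = exp (\<beta> * q * t) * (exp (\<beta> * t) * exp (\<beta> * t)) * F powr m"
    "exp (N * \<beta> * t) * ((exp (\<beta> * t) * Y) powr \<sigma>2 * (exp (k * \<beta> * t) * F) powr p) = exp (\<beta> * q * t) * (Y powr \<sigma>2 * F powr p)"
proof -
  have q2: "q = N + \<sigma>2 + p * k" using q_minus_pk by simp
  have c1: "exp (N * \<beta> * t) * (exp (\<sigma>1 * (\<beta> * t)) * exp (k * \<beta> * t)) = exp (\<beta> * q * t)"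
    unfolding exp_add[symmetric] q_def by (simp add: algebra_simps)
  have c2: "exp (N * \<beta> * t) * exp (m * (k * \<beta> * t)) = exp (\<beta> * q * t) * (exp (\<beta> * t) * exp (\<beta> * t))"
    unfolding exp_add[symmetric] q_eq by (simp add: algebra_simps)
  have c3: "exp (N * \<beta> * t) * (exp (\<sigma>2 * (\<beta> * t)) * exp (p * (k * \<beta> * t))) = exp (\<beta> * q * t)"
    unfolding exp_add[symmetric] q2 by (simp add: algebra_simps)
  have e: "exp x powr a = exp (a * x)" for x a :: real by (simp add: exp_powr_real mult.commute)
  have pm: "(exp x * y) powr a = exp (a * x) * y powr a" if "0 \<le> y" for x y a :: real
    using that by (simp add: powr_mult e)
  have r: "a * ((b * u) * (c * v)) = (a * (b * c)) * (u * v)" for a b c u v :: real by simp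
  show "exp (N * \<beta> * t) * ((exp (\<beta> * t) * Y) powr \<sigma>1 * (exp (k * \<beta> * t) * F)) = exp (\<beta> * q * t) * (Y powr \<sigma>1 * F)"
    unfolding pm[OF assms(1)] r c1 by (rule refl)
  show "exp (N * \<beta> * t) * (exp (k * \<beta> * t) * F) powr m = exp (\<beta> * q * t) * (exp (\<beta> * t) * exp (\<beta> * t)) * F powr m"
    unfolding pm[OF assms(2)] mult.assoc[of "exp (N * \<beta> * t)", symmetric] c2 by (rule refl)
  show "exp (N * \<beta> * t) * ((exp (\<beta> * t) * Y) powr \<sigma>2 * (exp (k * \<beta> * t) * F) powr p) = exp (\<beta> * q * t) * (Y powr \<sigma>2 * F powr p)"
    unfolding pm[OF assms(1)] pm[OF assms(2)] r c3 by (rule refl)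
qed

lemma profile_jointly_continuous:
  assumes "continuous_on {0..} f"
  shows "jointly_continuous (exp_self_similar \<alpha> \<beta> f :: 'a::euclidean_space \<Rightarrow> real \<Rightarrow> real)"
proof -
  have "continuous_on UNIV (\<lambda>z::'a \<times> real. exp (\<alpha> * snd z) * f (norm (fst z) * exp (- \<beta> * snd z)))"
    by (intro continuous_intros continuous_on_compose2[OF assms]) auto
  then show ?thesis unfolding jointly_continuous_def exp_self_similar_def by (simp add: case_prod_unfold)
qed

text \<open>In comoving coordinates the integrand splits into \<open>J1\<close>, which for fixed
  \<open>y\<close> is a multiple of a time derivative of a function of bounded support, and
  \<open>J2\<close>, which for fixed \<open>t\<close> integrates to zero by
  \<open>spatial_identity\<close>.\<close>

lemma profile_weak_solution:
  assumes N: "N = real DIM('a)" and pr: "profile \<beta> f"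
  shows "weak_solution m p \<sigma>1 \<sigma>2 (exp_self_similar (k * \<beta>) \<beta> f :: 'a::euclidean_space \<Rightarrow> real \<Rightarrow> real)"
proof -
  note pd = profileD(1,2)[OF pr]
  let ?u = "exp_self_similar (k * \<beta>) \<beta> f :: 'a \<Rightarrow> real \<Rightarrow> real"
  have uc: "jointly_continuous ?u" by (rule profile_jointly_continuous[OF pd(1)])
  have un: "0 \<le> ?u x t" for x t unfolding exp_self_similar_def using pd(2) by simp
  have u0: "exp (k * \<beta> * t) * f (norm (exp (\<beta> * t) *\<^sub>R y) * exp (- \<beta> * t)) = exp (k * \<beta> * t) * f (norm y)" for y :: 'a and t
  proof -
    have "exp (\<beta> * t) * exp (- \<beta> * t) = 1" by (simp add: exp_minus)
    then have "norm (exp (\<beta> * t) *\<^sub>R y) * exp (- \<beta> * t) = norm y" by simp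
    then show ?thesis by (simp only:)
  qed
  have fn: "0 \<le> f (norm y)" for y :: 'a using pd(2) by simp
  have "has_bochner_integral lborel
        (\<lambda>(x, t). norm x powr \<sigma>1 * ?u x t * time_deriv \<phi> x t
                 + ?u x t powr m * laplacian \<phi> x t
                 + norm x powr \<sigma>2 * ?u x t powr p * \<phi> x t) 0" (is "has_bochner_integral lborel ?F 0")
    if tf: "test_function \<phi>" for \<phi>
  proof -
    note td = test_function_derivs[OF tf]
    obtain R where R: "0 < R" "vanishes_beyond R \<phi>" using test_function_vanishes[OF tf] by blast
    define R2 where "R2 = R * exp (\<bar>\<beta>\<bar> * R)"
    define W where "W \<psi> z = \<psi> (exp (\<beta> * snd z) *\<^sub>R fst z) (snd z)" for \<psi> :: "'a \<Rightarrow> real \<Rightarrow> real" and z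
    have cW: "continuous_on UNIV (W \<psi>)" if "jointly_continuous \<psi>" for \<psi>
    proof -
      have "continuous_on UNIV (\<lambda>z. (\<lambda>(x, t). \<psi> x t) (exp (\<beta> * snd z) *\<^sub>R fst z, snd z))"
        by (rule continuous_on_compose2[OF that[unfolded jointly_continuous_def]]) (auto intro!: continuous_intros)
      then show ?thesis unfolding W_def[abs_def] by simp
    qed
    have vW: "W \<psi> z = 0" if "vanishes_beyond R \<psi>" "R2 < norm (fst z) \<or> R < \<bar>snd z\<bar>" for \<psi> z
      using vanishes_beyond_comoving[OF that(1) R(1), of \<beta> "fst z" "snd z"] that(2) unfolding W_def R2_def by blast
    have ev: "vanishes_beyond R (time_deriv \<phi>)" "vanishes_beyond R (space_deriv b \<phi>)"
      "vanishes_beyond R (space_deriv b (space_deriv b \<phi>))" for b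
      using R(2) vanishes_beyond_space_deriv vanishes_beyond_time_deriv by blast+
    define g1 where "g1 z = exp (\<beta> * q * snd z) * (\<beta> * q * W \<phi> z + (W (time_deriv \<phi>) z
        + (\<Sum>b\<in>Basis. \<beta> * exp (\<beta> * snd z) * (fst z \<bullet> b) * W (space_deriv b \<phi>) z)))" for z
    define g2 where "g2 z = exp (\<beta> * q * snd z) * (\<beta> * (\<Sum>b\<in>Basis. (fst z \<bullet> b) * (exp (\<beta> * snd z) * W (space_deriv b \<phi>) z)) + \<beta> * q * W \<phi> z)" for z
    define g3 where "g3 z = exp (\<beta> * q * snd z) * (\<Sum>b\<in>Basis. exp (\<beta> * snd z) * (exp (\<beta> * snd z) * W (space_deriv b (space_deriv b \<phi>)) z))" for z
    define g4 where "g4 z = exp (\<beta> * q * snd z) * W \<phi> z" for z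
    note cW' = cW[OF td(1)] cW[OF td(2)] cW[OF td(3)] cW[OF td(4)]
    have cg: "continuous_on UNIV g1" "continuous_on UNIV g2" "continuous_on UNIV g3" "continuous_on UNIV g4"
      unfolding g1_def[abs_def] g2_def[abs_def] g3_def[abs_def] g4_def[abs_def]
      by (intro continuous_intros cW'; assumption)+
    have vg: "g1 z = 0" "g2 z = 0" "g3 z = 0" "g4 z = 0" if z: "R2 < norm (fst z) \<or> R < \<bar>snd z\<bar>" for z
      unfolding g1_def g2_def g3_def g4_def vW[OF R(2) z] vW[OF ev(1) z] vW[OF ev(2) z] vW[OF ev(3) z] by simp_all
    have cf: "continuous_on UNIV (\<lambda>z::'a \<times> real. h (norm (fst z)))" if "continuous_on {0..} h" for h :: "real \<Rightarrow> real"
      by (rule continuous_on_compose2[OF that]) (auto intro!: continuous_intros)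
    have fp: "continuous_on {0..} (\<lambda>x. f x powr p)" by (rule continuous_on_powr_p[OF pd])
    have fm: "continuous_on {0..} (\<lambda>x. f x powr m)"
      using pd m_pos by (intro continuous_on_powr' continuous_intros) auto
    have big: "R2 < norm (fst z) \<or> R < \<bar>snd z\<bar>" if "R2 + R < norm z" for z :: "'a \<times> real"
      using norm_Pair_le[of "fst z" "snd z"] that by (simp) linarith
    have wint: "integrable lborel (\<lambda>z. norm (fst z) powr \<sigma> * h z)"
      if "0 < N + \<sigma>" "continuous_on UNIV h" "\<And>z. R2 < norm (fst z) \<or> R < \<bar>snd z\<bar> \<Longrightarrow> h z = 0" for \<sigma> and h :: "'a \<times> real \<Rightarrow> real"
    proof -
      note t = that
      obtain C where "\<And>z. \<bar>h z\<bar> \<le> C" using continuous_compact_support_bounded[OF t(2), of "R2 + R"] big t(3) by blast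
      then show ?thesis using t by (intro weighted_integrable_prod[where C = C and R = R2 and T = R]) (auto simp: N intro: borel_measurable_continuous_onI)
    qed
    \<comment> \<open>The operator \<open>\<beta> * (y \<bullet> grad) + \<beta> * q\<close>,
      applied to the test function, is added in \<open>J1\<close>, where it completes the time
      derivative, and subtracted in \<open>J2\<close>, where it completes the stationary
      equation.\<close>
    define J1 where "J1 z = norm (fst z) powr \<sigma>1 * (f (norm (fst z)) * g1 z)" for z
    define J2 where "J2 z = f (norm (fst z)) powr m * g3 z - norm (fst z) powr \<sigma>1 * (f (norm (fst z)) * g2 z)
      + norm (fst z) powr \<sigma>2 * (f (norm (fst z)) powr p * g4 z)" for z
    have i1: "integrable lborel J1"
      unfolding J1_def[abs_def] by (rule wint[OF N_\<sigma>1 continuous_on_mult[OF cf[OF pd(1)] cg(1)]]) (simp add: vg)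
    have i2: "integrable lborel J2"
      unfolding J2_def[abs_def]
      by (intro Bochner_Integration.integrable_add Bochner_Integration.integrable_diff
          continuous_compact_support_integrable[OF continuous_on_mult[OF cf[OF fm] cg(3)], of "R2 + R"]
          wint[OF N_\<sigma>1 continuous_on_mult[OF cf[OF pd(1)] cg(2)]]
          wint[OF N_\<sigma>2 continuous_on_mult[OF cf[OF fp] cg(4)]]) (simp_all add: vg big)
    have prod: "(lborel :: ('a \<times> real) measure) = lborel \<Otimes>\<^sub>M lborel" by (rule lborel_prod[symmetric])
    have "integral\<^sup>L lborel J1 = 0"
    proof -
      have "(\<integral>t. J1 (y, t) \<partial>lborel) = 0" for y
      proof -
        define G where "G t = exp (\<beta> * q * t) * \<phi> (exp (\<beta> * t) *\<^sub>R y) t" for t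
        have "(G has_real_derivative g1 (y, t)) (at t)" for t
        proof -
          have "((\<lambda>t. exp (\<beta> * q * t)) has_real_derivative \<beta> * q * exp (\<beta> * q * t)) (at t)"
            by (auto intro!: derivative_eq_intros)
          from DERIV_mult[OF this test_function_comoving_derivative[OF tf, of \<beta> y t]]
          show ?thesis unfolding G_def[abs_def] g1_def W_def by (simp add: algebra_simps)
        qed
        moreover have "isCont (\<lambda>t. g1 (y, t)) t" for t
        proof -
          have "continuous_on UNIV (\<lambda>t. g1 (y, t))"
            by (rule continuous_on_compose2[OF cg(1)]) (auto intro!: continuous_intros)
          then show ?thesis by (simp add: continuous_on_eq_continuous_at)
        qed
        ultimately have "(\<integral>t. g1 (y, t) * indicator {- R - 1..R + 1} t \<partial>lborel) = G (R + 1) - G (- R - 1)"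
          using R(1) by (intro integral_FTC_Icc_real) auto
        moreover have "g1 (y, t) * indicator {- R - 1..R + 1} t = g1 (y, t)" for t
          using vg(1)[of "(y, t)"] by (cases "R < \<bar>t\<bar>") (auto simp: indicator_def)
        moreover have "G (R + 1) = 0" "G (- R - 1) = 0"
          using vanishes_beyond_comoving[OF R(2,1), of \<beta> y] R(1) unfolding G_def by auto
        ultimately have "(\<integral>t. g1 (y, t) \<partial>lborel) = 0" by simp
        then show ?thesis unfolding J1_def by simp
      qed
      then show ?thesis using lborel_pair.integral_fst'[of J1] i1 unfolding prod by simp
    qed
    moreover have "integral\<^sup>L lborel J2 = 0"
    proof -
      have "(\<integral>y. J2 (y, t) \<partial>lborel) = 0" for t
      proof -
        have csl: "continuous_on UNIV (\<lambda>y. W \<psi> (y, t))" if "jointly_continuous \<psi>" for \<psi>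
          by (rule continuous_on_compose2[OF cW[OF that]]) (auto intro!: continuous_intros)
        have "(\<integral>y. f (norm y) powr m * (\<Sum>b\<in>Basis. exp (\<beta> * t) * (exp (\<beta> * t) * W (space_deriv b (space_deriv b \<phi>)) (y, t)))
         - norm y powr \<sigma>1 * (f (norm y) * (\<beta> * (\<Sum>b\<in>Basis. (y \<bullet> b) * (exp (\<beta> * t) * W (space_deriv b \<phi>) (y, t))) + \<beta> * q * W \<phi> (y, t)))
         + norm y powr \<sigma>2 * (f (norm y) powr p * W \<phi> (y, t)) \<partial>lborel) = 0"
        proof (rule spatial_identity[OF N pr, of _ _ _ R2])
          fix b y :: 'a assume b: "b \<in> Basis"
          show "((\<lambda>s. W \<phi> (y + s *\<^sub>R b, t)) has_real_derivative exp (\<beta> * t) * W (space_deriv b \<phi>) (y, t)) (at 0)"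
            using scaled_line_derivative[OF td(6)[OF b, of "exp (\<beta> * t) *\<^sub>R y" t]] unfolding W_def by simp
          show "((\<lambda>s. exp (\<beta> * t) * W (space_deriv b \<phi>) (y + s *\<^sub>R b, t)) has_real_derivative
             exp (\<beta> * t) * (exp (\<beta> * t) * W (space_deriv b (space_deriv b \<phi>)) (y, t))) (at 0)"
            using DERIV_cmult[OF scaled_line_derivative[OF td(7)[OF b, of "exp (\<beta> * t) *\<^sub>R y" t]], of "exp (\<beta> * t)"] unfolding W_def by simp
        next
          show "continuous_on UNIV (\<lambda>y. W \<phi> (y, t))" by (rule csl[OF td(1)])
          show "continuous_on UNIV (\<lambda>y. exp (\<beta> * t) * W (space_deriv b \<phi>) (y, t))" if "b \<in> Basis" for b
            by (intro continuous_intros csl td(3) that)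
          show "continuous_on UNIV (\<lambda>y. exp (\<beta> * t) * (exp (\<beta> * t) * W (space_deriv b (space_deriv b \<phi>)) (y, t)))" if "b \<in> Basis" for b
            by (intro continuous_intros csl td(4) that)
        qed (simp_all add: vW R(2) ev)
        from arg_cong[OF this, of "\<lambda>c. exp (\<beta> * q * t) * c"]
        have "(\<integral>y. exp (\<beta> * q * t) * (f (norm y) powr m * (\<Sum>b\<in>Basis. exp (\<beta> * t) * (exp (\<beta> * t) * W (space_deriv b (space_deriv b \<phi>)) (y, t)))
         - norm y powr \<sigma>1 * (f (norm y) * (\<beta> * (\<Sum>b\<in>Basis. (y \<bullet> b) * (exp (\<beta> * t) * W (space_deriv b \<phi>) (y, t))) + \<beta> * q * W \<phi> (y, t)))
         + norm y powr \<sigma>2 * (f (norm y) powr p * W \<phi> (y, t))) \<partial>lborel) = 0" by simp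
        moreover have "E * (A * B - C * (D * H) + P * (Q * S)) = A * (E * B) - C * (D * (E * H)) + P * (Q * (E * S))" for E A B C D H P Q S :: real
          by (simp add: algebra_simps)
        ultimately show ?thesis unfolding J2_def g2_def g3_def g4_def fst_conv snd_conv by (simp only:)
      qed
      then show ?thesis using lborel_pair.integral_snd[of "\<lambda>y t. J2 (y, t)"] i2 unfolding prod by (simp add: case_prod_unfold)
    qed
    ultimately have "has_bochner_integral lborel (\<lambda>z. J1 z + J2 z) (0 + 0)"
      by (intro has_bochner_integral_add) (use i1 i2 in \<open>simp_all add: has_bochner_integral_iff\<close>)
    moreover have "J1 z + J2 z = exp (real DIM('a) * \<beta> * snd z) * ?F (comoving \<beta> z)" for z
    proof -
      obtain y t where z: "z = (y, t)" by (cases z)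
      note ce = comoving_exponents[where Y = "norm y" and F = "f (norm y)" and \<beta> = \<beta> and t = t, OF norm_ge_zero fn]
      define S where "S = (\<Sum>b\<in>Basis. W (space_deriv b (space_deriv b \<phi>)) z)"
      define X where "X = (\<Sum>b\<in>Basis. (y \<bullet> b) * W (space_deriv b \<phi>) z)"
      define E where "E = exp (\<beta> * q * t)"
      define e where "e = exp (\<beta> * t)"
      define Fp where "Fp = f (norm y) powr p"
      define Fm where "Fm = f (norm y) powr m"
      define Y1 where "Y1 = norm y powr \<sigma>1"
      define Y2 where "Y2 = norm y powr \<sigma>2"
      have g: "g1 z = E * (\<beta> * q * W \<phi> z + (W (time_deriv \<phi>) z + \<beta> * e * X))"
        "g2 z = E * (\<beta> * (e * X) + \<beta> * q * W \<phi> z)" "g3 z = E * (e * e * S)" "g4 z = E * W \<phi> z"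
        unfolding g1_def g2_def g3_def g4_def S_def X_def sum_distrib_left E_def e_def by (simp_all add: z mult_ac)
      have L: "laplacian \<phi> (exp (\<beta> * t) *\<^sub>R y) t = S" unfolding laplacian_def S_def W_def z by simp
      have "?F (comoving \<beta> z) = (e * norm y) powr \<sigma>1 * (exp (k * \<beta> * t) * f (norm y)) * W (time_deriv \<phi>) z
          + (exp (k * \<beta> * t) * f (norm y)) powr m * S + (e * norm y) powr \<sigma>2 * (exp (k * \<beta> * t) * f (norm y)) powr p * W \<phi> z"
        unfolding comoving_def z exp_self_similar_def fst_conv snd_conv case_prod_conv u0 L W_def e_def by simp
      also have "exp (N * \<beta> * t) * \<dots> = exp (N * \<beta> * t) * ((e * norm y) powr \<sigma>1 * (exp (k * \<beta> * t) * f (norm y))) * W (time_deriv \<phi>) z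
          + exp (N * \<beta> * t) * (exp (k * \<beta> * t) * f (norm y)) powr m * S + exp (N * \<beta> * t) * ((e * norm y) powr \<sigma>2 * (exp (k * \<beta> * t) * f (norm y)) powr p) * W \<phi> z"
        by (simp only: distrib_left mult.assoc)
      also have "\<dots> = E * (Y1 * f (norm y)) * W (time_deriv \<phi>) z + E * (e * e) * Fm * S + E * (Y2 * Fp) * W \<phi> z"
        unfolding e_def ce E_def Y1_def Y2_def Fm_def Fp_def by (rule refl)
      also have "\<dots> = J1 z + J2 z"
        unfolding J1_def J2_def g unfolding z fst_conv Y1_def[symmetric] Y2_def[symmetric] Fm_def[symmetric] Fp_def[symmetric]
        by (simp add: algebra_simps)
      finally show ?thesis unfolding z by (simp add: N)
    qed
    ultimately have h: "has_bochner_integral lborel (\<lambda>z. exp (real DIM('a) * \<beta> * snd z) * ?F (comoving \<beta> z)) 0" by simp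
    have jm: "(\<lambda>z. \<psi> (fst z) (snd z)) \<in> borel_measurable borel" if "jointly_continuous \<psi>" for \<psi> :: "'a \<Rightarrow> real \<Rightarrow> real"
      using borel_measurable_continuous_onI[OF that[unfolded jointly_continuous_def]] by (simp add: case_prod_unfold)
    have [measurable]: "(\<lambda>z. ?u (fst z) (snd z)) \<in> borel_measurable borel" "(\<lambda>z. time_deriv \<phi> (fst z) (snd z)) \<in> borel_measurable borel"
      "(\<lambda>z. \<phi> (fst z) (snd z)) \<in> borel_measurable borel" using jm uc td(1,2) by blast+
    have [measurable]: "(\<lambda>z. laplacian \<phi> (fst z) (snd z)) \<in> borel_measurable borel"
      unfolding laplacian_def by (intro borel_measurable_sum jm td(4))
    have [measurable]: "(\<lambda>z::'a \<times> real. norm (fst z)) \<in> borel_measurable borel"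
      by (intro borel_measurable_continuous_onI continuous_intros)
    have "?F \<in> borel_measurable borel" unfolding case_prod_unfold by measurable
    from has_bochner_integral_comoving[OF this, of 0 \<beta>] h show ?thesis by blast
  qed
  with uc un show ?thesis unfolding weak_solution_def by blast
qed

end

section \<open>Weak solutions come from profiles\<close>

text \<open>Valid to the left of \<open>a\<close> as well: there the interval of integration is
  empty and the value \<open>0\<close> agrees with the primitive, as \<open>g\<close> vanishes up to
  \<open>a\<close>.\<close>

lemma has_real_derivative_antiderivative_from:
  fixes g :: "real \<Rightarrow> real"
  assumes "continuous_on UNIV g" "\<And>z. z \<le> a \<Longrightarrow> g z = 0"
  shows "((\<lambda>z. integral {a..z} g) has_real_derivative g z) (at z)"
proof -
  define L where "L = min a z - 1"
  define U where "U = max a z + 1"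
  have ig: "g integrable_on {x..y}" for x y
    by (intro integrable_continuous_interval continuous_on_subset[OF assms(1)]) simp
  have zero: "integral {L..x} g = 0" if "x \<le> a" for x
    using integral_cong[of "{L..x}" g "\<lambda>_. 0"] assms(2) that by simp
  have eq: "integral {L..x} g = integral {a..x} g" for x
  proof (cases "x < a")
    case True
    then show ?thesis using zero[of x] by simp
  next
    case False
    have "integral {L..a} g + integral {a..x} g = integral {L..x} g"
      by (rule Henstock_Kurzweil_Integration.integral_combine) (use False ig in \<open>auto simp: L_def\<close>)
    then show ?thesis using zero[of a] by simp
  qed
  have "((\<lambda>x. integral {L..x} g) has_vector_derivative g z) (at z within {L..U})"
    by (intro integral_has_vector_derivative continuous_on_subset[OF assms(1)]) (auto simp: L_def U_def)
  then have "((\<lambda>x. integral {L..x} g) has_real_derivative g z) (at z)"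
    by (simp add: has_real_derivative_iff_has_vector_derivative at_within_Icc_at L_def U_def)
  then show ?thesis unfolding eq .
qed

lemma has_real_derivative_max_0_square:
  "((\<lambda>x::real. (max 0 x)\<^sup>2) has_real_derivative 2 * max 0 x) (at x)"
proof -
  consider "0 < x" | "x < 0" | "x = 0" by linarith
  then show ?thesis
  proof cases
    case 1
    have "((\<lambda>x::real. x\<^sup>2) has_real_derivative 2 * x) (at x)" by (auto intro!: derivative_eq_intros)
    then have "((\<lambda>x::real. (max 0 x)\<^sup>2) has_real_derivative 2 * x) (at x)"
      by (rule has_field_derivative_transform_within_open[of _ _ _ "{0<..}"]) (use 1 in auto)
    then show ?thesis using 1 by simp
  next
    case 2
    have "((\<lambda>x::real. 0) has_real_derivative 0) (at x)" by simp
    then have "((\<lambda>x::real. (max 0 x)\<^sup>2) has_real_derivative 0) (at x)"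
      by (rule has_field_derivative_transform_within_open[of _ _ _ "{..<0}"]) (use 2 in auto)
    then show ?thesis using 2 by simp
  next
    case 3
    have e: "(\<lambda>h::real. ((max 0 h)\<^sup>2 - 0) / h) = max 0"
      by (auto simp: fun_eq_iff max_def power2_eq_square)
    have "((\<lambda>h::real. max 0 h) \<longlongrightarrow> max 0 0) (at 0)" by (intro tendsto_intros)
    then show ?thesis using 3 e unfolding DERIV_def by simp
  qed
qed

section \<open>Separated radial test functions\<close>

definition bump :: "real \<Rightarrow> real" where "bump t = (max 0 (1 - t\<^sup>2))\<^sup>2"

definition bump' :: "real \<Rightarrow> real" where "bump' t = 2 * max 0 (1 - t\<^sup>2) * (- 2 * t)"

lemma has_real_derivative_bump: "(bump has_real_derivative bump' t) (at t)"
proof -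
  have "((\<lambda>t. 1 - t\<^sup>2) has_real_derivative - 2 * t) (at t)" by (auto intro!: derivative_eq_intros)
  from DERIV_chain2[OF has_real_derivative_max_0_square this] show ?thesis
    unfolding bump_def[abs_def] bump'_def .
qed

lemma continuous_on_bump: "continuous_on S bump" "continuous_on S bump'"
  unfolding bump_def[abs_def] bump'_def[abs_def] by (intro continuous_intros)+

lemma bump_eq_0: "1 < \<bar>t\<bar> \<Longrightarrow> bump t = 0" "1 < \<bar>t\<bar> \<Longrightarrow> bump' t = 0"
  unfolding bump_def bump'_def using abs_square_less_1[of t] by (auto simp: max_def not_less)

lemma bump_integrals:
  "integrable lborel bump" "integrable lborel bump'" "integral\<^sup>L lborel bump' = 0" "0 < integral\<^sup>L lborel bump"
proof -
  show i: "integrable lborel bump" "integrable lborel bump'"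
    by (rule continuous_compact_support_integrable[of _ 1]; simp add: continuous_on_bump bump_eq_0)+
  have "(\<integral>t. bump' t * indicator {- 1..1} t \<partial>lborel) = bump 1 - bump (- 1)"
    by (rule integral_FTC_Icc_real)
       (use has_real_derivative_bump continuous_on_bump(2)[of UNIV] in \<open>auto simp: continuous_on_eq_continuous_at\<close>)
  moreover have "bump' t * indicator {- 1..1} t = bump' t" for t
    using bump_eq_0(2)[of t] by (cases "1 < \<bar>t\<bar>") (auto simp: indicator_def)
  ultimately show "integral\<^sup>L lborel bump' = 0" by (simp add: bump_def)
  have "(\<integral>t. indicator {- 1/2..1/2::real} t * (1 / 2 :: real) \<partial>lborel) \<le> integral\<^sup>L lborel bump"
  proof (rule integral_mono[OF _ i(1)])
    fix t :: real
    show "indicator {- 1/2..1/2} t * (1 / 2) \<le> bump t"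
    proof (cases "t \<in> {- 1/2..1/2}")
      case True
      then have "\<bar>t\<bar> \<le> 1 / 2" by auto
      then have "t\<^sup>2 \<le> (1 / 2)\<^sup>2" by (intro power2_le_iff_abs_le[THEN iffD2]) auto
      then have "t\<^sup>2 \<le> 1 / 4" by (simp add: power2_eq_square)
      then have "3 / 4 \<le> max 0 (1 - t\<^sup>2)" by (simp add: le_max_iff_disj)
      then have "(3 / 4)\<^sup>2 \<le> bump t" unfolding bump_def by (rule power_mono) simp
      then show ?thesis using True by (simp add: power2_eq_square)
    qed (simp add: bump_def)
  qed simp
  then show "0 < integral\<^sup>L lborel bump" by simp
qed

text \<open>A function of \<open>norm y ^ 2\<close> in the comoving variable
  \<open>y = exp (- \<beta> * t) *\<^sub>R x\<close>, times a cutoff in time. Squaring the norm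
  avoids its singularity at the origin; one continuous derivative of \<open>\<zeta>\<close> and two
  of \<open>\<theta>\<close> match what \<open>test_function\<close> asks for.\<close>

lemma separated_test_function:
  fixes \<theta> \<theta>1 \<theta>2 \<zeta> \<zeta>' :: "real \<Rightarrow> real"
  assumes th: "\<And>z. (\<theta> has_real_derivative \<theta>1 z) (at z)" "\<And>z. (\<theta>1 has_real_derivative \<theta>2 z) (at z)"
      "continuous_on UNIV \<theta>2" "\<And>z. B \<le> z \<Longrightarrow> \<theta> z = 0"
    and ch: "\<And>t. (\<zeta> has_real_derivative \<zeta>' t) (at t)" "continuous_on UNIV \<zeta>'" "\<And>t. 1 < \<bar>t\<bar> \<Longrightarrow> \<zeta> t = 0"
    and \<phi>: "\<phi> = (\<lambda>(x::'a::euclidean_space) t. \<zeta> t * \<theta> (exp (- 2 * \<beta> * t) * (x \<bullet> x)))"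
  shows "test_function \<phi>"
    "time_deriv \<phi> x t = \<zeta>' t * \<theta> (exp (- 2 * \<beta> * t) * (x \<bullet> x))
      + \<zeta> t * (\<theta>1 (exp (- 2 * \<beta> * t) * (x \<bullet> x)) * (- 2 * \<beta> * exp (- 2 * \<beta> * t) * (x \<bullet> x)))"
    "laplacian \<phi> x t = \<zeta> t * exp (- 2 * \<beta> * t) * (2 * real DIM('a) * \<theta>1 (exp (- 2 * \<beta> * t) * (x \<bullet> x))
      + 4 * (exp (- 2 * \<beta> * t) * (x \<bullet> x)) * \<theta>2 (exp (- 2 * \<beta> * t) * (x \<bullet> x)))"
proof -
  define e where "e t = exp (- 2 * \<beta> * t)" for t :: real
  have ce: "continuous_on S e" for S unfolding e_def[abs_def] by (intro continuous_intros)
  have \<phi>': "\<phi> = (\<lambda>(x::'a) t. \<zeta> t * \<theta> (e t * (x \<bullet> x)))" unfolding \<phi> e_def ..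
  define D where "D x t = \<zeta>' t * \<theta> (e t * (x \<bullet> x)) + \<zeta> t * (\<theta>1 (e t * (x \<bullet> x)) * (- 2 * \<beta> * e t * (x \<bullet> x)))" for x :: 'a and t
  define S1 where "S1 b x t = \<zeta> t * (\<theta>1 (e t * (x \<bullet> x)) * (e t * (2 * (x \<bullet> b))))" for b x :: 'a and t
  define S2 where "S2 b' b x t = \<zeta> t * (\<theta>2 (e t * (x \<bullet> x)) * (e t * (2 * (x \<bullet> b'))) * (e t * (2 * (x \<bullet> b)))
      + \<theta>1 (e t * (x \<bullet> x)) * (e t * (2 * (b' \<bullet> b))))" for b' b x :: 'a and t
  have de: "(e has_real_derivative - 2 * \<beta> * e t) (at t)" for t
    unfolding e_def[abs_def] by (auto intro!: derivative_eq_intros)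
  have dt: "((\<lambda>t. \<phi> x t) has_real_derivative D x t) (at t)" for x t
  proof -
    have "((\<lambda>t. e t * (x \<bullet> x)) has_real_derivative - 2 * \<beta> * e t * (x \<bullet> x)) (at t)"
      by (rule DERIV_cmult_right[OF de])
    from DERIV_mult[OF ch(1) DERIV_chain2[OF th(1) this]]
    show ?thesis unfolding \<phi>' D_def by (simp add: mult.commute)
  qed
  have dw: "((\<lambda>h. e t * ((x + h *\<^sub>R b) \<bullet> (x + h *\<^sub>R b))) has_real_derivative e t * (2 * (x \<bullet> b))) (at 0)" for b x :: 'a and t
  proof -
    have "((\<lambda>s. x \<bullet> x + 2 * s * (x \<bullet> b) + s\<^sup>2 * (b \<bullet> b)) has_real_derivative 2 * (x \<bullet> b)) (at 0)"
      by (auto intro!: derivative_eq_intros)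
    moreover have "(\<lambda>s. x \<bullet> x + 2 * s * (x \<bullet> b) + s\<^sup>2 * (b \<bullet> b)) = (\<lambda>s. (x + s *\<^sub>R b) \<bullet> (x + s *\<^sub>R b))"
      by (simp add: fun_eq_iff inner_simps inner_commute power2_eq_square algebra_simps)
    ultimately show ?thesis by (intro DERIV_cmult) simp
  qed
  have w0: "e t * ((x + 0 *\<^sub>R b) \<bullet> (x + 0 *\<^sub>R b)) = e t * (x \<bullet> x)" for b x :: 'a and t by simp
  have ds1: "((\<lambda>h. \<phi> (x + h *\<^sub>R b) t) has_real_derivative S1 b x t) (at 0)" for b x t
    using DERIV_cmult[OF DERIV_chain2[OF th(1) dw], of "\<zeta> t" t x b] unfolding \<phi>' S1_def w0 .
  have ds2: "((\<lambda>h. S1 b (x + h *\<^sub>R b') t) has_real_derivative S2 b' b x t) (at 0)" for b' b x t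
  proof -
    have "((\<lambda>h. (x + h *\<^sub>R b') \<bullet> b) has_real_derivative b' \<bullet> b) (at 0)"
      unfolding inner_add_left inner_scaleR_left by (auto intro!: derivative_eq_intros)
    then have "((\<lambda>h. e t * (2 * ((x + h *\<^sub>R b') \<bullet> b))) has_real_derivative e t * (2 * (b' \<bullet> b))) (at 0)"
      by (intro DERIV_cmult)
    from DERIV_cmult[OF DERIV_mult[OF DERIV_chain2[OF th(2) dw[of t x b']] this], of "\<zeta> t"]
    show ?thesis unfolding S1_def S2_def w0 by (rule DERIV_cong) simp
  qed
  have td: "time_deriv \<phi> = D" unfolding time_deriv_def fun_eq_iff using DERIV_imp_deriv[OF dt] by blast
  have sd: "space_deriv b \<phi> = S1 b" for b unfolding space_deriv_def fun_eq_iff using DERIV_imp_deriv[OF ds1] by blast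
  have sd2: "space_deriv b' (S1 b) = S2 b' b" for b b' unfolding space_deriv_def fun_eq_iff using DERIV_imp_deriv[OF ds2] by blast
  have isc: "continuous_on UNIV \<theta>" "continuous_on UNIV \<theta>1" "continuous_on UNIV \<zeta>"
    using th(1,2) ch(1) by (meson DERIV_isCont continuous_at_imp_continuous_on)+
  have comp: "continuous_on UNIV (\<lambda>z::'a \<times> real. g (e (snd z) * (fst z \<bullet> fst z)))" if "continuous_on UNIV g" for g :: "real \<Rightarrow> real"
    by (rule continuous_on_compose2[OF that]) (auto intro!: continuous_intros continuous_on_compose2[OF ce])
  have comp2: "continuous_on UNIV (\<lambda>z::'a \<times> real. g (snd z))" if "continuous_on UNIV g" for g :: "real \<Rightarrow> real"
    by (rule continuous_on_compose2[OF that]) (auto intro!: continuous_intros)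
  note cont = comp[OF isc(1)] comp[OF isc(2)] comp[OF th(3)] comp2[OF isc(3)] comp2[OF ch(2)] comp2[OF ce]
  have jc: "jointly_continuous \<phi>" "jointly_continuous D" "jointly_continuous (S1 b)" "jointly_continuous (S2 b' b)" for b b'
    unfolding jointly_continuous_def \<phi>' D_def S1_def S2_def case_prod_unfold
    by (intro continuous_intros cont)+
  have bound: "norm (x, t) \<le> sqrt (\<bar>B\<bar> * exp (2 * \<bar>\<beta>\<bar>)) + 1" if "\<phi> x t \<noteq> 0" for x t
  proof -
    have t: "\<bar>t\<bar> \<le> 1" using ch(3)[of t] that unfolding \<phi>' by fastforce
    have "e t * (x \<bullet> x) < B" using th(4)[of "e t * (x \<bullet> x)"] that unfolding \<phi>' by fastforce
    then have "exp (2 * \<beta> * t) * (e t * (x \<bullet> x)) \<le> exp (2 * \<beta> * t) * \<bar>B\<bar>" by (intro mult_left_mono) auto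
    moreover have "exp (2 * \<beta> * t) * (e t * (x \<bullet> x)) = x \<bullet> x"
      unfolding e_def mult.assoc[symmetric] exp_add[symmetric] by simp
    ultimately have "x \<bullet> x \<le> exp (2 * \<beta> * t) * \<bar>B\<bar>" by (simp only:)
    also have "\<dots> \<le> exp (2 * \<bar>\<beta>\<bar>) * \<bar>B\<bar>"
    proof (intro mult_right_mono)
      have "\<beta> * t \<le> \<bar>\<beta>\<bar> * \<bar>t\<bar>" by (metis abs_ge_self abs_mult)
      also have "\<dots> \<le> \<bar>\<beta>\<bar> * 1" using t by (intro mult_left_mono) auto
      finally show "exp (2 * \<beta> * t) \<le> exp (2 * \<bar>\<beta>\<bar>)" by simp
    qed simp
    finally have "norm x \<le> sqrt (\<bar>B\<bar> * exp (2 * \<bar>\<beta>\<bar>))"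
      unfolding norm_eq_sqrt_inner by (simp add: mult.commute)
    then show ?thesis using norm_Pair_le[of x t] t by simp
  qed
  have "bounded {(x, t). \<phi> x t \<noteq> 0}" unfolding bounded_iff using bound by blast
  then have "compact (closure {(x, t). \<phi> x t \<noteq> 0})" by (simp add: compact_eq_bounded_closed bounded_closure)
  then show "test_function \<phi>"
    unfolding test_function_def time_C1_def space_C1_def td sd sd2
    using jc field_differentiable_def dt ds1 ds2 by blast
  show "time_deriv \<phi> x t = \<zeta>' t * \<theta> (exp (- 2 * \<beta> * t) * (x \<bullet> x))
      + \<zeta> t * (\<theta>1 (exp (- 2 * \<beta> * t) * (x \<bullet> x)) * (- 2 * \<beta> * exp (- 2 * \<beta> * t) * (x \<bullet> x)))"
    unfolding td D_def e_def by (rule refl)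
  have "(\<Sum>b\<in>Basis. (x \<bullet> b) * (x \<bullet> b)) = x \<bullet> x" by (rule euclidean_inner[symmetric])
  moreover have "S2 b b x t = \<zeta> t * e t * (4 * e t * \<theta>2 (e t * (x \<bullet> x))) * ((x \<bullet> b) * (x \<bullet> b)) + \<zeta> t * e t * (2 * \<theta>1 (e t * (x \<bullet> x)))"
    if "b \<in> Basis" for b
    unfolding S2_def using that by (simp add: algebra_simps)
  then have "(\<Sum>b\<in>Basis. S2 b b x t) = (\<Sum>b\<in>Basis. \<zeta> t * e t * (4 * e t * \<theta>2 (e t * (x \<bullet> x))) * ((x \<bullet> b) * (x \<bullet> b)) + \<zeta> t * e t * (2 * \<theta>1 (e t * (x \<bullet> x))))"
    by (rule sum.cong[OF refl])
  ultimately have "laplacian \<phi> x t = \<zeta> t * e t * (4 * e t * \<theta>2 (e t * (x \<bullet> x))) * (x \<bullet> x) + real DIM('a) * (\<zeta> t * e t * (2 * \<theta>1 (e t * (x \<bullet> x))))"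
    unfolding laplacian_def sd sd2 by (simp add: sum.distrib sum_distrib_left[symmetric])
  then show "laplacian \<phi> x t = \<zeta> t * exp (- 2 * \<beta> * t) * (2 * real DIM('a) * \<theta>1 (exp (- 2 * \<beta> * t) * (x \<bullet> x))
      + 4 * (exp (- 2 * \<beta> * t) * (x \<bullet> x)) * \<theta>2 (exp (- 2 * \<beta> * t) * (x \<bullet> x)))"
    unfolding e_def[symmetric] by (simp add: algebra_simps)
qed

context profile_parameters
begin

text \<open>The time factor \<open>exp (- \<beta> * q * t) * bump t\<close> cancels the common
  factor \<open>exp (\<beta> * q * t)\<close> of the comoving integrand. What multiplies
  \<open>bump'\<close> integrates to zero in time, and the positive integral of \<open>bump\<close>
  can be divided out, which leaves a stationary identity.\<close>

lemma weak_solution_radial_identity: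
  assumes N: "N = real DIM('a::euclidean_space)"
    and ws: "weak_solution m p \<sigma>1 \<sigma>2 (exp_self_similar (k * \<beta>) \<beta> f :: 'a \<Rightarrow> real \<Rightarrow> real)"
    and fn: "\<And>r. 0 \<le> r \<Longrightarrow> 0 \<le> f r"
    and th: "\<And>z. (\<theta> has_real_derivative \<theta>1 z) (at z)" "\<And>z. (\<theta>1 has_real_derivative \<theta>2 z) (at z)"
      "continuous_on UNIV \<theta>2" "\<And>z. z\<^sub>0 \<le> z \<Longrightarrow> \<theta> z = 0"
  shows "integral\<^sup>L lborel (\<lambda>y::'a. norm y powr \<sigma>1 * (f (norm y) * (- 2 * \<beta> * (norm y)\<^sup>2 * \<theta>1 ((norm y)\<^sup>2) - \<beta> * q * \<theta> ((norm y)\<^sup>2)))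
      + f (norm y) powr m * (2 * N * \<theta>1 ((norm y)\<^sup>2) + 4 * (norm y)\<^sup>2 * \<theta>2 ((norm y)\<^sup>2))
      + norm y powr \<sigma>2 * (f (norm y) powr p * \<theta> ((norm y)\<^sup>2))) = 0" (is "integral\<^sup>L lborel ?C = 0")
proof -
  let ?u = "exp_self_similar (k * \<beta>) \<beta> f :: 'a \<Rightarrow> real \<Rightarrow> real"
  define \<zeta> where "\<zeta> t = exp (- \<beta> * q * t) * bump t" for t
  define \<zeta>' where "\<zeta>' t = exp (- \<beta> * q * t) * (bump' t - \<beta> * q * bump t)" for t
  define \<phi> where "\<phi> = (\<lambda>(x::'a) t. \<zeta> t * \<theta> (exp (- 2 * \<beta> * t) * (x \<bullet> x)))"
  have d\<zeta>: "(\<zeta> has_real_derivative \<zeta>' t) (at t)" for t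
  proof -
    have "((\<lambda>t. exp (- \<beta> * q * t)) has_real_derivative - \<beta> * q * exp (- \<beta> * q * t)) (at t)"
      by (auto intro!: derivative_eq_intros)
    from DERIV_mult[OF this has_real_derivative_bump] show ?thesis
      unfolding \<zeta>_def[abs_def] \<zeta>'_def by (simp add: algebra_simps)
  qed
  have c\<zeta>': "continuous_on UNIV \<zeta>'"
    unfolding \<zeta>'_def[abs_def] by (intro continuous_intros continuous_on_bump)
  have v\<zeta>: "\<zeta> t = 0" if "1 < \<bar>t\<bar>" for t unfolding \<zeta>_def using bump_eq_0(1)[OF that] by simp
  note tf = separated_test_function[OF th d\<zeta> c\<zeta>' v\<zeta> \<phi>_def]
  let ?F = "\<lambda>(x, t). norm x powr \<sigma>1 * ?u x t * time_deriv \<phi> x t + ?u x t powr m * laplacian \<phi> x t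
                 + norm x powr \<sigma>2 * ?u x t powr p * \<phi> x t"
  have h: "has_bochner_integral lborel ?F 0" using ws tf(1) unfolding weak_solution_def by blast
  have "?F \<in> borel_measurable borel" using borel_measurable_has_bochner_integral[OF h] by simp
  from has_bochner_integral_comoving[OF this, of 0 \<beta>] h
  have h2: "has_bochner_integral lborel (\<lambda>z. exp (real DIM('a) * \<beta> * snd z) * ?F (comoving \<beta> z)) 0" by blast
  define Ay where "Ay y = norm y powr \<sigma>1 * (f (norm y) * \<theta> ((norm y)\<^sup>2))" for y :: 'a
  have eq: "exp (real DIM('a) * \<beta> * snd z) * ?F (comoving \<beta> z) = bump' (snd z) * Ay (fst z) + bump (snd z) * ?C (fst z)" for z
  proof -
    obtain y t where z: "z = (y, t)" by (cases z)
    have fy: "0 \<le> f (norm y)" using fn by simp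
    define E where "E = exp (\<beta> * q * t)"
    define w where "w = (norm y)\<^sup>2"
    define e where "e = exp (\<beta> * t)"
    define i where "i = exp (- 2 * \<beta> * t)"
    define Fk where "Fk = exp (k * \<beta> * t) * f (norm y)"
    define En where "En = exp (N * \<beta> * t)"
    define Y1 where "Y1 = norm y powr \<sigma>1"
    define Y2 where "Y2 = norm y powr \<sigma>2"
    define Fm where "Fm = f (norm y) powr m"
    define Fp where "Fp = f (norm y) powr p"
    have ce: "En * ((e * norm y) powr \<sigma>1 * Fk) = E * (Y1 * f (norm y))" "En * Fk powr m = E * (e * e) * Fm"
      "En * ((e * norm y) powr \<sigma>2 * Fk powr p) = E * (Y2 * Fp)"
      unfolding En_def e_def Fk_def E_def Y1_def Y2_def Fm_def Fp_def by (rule comoving_exponents[OF norm_ge_zero fy])+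
    have "exp (\<beta> * t) * exp (- \<beta> * t) = 1" by (simp add: exp_minus)
    then have "norm (exp (\<beta> * t) *\<^sub>R y) * exp (- \<beta> * t) = norm y" by simp
    then have u: "?u (e *\<^sub>R y) t = Fk" unfolding exp_self_similar_def e_def Fk_def by (simp only:)
    have ei: "(e * e) * i = 1" unfolding e_def i_def exp_add[symmetric] by simp
    have wi: "i * ((e *\<^sub>R y) \<bullet> (e *\<^sub>R y)) = w"
    proof -
      have "i * ((e *\<^sub>R y) \<bullet> (e *\<^sub>R y)) = ((e * e) * i) * (y \<bullet> y)" by simp
      then show ?thesis unfolding ei w_def power2_norm_eq_inner by simp
    qed
    have EZ: "E * \<zeta> t = bump t" "E * \<zeta>' t = bump' t - \<beta> * q * bump t"
      unfolding E_def \<zeta>_def \<zeta>'_def mult.assoc[symmetric] exp_add[symmetric] by simp_all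
    have td: "time_deriv \<phi> (e *\<^sub>R y) t = \<zeta>' t * \<theta> w + \<zeta> t * (\<theta>1 w * (- 2 * \<beta> * w))"
      using tf(2)[where x = "e *\<^sub>R y" and t = t] unfolding i_def[symmetric] mult.assoc[of "- 2 * \<beta>" i] wi .
    have la: "laplacian \<phi> (e *\<^sub>R y) t = \<zeta> t * i * (2 * N * \<theta>1 w + 4 * w * \<theta>2 w)"
      using tf(3)[where x = "e *\<^sub>R y" and t = t] unfolding i_def[symmetric] wi N .
    have ph: "\<phi> (e *\<^sub>R y) t = \<zeta> t * \<theta> w" unfolding \<phi>_def i_def[symmetric] wi by (rule refl)
    have ne: "norm (e *\<^sub>R y) = e * norm y" unfolding e_def by simp
    have "exp (real DIM('a) * \<beta> * snd z) * ?F (comoving \<beta> z) = En * ((e * norm y) powr \<sigma>1 * Fk * (\<zeta>' t * \<theta> w + \<zeta> t * (\<theta>1 w * (- 2 * \<beta> * w)))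
       + Fk powr m * (\<zeta> t * i * (2 * N * \<theta>1 w + 4 * w * \<theta>2 w)) + (e * norm y) powr \<sigma>2 * Fk powr p * (\<zeta> t * \<theta> w))"
      unfolding z comoving_def fst_conv snd_conv case_prod_conv e_def[symmetric] u td la ph ne En_def N by (rule refl)
    also have "\<dots> = (En * ((e * norm y) powr \<sigma>1 * Fk)) * (\<zeta>' t * \<theta> w + \<zeta> t * (\<theta>1 w * (- 2 * \<beta> * w)))
       + (En * Fk powr m) * (\<zeta> t * i * (2 * N * \<theta>1 w + 4 * w * \<theta>2 w)) + (En * ((e * norm y) powr \<sigma>2 * Fk powr p)) * (\<zeta> t * \<theta> w)"
      by (simp only: distrib_left mult.assoc)
    also have "\<dots> = Y1 * f (norm y) * ((E * \<zeta>' t) * \<theta> w + (E * \<zeta> t) * (\<theta>1 w * (- 2 * \<beta> * w)))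
       + ((e * e) * i) * (Fm * ((E * \<zeta> t) * (2 * N * \<theta>1 w + 4 * w * \<theta>2 w))) + Y2 * Fp * ((E * \<zeta> t) * \<theta> w)"
      unfolding ce by (simp add: algebra_simps)
    also have "\<dots> = bump' t * (Y1 * (f (norm y) * \<theta> w)) + bump t * (Y1 * (f (norm y) * (- 2 * \<beta> * w * \<theta>1 w - \<beta> * q * \<theta> w))
       + Fm * (2 * N * \<theta>1 w + 4 * w * \<theta>2 w) + Y2 * (Fp * \<theta> w))"
      unfolding EZ ei by (simp add: algebra_simps)
    finally show ?thesis unfolding z fst_conv snd_conv Ay_def Y1_def Y2_def Fm_def Fp_def w_def .
  qed
  define J where "J z = bump' (snd z) * Ay (fst z) + bump (snd z) * ?C (fst z)" for z
  have hJ: "has_bochner_integral (lborel \<Otimes>\<^sub>M lborel) J 0"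
    using h2 unfolding eq J_def[symmetric] lborel_prod .
  have inner: "(\<integral>t. J (y, t) \<partial>lborel) = integral\<^sup>L lborel bump * ?C y" for y
    unfolding J_def fst_conv snd_conv
    using bump_integrals(1,2,3) by (subst Bochner_Integration.integral_add) simp_all
  have "(\<integral>y. (\<integral>t. J (y, t) \<partial>lborel) \<partial>lborel) = integral\<^sup>L (lborel \<Otimes>\<^sub>M lborel) J"
    by (rule lborel_pair.integral_fst') (use hJ in \<open>simp add: has_bochner_integral_iff\<close>)
  then have "integral\<^sup>L lborel bump * (\<integral>y. ?C y \<partial>lborel) = 0"
    unfolding inner using hJ by (simp add: has_bochner_integral_iff)
  then show ?thesis using bump_integrals(4) by simp
qed

text \<open>
  The test function is chosen so that \<open>2 * r powr N * \<theta>1 (r\<^sup>2)\<close> is the antiderivative of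
  \<open>g (r\<^sup>2) * (2 * r)\<close>; an integration by parts then leaves only \<open>f powr m - prim \<beta> f\<close>.
\<close>

lemma weak_solution_moment:
  assumes N: "N = real DIM('a::euclidean_space)"
    and ws: "weak_solution m p \<sigma>1 \<sigma>2 (exp_self_similar (k * \<beta>) \<beta> f :: 'a \<Rightarrow> real \<Rightarrow> real)"
    and f: "continuous_on {0..} f" "\<And>r. 0 \<le> r \<Longrightarrow> 0 \<le> f r"
    and b: "0 < lo" "lo < b\<^sup>2" "0 < b"
    and g: "continuous_on UNIV g" "\<And>z. z \<le> lo \<Longrightarrow> g z = 0" "\<And>z. b\<^sup>2 \<le> z \<Longrightarrow> g z = 0" "integral {lo..b\<^sup>2} g = 0"
  shows "((\<lambda>r. g (r\<^sup>2) * (2 * r) * (f r powr m - prim \<beta> f r)) has_integral 0) {0..b}"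
    "((\<lambda>r. g (r\<^sup>2) * (2 * r)) has_integral 0) {0..b}"
proof -
  define hi where "hi = b\<^sup>2"
  define \<omega> where "\<omega> z = integral {lo..z} g" for z
  define \<theta>1 where "\<theta>1 z = \<omega> z * z powr (- (N / 2)) / 2" for z
  define \<theta>2 where "\<theta>2 z = g z * z powr (- (N / 2)) / 2 - N / 4 * \<omega> z * z powr (- (N / 2) - 1)" for z
  \<comment> \<open>Normalised to vanish beyond \<open>hi\<close>. Below \<open>lo\<close> it is
    constant, in general nonzero, so the test function does see the origin.\<close>
  define \<theta> where "\<theta> z = integral {lo..z} \<theta>1 - integral {lo..hi} \<theta>1" for z
  have AB: "lo < hi" using b(2) unfolding hi_def .
  have d\<omega>: "(\<omega> has_real_derivative g z) (at z)" for z
    unfolding \<omega>_def[abs_def] by (rule has_real_derivative_antiderivative_from[OF g(1,2)])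
  have \<omega>0: "\<omega> z = 0" if "z \<le> lo" for z
    using integral_cong[of "{lo..z}" g "\<lambda>_. 0"] g(2) that unfolding \<omega>_def by simp
  have after: "integral {lo..z} h = integral {lo..hi} h" if "hi \<le> z" "continuous_on UNIV h" "\<And>z. hi \<le> z \<Longrightarrow> h z = 0" for z and h :: "real \<Rightarrow> real"
  proof -
    note t = that
    have "integral {lo..hi} h + integral {hi..z} h = integral {lo..z} h"
      by (rule Henstock_Kurzweil_Integration.integral_combine)
         (use AB t(1) in \<open>auto intro!: integrable_continuous_interval continuous_on_subset[OF t(2)]\<close>)
    moreover have "integral {hi..z} h = 0" using integral_cong[of "{hi..z}" h "\<lambda>_. 0"] t(3) by simp
    ultimately show ?thesis by simp
  qed
  have \<omega>hi: "\<omega> z = 0" if "hi \<le> z" for z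
    using after[OF that g(1)] g(3,4) unfolding \<omega>_def hi_def[symmetric] by simp
  have d1: "(\<theta>1 has_real_derivative \<theta>2 z) (at z)" for z
  proof (cases "z < lo")
    case True
    have "((\<lambda>z. 0) has_real_derivative 0) (at z)" by simp
    then have "(\<theta>1 has_real_derivative 0) (at z)"
      by (rule has_field_derivative_transform_within_open[of _ _ _ "{..<lo}"]) (use True \<omega>0 in \<open>auto simp: \<theta>1_def\<close>)
    then show ?thesis using True \<omega>0[of z] g(2)[of z] by (simp add: \<theta>2_def)
  next
    case False
    then have "0 < z" using b(1) by simp
    then have "((\<lambda>z. z powr (- (N / 2))) has_real_derivative - (N / 2) * z powr (- (N / 2) - 1)) (at z)"
      by (auto intro!: derivative_eq_intros)
    from DERIV_cdivide[OF DERIV_mult[OF d\<omega> this], of 2] show ?thesis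
      unfolding \<theta>1_def[abs_def] \<theta>2_def by (rule DERIV_cong) (simp add: field_simps)
  qed
  have c1: "continuous_on UNIV \<theta>1" using d1 by (meson DERIV_isCont continuous_at_imp_continuous_on)
  have \<theta>1_0: "\<theta>1 z = 0" if "z \<le> lo" for z unfolding \<theta>1_def using \<omega>0[OF that] by simp
  have d0: "(\<theta> has_real_derivative \<theta>1 z) (at z)" for z
    unfolding \<theta>_def[abs_def]
    using DERIV_diff[OF has_real_derivative_antiderivative_from[where a = lo, OF c1 \<theta>1_0] DERIV_const[of "integral {lo..hi} \<theta>1"], of z] by simp
  have c0: "continuous_on UNIV \<theta>" using d0 by (meson DERIV_isCont continuous_at_imp_continuous_on)
  have v1: "\<theta>1 z = 0" "\<theta>2 z = 0" if "hi \<le> z" for z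
    unfolding \<theta>1_def \<theta>2_def using \<omega>hi[OF that] g(3)[of z] that hi_def by simp_all
  have v0: "\<theta> z = 0" if "hi \<le> z" for z
    using after[OF that c1 v1(1)] unfolding \<theta>_def by simp
  have c2: "continuous_on UNIV \<theta>2"
  proof (intro continuous_at_imp_continuous_on ballI)
    fix z :: real
    show "isCont \<theta>2 z"
    proof (cases "z < lo")
      case True
      have "eventually (\<lambda>z. z < lo) (nhds z)" using True by (rule eventually_nhds_in_open[of "{..<lo}", simplified])
      then have "eventually (\<lambda>z. \<theta>2 z = 0) (nhds z)"
        by eventually_elim (simp add: \<theta>2_def \<omega>0 g(2))
      then show ?thesis using isCont_cong[of \<theta>2 "\<lambda>_. 0" z] by simp
    next
      case False
      then have "0 < z" using b(1) by simp
      moreover have "isCont \<omega> z" "isCont g z"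
        using DERIV_isCont[OF d\<omega>] g(1) by (simp_all add: continuous_on_eq_continuous_at)
      ultimately show ?thesis unfolding \<theta>2_def[abs_def] by (intro continuous_intros) auto
    qed
  qed
  \<comment> \<open>The even extension of \<open>f\<close>, continuous on the whole line.\<close>
  define fe where "fe r = f \<bar>r\<bar>" for r
  have cfe: "continuous_on UNIV fe" unfolding fe_def[abs_def]
    by (rule continuous_on_compose2[OF f(1)]) (auto intro!: continuous_intros)
  define T1 where "T1 r = fe r * (- 2 * \<beta> * r\<^sup>2 * \<theta>1 (r\<^sup>2) - \<beta> * q * \<theta> (r\<^sup>2))" for r
  define T2 where "T2 r = fe r powr m * (2 * N * \<theta>1 (r\<^sup>2) + 4 * r\<^sup>2 * \<theta>2 (r\<^sup>2))" for r
  define T3 where "T3 r = fe r powr p * \<theta> (r\<^sup>2)" for r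
  define C where "C r = r powr \<sigma>1 * T1 r + T2 r + r powr \<sigma>2 * T3 r" for r
  have fen: "0 \<le> fe r" for r unfolding fe_def using f(2) by simp
  have sq: "continuous_on UNIV (\<lambda>r. h (r\<^sup>2))" if "continuous_on UNIV h" for h :: "real \<Rightarrow> real"
    by (rule continuous_on_compose2[OF that]) (auto intro!: continuous_intros)
  have fpow: "continuous_on UNIV (\<lambda>r. fe r powr a)" if "0 < a" for a
    using that fen by (intro continuous_on_powr' cfe continuous_intros) auto
  have cT: "continuous_on UNIV T1" "continuous_on UNIV T2" "continuous_on UNIV T3"
    unfolding T1_def[abs_def] T2_def[abs_def] T3_def[abs_def]
    by (rule cfe sq[OF c0] sq[OF c1] sq[OF c2] fpow[OF m_pos] fpow[OF p_pos] continuous_on_const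
        continuous_on_mult continuous_on_add continuous_on_diff continuous_on_power continuous_on_id)+
  have vT: "T1 r = 0" "T2 r = 0" "T3 r = 0" if "b < r" for r
  proof -
    have "hi \<le> r\<^sup>2" unfolding hi_def using that b(3) by (intro power_mono) auto
    then show "T1 r = 0" "T2 r = 0" "T3 r = 0" unfolding T1_def T2_def T3_def using v0 v1 by simp_all
  qed
  have cTn: "continuous_on UNIV (\<lambda>y::'a. h (norm y))" if "continuous_on UNIV h" for h :: "real \<Rightarrow> real"
    by (rule continuous_on_compose2[OF that]) (auto intro!: continuous_intros)
  have wint: "integrable lborel (\<lambda>y::'a. norm y powr \<sigma> * h (norm y))"
    if "0 < N + \<sigma>" "continuous_on UNIV h" "\<And>r. b < r \<Longrightarrow> h r = 0" for \<sigma> and h :: "real \<Rightarrow> real"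
  proof -
    note t = that
    obtain D where "\<And>y::'a. \<bar>h (norm y)\<bar> \<le> D"
      using continuous_compact_support_bounded[OF cTn[OF t(2)], of b] t(3) by blast
    then show ?thesis
      using t by (intro weighted_integrable[where C = D and R = b]) (auto simp: N intro!: borel_measurable_continuous_onI cTn)
  qed
  have int: "integrable lborel (\<lambda>y::'a. C (norm y))"
    unfolding C_def
    by (intro Bochner_Integration.integrable_add wint N_\<sigma>1 N_\<sigma>2 cT vT continuous_compact_support_integrable[where R = b] cTn)
  have zero: "integral\<^sup>L lborel (\<lambda>y::'a. C (norm y)) = 0"
    using weak_solution_radial_identity[OF N ws f(2) d0 d1 c2 v0] unfolding C_def T1_def T2_def T3_def fe_def by simp
  have Cm: "C \<in> borel_measurable borel"
    unfolding C_def[abs_def] using cT[THEN borel_measurable_continuous_onI] by measurable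
  define Q where "Q r = indicator {0<..} r * r powr (N - 1) * C r" for r :: real
  have "integrable lborel Q" "integral\<^sup>L lborel Q = 0"
    using radial_integral[OF Cm, where 'a = 'a] int zero sphere_const_pos[where 'a = 'a] unfolding N[symmetric] Q_def[symmetric] by auto
  then have "(Q has_integral 0) UNIV" using has_integral_integral_lborel[of Q] by simp
  moreover have "Q r = 0" if "r \<notin> {0..b}" for r
    using that vT unfolding Q_def C_def by (auto simp: indicator_def)
  then have "(\<lambda>r. if r \<in> {0..b} then Q r else 0) = Q" by auto
  ultimately have Q0: "(Q has_integral 0) {0..b}" using has_integral_restrict_UNIV[of "{0..b}" Q 0] by simp
  \<comment> \<open>For positive \<open>r\<close> this is \<open>r powr (N - 2) * flux\<close>,
    whose derivative is just the pair of weighted integrands. \<open>H\<close> is the boundary term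
    of the integration by parts and vanishes at both ends.\<close>
  define K where "K r = \<beta> * q * (r powr (N + \<sigma>1) * pmean (N + \<sigma>1) f r) - r powr (N + \<sigma>2) * pmean (N + \<sigma>2) (\<lambda>x. f x powr p) r" for r
  define H where "H r = \<omega> (r\<^sup>2) * prim \<beta> f r - K r * \<theta> (r\<^sup>2)" for r
  define M where "M r = f r powr m - prim \<beta> f r" for r
  have fp: "continuous_on {0..} (\<lambda>x. f x powr p)" by (rule continuous_on_powr_p[OF f])
  have dsq: "((\<lambda>r::real. r\<^sup>2) has_real_derivative 2 * r) (at r)" for r by (auto intro!: derivative_eq_intros)
  have dH: "(H has_real_derivative Q r - g (r\<^sup>2) * (2 * r) * M r) (at r)" if r: "0 < r" for r
  proof -
    have dK: "(K has_real_derivative \<beta> * q * (r powr (N + \<sigma>1 - 1) * f r) - r powr (N + \<sigma>2 - 1) * f r powr p) (at r)"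
      unfolding K_def[abs_def]
      by (intro DERIV_diff DERIV_cmult has_real_derivative_powr_mult_pmean N_\<sigma>1 N_\<sigma>2 r f(1) fp)
    note d = DERIV_diff[OF DERIV_mult[OF DERIV_chain2[OF d\<omega> dsq] has_real_derivative_prim[OF f r]]
        DERIV_mult[OF dK DERIV_chain2[OF d0 dsq]]]
    define a where "a = r powr (N - 1)"
    define y1 where "y1 = r powr \<sigma>1"
    define y2 where "y2 = r powr \<sigma>2"
    have a0: "0 < a" unfolding a_def using r by simp
    have pw: "r powr (N + \<sigma>1 - 1) = a * y1" "r powr (N + \<sigma>2 - 1) = a * y2" "r powr (N + \<sigma>1) = a * r * y1"
      "r powr (N + \<sigma>2) = a * r * y2" "r powr (\<sigma>1 + 2) = y1 * r\<^sup>2" "r powr (\<sigma>2 + 2) = y2 * r\<^sup>2"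
      unfolding a_def y1_def y2_def using r by (simp_all add: powr_add powr_diff power2_eq_square)
    have "(r\<^sup>2) powr (- (N / 2)) = r powr (- N)" using r by (simp add: powr_powr flip: powr_numeral)
    also have "\<dots> = 1 / (a * r)" unfolding a_def using r by (simp add: powr_minus powr_diff field_simps)
    finally have z1: "(r\<^sup>2) powr (- (N / 2)) = 1 / (a * r)" .
    have z2: "(r\<^sup>2) powr (- (N / 2) - 1) = 1 / (a * r * r\<^sup>2)"
      using z1 r by (simp add: powr_diff)
    define w where "w = \<omega> (r\<^sup>2)"
    define G where "G = g (r\<^sup>2)"
    have t1: "\<theta>1 (r\<^sup>2) = w / (2 * a * r)" unfolding \<theta>1_def z1 w_def by simp
    have t2: "\<theta>2 (r\<^sup>2) = G / (2 * a * r) - N * w / (4 * a * r * r\<^sup>2)" unfolding \<theta>2_def z1 z2 w_def G_def by simp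
    have ind: "indicator {0<..} r = (1::real)" using r by simp
    have fr: "fe r = f r" unfolding fe_def using r by simp
    have alg: "G * (2 * r) * P + (bq * (y1 * r\<^sup>2) * G1 - y2 * r\<^sup>2 * G2 - bb * (y1 * r\<^sup>2) * F) / r * w -
          ((bq * (a * y1 * F) - a * y2 * Fp) * \<Theta> + w / (2 * a * r) * (2 * r) * (bq * (a * r * y1 * G1) - a * r * y2 * G2))
        = a * (y1 * (F * (- 2 * bb * r\<^sup>2 * (w / (2 * a * r)) - bq * \<Theta>)) + Fm * (2 * N * (w / (2 * a * r)) + 4 * r\<^sup>2 * (G / (2 * a * r) - N * w / (4 * a * r * r\<^sup>2))) + y2 * (Fp * \<Theta>))
          - G * (2 * r) * (Fm - P)" for bq G1 G2 bb F P Fp \<Theta> Fm :: real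
    proof -
      have "a * (Fm * (2 * N * (w / (2 * a * r)) + 4 * r\<^sup>2 * (G / (2 * a * r) - N * w / (4 * a * r * r\<^sup>2)))) = 2 * r * G * Fm"
        using a0 r by (simp add: field_simps power2_eq_square)
      moreover have "(bq * (y1 * r\<^sup>2) * G1 - y2 * r\<^sup>2 * G2 - bb * (y1 * r\<^sup>2) * F) / r * w = w * (bq * (r * y1 * G1) - r * y2 * G2) - bb * r * y1 * w * F"
        using r by (simp add: field_simps power2_eq_square)
      moreover have "w / (2 * a * r) * (2 * r) * (bq * (a * r * y1 * G1) - a * r * y2 * G2) = w * (bq * (r * y1 * G1) - r * y2 * G2)"
        using a0 r by (simp add: field_simps)
      moreover have "a * (y1 * (F * (- 2 * bb * r\<^sup>2 * (w / (2 * a * r)) - bq * \<Theta>))) = - bb * r * y1 * w * F - bq * (a * y1 * F) * \<Theta>"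
        using a0 r by (simp add: field_simps power2_eq_square)
      ultimately show ?thesis unfolding distrib_left[of a] by (simp add: algebra_simps)
    qed
    show ?thesis
      unfolding H_def[abs_def]
    proof (rule DERIV_cong[OF d])
      show "g (r\<^sup>2) * (2 * r) * prim \<beta> f r + (flux \<beta> f r - \<beta> * r powr (\<sigma>1 + 2) * f r) / r * \<omega> (r\<^sup>2) -
          ((\<beta> * q * (r powr (N + \<sigma>1 - 1) * f r) - r powr (N + \<sigma>2 - 1) * f r powr p) * \<theta> (r\<^sup>2) + \<theta>1 (r\<^sup>2) * (2 * r) * K r)
        = Q r - g (r\<^sup>2) * (2 * r) * M r"
        unfolding flux_def K_def Q_def C_def T1_def T2_def T3_def M_def pw t1 t2 fr
          a_def[symmetric] y1_def[symmetric] y2_def[symmetric] w_def[symmetric] G_def[symmetric]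
          ind mult_1_left by (rule alg)
    qed
  qed
  have cH: "continuous_on {0..b} H"
  proof -
    have sub: "continuous_on {0..b} h" if "continuous_on {0..} h" for h :: "real \<Rightarrow> real"
      by (rule continuous_on_subset[OF that]) auto
    have sub2: "continuous_on {0..b} h" if "continuous_on UNIV h" for h :: "real \<Rightarrow> real"
      by (rule continuous_on_subset[OF that]) auto
    have pw: "continuous_on {0..} (\<lambda>x::real. x powr a)" if "0 < a" for a
      using that by (intro continuous_on_powr' continuous_intros) auto
    have c\<omega>: "continuous_on UNIV \<omega>" using d\<omega> by (meson DERIV_isCont continuous_at_imp_continuous_on)
    show ?thesis unfolding H_def[abs_def] K_def[abs_def]
      by (intro continuous_intros sub2[OF sq[OF c\<omega>]] sub2[OF sq[OF c0]] sub[OF continuous_on_prim[OF f]]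
          sub[OF pw[OF N_\<sigma>1]] sub[OF pw[OF N_\<sigma>2]] sub[OF continuous_on_pmean[OF N_\<sigma>1 f(1)]] sub[OF continuous_on_pmean[OF N_\<sigma>2 fp]])
  qed
  have "((\<lambda>r. Q r - g (r\<^sup>2) * (2 * r) * M r) has_integral H b - H 0) {0..b}"
  proof (rule fundamental_theorem_of_calculus_interior[OF _ cH])
    fix r assume "r \<in> {0<..<b}"
    then show "(H has_vector_derivative Q r - g (r\<^sup>2) * (2 * r) * M r) (at r)"
      using dH[of r] by (simp add: has_real_derivative_iff_has_vector_derivative)
  qed (use b(3) in auto)
  moreover have "H b = 0" unfolding H_def hi_def[symmetric] using \<omega>hi[of hi] v0[of hi] by simp
  moreover have "H 0 = 0" unfolding H_def K_def using \<omega>0[of 0] b(1) by simp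
  ultimately have "((\<lambda>r. Q r - g (r\<^sup>2) * (2 * r) * M r) has_integral 0) {0..b}" by simp
  from has_integral_diff[OF Q0 this]
  show "((\<lambda>r. g (r\<^sup>2) * (2 * r) * (f r powr m - prim \<beta> f r)) has_integral 0) {0..b}" unfolding M_def by simp
  have "((\<lambda>r. g (r\<^sup>2) * (2 * r)) has_integral \<omega> (b\<^sup>2) - \<omega> (0\<^sup>2)) {0..b}"
  proof (rule fundamental_theorem_of_calculus)
    fix r
    show "((\<lambda>r. \<omega> (r\<^sup>2)) has_vector_derivative g (r\<^sup>2) * (2 * r)) (at r within {0..b})"
      using DERIV_chain2[OF d\<omega> dsq, of r] has_field_derivative_at_within
      unfolding has_real_derivative_iff_has_vector_derivative[symmetric] by blast
  qed (use b(3) in simp)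
  then show "((\<lambda>r. g (r\<^sup>2) * (2 * r)) has_integral 0) {0..b}"
    using \<omega>0[of 0] \<omega>hi[of hi] b(1) unfolding hi_def[symmetric] by simp
qed

text \<open>
  With \<open>M = f powr m - prim \<beta> f\<close> and \<open>c\<close> its weighted mean, taking \<open>g\<close> proportional to \<open>M - c\<close> forces
  \<open>M = c\<close>.
\<close>

lemma weak_solution_profile:
  assumes N: "N = real DIM('a::euclidean_space)"
    and ws: "weak_solution m p \<sigma>1 \<sigma>2 (exp_self_similar (k * \<beta>) \<beta> f :: 'a \<Rightarrow> real \<Rightarrow> real)"
    and f0: "0 < f 0"
  shows "profile \<beta> f"
proof -
  \<comment> \<open>Along a ray at time \<open>0\<close> the solution equals \<open>f\<close>, which
    thereby inherits continuity and sign.\<close>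
  obtain v :: 'a where v: "norm v = 1" using vector_choose_size[of 1] by auto
  have jc: "continuous_on UNIV (\<lambda>(x::'a, t). exp_self_similar (k * \<beta>) \<beta> f x t)"
    and nn: "\<And>x::'a. \<And>t. 0 \<le> exp_self_similar (k * \<beta>) \<beta> f x t"
    using ws unfolding weak_solution_def jointly_continuous_def by blast+
  have u0: "exp_self_similar (k * \<beta>) \<beta> f (r *\<^sub>R v) 0 = f r" if "0 \<le> r" for r
    unfolding exp_self_similar_def using that v by simp
  have "continuous_on {0..} (\<lambda>r::real. (r *\<^sub>R v, 0::real))"
    by (intro continuous_on_Pair continuous_on_scaleR continuous_on_id continuous_on_const)
  from continuous_on_compose2[OF jc this subset_UNIV]
  have "continuous_on {0..} (\<lambda>r. exp_self_similar (k * \<beta>) \<beta> f (r *\<^sub>R v) 0)" unfolding case_prod_conv .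
  moreover have "continuous_on {0..} (\<lambda>r. exp_self_similar (k * \<beta>) \<beta> f (r *\<^sub>R v) 0) = continuous_on {0..} f"
    by (rule continuous_on_cong[OF refl]) (simp add: u0)
  ultimately have f1: "continuous_on {0..} f" by blast
  have f2: "0 \<le> f r" if "0 \<le> r" for r using nn[of "r *\<^sub>R v" 0] u0[OF that] by simp
  define M where "M r = f r powr m - prim \<beta> f r" for r
  have cM: "continuous_on {0..} M"
  proof -
    have "continuous_on {0..} (\<lambda>r. f r powr m)"
      using f1 f2 m_pos by (intro continuous_on_powr' continuous_on_const) auto
    then show ?thesis unfolding M_def[abs_def] by (rule continuous_on_diff[OF _ continuous_on_prim[OF f1 f2]])
  qed
  have const: "\<exists>c. \<forall>r. a < r \<and> r < b \<longrightarrow> M r = c" if ab: "0 < a" "a < b" for a b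
  proof -
    \<comment> \<open>A nonnegative weight in the variable \<open>z = r^2\<close>, positive exactly
      for \<open>a < r < b\<close> among nonnegative \<open>r\<close>.\<close>
    define T where "T z = max 0 ((z - a\<^sup>2) * (b\<^sup>2 - z))" for z
    define Mz where "Mz z = M (sqrt \<bar>z\<bar>)" for z
    have AB: "0 < a\<^sup>2" "a\<^sup>2 < b\<^sup>2" using ab by (auto intro: power_strict_mono)
    have cT: "continuous_on S T" for S unfolding T_def[abs_def] by (intro continuous_intros)
    have cMz: "continuous_on S Mz" for S unfolding Mz_def[abs_def]
      by (rule continuous_on_compose2[OF cM]) (auto intro!: continuous_intros)
    have Tn: "0 \<le> T z" for z unfolding T_def by simp
    have Tp: "0 < T z" if "a\<^sup>2 < z" "z < b\<^sup>2" for z unfolding T_def using that by (simp add: less_max_iff_disj)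
    have T0: "T z = 0" if "z \<le> a\<^sup>2 \<or> b\<^sup>2 \<le> z" for z
    proof -
      have "(z - a\<^sup>2) * (b\<^sup>2 - z) \<le> 0"
        using that AB(2) by (auto intro: mult_nonpos_nonneg mult_nonneg_nonpos)
      then show ?thesis unfolding T_def by (rule max_absorb1)
    qed
    have iT: "integral {a\<^sup>2..b\<^sup>2} T \<noteq> 0"
    proof -
      have "0 < T ((a\<^sup>2 + b\<^sup>2) / 2)" using AB by (intro Tp) (simp_all add: field_simps)
      moreover have "(a\<^sup>2 + b\<^sup>2) / 2 \<in> {a\<^sup>2..b\<^sup>2}" using AB by simp
      ultimately show ?thesis using integral_eq_0_iff[OF cT AB(2) Tn] by (metis less_irrefl)
    qed
    \<comment> \<open>Makes the integral of \<open>g\<close> vanish, as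
      \<open>weak_solution_moment\<close> requires.\<close>
    define c where "c = integral {a\<^sup>2..b\<^sup>2} (\<lambda>z. T z * Mz z) / integral {a\<^sup>2..b\<^sup>2} T"
    define g where "g z = T z * (Mz z - c)" for z
    have cg: "continuous_on UNIV g" unfolding g_def[abs_def] by (intro continuous_intros cT cMz)
    have "integral {a\<^sup>2..b\<^sup>2} g = integral {a\<^sup>2..b\<^sup>2} (\<lambda>z. T z * Mz z - c * T z)"
      unfolding g_def by (simp add: algebra_simps)
    also have "\<dots> = integral {a\<^sup>2..b\<^sup>2} (\<lambda>z. T z * Mz z) - integral {a\<^sup>2..b\<^sup>2} (\<lambda>z. c * T z)"
      by (rule integral_diff) (intro integrable_continuous_interval continuous_intros cT cMz)+
    also have "\<dots> = 0" unfolding c_def using iT by simp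
    finally have ig: "integral {a\<^sup>2..b\<^sup>2} g = 0" .
    have b0: "0 < b" using ab by simp
    have g0: "g z = 0" if "z \<le> a\<^sup>2" for z unfolding g_def using T0 that by simp
    have g1: "g z = 0" if "b\<^sup>2 \<le> z" for z unfolding g_def using T0 that by simp
    note mom = weak_solution_moment[OF N ws f1 f2 AB b0 cg g0 g1 ig]
    \<comment> \<open>Subtracting \<open>c\<close> times the second identity of
      \<open>weak_solution_moment\<close> turns the integrand into a nonnegative multiple of the
      square of \<open>M r - c\<close>.\<close>
    have "((\<lambda>r. g (r\<^sup>2) * (2 * r) * M r - g (r\<^sup>2) * (2 * r) * c) has_integral 0 - 0 * c) {0..b}"
      unfolding M_def by (intro has_integral_diff has_integral_mult_left mom)
    moreover have "g (r\<^sup>2) * (2 * r) * M r - g (r\<^sup>2) * (2 * r) * c = T (r\<^sup>2) * (2 * r) * (M r - c)\<^sup>2" if "r \<in> {0..b}" for r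
    proof -
      have "Mz (r\<^sup>2) = M r" unfolding Mz_def using that by simp
      then show ?thesis unfolding g_def by (simp add: power2_eq_square algebra_simps)
    qed
    ultimately have "((\<lambda>r. T (r\<^sup>2) * (2 * r) * (M r - c)\<^sup>2) has_integral 0) {0..b}"
      by (subst has_integral_cong[where g = "\<lambda>r. g (r\<^sup>2) * (2 * r) * M r - g (r\<^sup>2) * (2 * r) * c"]) simp_all
    then have I: "integral {0..b} (\<lambda>r. T (r\<^sup>2) * (2 * r) * (M r - c)\<^sup>2) = 0" by (rule integral_unique)
    have cS: "continuous_on {0..b} (\<lambda>r. T (r\<^sup>2))"
      by (rule continuous_on_compose2[OF cT[of UNIV]]) (auto intro!: continuous_intros)
    have cI: "continuous_on {0..b} (\<lambda>r. T (r\<^sup>2) * (2 * r) * (M r - c)\<^sup>2)"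
      by (intro continuous_intros cS continuous_on_subset[OF cM]) auto
    have z: "T (r\<^sup>2) * (2 * r) * (M r - c)\<^sup>2 = 0" if "r \<in> {0..b}" for r
      using integral_eq_0_iff[OF cI b0] I Tn that by simp
    have "M r = c" if r: "a < r" "r < b" for r
    proof -
      have "0 < T (r\<^sup>2)" using r ab by (intro Tp) (auto intro!: power_strict_mono)
      then show ?thesis using z[of r] r ab by simp
    qed
    then show ?thesis by blast
  qed
  have c1: "M r = M 1" if r: "0 < r" for r
  proof -
    have ab: "0 < min r 1 / 2" "min r 1 / 2 < max r 1 + 1" "min r 1 / 2 < r" "r < max r 1 + 1"
      "min r 1 / 2 < 1" "1 < max r 1 + 1" using r by linarith+
    obtain c where c: "\<forall>s. min r 1 / 2 < s \<and> s < max r 1 + 1 \<longrightarrow> M s = c"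
      using const[OF ab(1,2)] by blast
    then have "M r = c" "M 1 = c" using ab by blast+
    then show ?thesis by simp
  qed
  have "M 0 = M 1"
  proof -
    have "(M \<longlongrightarrow> M 0) (at 0 within {0..})" using cM unfolding continuous_on_def by simp
    then have "(M \<longlongrightarrow> M 0) (at_right 0)" by (rule tendsto_within_subset) auto
    moreover have "eventually (\<lambda>r. M 1 = M r) (at_right (0::real))"
      using eventually_at_right_less[of "0::real"] by eventually_elim (rule c1[symmetric])
    then have "(M \<longlongrightarrow> M 1) (at_right 0)" by (rule Lim_transform_eventually[OF tendsto_const])
    ultimately show ?thesis by (intro tendsto_unique[OF trivial_limit_at_right_real])
  qed
  moreover have "M 0 = f 0 powr m" unfolding M_def by (simp add: prim_0)
  ultimately have "M r = f 0 powr m" if "0 \<le> r" for r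
    using c1[of r] that by (metis order_le_less)
  then have "f r powr m = f 0 powr m + prim \<beta> f r" if "0 \<le> r" for r using that unfolding M_def by (metis diff_add_cancel)
  then show ?thesis unfolding profile_def using f0 f1 f2 by blast
qed

end

section \<open>Rescaling and asymptotics\<close>

lemma compactly_supported_exp_self_similar:
  assumes "\<And>r. R < r \<Longrightarrow> f r = 0"
  shows "compactly_supported_in_space (exp_self_similar \<alpha> \<beta> f :: 'a::euclidean_space \<Rightarrow> real \<Rightarrow> real)"
  unfolding compactly_supported_in_space_def
proof
  fix t :: real
  have "norm x \<le> R * exp (\<beta> * t)" if "exp_self_similar \<alpha> \<beta> f x t \<noteq> 0" for x :: 'a
  proof -
    have "norm x * exp (- \<beta> * t) \<le> R"
      using that assms[of "norm x * exp (- \<beta> * t)"] unfolding exp_self_similar_def by fastforce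
    then show ?thesis by (simp add: exp_minus field_simps)
  qed
  then have "bounded {x::'a. exp_self_similar \<alpha> \<beta> f x t \<noteq> 0}" unfolding bounded_iff by blast
  then show "compact (closure {x::'a. exp_self_similar \<alpha> \<beta> f x t \<noteq> 0})"
    by (simp add: compact_eq_bounded_closed bounded_closure)
qed

lemma compactly_supported_profile_zero:
  assumes "compactly_supported_in_space (exp_self_similar \<alpha> \<beta> f :: 'a::euclidean_space \<Rightarrow> real \<Rightarrow> real)"
  shows "\<exists>R\<ge>0. f R = 0"
proof -
  let ?S = "{x::'a. exp_self_similar \<alpha> \<beta> f x 0 \<noteq> 0}"
  have "bounded (closure ?S)"
    using assms compact_imp_bounded unfolding compactly_supported_in_space_def by blast
  then have "bounded ?S" using bounded_subset closure_subset by blast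
  then obtain R where R: "0 < R" "\<And>x. x \<in> ?S \<Longrightarrow> norm x \<le> R" unfolding bounded_pos by blast
  obtain x :: 'a where x: "norm x = R + 1" using vector_choose_size[of "R + 1"] R(1) by auto
  then have "x \<notin> ?S" using R(2)[of x] by auto
  then have "f (R + 1) = 0" unfolding exp_self_similar_def using x by simp
  then show ?thesis using R(1) by (intro exI[of _ "R + 1"]) simp
qed

context profile_parameters
begin

definition rescale where "rescale c f x = c powr (- k) * f (c * x)"

text \<open>Homogeneity of each term: \<open>k * m = k + \<sigma>1 + 2\<close> and
  \<open>k * m = k * p + \<sigma>2 + 2\<close> produce the common factor
  \<open>c powr (- (k * m))\<close>.\<close>

lemma prim_rescale:
  assumes f: "continuous_on {0..} f" "\<And>x. 0 \<le> x \<Longrightarrow> 0 \<le> f x" and c: "0 < c" and r: "0 \<le> r"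
  shows "prim \<beta> (rescale c f) r = c powr (- (k * m)) * prim \<beta> f (c * r)"
proof -
  have P1: "pmean a (\<lambda>x. C * g (c * x)) = (\<lambda>r. C * pmean a g (c * r))" for a C and g :: "real \<Rightarrow> real"
    by (simp add: fun_eq_iff pmean_cmult pmean_scale)
  have e0: "rescale c f = (\<lambda>x. c powr (- k) * f (c * x))" by (simp add: rescale_def fun_eq_iff)
  have e1: "rescale c f x powr p = c powr (- (k * p)) * f (c * x) powr p" if "0 \<le> x" for x
    unfolding rescale_def using c f(2)[of "c * x"] that by (simp add: powr_mult powr_powr)
  have e2: "pmean (\<sigma>2 + 2) (pmean (N + \<sigma>2) (\<lambda>x. rescale c f x powr p)) r
      = c powr (- (k * p)) * pmean (\<sigma>2 + 2) (pmean (N + \<sigma>2) (\<lambda>x. f x powr p)) (c * r)"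
  proof -
    have "pmean (\<sigma>2 + 2) (pmean (N + \<sigma>2) (\<lambda>x. rescale c f x powr p)) r
      = pmean (\<sigma>2 + 2) (pmean (N + \<sigma>2) (\<lambda>x. c powr (- (k * p)) * f (c * x) powr p)) r"
      by (intro pmean_cong r) (simp_all add: e1)
    also have "\<dots> = c powr (- (k * p)) * pmean (\<sigma>2 + 2) (pmean (N + \<sigma>2) (\<lambda>x. f x powr p)) (c * r)"
      using P1[of "N + \<sigma>2" "c powr (- (k * p))" "\<lambda>x. f x powr p"]
        P1[of "\<sigma>2 + 2" "c powr (- (k * p))" "pmean (N + \<sigma>2) (\<lambda>x. f x powr p)"] by simp
    finally show ?thesis .
  qed
  have e3: "c powr (- k) * (r powr (\<sigma>1 + 2) * z) = c powr (- (k * m)) * ((c * r) powr (\<sigma>1 + 2) * z)" for z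
    unfolding km_eq using c r by (simp add: powr_mult flip: powr_add)
  have e4: "r powr (\<sigma>2 + 2) * (c powr (- (k * p)) * z) = c powr (- (k * m)) * ((c * r) powr (\<sigma>2 + 2) * z)" for z
  proof -
    have "c powr (- (k * m)) * c powr (\<sigma>2 + 2) = c powr (- (k * p))"
      unfolding \<sigma>2_plus_2 powr_add[symmetric] by (simp add: algebra_simps)
    then show ?thesis using c r by (simp add: powr_mult) 
  qed
  have "prim \<beta> (rescale c f) r = \<beta> * q * (c powr (- k) * (r powr (\<sigma>1 + 2) * pmean (\<sigma>1 + 2) (pmean (N + \<sigma>1) f) (c * r)))
     - r powr (\<sigma>2 + 2) * (c powr (- (k * p)) * pmean (\<sigma>2 + 2) (pmean (N + \<sigma>2) (\<lambda>x. f x powr p)) (c * r))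
     - \<beta> * (c powr (- k) * (r powr (\<sigma>1 + 2) * pmean (\<sigma>1 + 2) f (c * r)))"
    unfolding prim_def lin_def e2 unfolding e0 P1 by simp
  then show ?thesis unfolding e3 e4 prim_def lin_def by (simp add: algebra_simps)
qed

lemma profile_rescale:
  assumes pr: "profile \<beta> f" and c: "0 < c"
  shows "profile \<beta> (rescale c f)"
proof -
  note pd = profileD[OF pr]
  have "continuous_on {0..} (rescale c f)"
    unfolding rescale_def[abs_def] using c
    by (intro continuous_on_mult continuous_on_const continuous_on_compose2[OF pd(1)] continuous_on_id) auto
  moreover have "0 \<le> rescale c f x" if "0 \<le> x" for x
    unfolding rescale_def using pd(2)[of "c * x"] c that by simp
  moreover have "0 < rescale c f 0" unfolding rescale_def using pd(3) c by simp
  moreover have "rescale c f r powr m = rescale c f 0 powr m + prim \<beta> (rescale c f) r" if r: "0 \<le> r" for r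
  proof -
    have pw: "rescale c f x powr m = c powr (- (k * m)) * f (c * x) powr m" if "0 \<le> x" for x
      unfolding rescale_def using c pd(2)[of "c * x"] that by (simp add: powr_mult powr_powr)
    have cr: "0 \<le> c * r" using c r by simp
    have "f (c * r) powr m = f 0 powr m + prim \<beta> f (c * r)" by (rule pd(4)[OF cr])
    then have "c powr (- (k * m)) * f (c * r) powr m = c powr (- (k * m)) * f 0 powr m + c powr (- (k * m)) * prim \<beta> f (c * r)"
      by (simp only: distrib_left)
    moreover have "prim \<beta> (rescale c f) r = c powr (- (k * m)) * prim \<beta> f (c * r)"
      by (rule prim_rescale[OF pd(1,2) c r])
    ultimately show ?thesis using pw[OF r] pw[OF order_refl] unfolding mult_zero_right by linarith
  qed
  ultimately show ?thesis unfolding profile_def by blast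
qed

text \<open>The exponent is fixed by \<open>c powr - k = K powr (1 / (m - p))\<close>, the value at
  the origin that the bracket prescribes for the parameter \<open>K\<close>.\<close>

definition origin_rescale where "origin_rescale K f = rescale (K powr (- (1 / (k * (m - p))))) f"

lemma origin_rescale_0:
  assumes "0 < K" "f 0 = 1"
  shows "origin_rescale K f 0 = K powr (1 / (m - p))"
  unfolding origin_rescale_def rescale_def using assms k_pos by (simp add: powr_powr)

text \<open>For \<open>1 < p\<close> one has \<open>\<sigma>1 - \<sigma>2 = (p - 1) * k > 0\<close>,
  so both terms carrying \<open>\<beta>\<close> are of higher order at the origin. What remains is
  the double mean of \<open>f powr p\<close>, and each mean divides by its exponent there.\<close>

lemma prim_origin_limit:
  assumes pr: "profile \<beta> f" and p: "1 < p"
  shows "((\<lambda>r. prim \<beta> f r / r powr (\<sigma>2 + 2)) \<longlongrightarrow> - (f 0 powr p / ((N + \<sigma>2) * (\<sigma>2 + 2)))) (at_right 0)"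
proof -
  note pd = profileD(1,2)[OF pr]
  have fp: "continuous_on {0..} (\<lambda>x. f x powr p)" by (rule continuous_on_powr_p[OF pd])
  define g1 where "g1 = pmean (\<sigma>1 + 2) (pmean (N + \<sigma>1) f)"
  define g2 where "g2 = pmean (\<sigma>2 + 2) (pmean (N + \<sigma>2) (\<lambda>x. f x powr p))"
  define g3 where "g3 = pmean (\<sigma>1 + 2) f"
  have cg: "continuous_on {0..} g1" "continuous_on {0..} g2" "continuous_on {0..} g3"
    unfolding g1_def g2_def g3_def by (intro continuous_on_pmean N_\<sigma>1 N_\<sigma>2 \<sigma>1_plus_2_pos \<sigma>2_plus_2_pos pd(1) fp)+
  have lim: "(g \<longlongrightarrow> g 0) (at_right 0)" if "continuous_on {0..} g" for g :: "real \<Rightarrow> real"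
  proof -
    have "(g \<longlongrightarrow> g 0) (at 0 within {0..})" using that unfolding continuous_on_def by simp
    then show ?thesis by (rule tendsto_within_subset) auto
  qed
  have "\<sigma>1 - \<sigma>2 = (p - 1) * k" using \<sigma>2_plus_2 km_eq by (simp add: algebra_simps)
  then have s: "0 < \<sigma>1 - \<sigma>2" using p k_pos by simp
  have "((\<lambda>r::real. r powr (\<sigma>1 - \<sigma>2)) \<longlongrightarrow> 0 powr (\<sigma>1 - \<sigma>2)) (at_right 0)"
    using s by (intro tendsto_powr' tendsto_intros) (auto simp: eventually_at_filter)
  then have z: "((\<lambda>r::real. r powr (\<sigma>1 - \<sigma>2)) \<longlongrightarrow> 0) (at_right 0)" by simp
  have "((\<lambda>r. r powr (\<sigma>1 - \<sigma>2) * (\<beta> * q * g1 r - \<beta> * g3 r) - g2 r) \<longlongrightarrow> 0 * (\<beta> * q * g1 0 - \<beta> * g3 0) - g2 0) (at_right 0)"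
    by (intro tendsto_intros z lim cg)
  moreover have "eventually (\<lambda>r. r powr (\<sigma>1 - \<sigma>2) * (\<beta> * q * g1 r - \<beta> * g3 r) - g2 r = prim \<beta> f r / r powr (\<sigma>2 + 2)) (at_right 0)"
    using eventually_at_right_less[of "0::real"]
  proof eventually_elim
    case (elim r)
    have "r powr (\<sigma>1 + 2) = r powr (\<sigma>1 - \<sigma>2) * r powr (\<sigma>2 + 2)" by (simp flip: powr_add)
    moreover have "0 < r powr (\<sigma>2 + 2)" using elim by simp
    ultimately show ?case
      unfolding prim_def lin_def g1_def[symmetric] g2_def[symmetric] g3_def[symmetric]
      by (simp add: field_simps)
  qed
  ultimately have "((\<lambda>r. prim \<beta> f r / r powr (\<sigma>2 + 2)) \<longlongrightarrow> 0 * (\<beta> * q * g1 0 - \<beta> * g3 0) - g2 0) (at_right 0)"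
    by (rule Lim_transform_eventually)
  then show ?thesis unfolding g2_def by (simp add: pmean_zero N_\<sigma>2 \<sigma>2_plus_2_pos)
qed

text \<open>The bracket in the variables of the Volterra equation:
  \<open>1 / ((N + \<sigma>2) * (\<sigma>2 + 2))\<close> is the double mean of a constant, and
  \<open>(m - p) / m\<close> comes from passing from \<open>f powr m\<close> to
  \<open>f powr (m - p)\<close>.\<close>

lemma origin_bracket_eq:
  "origin_bracket N m p \<sigma>1 K \<xi> = K - (m - p) / (m * (N + \<sigma>2) * (\<sigma>2 + 2)) * \<xi> powr (\<sigma>2 + 2)"
  "(\<sigma>1 + 2) * (m - p) / (m - 1) = \<sigma>2 + 2"
proof -
  show e: "(\<sigma>1 + 2) * (m - p) / (m - 1) = \<sigma>2 + 2" unfolding \<sigma>2_plus_2 k_def by simp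
  have m1: "0 < m - 1" using m_gt_1 by simp
  have mp: "0 < m - p" using p_less_m by simp
  have 1: "N * (m - 1) + \<sigma>1 * (m - p) - 2 * (p - 1) = (m - 1) * (N + \<sigma>2)"
    unfolding \<sigma>2_eq using m1 by (simp add: field_simps)
  have 2: "\<sigma>1 + 2 = (\<sigma>2 + 2) * (m - 1) / (m - p)"
    using e m1 mp by (simp add: field_simps)
  have gen: "a\<^sup>2 / (m * (s * a / b) * (a * n)) = b / (m * n * s)" if "0 < a" "0 < b" "0 < n" "0 < s" for a b n s :: real
    using that m_pos by (simp add: field_simps power2_eq_square)
  have "(m - 1)\<^sup>2 / (m * (\<sigma>1 + 2) * (N * (m - 1) + \<sigma>1 * (m - p) - 2 * (p - 1))) = (m - p) / (m * (N + \<sigma>2) * (\<sigma>2 + 2))"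
    unfolding 1 unfolding 2 by (rule gen[OF m1 mp N_\<sigma>2 \<sigma>2_plus_2_pos])
  then show "origin_bracket N m p \<sigma>1 K \<xi> = K - (m - p) / (m * (N + \<sigma>2) * (\<sigma>2 + 2)) * \<xi> powr (\<sigma>2 + 2)"
    unfolding origin_bracket_def e by (simp only:)
qed

text \<open>The first claim is continuity at the origin. For the second,
  \<open>f powr (m - p)\<close> is the power \<open>(m - p) / m\<close> of \<open>f powr m\<close>,
  linearised at \<open>f 0 powr m\<close>; the slope times the limit in
  \<open>prim_origin_limit\<close> cancels the coefficient of the bracket.\<close>

lemma profile_origin_behaviour:
  assumes pr: "profile \<beta> f" and K: "0 < K" and f0: "f 0 = K powr (1 / (m - p))"
  shows "origin_behaviour N m p \<sigma>1 K f"
proof -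
  note pd = profileD[OF pr]
  define c where "c = (m - p) / (m * (N + \<sigma>2) * (\<sigma>2 + 2))"
  have br: "origin_bracket N m p \<sigma>1 K = (\<lambda>\<xi>. K - c * \<xi> powr (\<sigma>2 + 2))"
    unfolding c_def by (simp add: fun_eq_iff origin_bracket_eq)
  have "(f \<longlongrightarrow> f 0) (at 0 within {0..})" using pd(1) unfolding continuous_on_def by simp
  then have fl: "(f \<longlongrightarrow> f 0) (at_right 0)" by (rule tendsto_within_subset) auto
  have "((\<lambda>r::real. r powr (\<sigma>2 + 2)) \<longlongrightarrow> 0 powr (\<sigma>2 + 2)) (at_right 0)"
    using \<sigma>2_plus_2_pos by (intro tendsto_powr' tendsto_intros) (auto simp: eventually_at_filter)
  then have bl: "((\<lambda>r::real. K - c * r powr (\<sigma>2 + 2)) \<longlongrightarrow> K - c * 0) (at_right 0)"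
    by (intro tendsto_intros) simp
  have "((\<lambda>r. f r / (K - c * r powr (\<sigma>2 + 2)) powr (1 / (m - p))) \<longlongrightarrow> f 0 / (K - c * 0) powr (1 / (m - p))) (at_right 0)"
    using K by (intro tendsto_intros fl bl) auto
  then have "((\<lambda>r. f r / (K - c * r powr (\<sigma>2 + 2)) powr (1 / (m - p))) \<longlongrightarrow> 1) (at_right 0)"
    using K f0 by simp
  then have first: "f \<sim>[at_right 0] (\<lambda>\<xi>. origin_bracket N m p \<sigma>1 K \<xi> powr (1 / (m - p)))"
    unfolding br by (rule asymp_equivI')
  have second: "(\<lambda>\<xi>. f \<xi> powr (m - p) - origin_bracket N m p \<sigma>1 K \<xi>)
        \<in> o[at_right 0](\<lambda>\<xi>. \<xi> powr ((\<sigma>1 + 2) * (m - p) / (m - 1)))" if p: "1 < p"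
    unfolding origin_bracket_eq(2)
  proof (rule smalloI_tendsto)
    define e where "e = (m - p) / m"
    define d where "d = e * f 0 powr (- p)"
    define x0 where "x0 = f 0 powr m"
    have x0: "0 < x0" unfolding x0_def using pd(3) by simp
    have "((\<lambda>x. x powr e) has_real_derivative e * x0 powr (e - 1)) (at x0)"
      using x0 by (rule has_real_derivative_powr)
    moreover have "x0 powr (e - 1) = f 0 powr (- p)"
    proof -
      have "m * (e - 1) = - p" unfolding e_def using m_pos by (simp add: field_simps)
      then show ?thesis unfolding x0_def powr_powr by (simp only:)
    qed
    ultimately have "((\<lambda>x. x powr e) has_real_derivative d) (at x0)" unfolding d_def by simp
    \<comment> \<open>Caratheodory's form of the derivative: the difference quotient itself could
      have denominator zero along \<open>f powr m\<close>.\<close>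
    then obtain g where g: "\<forall>z. z powr e - x0 powr e = g z * (z - x0)" "isCont g x0" "g x0 = d"
      unfolding CARAT_DERIV by blast
    have fm: "((\<lambda>r. f r powr m) \<longlongrightarrow> x0) (at_right 0)"
      unfolding x0_def using pd(3) by (intro tendsto_intros fl) auto
    have "((\<lambda>r. g (f r powr m) * (prim \<beta> f r / r powr (\<sigma>2 + 2)) + c) \<longlongrightarrow>
        g x0 * - (f 0 powr p / ((N + \<sigma>2) * (\<sigma>2 + 2))) + c) (at_right 0)"
      by (intro tendsto_add tendsto_mult tendsto_const prim_origin_limit[OF pr p] isCont_tendsto_compose[OF g(2)] fm)
    moreover have "g x0 * - (f 0 powr p / ((N + \<sigma>2) * (\<sigma>2 + 2))) + c = 0"
    proof -
      have "f 0 powr (- p) * f 0 powr p = 1" using pd(3) by (simp flip: powr_add)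
      moreover have "e * a * - (b / (n * s)) + (m - p) / (m * n * s) = 0" if "a * b = 1" "0 < n" "0 < s" for a b n s
      proof -
        have "e * a * - (b / (n * s)) = - ((m - p) / (m * n * s)) * (a * b)"
          unfolding e_def using m_pos that(2,3) by (simp add: field_simps)
        then show ?thesis unfolding that(1) by simp
      qed
      ultimately show ?thesis unfolding g(3) d_def c_def using N_\<sigma>2 \<sigma>2_plus_2_pos by blast
    qed
    ultimately have L: "((\<lambda>r. g (f r powr m) * (prim \<beta> f r / r powr (\<sigma>2 + 2)) + c) \<longlongrightarrow> 0) (at_right 0)"
      by (simp only:)
    have ev: "eventually (\<lambda>r. g (f r powr m) * (prim \<beta> f r / r powr (\<sigma>2 + 2)) + c =
        (f r powr (m - p) - origin_bracket N m p \<sigma>1 K r) / r powr (\<sigma>2 + 2)) (at_right 0)"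
      using eventually_at_right_less[of "0::real"]
    proof eventually_elim
      case (elim r)
      have fpw: "(f s powr m) powr e = f s powr (m - p)" for s
        unfolding powr_powr e_def using m_pos by simp
      have r0: "0 \<le> r" using elim by simp
      have K': "x0 powr e = K" unfolding x0_def fpw unfolding f0 powr_powr using K p_less_m by simp
      have pe: "prim \<beta> f r = f r powr m - x0" using pd(4)[OF r0] unfolding x0_def by linarith
      have "g (f r powr m) * (f r powr m - x0) = f r powr (m - p) - K"
        using g(1)[rule_format, of "f r powr m"] unfolding K' fpw by (rule sym)
      moreover have "G * (Q / R) + c = (F - (K - c * R)) / R" if "G * Q = F - K" "0 < R" for G Q R F :: real
        using that by (simp add: field_simps)
      ultimately show ?case unfolding pe br using elim by simp
    qed
    show "((\<lambda>r. (f r powr (m - p) - origin_bracket N m p \<sigma>1 K r) / r powr (\<sigma>2 + 2)) \<longlongrightarrow> 0) (at_right 0)"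
      by (rule Lim_transform_eventually[OF L ev])
    show "eventually (\<lambda>r. r powr (\<sigma>2 + 2) \<noteq> 0) (at_right (0::real))"
      using eventually_at_right_less[of "0::real"] by eventually_elim simp
  qed
  show ?thesis unfolding origin_behaviour_def using first second by blast
qed

text \<open>Rescaling shifts \<open>ln \<xi>\<close> by \<open>ln c\<close>. As
  \<open>(ln c + ln x) / ln x\<close> tends to \<open>1\<close>, the leading constant is the same
  for every \<open>c\<close>.\<close>

lemma rescale_tail_behaviour:
  assumes orb: "orbit \<beta> UNIV (log_h f) (log_Z \<beta> f)" and Z: "\<And>s. 0 < log_Z \<beta> f s"
    and be: "0 < \<beta>" and al: "\<alpha> = k * \<beta>" and p: "1 < p" and c: "0 < c"
  shows "tail_behaviour m p \<alpha> \<sigma>1 (rescale c f)"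
proof -
  define e where "e = 1 / (p - 1)"
  define tc where "tc = (\<beta> / (p - 1)) powr e"
  have tc0: "0 < tc" unfolding tc_def using be p by simp
  have "\<alpha> * (m - 1) / ((p - 1) * (\<sigma>1 + 2)) = \<beta> / (p - 1)"
  proof -
    have "s / a * \<beta> * a / (r * s) = \<beta> / r" if "0 < a" "0 < s" for a r s :: real using that by simp
    then show ?thesis unfolding al k_def using m_gt_1 \<sigma>1_plus_2_pos by simp
  qed
  then have tc: "tail_const m p \<alpha> \<sigma>1 = tc" unfolding tail_const_def tc_def e_def by (simp only:)
  have lim: "((\<lambda>s. log_h f s * s powr e) \<longlongrightarrow> tc) at_top"
    unfolding e_def tc_def by (rule orbit_tail_asymptotics[OF orb be Z p])
  have lnc: "filterlim (\<lambda>x. ln c + ln x) at_top at_top"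
    by (rule filterlim_tendsto_add_at_top[OF tendsto_const ln_at_top])
  have l1: "((\<lambda>x. log_h f (ln c + ln x) * (ln c + ln x) powr e) \<longlongrightarrow> tc) at_top"
    by (rule filterlim_compose[OF lim lnc])
  \<comment> \<open>\<open>1 - ln c * inverse (ln c + ln x)\<close> is
    \<open>ln x / (ln c + ln x)\<close>, written so that its limit is immediate.\<close>
  have "((\<lambda>x::real. ln c * inverse (ln c + ln x)) \<longlongrightarrow> ln c * 0) at_top"
    by (intro tendsto_mult tendsto_const tendsto_inverse_0_at_top lnc)
  from tendsto_diff[OF tendsto_const[of 1] this]
  have "((\<lambda>x::real. 1 - ln c * inverse (ln c + ln x)) \<longlongrightarrow> 1) at_top" by simp
  then have "((\<lambda>x::real. (1 - ln c * inverse (ln c + ln x)) powr e) \<longlongrightarrow> 1 powr e) at_top"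
    by (intro tendsto_intros) auto
  from tendsto_mult[OF l1 this]
  have "((\<lambda>x. log_h f (ln c + ln x) * (ln c + ln x) powr e * (1 - ln c * inverse (ln c + ln x)) powr e / tc) \<longlongrightarrow> tc / tc) at_top"
    using tc0 by (intro tendsto_divide tendsto_const) simp_all
  then have L: "((\<lambda>x. log_h f (ln c + ln x) * (ln c + ln x) powr e * (1 - ln c * inverse (ln c + ln x)) powr e / tc) \<longlongrightarrow> 1) at_top"
    using tc0 by simp
  have ev: "eventually (\<lambda>x. log_h f (ln c + ln x) * (ln c + ln x) powr e * (1 - ln c * inverse (ln c + ln x)) powr e / tc =
      rescale c f x / (tc * x powr k * ln x powr (- 1 / (p - 1)))) at_top"
    using eventually_gt_at_top[of "1::real"] filterlim_at_top_dense[THEN iffD1, OF lnc, rule_format, of 0]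
  proof eventually_elim
    case (elim x)
    have x: "0 < x" "0 < ln x" using elim by simp_all
    define L where "L = ln c + ln x"
    have L0: "0 < L" using elim(2) unfolding L_def .
    have i: "1 - ln c * inverse L = ln x / L" using L0 unfolding L_def by (simp add: field_simps)
    have "L powr e * (ln x / L) powr e = (L * (ln x / L)) powr e" using L0 x by (subst powr_mult) auto
    also have "L * (ln x / L) = ln x" using L0 by simp
    finally have e1: "L powr e * (ln x / L) powr e = ln x powr e" .
    have "exp L = c * x" unfolding L_def using c x by (simp add: exp_add)
    then have "log_h f L = exp (- k * L) * f (c * x)" unfolding log_h_def by simp
    also have "exp (- k * L) = c powr (- k) * x powr (- k)"
      unfolding powr_def L_def using c x by (simp add: exp_add[symmetric] algebra_simps)
    finally have e2: "log_h f L = rescale c f x * x powr (- k)" unfolding rescale_def by simp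
    have e3: "ln x powr (- 1 / (p - 1)) = inverse (ln x powr e)" unfolding e_def by (simp add: powr_minus)
    show ?case unfolding L_def[symmetric] i mult.assoc e1 e3 unfolding e2
      using tc0 x by (simp add: powr_minus field_simps)
  qed
  have "rescale c f \<sim>[at_top] (\<lambda>x. tc * x powr k * ln x powr (- 1 / (p - 1)))"
    by (rule asymp_equivI'[OF Lim_transform_eventually[OF L ev]])
  then show ?thesis unfolding tail_behaviour_def tc k_def[symmetric] using tc0 by blast
qed

end

theorem theorem5p4:
  fixes m p \<sigma>1 \<sigma>2 :: real
  assumes "1 < m" and "1 \<le> p" and "p < m"
    and "DIM('a::euclidean_space) \<ge> 2 \<Longrightarrow> \<sigma>1 > -2"
    and "DIM('a) = 1 \<Longrightarrow> \<sigma>1 \<ge> 0"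
    and "DIM('a) = 1 \<Longrightarrow> (m - 1) + \<sigma>1 * (m - p) - 2 * (p - 1) > 0"
    and "\<sigma>2 = (\<sigma>1 * (m - p) - 2 * (p - 1)) / (m - 1)"
  shows "\<exists>\<alpha>s \<beta>s :: real.
    (0 < \<alpha>s \<and> 0 < \<beta>s \<and> \<alpha>s / \<beta>s = (\<sigma>1 + 2) / (m - 1) \<and>
      (\<exists>F. compact_family TYPE('a) m p \<sigma>1 \<sigma>2 \<alpha>s \<beta>s F)) \<and>
    (\<forall>\<alpha> \<beta>. 0 < \<alpha> \<and> 0 < \<beta> \<and> \<alpha> / \<beta> = (\<sigma>1 + 2) / (m - 1) \<and>
      (\<exists>F. compact_family TYPE('a) m p \<sigma>1 \<sigma>2 \<alpha> \<beta> F) \<longrightarrow> \<alpha> = \<alpha>s \<and> \<beta> = \<beta>s) \<and>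
    (\<forall>\<alpha> \<beta>. \<alpha>s < \<alpha> \<and> 0 < \<beta> \<and> \<alpha> / \<beta> = (\<sigma>1 + 2) / (m - 1) \<longrightarrow>
      (\<exists>F. tail_family TYPE('a) m p \<sigma>1 \<sigma>2 \<alpha> \<beta> F))"
proof -
  have dim: "DIM('a) = 1 \<or> 2 \<le> DIM('a)" using DIM_positive[where 'a = 'a] by linarith
  have s2: "(m - 1) * (\<sigma>2 + 2) = (\<sigma>1 + 2) * (m - p)"
    unfolding assms(7) using assms(1) by (simp add: field_simps)
  interpret profile_parameters m p \<sigma>1 \<sigma>2 "real DIM('a)"
  proof
    show s1: "-2 < \<sigma>1" using dim assms(4,5) by fastforce
    show "0 < real DIM('a) + \<sigma>1" using dim assms(4,5) by fastforce
    \<comment> \<open>In dimension one this is the sixth hypothesis divided by \<open>m - 1\<close>;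
      in higher dimensions it follows from \<open>0 < \<sigma>2 + 2\<close>.\<close>
    show "0 < real DIM('a) + \<sigma>2"
    proof (cases "DIM('a) = 1")
      case True
      have "(m - 1) * (1 + \<sigma>2) = (m - 1) + \<sigma>1 * (m - p) - 2 * (p - 1)" using s2 by (simp add: algebra_simps)
      then have "0 < (m - 1) * (1 + \<sigma>2)" using assms(6)[OF True] by simp
      then show ?thesis using assms(1) True by (simp add: zero_less_mult_iff)
    next
      case False
      have "0 < (m - 1) * (\<sigma>2 + 2)" unfolding s2 using s1 assms(3) by simp
      then have "0 < \<sigma>2 + 2" using assms(1) by (simp add: zero_less_mult_iff)
      moreover have "2 \<le> real DIM('a)" using False dim by simp
      ultimately show ?thesis by linarith
    qed
  qed (use assms in auto)
  obtain \<beta>s S where be: "0 < \<beta>s" and S: "mdom \<beta>s = {..<S}" and co: "compact_orbit \<beta>s S (mh \<beta>s) (mZ \<beta>s)"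
    and ab: "\<And>\<beta>. \<beta>s < \<beta> \<Longrightarrow> mdom \<beta> = UNIV \<and> (\<forall>s. 0 < mZ \<beta> s)"
    by (rule critical_exponent_exists) (rule that)
  define f where "f = (\<lambda>r. if r < exp S then msol \<beta>s r else 0)"
  have pf: "profile \<beta>s f" unfolding f_def by (rule msol_profile_compact[OF less_imp_le[OF be] S co])
  have f0: "f 0 = 1" unfolding f_def using msol_0[OF less_imp_le[OF be]] by simp
  have ratio: "\<alpha> = k * \<beta>" if "\<alpha> / \<beta> = (\<sigma>1 + 2) / (m - 1)" "0 < \<beta>" for \<alpha> \<beta>
    using that unfolding k_def by (simp add: field_simps)
  have fam: "weak_solution m p \<sigma>1 \<sigma>2 (exp_self_similar (k * \<beta>) \<beta> (origin_rescale K g) :: 'a \<Rightarrow> real \<Rightarrow> real)"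
      "0 < origin_rescale K g 0" "origin_behaviour (real DIM('a)) m p \<sigma>1 K (origin_rescale K g)"
    if "profile \<beta> g" "g 0 = 1" "0 < K" for \<beta> g K
  proof -
    have pr: "profile \<beta> (origin_rescale K g)"
      unfolding origin_rescale_def by (rule profile_rescale[OF that(1)]) (use that(3) in simp)
    show "weak_solution m p \<sigma>1 \<sigma>2 (exp_self_similar (k * \<beta>) \<beta> (origin_rescale K g) :: 'a \<Rightarrow> real \<Rightarrow> real)"
      by (rule profile_weak_solution[OF refl pr])
    show "0 < origin_rescale K g 0" by (rule profileD(3)[OF pr])
    show "origin_behaviour (real DIM('a)) m p \<sigma>1 K (origin_rescale K g)"
      by (rule profile_origin_behaviour[OF pr that(3) origin_rescale_0[where f = g, OF that(3,2)]])
  qed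
  have compact: "compact_family TYPE('a) m p \<sigma>1 \<sigma>2 (k * \<beta>s) \<beta>s (\<lambda>K. origin_rescale K f)"
    unfolding compact_family_def
  proof (intro allI impI conjI)
    fix K :: real assume K: "0 < K"
    define c where "c = K powr (- (1 / (k * (m - p))))"
    have c: "0 < c" unfolding c_def using K by simp
    have "origin_rescale K f r = 0" if "exp S / c < r" for r
      unfolding origin_rescale_def c_def[symmetric] rescale_def f_def using that c by (simp add: field_simps)
    then show "compactly_supported_in_space (exp_self_similar (k * \<beta>s) \<beta>s (origin_rescale K f) :: 'a \<Rightarrow> real \<Rightarrow> real)"
      by (rule compactly_supported_exp_self_similar)
  qed (rule fam[OF pf f0]; assumption)+
  have unique: "\<beta> = \<beta>s" if b: "0 < \<beta>" and cf: "compact_family TYPE('a) m p \<sigma>1 \<sigma>2 (k * \<beta>) \<beta> F" for \<beta> F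
  proof -
    \<comment> \<open>Uniqueness is read off from the member with \<open>K = 1\<close>: as a weak
      solution it comes from a profile, and its bounded support provides a zero, hence a compact
      orbit for the same \<open>\<beta>\<close>.\<close>
    have ws: "weak_solution m p \<sigma>1 \<sigma>2 (exp_self_similar (k * \<beta>) \<beta> (F 1) :: 'a \<Rightarrow> real \<Rightarrow> real)"
      and cs: "compactly_supported_in_space (exp_self_similar (k * \<beta>) \<beta> (F 1) :: 'a \<Rightarrow> real \<Rightarrow> real)"
      and F0: "0 < F 1 0"
      using cf[unfolded compact_family_def, rule_format, of 1] by simp_all
    have pr: "profile \<beta> (F 1)" by (rule weak_solution_profile[OF refl ws F0])
    obtain R where R: "0 \<le> R" "F 1 R = 0" using compactly_supported_profile_zero[OF cs] by blast
    obtain T where "compact_orbit \<beta> T (log_h (F 1)) (log_Z \<beta> (F 1))"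
      using profile_first_zero_compact_orbit[OF pr R(2,1)] by blast
    from compact_orbit_unique[OF this co] show ?thesis using b be by simp
  qed
  have tail: "tail_family TYPE('a) m p \<sigma>1 \<sigma>2 (k * \<beta>) \<beta> (\<lambda>K. origin_rescale K (msol \<beta>))" if b: "\<beta>s < \<beta>" for \<beta>
    unfolding tail_family_def
  proof (intro allI impI conjI)
    fix K :: real assume K: "0 < K"
    have b0: "0 < \<beta>" using b be by simp
    have U: "mdom \<beta> = UNIV" and Z: "\<And>s. 0 < mZ \<beta> s" using ab[OF b] by blast+
    note pm = msol_profile_global(1)[OF less_imp_le[OF b0] U] and m0 = msol_0[OF less_imp_le[OF b0]]
    show "weak_solution m p \<sigma>1 \<sigma>2 (exp_self_similar (k * \<beta>) \<beta> (origin_rescale K (msol \<beta>)) :: 'a \<Rightarrow> real \<Rightarrow> real)"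
      "origin_behaviour (real DIM('a)) m p \<sigma>1 K (origin_rescale K (msol \<beta>))"
      by (rule fam[OF pm m0 K])+
    assume "1 < p"
    have orb: "orbit \<beta> UNIV (mh \<beta>) (mZ \<beta>)" using msol_orbit[OF less_imp_le[OF b0]] unfolding U .
    show "tail_behaviour m p (k * \<beta>) \<sigma>1 (origin_rescale K (msol \<beta>))"
      unfolding origin_rescale_def
      by (rule rescale_tail_behaviour[OF orb Z b0 refl \<open>1 < p\<close>]) (use K in simp)
  qed
  show ?thesis
  proof (rule exI[of _ "k * \<beta>s"], rule exI[of _ \<beta>s], intro conjI allI impI)
    show "0 < k * \<beta>s" by (rule mult_pos_pos[OF k_pos be])
    show "0 < \<beta>s" by (rule be)
    show "k * \<beta>s / \<beta>s = (\<sigma>1 + 2) / (m - 1)" unfolding k_def[symmetric] using be by simp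
    show "\<exists>F. compact_family TYPE('a) m p \<sigma>1 \<sigma>2 (k * \<beta>s) \<beta>s F" using compact by blast
  next
    fix \<alpha> \<beta> assume h: "0 < \<alpha> \<and> 0 < \<beta> \<and> \<alpha> / \<beta> = (\<sigma>1 + 2) / (m - 1) \<and>
      (\<exists>F. compact_family TYPE('a) m p \<sigma>1 \<sigma>2 \<alpha> \<beta> F)"
    then have a: "\<alpha> = k * \<beta>" using ratio by blast
    then show "\<beta> = \<beta>s" using h unique by blast
    then show "\<alpha> = k * \<beta>s" using a by simp
  next
    fix \<alpha> \<beta> assume h: "k * \<beta>s < \<alpha> \<and> 0 < \<beta> \<and> \<alpha> / \<beta> = (\<sigma>1 + 2) / (m - 1)"
    then have a: "\<alpha> = k * \<beta>" using ratio by blast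
    then have "\<beta>s < \<beta>" using h k_pos by simp
    from tail[OF this] show "\<exists>F. tail_family TYPE('a) m p \<sigma>1 \<sigma>2 \<alpha> \<beta> F" unfolding a by blast
  qed
qed

end
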